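(* Let $\sigma=\chi_{(\nu_1,\delta_1)}\boxtimes\chi_{(\nu_2,\delta_2)}$ with $\nu_1,\nu_2\in\mathbb{C}$, $\delta_1,\delta_2\in\{0,1\}$, $\delta_1\ge\delta_2$, such that $\nu_1-\nu_2+\delta_1-\delta_2+1\notin2\mathbb{Z}_{\le0}$. Write $y=\mathrm{diag}(y_1y_2,y_2)$ with $y_1,y_2>0$. (1) There exists $\Phi^{\mathrm{mg}}_\sigma\in\mathcal I^{\mathrm{mg}}_{\Pi_\sigma,\psi_1}$ such that: if $\delta_1=\delta_2$, \[\Phi^{\mathrm{mg}}_\sigma(\zeta_{(\sigma;0)})(y)=2y_1^{(\nu_1+\nu_2+1)/2}y_2^{\nu_1+\nu_2}K_{(\nu_1-\nu_2)/2}(2\pi y_1)=\frac{y_1^{1/2}y_2^{\nu_1+\nu_2}}{4\pi\sqrt{-1}}\int_s\Gamma_{\mathbb{R}}(s+\nu_1)\Gamma_{\mathbb{R}}(s+\nu_2)y_1^{-s}ds;\] if $(\delta_1,\delta_2)=(1,0)$, for $q\in\{\pm1\}$, \begin{align*}\Phi^{\mathrm{mg}}_\sigma(\zeta_{(\sigma;q)})(y)&=2(\sqrt{-1})^qy_1^{(\nu_1+\nu_2+2)/2}y_2^{\nu_1+\nu_2}\bigl(K_{(\nu_1-\nu_2+1)/2}(2\pi y_1)+qK_{(\nu_1-\nu_2-1)/2}(2\pi y_1)\bigr)\\&=(\sqrt{-1})^q\frac{y_1^{1/2}y_2^{\nu_1+\nu_2}}{4\pi\sqrt{-1}}\int_s\{\Gamma_{\mathbb{R}}(s+\nu_1+1)\Gamma_{\mathbb{R}}(s+\nu_2)+q\Gamma_{\mathbb{R}}(s+\nu_1)\Gamma_{\mathbb{R}}(s+\nu_2+1)\}y_1^{-s}ds.\end{align*}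 Here $\int_s$ is over an upward vertical line with real part large enough that all poles of the integrand lie to its left. (2) Assume moreover $\nu_1-\nu_2\notin\delta_1-\delta_2+2\mathbb{Z}$. Then there exist $\Phi^{+}_\sigma,\Phi^{-}_\sigma\in\mathcal I_{\Pi_\sigma,\psi_1}$ such that: if $\delta_1=\delta_2$, $\Phi^{\pm}_\sigma(\zeta_{(\sigma;0)})(y)=y_1^{(\nu_1+\nu_2+1)/2}y_2^{\nu_1+\nu_2}\hat I_{\pm(\nu_1-\nu_2)/2}(2\pi y_1)$; if $(\delta_1,\delta_2)=(1,0)$, for $q\in\{\pm1\}$, $\Phi^{\pm}_\sigma(\zeta_{(\sigma;q)})(y)=(\sqrt{-1})^qy_1^{(\nu_1+\nu_2+2)/2}y_2^{\nu_1+\nu_2}\bigl(\hat I_{\pm(\nu_1-\nu_2+1)/2}(2\pi y_1)+q\hat I_{\pm(\nu_1-\nu_2-1)/2}(2\pi y_1)\bigr)$. Moreover $\{\Phi^+_\sigma,\Phi^-_\sigma\}$ is a basis of $\mathcal I_{\Pi_\sigma,\psi_1}$ and $\Phi^{\mathrm{mg}}_\sigma=\Phi^+_\sigma+\Phi^-_\sigma$.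
   Context: $G=GL(2,\mathbb{R})$, $K=O(2)$, $N$ upper unipotent matrices, $M$ diagonal matrices, $P=NM$. $\chi_{(\nu,\delta)}(t)=(t/|t|)^\delta|t|^\nu$; $\sigma(x\,\mathrm{diag}(m_1,m_2))=\chi_{(\nu_1,\delta_1)}(m_1)\chi_{(\nu_2,\delta_2)}(m_2)$ and $\rho(x\,\mathrm{diag}(m_1,m_2))=|m_1|^{1/2}|m_2|^{-1/2}$ for $x\in N$. The principal series $\Pi_\sigma$ acts on the $L^2(K)$-completion $H(\sigma)$ of continuous $f$ on $K$ with $f(mk)=\sigma(m)f(k)$ ($m\in K\cap M$) by $(\Pi_\sigma(g)f)(k)=\rho(p)\sigma(p)f(k')$, $kg=pk'$. With $k_\theta=\begin{pmatrix}\cos\theta&\sin\theta\\-\sin\theta&\cos\theta\end{pmatrix}$, for $q\in\delta_1-\delta_2+2\mathbb{Z}$ let $\zeta_{(\sigma;q)}\in H(\sigma)$ be the function $\zeta_{(\sigma;q)}(\mathrm{diag}(\varepsilon_1,\varepsilon_2)k_\theta)=\varepsilon_1^{\delta_1}\varepsilon_2^{\delta_2}e^{\sqrt{-1}q\theta}$ ($\varepsilon_i\in\{\pm1\}$); these form a basis of the $K$-finite vectors $H(\sigma)_K$. $\psi_1(x)=\exp(2\pi\sqrt{-1}x_{1,2})$ on $N$; $C^\infty(N\backslash G;\psi_1)$ is the space of smooth $f$ on $G$ with $f(xg)=\psi_1(x)f(g)$ ($G$ acting by right translation), and $\mathcal I_{\Pi_\sigma,\psi_1}=\mathrm{Hom}_{(\mathfrak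 g_{\mathbb{C}},K)}(H(\sigma)_K,C^\infty(N\backslash G;\psi_1)_K)$; $\mathcal I^{\mathrm{mg}}_{\Pi_\sigma,\psi_1}$ is its subspace of $\Phi$ such that all $\Phi(f)$ have moderate growth. $\Gamma_{\mathbb{R}}(s)=\pi^{-s/2}\Gamma(s/2)$. $K_r(z)=\frac12\int_0^\infty\exp(-\frac z2(t+t^{-1}))t^r\frac{dt}{t}$ is the modified Bessel function of the second kind, and for $r\notin\mathbb{Z}$, $\hat I_r(z)=\sum_{k\ge0}\frac{(-1)^k}{k!}\Gamma(-r-k)(z/2)^{r+2k}$ ($=\frac{-\pi}{\sin(\pi r)}I_r(z)$). *)

theory Defs
  imports "HOL-Complex_Analysis.Complex_Analysis"
begin

type_synonym mat2 = "real^2^2"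

definition diag2 :: "'a::zero \<Rightarrow> 'a \<Rightarrow> 'a^2^2" where
  "diag2 a b = vector [vector [a, 0], vector [0, b]]"

definition rot :: "real \<Rightarrow> mat2" where
  "rot \<theta> = vector [vector [cos \<theta>, sin \<theta>], vector [- sin \<theta>, cos \<theta>]]"

definition G_grp :: "mat2 set" where
  "G_grp = {g. invertible g}"

definition K_grp :: "mat2 set" where
  "K_grp = {k. orthogonal_matrix k}"

definition N_grp :: "mat2 set" where
  "N_grp = {x. x$1$1 = 1 \<and> x$2$2 = 1 \<and> x$2$1 = 0}"

definition M_grp :: "mat2 set" where
  "M_grp = {diag2 a b | a b. a \<noteq> 0 \<and> b \<noteq> 0}"

definition P_grp :: "mat2 set" where
  "P_grp = {x ** m | x m. x \<in> N_grp \<and> m \<in> M_grp}"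

definition mat_exp :: "mat2 \<Rightarrow> mat2" where
  "mat_exp X = (\<Sum>n. (1 / fact n) *\<^sub>R (((**) X) ^^ n) (mat 1))"

text \<open>The decomposition \<open>h = p k'\<close> with \<open>p \<in> P\<close>, \<open>k' \<in> K\<close> is unique up to
  \<open>M \<inter> K\<close>; it is normalised here by requiring the diagonal of \<open>p\<close> to be positive.\<close>

definition iwasawa :: "mat2 \<Rightarrow> mat2 \<times> mat2" where
  "iwasawa h = (THE (p, k'). p \<in> P_grp \<and> p$1$1 > 0 \<and> p$2$2 > 0 \<and> k' \<in> K_grp \<and> h = p ** k')"

text \<open>Normalised Haar measure of \<open>O(2)\<close>, as a Borel measure on the matrix space
  concentrated on \<open>O(2)\<close>.\<close>

definition haar_K :: "mat2 measure" where
  "haar_K = distr (uniform_measure lborel {0..<2*pi} \<Otimes>\<^sub>M uniform_count_measure {1, -1}) borel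
     (\<lambda>(\<theta>, \<epsilon>). diag2 \<epsilon> 1 ** rot \<theta>)"

definition L2_K :: "(mat2 \<Rightarrow> complex) set" where
  "L2_K = {f \<in> borel_measurable borel. integrable haar_K (\<lambda>k. (cmod (f k))\<^sup>2)}"

definition L2_norm :: "(mat2 \<Rightarrow> complex) \<Rightarrow> real" where
  "L2_norm f = sqrt (\<integral>k. (cmod (f k))\<^sup>2 \<partial>haar_K)"

definition ae_eq :: "(mat2 \<Rightarrow> complex) \<Rightarrow> (mat2 \<Rightarrow> complex) \<Rightarrow> bool" where
  "ae_eq f h \<longleftrightarrow> (AE k in haar_K. f k = h k)"

definition chi :: "complex \<Rightarrow> nat \<Rightarrow> real \<Rightarrow> complex" where
  "chi \<nu> \<delta> t = complex_of_real (t / \<bar>t\<bar>) ^ \<delta> * complex_of_real \<bar>t\<bar> powr \<nu>"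

text \<open>An element \<open>x diag(m\<^sub>1, m\<^sub>2)\<close> of \<open>P = N M\<close> has diagonal entries \<open>m\<^sub>1\<close>, \<open>m\<^sub>2\<close>.
  Below, \<open>\<sigma>\<close> always stands for such a character \<open>sigma_char \<nu>\<^sub>1 \<delta>\<^sub>1 \<nu>\<^sub>2 \<delta>\<^sub>2\<close> of \<open>P\<close>.\<close>

definition sigma_char :: "complex \<Rightarrow> nat \<Rightarrow> complex \<Rightarrow> nat \<Rightarrow> mat2 \<Rightarrow> complex" where
  "sigma_char \<nu>1 \<delta>1 \<nu>2 \<delta>2 p = chi \<nu>1 \<delta>1 (p$1$1) * chi \<nu>2 \<delta>2 (p$2$2)"

definition rho_char :: "mat2 \<Rightarrow> real" where
  "rho_char p = \<bar>p$1$1\<bar> powr (1/2) * \<bar>p$2$2\<bar> powr (-1/2)"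

definition H_cont :: "(mat2 \<Rightarrow> complex) \<Rightarrow> (mat2 \<Rightarrow> complex) set" where
  "H_cont \<sigma> = {f \<in> L2_K. continuous_on K_grp f \<and>
     (\<forall>m \<in> K_grp \<inter> M_grp. \<forall>k \<in> K_grp. f (m ** k) = \<sigma> m * f k)}"

text \<open>The completion \<open>H(\<sigma>)\<close> is the closure of \<open>H_cont \<sigma>\<close> in \<open>L\<^sup>2(K)\<close>. Its elements are
  represented by functions; two functions represent the same element iff \<open>ae_eq\<close> holds.\<close>

definition H_sp :: "(mat2 \<Rightarrow> complex) \<Rightarrow> (mat2 \<Rightarrow> complex) set" where
  "H_sp \<sigma> = {f \<in> L2_K. \<forall>\<epsilon>>0. \<exists>g \<in> H_cont \<sigma>. L2_norm (\<lambda>k. f k - g k) < \<epsilon>}"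

definition prin_act :: "(mat2 \<Rightarrow> complex) \<Rightarrow> mat2 \<Rightarrow> (mat2 \<Rightarrow> complex) \<Rightarrow> mat2 \<Rightarrow> complex" where
  "prin_act \<sigma> g f k = (if k \<in> K_grp
     then (case iwasawa (k ** g) of (p, k') \<Rightarrow> complex_of_real (rho_char p) * \<sigma> p * f k')
     else 0)"

text \<open>\<open>f\<close> is \<open>K\<close>-finite: the span of its \<open>K\<close>-translates is finite-dimensional, that is, contained
  in the span of a finite set \<open>B\<close> (modulo \<open>ae_eq\<close>).\<close>

definition H_fin :: "(mat2 \<Rightarrow> complex) \<Rightarrow> (mat2 \<Rightarrow> complex) set" where
  "H_fin \<sigma> = {f \<in> H_sp \<sigma>. \<exists>B. finite B \<and> B \<subseteq> H_sp \<sigma> \<and>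
     (\<forall>\<kappa> \<in> K_grp. \<exists>c. ae_eq (prin_act \<sigma> \<kappa> f) (\<lambda>k. \<Sum>b\<in>B. c b * b k))}"

text \<open>\<open>h = d\<Pi>\<^sub>\<sigma>(X) f\<close>, the derivative at \<open>t = 0\<close> of \<open>\<Pi>\<^sub>\<sigma>(exp(tX)) f\<close> in \<open>L\<^sup>2(K)\<close>, for
  \<open>X\<close> in the real Lie algebra and then, by complex linearity, in its complexification.\<close>

definition has_lie_deriv ::
  "(mat2 \<Rightarrow> complex) \<Rightarrow> mat2 \<Rightarrow> (mat2 \<Rightarrow> complex) \<Rightarrow> (mat2 \<Rightarrow> complex) \<Rightarrow> bool" where
  "has_lie_deriv \<sigma> X f h \<longleftrightarrow> h \<in> H_sp \<sigma> \<and>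
     ((\<lambda>t. L2_norm (\<lambda>k. (prin_act \<sigma> (mat_exp (t *\<^sub>R X)) f k - f k) / complex_of_real t - h k))
       \<longlongrightarrow> 0) (at 0)"

definition re_mat :: "complex^2^2 \<Rightarrow> mat2" where
  "re_mat Z = (\<chi> i j. Re (Z$i$j))"

definition im_mat :: "complex^2^2 \<Rightarrow> mat2" where
  "im_mat Z = (\<chi> i j. Im (Z$i$j))"

definition has_lie_deriv_C ::
  "(mat2 \<Rightarrow> complex) \<Rightarrow> complex^2^2 \<Rightarrow> (mat2 \<Rightarrow> complex) \<Rightarrow> (mat2 \<Rightarrow> complex) \<Rightarrow> bool" where
  "has_lie_deriv_C \<sigma> Z f h \<longleftrightarrow> h \<in> H_sp \<sigma> \<and>
     (\<exists>h1 h2. has_lie_deriv \<sigma> (re_mat Z) f h1 \<and> has_lie_deriv \<sigma> (im_mat Z) f h2 \<and>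
        ae_eq h (\<lambda>k. h1 k + \<i> * h2 k))"

text \<open>For \<open>q \<equiv> \<delta>\<^sub>1 - \<delta>\<^sub>2 (mod 2)\<close> the value does not depend on the chosen decomposition
  \<open>k = diag(\<epsilon>\<^sub>1, \<epsilon>\<^sub>2) k\<^sub>\<theta>\<close>.\<close>

definition zeta_fn :: "nat \<Rightarrow> nat \<Rightarrow> int \<Rightarrow> mat2 \<Rightarrow> complex" where
  "zeta_fn \<delta>1 \<delta>2 q k = (if k \<in> K_grp
     then (THE z. \<exists>\<epsilon>1 \<epsilon>2 \<theta>. \<epsilon>1 \<in> {1, -1} \<and> \<epsilon>2 \<in> {1, -1} \<and> k = diag2 \<epsilon>1 \<epsilon>2 ** rot \<theta> \<and>
             z = complex_of_real (\<epsilon>1 ^ \<delta>1 * \<epsilon>2 ^ \<delta>2) * exp (\<i> * of_int q * complex_of_real \<theta>))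
     else 0)"

text \<open>Only meaningful for open \<open>S\<close>: the derivatives are taken at \<open>x\<close> in the ambient space.\<close>

primrec Ck_on :: "nat \<Rightarrow> 'a::real_normed_vector set \<Rightarrow> ('a \<Rightarrow> 'b::real_normed_vector) \<Rightarrow> bool" where
  "Ck_on 0 S f \<longleftrightarrow> continuous_on S f"
| "Ck_on (Suc n) S f \<longleftrightarrow> (\<forall>x\<in>S. f differentiable (at x)) \<and>
     (\<forall>v. Ck_on n S (\<lambda>x. frechet_derivative f (at x) v))"

definition smooth_on :: "'a::real_normed_vector set \<Rightarrow> ('a \<Rightarrow> 'b::real_normed_vector) \<Rightarrow> bool" where
  "smooth_on S f \<longleftrightarrow> (\<forall>n. Ck_on n S f)"

definition psi1 :: "mat2 \<Rightarrow> complex" where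
  "psi1 x = exp (2 * complex_of_real pi * \<i> * complex_of_real (x$1$2))"

text \<open>Functions on \<open>G\<close> are extended by \<open>0\<close> to all matrices, so that equality of functions
  on \<open>G\<close> is equality in HOL.\<close>

definition whittaker_space :: "(mat2 \<Rightarrow> complex) set" where
  "whittaker_space = {\<phi>. (\<forall>g. g \<notin> G_grp \<longrightarrow> \<phi> g = 0) \<and> smooth_on G_grp \<phi> \<and>
     (\<forall>x \<in> N_grp. \<forall>g \<in> G_grp. \<phi> (x ** g) = psi1 x * \<phi> g)}"

definition whittaker_fin :: "(mat2 \<Rightarrow> complex) set" where
  "whittaker_fin = {\<phi> \<in> whittaker_space. \<exists>B. finite B \<and> B \<subseteq> whittaker_space \<and>
     (\<forall>\<kappa> \<in> K_grp. \<exists>c. \<forall>g. \<phi> (g ** \<kappa>) = (\<Sum>b\<in>B. c b * b g))}"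

definition right_deriv :: "mat2 \<Rightarrow> (mat2 \<Rightarrow> complex) \<Rightarrow> mat2 \<Rightarrow> complex" where
  "right_deriv X \<phi> g = vector_derivative (\<lambda>t. \<phi> (g ** mat_exp (t *\<^sub>R X))) (at 0)"

definition right_deriv_C :: "complex^2^2 \<Rightarrow> (mat2 \<Rightarrow> complex) \<Rightarrow> mat2 \<Rightarrow> complex" where
  "right_deriv_C Z \<phi> g = right_deriv (re_mat Z) \<phi> g + \<i> * right_deriv (im_mat Z) \<phi> g"

type_synonym whittaker_map = "(mat2 \<Rightarrow> complex) \<Rightarrow> mat2 \<Rightarrow> complex"

text \<open>The space of \<open>(g\<^sub>C, K)\<close>-homomorphisms from \<open>H(\<sigma>)\<^sub>K\<close> to the \<open>K\<close>-finite Whittaker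
  functions. A homomorphism is a map on representatives that respects \<open>ae_eq\<close>, extended by
  \<open>0\<close> outside \<open>H(\<sigma>)\<^sub>K\<close>.\<close>

definition whittaker_homs :: "(mat2 \<Rightarrow> complex) \<Rightarrow> whittaker_map set" where
  "whittaker_homs \<sigma> = {\<Phi>.
     (\<forall>f. f \<notin> H_fin \<sigma> \<longrightarrow> \<Phi> f = (\<lambda>g. 0)) \<and>
     (\<forall>f \<in> H_fin \<sigma>. \<Phi> f \<in> whittaker_fin) \<and>
     (\<forall>f \<in> H_fin \<sigma>. \<forall>h \<in> H_fin \<sigma>. ae_eq f h \<longrightarrow> \<Phi> f = \<Phi> h) \<and>
     (\<forall>f \<in> H_fin \<sigma>. \<forall>h \<in> H_fin \<sigma>. \<forall>a b.
        \<Phi> (\<lambda>k. a * f k + b * h k) = (\<lambda>g. a * \<Phi> f g + b * \<Phi> h g)) \<and>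
     (\<forall>f \<in> H_fin \<sigma>. \<forall>\<kappa> \<in> K_grp. \<Phi> (prin_act \<sigma> \<kappa> f) = (\<lambda>g. \<Phi> f (g ** \<kappa>))) \<and>
     (\<forall>f \<in> H_fin \<sigma>. \<forall>h \<in> H_fin \<sigma>. \<forall>Z. has_lie_deriv_C \<sigma> Z f h \<longrightarrow>
        (\<forall>g \<in> G_grp. \<Phi> h g = right_deriv_C Z (\<Phi> f) g))}"

text \<open>Polynomial growth in the norms of \<open>g\<close> and of its inverse.\<close>

definition moderate_growth :: "(mat2 \<Rightarrow> complex) \<Rightarrow> bool" where
  "moderate_growth \<phi> \<longleftrightarrow>
     (\<exists>C (r::nat). \<forall>g \<in> G_grp. cmod (\<phi> g) \<le> C * (norm g + norm (matrix_inv g)) ^ r)"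

definition whittaker_homs_mg :: "(mat2 \<Rightarrow> complex) \<Rightarrow> whittaker_map set" where
  "whittaker_homs_mg \<sigma> = {\<Phi> \<in> whittaker_homs \<sigma>. \<forall>f \<in> H_fin \<sigma>. moderate_growth (\<Phi> f)}"

definition Gamma_R :: "complex \<Rightarrow> complex" where
  "Gamma_R s = complex_of_real pi powr (- s / 2) * Gamma (s / 2)"

definition bessel_K :: "complex \<Rightarrow> complex \<Rightarrow> complex" where
  "bessel_K r z = 1/2 * (LBINT t:{0<..}. exp (- z / 2 * complex_of_real (t + 1 / t)) *
                           complex_of_real t powr r / complex_of_real t)"

definition bessel_I_hat :: "complex \<Rightarrow> complex \<Rightarrow> complex" where
  "bessel_I_hat r z =
     (\<Sum>k. (-1) ^ k / fact k * Gamma (- r - of_nat k) * (z / 2) powr (r + 2 * of_nat k))"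

text \<open>\<open>\<integral>\<^sub>s F(s) ds = v\<close> over every upward vertical line \<open>Re s = c\<close> to the right of all poles of
  \<open>F\<close>; the integral along the line is \<open>\<i> \<integral> F(c + \<i>t) dt\<close>.\<close>

definition has_vertical_integral :: "(complex \<Rightarrow> complex) \<Rightarrow> complex \<Rightarrow> bool" where
  "has_vertical_integral F v \<longleftrightarrow>
     (\<forall>c::real. (\<forall>s. is_pole F s \<longrightarrow> Re s < c) \<longrightarrow>
        has_bochner_integral lborel (\<lambda>t. \<i> * F (Complex c t)) v)"

end

theory Submission
 imports Defs "HOL-Probability.Probability" "HOL-Real_Asymp.Real_Asymp"
begin

no_notation fps_nth (infixl "$" 75) \<comment> \<open>makes \<open>A$i$j\<close> ambiguous otherwise\<close>

text \<open>The vectors \<open>\<zeta>\<^sub>q\<close> extend to functions on \<open>G\<close> of weight \<open>q\<close> under \<open>SO(2)\<close>, and the Lie algebra maps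
 weight \<open>q\<close> to the weights \<open>q\<close>, \<open>q + 2\<close> and \<open>q - 2\<close> with coefficients
 \<open>(\<nu>\<^sub>1 - \<nu>\<^sub>2 + 1 \<plusminus> q)/2\<close>. Since \<open>H(\<sigma>)\<^sub>K\<close> consists of the finite combinations of the \<open>\<zeta>\<^sub>q\<close>,
 a homomorphism \<open>\<Phi>\<close> amounts to Whittaker functions \<open>\<Phi>(\<zeta>\<^sub>q)\<close> with the same relations. By equivariance
 under \<open>N\<close>, \<open>K\<close> and the centre they are determined by their radial parts \<open>w\<^sub>q(y)\<close>, for which the
 relations become first order differential equations expressing \<open>w\<^sub>q\<^sub>+\<^sub>2\<close> and
 \<open>w\<^sub>q\<^sub>-\<^sub>2\<close> through \<open>w\<^sub>q\<close>. The hypothesis on \<open>\<nu>\<^sub>1 - \<nu>\<^sub>2\<close> says that no coefficient vanishes when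
 moving away from the weight \<open>0\<close>, or from the weights \<open>\<plusminus>1\<close>; there the relations are equivalent to
 the system \<open>F' = (r/z) F - H\<close>, \<open>H' = - F - ((r + 1)/z) H\<close>. So homomorphisms correspond to
 solutions of this system, among which are \<open>(K\<^sub>r, K\<^sub>r\<^sub>+\<^sub>1)\<close> and, for non-integral \<open>r\<close>, the basis
 given by \<open>I\<close> at \<open>r\<close> and \<open>- r\<close>. The radial parts are combinations of \<open>F\<close> and \<open>H\<close> with
 polynomial coefficients, so polynomial bounds for \<open>K\<close> give moderate growth. The Mellin
 formulas follow from Fourier inversion for \<open>\<Gamma>\<close> along vertical lines.\<close>

section \<open>Bessel systems\<close>

text \<open>Two obstacles shape the proof. Elements of \<open>H_sp\<close> are functions known only
  up to null sets, while \<open>prin_act\<close> and \<open>has_lie_deriv\<close> work on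
  representatives. So right translation has to preserve the null sets of K, and L2 derivatives have
  to be identified almost everywhere, which rests on differentiability that is uniform over K.
  Secondly, all weights must be controlled at once. Each radial part is a pair of polynomials
  applied to one fixed Bessel pair. Dividing by \<nu> + 1 + q on the way out makes one family of
  relations hold by construction; the opposite ones follow from a commutator, with the Casimir
  eigenvalue \<nu>^2 - (q + 1)^2 as induction hypothesis. The first order system is preferred to the
  Bessel equation because its Wronskian times z is constant, so that Cramer's rule expresses every
  solution through two given ones. The coefficients in the relation between K and I are found from
  the limit at 0, which sees only the more singular solution; shifting the order by integers in both
  directions makes each of the two solutions the singular one in turn.\<close>

definition bessel_pair :: "complex => (real => complex) => (real => complex) => bool" where
 "bessel_pair r F H \<longleftrightarrow> (\<forall>z>0.
   (F has_vector_derivative (r / of_real z * F z - H z)) (at z) \<and>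
   (H has_vector_derivative (- F z - (r + 1) / of_real z * H z)) (at z))"

text \<open>The coefficient matrix of the system has trace -1/z, so by Liouville's formula the
  Wronskian is a constant times 1/z; the factor \<open>of_real z\<close> compensates this.\<close>

lemma bessel_pair_wronskian_const:
 assumes "bessel_pair r F H" "bessel_pair r F' H'"
 obtains c where "\<And>z. z > 0 ==> of_real z * (F z * H' z - H z * F' z) = (c::complex)"
proof -
 let ?W = "\<lambda>z. of_real z * (F z * H' z - H z * F' z)"
 have "(?W has_vector_derivative 0) (at z within {0<..})" if "z > 0" for z
 proof -
  have "(?W has_vector_derivative 
    (of_real z * ((F z * (- F' z - (r + 1) / of_real z * H' z) + (r / of_real z * F z - H z) * H' z)
     - (H z * (r / of_real z * F' z - H' z) + (- F z - (r + 1) / of_real z * H z) * F' z))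
     + of_real 1 * (F z * H' z - H z * F' z))) (at z)"
   using assms that unfolding bessel_pair_def
   by (intro has_vector_derivative_mult has_vector_derivative_diff has_vector_derivative_of_real
     derivative_eq_intros) auto
  moreover have "(of_real z * ((F z * (- F' z - (r + 1) / of_real z * H' z) + (r / of_real z * F z - H z) * H' z)
     - (H z * (r / of_real z * F' z - H' z) + (- F z - (r + 1) / of_real z * H z) * F' z))
     + of_real 1 * (F z * H' z - H z * F' z)) = 0"
   using that by (simp add: field_simps)
  ultimately show ?thesis using has_vector_derivative_at_within by metis
 qed
 then show ?thesis
  by (intro has_vector_derivative_zero_constant[of "{0<..}" ?W, OF convex_real_interval(3) _ that]) auto
qed

lemma bessel_pair_lin_comb:
 assumes "bessel_pair r F H" "bessel_pair r F' H'"
 shows "bessel_pair r (\<lambda>z. a * F z + b * F' z) (\<lambda>z. a * H z + b * H' z)"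
 unfolding bessel_pair_def
proof (intro allI impI conjI)
 fix z :: real assume z: "z > 0"
 have "((\<lambda>z. a * F z + b * F' z) has_vector_derivative
   a * (r / of_real z * F z - H z) + b * (r / of_real z * F' z - H' z)) (at z)"
  using assms z unfolding bessel_pair_def
  by (intro has_vector_derivative_add has_vector_derivative_mult_right) auto
 then show "((\<lambda>z. a * F z + b * F' z) has_vector_derivative
   r / of_real z * (a * F z + b * F' z) - (a * H z + b * H' z)) (at z)"
  by (simp add: algebra_simps)
 have "((\<lambda>z. a * H z + b * H' z) has_vector_derivative
   a * (- F z - (r + 1) / of_real z * H z) + b * (- F' z - (r + 1) / of_real z * H' z)) (at z)"
  using assms z unfolding bessel_pair_def
  by (intro has_vector_derivative_add has_vector_derivative_mult_right) auto
 then show "((\<lambda>z. a * H z + b * H' z) has_vector_derivative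
   - (a * F z + b * F' z) - (r + 1) / of_real z * (a * H z + b * H' z)) (at z)"
  by (simp add: algebra_simps)
qed

text \<open>Cramer's rule: the Wronskians of \<open>(F, H)\<close> with the two given solutions are
  constants as well, and divided by \<open>w\<close> they are the coefficients.\<close>

lemma bessel_pair_basis:
 assumes FH: "bessel_pair r F H" and 1: "bessel_pair r F1 H1" and 2: "bessel_pair r F2 H2"
  and w: "w \<noteq> 0" "\<And>z. z > 0 ==> of_real z * (F1 z * H2 z - H1 z * F2 z) = w"
 obtains a b where "\<And>z. z > 0 ==> F z = a * F1 z + b * F2 z"
  "\<And>z. z > 0 ==> H z = a * H1 z + b * H2 z"
proof -
 obtain c where c: "\<And>z. z > 0 ==> of_real z * (F z * H2 z - H z * F2 z) = c"
  using bessel_pair_wronskian_const[OF FH 2] by metis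
 obtain d where d: "\<And>z. z > 0 ==> of_real z * (F1 z * H z - H1 z * F z) = d"
  using bessel_pair_wronskian_const[OF 1 FH] by metis
 have "w * F z = c * F1 z + d * F2 z" "w * H z = c * H1 z + d * H2 z" if "z > 0" for z
  unfolding w(2)[OF that, symmetric] c[OF that, symmetric] d[OF that, symmetric]
  by (auto simp: algebra_simps)
 then have "F z = c / w * F1 z + d / w * F2 z" "H z = c / w * H1 z + d / w * H2 z" if "z > 0" for z
  using w(1) that by (simp_all add: divide_simps mult.commute)
 then show ?thesis by (rule that)
qed

lemma bessel_pair_basis_unique:
 assumes w: "w \<noteq> 0" "\<And>z. z > 0 ==> of_real z * (F1 z * H2 z - H1 z * F2 z) = (w::complex)"
  and eq: "\<And>z::real. z > 0 ==> a * F1 z + b * F2 z = a' * F1 z + b' * F2 z"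
  "\<And>z::real. z > 0 ==> a * H1 z + b * H2 z = a' * H1 z + b' * H2 z"
 shows "a = a'" "b = b'"
proof -
 \<comment> \<open>The factor 1 is the point z = 1 at which Cramer's rule is applied.\<close>
 have "(a - a') * w = 1 * ((a * F1 1 + b * F2 1 - (a' * F1 1 + b' * F2 1)) * H2 1 - (a * H1 1 + b * H2 1 - (a' * H1 1 + b' * H2 1)) * F2 1)"
  unfolding w(2)[of 1, symmetric, simplified] by (simp add: algebra_simps)
 also have "\<dots> = 0" using eq[of 1] by simp
 finally show "a = a'" using w(1) by simp
 have "(b - b') * w = 1 * ((a * H1 1 + b * H2 1 - (a' * H1 1 + b' * H2 1)) * F1 1 - (a * F1 1 + b * F2 1 - (a' * F1 1 + b' * F2 1)) * H1 1)"
  unfolding w(2)[of 1, symmetric, simplified] by (simp add: algebra_simps)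
 also have "\<dots> = 0" using eq[of 1] by simp
 finally show "b = b'" using w(1) by simp
qed

section \<open>The series \<open>bessel_I_hat\<close> and its Bessel pairs\<close>

definition I_hat_coeff :: "complex => nat => complex" where
 "I_hat_coeff r k = (-1) ^ k / fact k * Gamma (- r - of_nat k)"

text \<open>The entire part E_r of the Bessel function: \<open>bessel_I_hat r z\<close> is (z/2)^r
  E_r(z^2/4). In the variable w = z^2/4 and for non-integral r, the operator d/dw raises the order
  by one and r + w d/dw lowers it, both up to sign.\<close>

definition I_hat_series :: "complex => complex => complex" where
 "I_hat_series r w = (\<Sum>k. I_hat_coeff r k * w ^ k)"

lemma notin_Ints_shift: "(r::complex) \<notin> \<int> ==> - r - of_nat k \<notin> \<int>"
 by (metis Ints_minus Ints_of_nat Ints_add add.inverse_inverse diff_add_cancel)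

lemma I_hat_coeff_Suc:
 assumes "r \<notin> \<int>"
 shows "of_nat (Suc k) * I_hat_coeff r (Suc k) = - I_hat_coeff (r + 1) k"
proof -
 have "- r - of_nat (Suc k) = - (r + 1) - of_nat k" by simp
 then have "Gamma (- r - of_nat (Suc k)) = Gamma (- (r + 1) - of_nat k)" by (rule arg_cong)
 then show ?thesis by (simp add: I_hat_coeff_def field_simps del: of_nat_Suc)
qed

text \<open>Functional equation of Gamma at -r - k, which is not a pole because r is not an
  integer.\<close>

lemma I_hat_coeff_order:
 assumes "r \<notin> \<int>"
 shows "(r + of_nat k) * I_hat_coeff r k = - I_hat_coeff (r - 1) k"
proof -
 have "Gamma ((- r - of_nat k) + 1) = (- r - of_nat k) * Gamma (- r - of_nat k)"
  using notin_Ints_shift[OF assms, of k] nonpos_Ints_Int by (intro Gamma_plus1) auto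
 moreover have "- r - of_nat k + 1 = - (r - 1) - of_nat k" by simp
 ultimately have "Gamma (- (r - 1) - of_nat k) = (- r - of_nat k) * Gamma (- r - of_nat k)"
  by metis
 then have "I_hat_coeff (r - 1) k = (-1) ^ k / fact k * ((- r - of_nat k) * Gamma (- r - of_nat k))"
  unfolding I_hat_coeff_def by (rule arg_cong)
 also have "\<dots> = - ((r + of_nat k) * I_hat_coeff r k)"
  unfolding I_hat_coeff_def by (simp only: minus_add_distrib diff_conv_add_uminus[symmetric] mult_minus_left[symmetric] mult.left_commute)
 finally show ?thesis by simp
qed

lemma I_hat_coeff_ratio:
 assumes "r \<notin> \<int>"
 shows "I_hat_coeff r (Suc k) = I_hat_coeff r k / (of_nat (Suc k) * (r + 1 + of_nat k))"
proof -
 have r1: "r + 1 \<notin> \<int>" using assms by (metis Ints_1 Ints_diff add_diff_cancel_right')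
 have nz: "r + 1 + of_nat k \<noteq> 0"
 proof
  assume "r + 1 + of_nat k = 0"
  then have "r = - (1 + of_nat k)" by (simp only: eq_neg_iff_add_eq_0 add.assoc)
  then show False using assms by simp
 qed
 have "(r + 1 + of_nat k) * I_hat_coeff (r + 1) k = - I_hat_coeff r k"
  using I_hat_coeff_order[OF r1, of k] by simp
 moreover have "I_hat_coeff (r + 1) k = - (of_nat (Suc k) * I_hat_coeff r (Suc k))"
  using I_hat_coeff_Suc[OF assms, of k] by simp
 ultimately have "(of_nat (Suc k) * (r + 1 + of_nat k)) * I_hat_coeff r (Suc k) = I_hat_coeff r k"
  by (simp add: algebra_simps del: of_nat_Suc)
 moreover have "of_nat (Suc k) * (r + 1 + of_nat k) \<noteq> 0" using nz by (simp del: of_nat_Suc)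
 ultimately show ?thesis by (metis nonzero_mult_div_cancel_left)
qed

lemma summable_I_hat:
 assumes "r \<notin> \<int>"
 shows "summable (\<lambda>k. I_hat_coeff r k * w ^ k)"
proof -
 have "(\<lambda>k. cmod w / (cmod (of_nat (Suc k) * (r + 1 + of_nat k)))) \<longlonglongrightarrow> 0"
 proof (rule real_tendsto_divide_at_top)
  have "filterlim (\<lambda>k. real (Suc k) * (real k - cmod (r+1))) at_top sequentially" by real_asymp
  then show "filterlim (\<lambda>k. cmod (of_nat (Suc k) * (r + 1 + of_nat k))) at_top sequentially"
  proof (rule filterlim_at_top_mono, intro always_eventually allI)
   fix k
   have "real k - cmod (r+1) \<le> cmod (r + 1 + of_nat k)"
    using norm_triangle_ineq4[of "r + 1 + of_nat k" "r + 1"] by simp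
   then show "real (Suc k) * (real k - cmod (r+1)) \<le> cmod (of_nat (Suc k) * (r + 1 + of_nat k))"
    unfolding norm_mult norm_of_nat by (intro mult_left_mono) auto
  qed
 qed auto
 then have "\<forall>\<^sub>F k in sequentially. cmod w / (cmod (of_nat (Suc k) * (r + 1 + of_nat k))) < 1/2"
  by (rule order_tendstoD) auto
 then obtain N where N: "\<And>k. k \<ge> N ==> cmod w / (cmod (of_nat (Suc k) * (r + 1 + of_nat k))) < 1/2"
  unfolding eventually_sequentially by auto
 show ?thesis
 proof (rule summable_ratio_test[of "1/2" N])
  fix k assume k: "N \<le> k"
  have "norm (I_hat_coeff r (Suc k) * w ^ Suc k) = 
   cmod w / (cmod (of_nat (Suc k) * (r + 1 + of_nat k))) * norm (I_hat_coeff r k * w ^ k)"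
   unfolding I_hat_coeff_ratio[OF assms] by (simp add: norm_mult norm_divide norm_power)
  also have "\<dots> \<le> 1/2 * norm (I_hat_coeff r k * w ^ k)"
   using N[OF k] by (intro mult_right_mono) auto
  finally show "norm (I_hat_coeff r (Suc k) * w ^ Suc k) \<le> 1/2 * norm (I_hat_coeff r k * w ^ k)" .
 qed auto
qed

lemma I_hat_series_deriv:
 assumes "r \<notin> \<int>"
 shows "(I_hat_series r has_field_derivative - I_hat_series (r + 1) w) (at w)"
proof -
 have "((\<lambda>w. \<Sum>k. I_hat_coeff r k * w ^ k) has_field_derivative (\<Sum>k. diffs (I_hat_coeff r) k * w ^ k)) (at w)"
  by (rule termdiffs_strong_converges_everywhere) (rule summable_I_hat[OF assms])
 moreover have "diffs (I_hat_coeff r) = (\<lambda>k. - I_hat_coeff (r + 1) k)"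
  unfolding diffs_def using I_hat_coeff_Suc[OF assms] by (auto simp del: of_nat_Suc)
 moreover have "r + 1 \<notin> \<int>" using assms by (metis Ints_1 Ints_diff add_diff_cancel_right')
 ultimately show ?thesis unfolding I_hat_series_def[abs_def]
  using suminf_minus[OF summable_I_hat[of "r+1" w]] by simp
qed

lemma I_hat_series_order:
 assumes "r \<notin> \<int>"
 shows "r * I_hat_series r w - w * I_hat_series (r + 1) w = - I_hat_series (r - 1) w"
proof -
 have r1: "r + 1 \<notin> \<int>" "r - 1 \<notin> \<int>" using assms
  by (metis Ints_1 Ints_diff add_diff_cancel_right', metis Ints_1 Ints_add diff_add_cancel)
 \<comment> \<open>The terms of w d/dw E_r: the one for k = 0 vanishes and the others are those of
   -w E_(r+1), shifted by one.\<close>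
 have *: "of_nat k * I_hat_coeff r k * w ^ k = (case k of 0 => 0 | Suc j => - (w * (I_hat_coeff (r+1) j * w ^ j)))" for k
  using I_hat_coeff_Suc[OF assms, of "k-1"] by (cases k) (auto simp del: of_nat_Suc)
 have s1: "(\<lambda>k. I_hat_coeff (r - 1) k * w ^ k) sums I_hat_series (r-1) w"
  unfolding I_hat_series_def using summable_I_hat[OF r1(2)] by (rule summable_sums)
 have s2: "(\<lambda>k. I_hat_coeff (r + 1) k * w ^ k) sums I_hat_series (r+1) w"
  unfolding I_hat_series_def using summable_I_hat[OF r1(1)] by (rule summable_sums)
 have s3: "(\<lambda>k. I_hat_coeff r k * w ^ k) sums I_hat_series r w"
  unfolding I_hat_series_def using summable_I_hat[OF assms] by (rule summable_sums)
 have "(\<lambda>j. - (w * (I_hat_coeff (r+1) j * w ^ j))) sums (- (w * I_hat_series (r+1) w))"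
  by (intro sums_minus sums_mult s2)
 then have s4: "(\<lambda>k. of_nat k * I_hat_coeff r k * w ^ k) sums (- (w * I_hat_series (r+1) w) + 0)"
  unfolding * using sums_Suc[of "\<lambda>k. case k of 0 => 0 | Suc j => - (w * (I_hat_coeff (r+1) j * w ^ j))"]
  by simp
 have "(\<lambda>k. r * (I_hat_coeff r k * w ^ k) + of_nat k * I_hat_coeff r k * w ^ k) sums (r * I_hat_series r w + (- (w * I_hat_series (r+1) w) + 0))"
  by (intro sums_add sums_mult s3 s4)
 moreover have "r * (I_hat_coeff r k * w ^ k) + of_nat k * I_hat_coeff r k * w ^ k = - (I_hat_coeff (r - 1) k * w ^ k)" for k
 proof -
  have "r * (I_hat_coeff r k * w ^ k) + of_nat k * I_hat_coeff r k * w ^ k = (r + of_nat k) * I_hat_coeff r k * w ^ k"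
   by (simp add: algebra_simps)
  then show ?thesis unfolding I_hat_coeff_order[OF assms] by simp
 qed
 ultimately have "(\<lambda>k. - (I_hat_coeff (r - 1) k * w ^ k)) sums (r * I_hat_series r w + (- (w * I_hat_series (r+1) w) + 0))"
  by simp
 from sums_unique2[OF this sums_minus[OF s1]] show ?thesis by simp
qed

lemma bessel_I_hat_eq:
 assumes "r \<notin> \<int>" "z > 0"
 shows "bessel_I_hat r (of_real z) = of_real (z/2) powr r * I_hat_series r (of_real (z\<^sup>2 / 4))"
proof -
 have "(-1) ^ k / fact k * Gamma (- r - of_nat k) * (of_real z / 2) powr (r + 2 * of_nat k)
   = of_real (z/2) powr r * (I_hat_coeff r k * of_real (z\<^sup>2 / 4) ^ k)" for k
 proof -
  have "of_real (z/2) powr (r + 2 * of_nat k) = of_real (z/2) powr r * (of_real (z/2) powr of_nat (2*k) :: complex)"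
   by (simp add: powr_add)
  also have "of_real (z/2) powr of_nat (2*k) = (of_real (z/2) ^ (2 * k) :: complex)"
   using assms by (subst powr_nat) auto
  also have "\<dots> = of_real (z\<^sup>2 / 4) ^ k" by (simp add: power_mult power_divide)
  finally show ?thesis unfolding I_hat_coeff_def by simp
 qed
 then show ?thesis unfolding bessel_I_hat_def I_hat_series_def
  using suminf_mult[OF summable_I_hat[OF assms(1)]] by simp
qed

lemma has_vector_derivative_powr_real:
 assumes "z > 0" and that: "c > 0"
 shows "((\<lambda>z. of_real (z * c) powr s) has_vector_derivative (s / complex_of_real z * of_real (z * c) powr s)) (at z)"
proof -
 have "((\<lambda>z. of_real z * of_real c) has_vector_derivative of_real c) (at z)" 
  using has_vector_derivative_of_real[OF DERIV_cmult_Id[of c], of z] by (simp add: mult.commute)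
 moreover have "((\<lambda>w. w powr s) has_field_derivative s * (of_real z * of_real c) powr (s - 1)) (at (of_real z * of_real c))"
  using assms that by (intro has_field_derivative_powr) (auto simp: complex_nonpos_Reals_iff not_le mult_pos_pos simp flip: of_real_mult)
 ultimately have "((\<lambda>w. w powr s) \<circ> (\<lambda>z. of_real z * of_real c) has_vector_derivative of_real c * (s * (of_real z * of_real c) powr (s - 1))) (at z)"
  by (rule field_vector_diff_chain_at)
 moreover have "of_real c * (s * (of_real z * of_real c) powr (s - 1)) = s / of_real z * of_real (z * c) powr s"
  using assms that by (simp add: powr_diff field_simps)
 ultimately show ?thesis by (simp add: o_def)
qed

lemma bessel_pair_cong:
 assumes "bessel_pair r F H" "\<And>z. z > 0 ==> F' z = F z" "\<And>z. z > 0 ==> H' z = H z"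
 shows "bessel_pair r F' H'"
 unfolding bessel_pair_def
proof (intro allI impI conjI)
 fix z :: real assume z: "z > 0"
 show "(F' has_vector_derivative r / of_real z * F' z - H' z) (at z)"
  by (rule has_vector_derivative_transform_within_open[where S="{0<..}" and f=F])
   (use assms z in \<open>auto simp: bessel_pair_def\<close>)
 show "(H' has_vector_derivative - F' z - (r + 1) / of_real z * H' z) (at z)"
  by (rule has_vector_derivative_transform_within_open[where S="{0<..}" and f=H])
   (use assms z in \<open>auto simp: bessel_pair_def\<close>)
qed

lemma I_hat_fun_deriv:
 assumes "r \<notin> \<int>" "z > 0"
 shows "((\<lambda>z. of_real (z * (1/2)) powr r * I_hat_series r (of_real (z\<^sup>2 / 4))) has_vector_derivative
   of_real (z/2) powr r * (r / of_real z * I_hat_series r (of_real (z\<^sup>2 / 4))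
    - of_real (z/2) * I_hat_series (r + 1) (of_real (z\<^sup>2 / 4)))) (at z)"
proof -
 have "((\<lambda>z. complex_of_real (z\<^sup>2 / 4)) has_vector_derivative of_real (z/2)) (at z)"
  by (intro has_vector_derivative_of_real) (auto intro!: derivative_eq_intros)
 from field_vector_diff_chain_at[OF this I_hat_series_deriv[OF assms(1)]]
 have "((\<lambda>z. I_hat_series r (of_real (z\<^sup>2 / 4))) has_vector_derivative
    (of_real (z/2) * - I_hat_series (r + 1) (of_real (z\<^sup>2 / 4)))) (at z)" by (simp add: o_def)
 from has_vector_derivative_mult[OF has_vector_derivative_powr_real[of z "1/2" r] this]
 show ?thesis using assms(2) by (simp add: algebra_simps)
qed

text \<open>The power (z/2)^r contributes r/z and the entire part contributes its derivative
  -E_(r+1), which gives the first equation. For the second, \<open>I_hat_series_order\<close> at r +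
  1 trades the order r + 2 for r.\<close>

lemma bessel_pair_I_hat:
 assumes r: "r \<notin> \<int>"
 shows "bessel_pair r (\<lambda>z. bessel_I_hat r (of_real z)) (\<lambda>z. bessel_I_hat (r + 1) (of_real z))"
proof (rule bessel_pair_cong)
 have r1: "r + 1 \<notin> \<int>" using r by (metis Ints_1 Ints_diff add_diff_cancel_right')
 let ?F = "\<lambda>r z. of_real (z * (1/2)) powr r * I_hat_series r (of_real (z\<^sup>2 / 4))"
 show "bessel_I_hat r (of_real z) = ?F r z" "bessel_I_hat (r+1) (of_real z) = ?F (r+1) z" if "z > 0" for z
  using that bessel_I_hat_eq[OF r] bessel_I_hat_eq[OF r1] by simp_all
 show "bessel_pair r (?F r) (?F (r+1))"
  unfolding bessel_pair_def
 proof (intro allI impI conjI)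
  fix z :: real assume z: "z > 0"
  let ?w = "complex_of_real (z\<^sup>2 / 4)"
  have p: "of_real (z/2) powr (r + 1) = of_real (z/2) powr r * (of_real (z/2) :: complex)"
   using z by (simp add: powr_add)
  have "of_real (z/2) powr r * (r / of_real z * I_hat_series r ?w - of_real (z/2) * I_hat_series (r + 1) ?w)
    = r / of_real z * ?F r z - ?F (r+1) z" using p by (simp add: algebra_simps)
  with I_hat_fun_deriv[OF r z]
  show "(?F r has_vector_derivative r / of_real z * ?F r z - ?F (r+1) z) (at z)" by metis
  have "(r + 1) * I_hat_series (r + 1) ?w - ?w * I_hat_series (r + 1 + 1) ?w = - I_hat_series r ?w"
   using I_hat_series_order[OF r1, of ?w] by simp
  then have e: "?w * I_hat_series (r + 1 + 1) ?w = (r + 1) * I_hat_series (r + 1) ?w + I_hat_series r ?w"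
   by (simp add: algebra_simps)
  have "of_real (z/2) powr (r + 1) * ((r + 1) / of_real z * I_hat_series (r + 1) ?w - of_real (z/2) * I_hat_series (r + 1 + 1) ?w)
    = of_real (z/2) powr r * ((r + 1) / 2 * I_hat_series (r + 1) ?w - ?w * I_hat_series (r + 1 + 1) ?w)"
   unfolding p using z by (simp add: field_simps power2_eq_square)
  also have "\<dots> = - ?F r z - (r + 1) / of_real z * ?F (r+1) z"
   unfolding e times_divide_eq_right mult_1_right p using z by (simp add: field_simps)
  finally show "(?F (r+1) has_vector_derivative - ?F r z - (r + 1) / of_real z * ?F (r+1) z) (at z)"
   using I_hat_fun_deriv[OF r1 z] by metis
 qed
qed

text \<open>Exchanging the two components turns a pair of order r into one of order -r - 1, so this
  is \<open>bessel_pair_I_hat\<close> at -r - 1 read backwards.\<close>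

lemma bessel_pair_I_hat_neg:
 assumes r: "r \<notin> \<int>"
 shows "bessel_pair r (\<lambda>z. bessel_I_hat (- r) (of_real z)) (\<lambda>z. bessel_I_hat (- r - 1) (of_real z))"
proof -
 have "- r - 1 \<notin> \<int>" using notin_Ints_shift[OF r, of 1] by simp
 moreover have "(- r - 1) / w * x - y = - y - (r + 1) / w * x" "- x - (- r - 1 + 1) / w * y = r / w * y - x" for w x y :: complex
  by (simp_all add: add_divide_distrib diff_divide_distrib algebra_simps)
 ultimately show ?thesis using bessel_pair_I_hat[of "- r - 1"] unfolding bessel_pair_def
  by (simp add: minus_diff_commute conj_commute)
qed

text \<open>The constant is evaluated as z tends to 0: the first product contributes 2 E_r(0)
  E_(-r-1)(0), where E_s(0) = Gamma(-s), and the second carries a factor z^2.\<close>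

lemma I_hat_wronskian:
 assumes r: "r \<notin> \<int>" and z: "z > 0"
 shows "of_real z * (bessel_I_hat r (of_real z) * bessel_I_hat (- r - 1) (of_real z)
   - bessel_I_hat (r + 1) (of_real z) * bessel_I_hat (- r) (of_real z)) = 2 * Gamma (- r) * Gamma (r + 1)"
proof -
 obtain c where c: "\<And>z. z > 0 ==> of_real z * (bessel_I_hat r (of_real z) * bessel_I_hat (- r - 1) (of_real z)
   - bessel_I_hat (r + 1) (of_real z) * bessel_I_hat (- r) (of_real z)) = c"
  using bessel_pair_wronskian_const[OF bessel_pair_I_hat[OF r] bessel_pair_I_hat_neg[OF r]] by metis
 have r1: "r + 1 \<notin> \<int>" "- r - 1 \<notin> \<int>" "- r \<notin> \<int>" 
  using notin_Ints_shift[OF r, of 1] notin_Ints_shift[OF r, of 0] r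
  by (metis Ints_1 Ints_diff add_diff_cancel_right', simp_all)
 let ?E = "I_hat_series"
 let ?w = "\<lambda>z. complex_of_real (z\<^sup>2 / 4)"
 have c2: "c = 2 * ?E r (?w z) * ?E (- r - 1) (?w z) - of_real (z\<^sup>2 / 2) * ?E (r + 1) (?w z) * ?E (- r) (?w z)" if "z > 0" for z
 proof -
  have p: "of_real (z/2) powr (- r - 1) = of_real (z/2) powr (- r) / (of_real (z/2) :: complex)"
   "of_real (z/2) powr (r + 1) = of_real (z/2) powr r * (of_real (z/2) :: complex)"
   "of_real (z/2) powr (- r) = 1 / (of_real (z/2) powr r :: complex)"
   "of_real (z/2) powr r \<noteq> (0 :: complex)"
   using that by (auto simp: powr_add powr_diff powr_minus_divide)
  show ?thesis using c[OF that] that p(4)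
   unfolding bessel_I_hat_eq[OF r that] bessel_I_hat_eq[OF r1(1) that] bessel_I_hat_eq[OF r1(2) that] bessel_I_hat_eq[OF r1(3) that]
   unfolding p(1-3) by (simp add: divide_simps) (simp add: algebra_simps power2_eq_square)
 qed
 have cont: "isCont (?E s) 0" if "s \<notin> \<int>" for s
  using I_hat_series_deriv[OF that] by (rule DERIV_isCont)
 have wt: "(?w \<longlongrightarrow> 0) (at_right 0)" "((\<lambda>z. complex_of_real (z\<^sup>2 / 2)) \<longlongrightarrow> of_real 0) (at_right 0)"
  by (auto intro!: tendsto_eq_intros)
 have "((\<lambda>z. 2 * ?E r (?w z) * ?E (- r - 1) (?w z) - of_real (z\<^sup>2 / 2) * ?E (r + 1) (?w z) * ?E (- r) (?w z))
   \<longlongrightarrow> 2 * ?E r 0 * ?E (- r - 1) 0 - of_real 0 * ?E (r + 1) 0 * ?E (- r) 0) (at_right 0)"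
  by (intro tendsto_intros wt isCont_tendsto_compose[OF cont] r r1)
 moreover have "\<forall>\<^sub>F z in at_right 0. 2 * ?E r (?w z) * ?E (- r - 1) (?w z) - of_real (z\<^sup>2 / 2) * ?E (r + 1) (?w z) * ?E (- r) (?w z) = c"
  using c2 by (auto simp: eventually_at_right_less eventually_at_right[of 0 1] intro!: exI[of _ 1])
 ultimately have "((\<lambda>z. c) \<longlongrightarrow> 2 * ?E r 0 * ?E (- r - 1) 0) (at_right (0::real))"
  by (simp add: tendsto_cong)
 then have "c = 2 * ?E r 0 * ?E (- r - 1) 0"
  by (metis tendsto_const tendsto_unique trivial_limit_at_right_real)
 moreover have "?E s 0 = Gamma (- s)" for s
  unfolding I_hat_series_def using powser_zero[of "I_hat_coeff s"] by (simp add: I_hat_coeff_def)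
 ultimately show ?thesis using c[OF z] by (simp add: add.commute)
qed

text \<open>Serves for differentiation under the integral sign, where the bound is an integrated
  Taylor remainder, and for the matrix exponential.\<close>

lemma has_vector_derivative_quadratic_bound:
 fixes f :: "real => 'a::real_normed_vector"
 assumes "d > 0" "\<And>h. \<bar>h\<bar> < d ==> norm (f (x + h) - f x - h *\<^sub>R D) \<le> C * h\<^sup>2"
 shows "(f has_vector_derivative D) (at x)"
 unfolding has_vector_derivative_def has_derivative_at
proof (intro conjI bounded_linear_scaleR_left)
 show "(\<lambda>h. norm (f (x + h) - f x - h *\<^sub>R D) / norm h) \<midarrow>0\<rightarrow> 0"
 proof (rule Lim_null_comparison)
  show "\<forall>\<^sub>F h in at 0. norm (norm (f (x + h) - f x - h *\<^sub>R D) / norm h) \<le> C * \<bar>h\<bar>"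
   unfolding eventually_at
  proof (intro exI[of _ d] conjI ballI impI assms(1))
   fix h :: real assume "h \<noteq> 0 \<and> dist h 0 < d"
   then show "norm (norm (f (x + h) - f x - h *\<^sub>R D) / norm h) \<le> C * \<bar>h\<bar>"
    using assms(2)[of h] by (simp add: divide_simps power2_eq_square)
  qed
  show "((\<lambda>h. C * \<bar>h\<bar>) \<longlongrightarrow> 0) (at 0)" by (auto intro!: tendsto_eq_intros)
 qed
qed

lemma exp_mult_one_plus_square_le: "1 + u\<^sup>2 \<le> 2 * exp \<bar>u::real\<bar>"
 using exp_lower_Taylor_quadratic[of "\<bar>u\<bar>"] by simp

lemma integrable_inverse_one_plus_square:
 "integrable lborel (\<lambda>x::real. C / (1 + x\<^sup>2))"
 using integrable_mult_right[OF integrable_inverse_1_plus_square[unfolded set_integrable_def einterval_eq_UNIV], of C]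
 by (simp add: field_simps)

lemma integrable_one_plus_square_bound:
 fixes f :: "real => complex"
 assumes "continuous_on UNIV f" "\<And>u. norm (f u) * (1 + u\<^sup>2) \<le> C"
 shows "integrable lborel f"
proof (rule Bochner_Integration.integrable_bound[OF integrable_inverse_one_plus_square[of C]])
 show "f \<in> borel_measurable lborel" using borel_measurable_continuous_onI[OF assms(1)] by simp
 have "norm (f u) \<le> norm (C / (1 + u\<^sup>2))" for u
 proof -
  have "1 + u\<^sup>2 > 0" by (simp add: add_pos_nonneg)
  then have "norm (f u) \<le> C / (1 + u\<^sup>2)" using assms(2)[of u] by (simp add: field_simps)
  also have "\<dots> \<le> norm (C / (1 + u\<^sup>2))" unfolding real_norm_def by (rule abs_ge_self)
  finally show ?thesis .
 qed
 then show "AE u in lborel. norm (f u) \<le> norm (C / (1 + u\<^sup>2))" by auto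
qed

text \<open>The change of variables is done for real and imaginary parts separately; measurability
  of the integrand on the half line brings the result back from the completed measure to
  \<open>lborel\<close>.\<close>

lemma LBINT_exp_substitution:
 fixes f :: "real => complex"
 assumes cont: "continuous_on {0<..} f" and int: "integrable lborel (\<lambda>u. exp u *\<^sub>R f (exp u))"
 shows "set_integrable lborel {0<..} f" "(LBINT t:{0<..}. f t) = (LBINT u. exp u *\<^sub>R f (exp u))"
proof -
 have real: "set_integrable lborel {0<..} g \<and> (LBINT t:{0<..}. g t) = (LBINT u. exp u * g (exp u))"
  if g: "continuous_on {0<..} g" "integrable lborel (\<lambda>u. exp u * g (exp u))" for g :: "real => real"
 proof -
  let ?h = "\<lambda>u. exp u * g (exp u)"
  have m: "(\<lambda>t. indicator {0<..} t *\<^sub>R g t) \<in> borel_measurable borel"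
   using g(1) by (intro borel_measurable_continuous_on_indicator) auto
  have h: "integrable lebesgue ?h" "integral\<^sup>L lebesgue ?h = integral\<^sup>L lborel ?h"
   using g(2) borel_measurable_integrable[OF g(2)] by (simp_all add: integrable_completion integral_completion)
  have "?h absolutely_integrable_on UNIV" using h(1) by (simp add: set_integrable_def)
  moreover from this have "integral UNIV ?h = integral\<^sup>L lborel ?h"
   using set_lebesgue_integral_eq_integral(2)[of UNIV ?h] h(2) by (simp add: set_lebesgue_integral_def)
  ultimately have "g absolutely_integrable_on range exp \<and> integral (range exp) g = integral\<^sup>L lborel ?h"
   using has_absolute_integral_change_of_variables_1'[of UNIV exp exp g "integral\<^sup>L lborel ?h"]
   by (simp add: DERIV_exp inj_def)
  moreover have "range (exp :: real => real) = {0<..}"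
   by (auto simp: image_def) (metis exp_ln)
  ultimately have gi: "set_integrable lebesgue {0<..} g" "integral {0<..} g = integral\<^sup>L lborel ?h" by auto
  have "set_integrable lborel {0<..} g"
   using gi(1) m by (simp add: set_integrable_def integrable_completion)
  moreover have "(LBINT t:{0<..}. g t) = integral\<^sup>L lborel ?h"
   using gi set_borel_integral_eq_integral(2)[OF calculation] by simp
  ultimately show ?thesis by simp
 qed
 have R: "integrable lborel (\<lambda>u. exp u * Re (f (exp u)))" "integrable lborel (\<lambda>u. exp u * Im (f (exp u)))"
  using integrable_Re[OF int] integrable_Im[OF int] by simp_all
 have C: "continuous_on {0<..} (\<lambda>t. Re (f t))" "continuous_on {0<..} (\<lambda>t. Im (f t))"
  using cont by (auto intro!: continuous_intros)
 note r = real[OF C(1) R(1)] and i = real[OF C(2) R(2)]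
 show s: "set_integrable lborel {0<..} f"
 proof -
  let ?I = "indicat_real {0<..}"
  have "integrable lborel (\<lambda>t. complex_of_real (?I t *\<^sub>R Re (f t)) + \<i> * complex_of_real (?I t *\<^sub>R Im (f t)))"
   using r i unfolding set_integrable_def
   by (intro Bochner_Integration.integrable_add integrable_mult_right integrable_of_real) auto
  moreover have "complex_of_real (?I t *\<^sub>R Re (f t)) + \<i> * complex_of_real (?I t *\<^sub>R Im (f t)) = ?I t *\<^sub>R f t" for t
   by (simp add: complex_eq_iff)
  ultimately show ?thesis unfolding set_integrable_def by simp
 qed
 show "(LBINT t:{0<..}. f t) = (LBINT u. exp u *\<^sub>R f (exp u))"
 proof (rule complex_eqI)
  show "Re (LBINT t:{0<..}. f t) = Re (LBINT u. exp u *\<^sub>R f (exp u))"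
   using r integral_Re[OF int] integral_Re[OF s[unfolded set_integrable_def]] by (simp add: set_lebesgue_integral_def)
  show "Im (LBINT t:{0<..}. f t) = Im (LBINT u. exp u *\<^sub>R f (exp u))"
   using i integral_Im[OF int] integral_Im[OF s[unfolded set_integrable_def]] by (simp add: set_lebesgue_integral_def)
 qed
qed

lemma complex_exp_powr: "complex_of_real (exp u) powr r = exp (r * of_real u)"
 by (simp add: powr_def Ln_of_real del: of_real_exp)

lemma cosh_quadratic_lower: "cosh u \<ge> 1 + u\<^sup>2 / 4" for u :: real
proof -
 have "1 + \<bar>u\<bar> + u\<^sup>2 / 2 \<le> exp \<bar>u\<bar>" using exp_lower_Taylor_quadratic[of "\<bar>u\<bar>"] by simp
 moreover have "1 - \<bar>u\<bar> \<le> exp (- \<bar>u\<bar>)" using exp_ge_add_one_self[of "-\<bar>u\<bar>"] by simp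
 moreover have "cosh u = cosh \<bar>u\<bar>" by (cases "u \<ge> 0") auto
 ultimately show ?thesis by (simp add: cosh_def)
qed

section \<open>The Bessel function \<open>K\<close> and Mellin inversion\<close>

text \<open>Substituting \<open>t = exp u\<close> in the definition of the Bessel function gives \<open>K_int r x = 2 K\<^sub>r(x)\<close>.\<close>

definition K_ker :: "complex => real => real => complex" where
 "K_ker r x u = exp (of_real (- x * cosh u) + r * of_real u)"

definition K_int :: "complex => real => complex" where
 "K_int r x = (LBINT u. K_ker r x u)"

text \<open>From cosh u \<ge> u^2/4 and 1 + u^2 \<le> 2 exp |u|, the exponent is at most (|Re r| +
  1) |u| - x u^2/4, and completing the square bounds this by (|Re r| + 1)^2/x. With the factor 1 +
  u^2 on the left, integrability is immediate.\<close>

lemma K_ker_bound: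
 assumes "x > 0"
 shows "norm (K_ker r x u) * (1 + u\<^sup>2) \<le> 2 * exp ((\<bar>Re r\<bar> + 1)\<^sup>2 / x)"
proof -
 let ?b = "\<bar>Re r\<bar> + 1"
 have 0: "norm (K_ker r x u) = exp (- x * cosh u + Re r * u)" unfolding K_ker_def norm_exp_eq_Re by simp
 have "norm (K_ker r x u) * (1 + u\<^sup>2) \<le> exp (- x * cosh u + Re r * u) * (2 * exp \<bar>u\<bar>)"
  unfolding 0 by (intro mult_left_mono exp_mult_one_plus_square_le) auto
 also have "\<dots> = 2 * exp (- x * cosh u + Re r * u + \<bar>u\<bar>)" by (simp add: exp_add)
 finally have 1: "norm (K_ker r x u) * (1 + u\<^sup>2) \<le> 2 * exp (- x * cosh u + Re r * u + \<bar>u\<bar>)" .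
 have 2: "2 * exp (- x * cosh u + Re r * u + \<bar>u\<bar>) \<le> 2 * exp (?b\<^sup>2 / x)" 
 proof -
  have "Re r * u \<le> \<bar>Re r\<bar> * \<bar>u\<bar>" by (metis abs_ge_self abs_mult)
  moreover have "x * cosh u \<ge> x * (u\<^sup>2 / 4)" using assms cosh_quadratic_lower[of u] by (intro mult_left_mono) auto
  moreover have "?b * \<bar>u\<bar> \<le> x * (u\<^sup>2 / 4) + ?b\<^sup>2 / x"
  proof -
   have "0 \<le> (x * \<bar>u\<bar> / 2 - ?b)\<^sup>2" by simp
   then have "x * ?b * \<bar>u\<bar> \<le> x * x * (u\<^sup>2 / 4) + ?b\<^sup>2" by (simp add: power2_eq_square algebra_simps)
   then show ?thesis using assms by (simp add: field_simps power2_eq_square)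
  qed
  ultimately have "- x * cosh u + Re r * u + \<bar>u\<bar> \<le> ?b\<^sup>2 / x" by (simp add: algebra_simps)
  then show ?thesis by simp
 qed
 show ?thesis using order_trans[OF 1 2] .
qed

lemma K_ker_continuous: "continuous_on UNIV (K_ker r x)"
 unfolding K_ker_def[abs_def] cosh_def by (intro continuous_intros) auto

lemma K_ker_integrable: "x > 0 ==> integrable lborel (K_ker r x)"
 by (rule integrable_one_plus_square_bound[OF K_ker_continuous K_ker_bound])

lemma bessel_K_eq:
 assumes x: "x > 0"
 shows "bessel_K r (of_real x) = K_int r x / 2"
proof -
 let ?f = "\<lambda>t. exp (- complex_of_real x / 2 * complex_of_real (t + 1 / t)) * complex_of_real t powr r / complex_of_real t"
 have e: "exp u *\<^sub>R ?f (exp u) = K_ker r x u" for u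
 proof -
  have "exp u *\<^sub>R ?f (exp u) = exp (- complex_of_real x / 2 * complex_of_real (exp u + 1 / exp u)) * exp (r * of_real u)"
   unfolding complex_exp_powr by (simp add: scaleR_conv_of_real)
  moreover have "- complex_of_real x / 2 * complex_of_real (exp u + 1 / exp u) = of_real (- x * cosh u)"
   unfolding cosh_def exp_minus by (simp add: scaleR_conv_of_real inverse_eq_divide)
  ultimately show ?thesis unfolding K_ker_def exp_add by (simp only:)
 qed
 have c: "continuous_on {0<..} ?f"
  by (intro continuous_intros continuous_on_powr_complex) (auto simp: complex_nonpos_Reals_iff)
 have i: "integrable lborel (\<lambda>u. exp u *\<^sub>R ?f (exp u))" unfolding e using K_ker_integrable[OF x] .
 show ?thesis using LBINT_exp_substitution(2)[OF c i] unfolding e bessel_K_def K_int_def by simp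
qed

lemma K_int_minus: "K_int (- r) x = K_int r x"
proof -
 have "K_ker (- r) x (0 + (-1) * u) = K_ker r x u" for u by (simp add: K_ker_def)
 then show ?thesis unfolding K_int_def
  using lborel_integral_real_affine[of "-1" "K_ker (- r) x" 0] by simp
qed

text \<open>The source of both the derivative formula and the recurrence: differentiating the kernel
  in x or in u produces cosh u or sinh u, which only mixes the orders r + 1 and r - 1.\<close>

lemma K_ker_shift:
 "of_real (cosh u) * K_ker r x u = (K_ker (r + 1) x u + K_ker (r - 1) x u) / 2"
 "of_real (sinh u) * K_ker r x u = (K_ker (r + 1) x u - K_ker (r - 1) x u) / 2"
proof -
 have "K_ker (r + 1) x u = of_real (exp u) * K_ker r x u" "K_ker (r - 1) x u = of_real (exp (- u)) * K_ker r x u"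
  by (simp_all add: K_ker_def exp_add[symmetric] exp_of_real[symmetric] algebra_simps)
 then show "of_real (cosh u) * K_ker r x u = (K_ker (r + 1) x u + K_ker (r - 1) x u) / 2"
 "of_real (sinh u) * K_ker r x u = (K_ker (r + 1) x u - K_ker (r - 1) x u) / 2"
  by (simp_all add: cosh_def sinh_def algebra_simps scaleR_conv_of_real)
qed

text \<open>Differentiation under the integral with an explicit remainder. With v = -h cosh u the
  error is at most exp |v| |v|^2 times the kernel. For |h| < x/2 the exponential is absorbed by
  passing from x to x/2, and cosh^2 by passing to the orders r and r \<plusminus> 2; this is the
  majorant \<open>M\<close>.\<close>

lemma K_int_deriv:
 assumes x: "x > 0"
 shows "(K_int r has_vector_derivative - (K_int (r + 1) x + K_int (r - 1) x) / 2) (at x)"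
proof (rule has_vector_derivative_quadratic_bound[of "x/2"])
 define M where "M u = cmod (K_ker (r + 1 + 1) (x/2) u) + 2 * cmod (K_ker r (x/2) u) + cmod (K_ker (r - 1 - 1) (x/2) u)" for u
 have M: "integrable lborel M" unfolding M_def[abs_def] using x
  by (intro Bochner_Integration.integrable_add integrable_mult_right integrable_norm K_ker_integrable) auto
 fix h assume h: "\<bar>h\<bar> < x / 2"
 have int: "integrable lborel (K_ker r (x + h))" "integrable lborel (K_ker r x)"
  "integrable lborel (\<lambda>u. h *\<^sub>R (- (K_ker (r + 1) x u + K_ker (r - 1) x u) / 2))"
  using h x by (auto intro!: K_ker_integrable Bochner_Integration.integrable_add integrable_minus integrable_scaleR_right integrable_divide simp: abs_if split: if_splits)
 have "norm (K_int r (x + h) - K_int r x - h *\<^sub>R (- (K_int (r + 1) x + K_int (r - 1) x) / 2))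
  = norm (LBINT u::real. K_ker r (x + h) u - K_ker r x u - h *\<^sub>R (- (K_ker (r + 1) x u + K_ker (r - 1) x u) / 2))"
  using int x unfolding K_int_def by (simp add: K_ker_integrable)
 also have "\<dots> \<le> (LBINT u. h\<^sup>2 * M u)"
 proof (rule Bochner_Integration.integral_norm_bound_integral)
  fix u :: real
  let ?c = "cosh u"
  have "K_ker r (x + h) u - K_ker r x u - h *\<^sub>R (- (K_ker (r + 1) x u + K_ker (r - 1) x u) / 2)
    = K_ker r x u * (exp (of_real (- h * ?c)) - 1 - of_real (- h * ?c))"
  proof -
   have e: "K_ker r (x + h) u = K_ker r x u * exp (of_real (- h * ?c))"
    by (simp add: K_ker_def exp_add[symmetric] algebra_simps)
   have "h *\<^sub>R (- (K_ker (r + 1) x u + K_ker (r - 1) x u) / 2) = - (of_real h * (of_real ?c * K_ker r x u))"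
    unfolding K_ker_shift(1) by (simp add: scaleR_conv_of_real) (simp add: algebra_simps)
   then show ?thesis unfolding e by (simp add: algebra_simps)
  qed
  also have "norm \<dots> \<le> norm (K_ker r x u) * (exp \<bar>h * ?c\<bar> * (h * ?c)\<^sup>2)"
   unfolding norm_mult
   using Taylor_exp[of "complex_of_real (- h * ?c)" 1]
   by (intro mult_left_mono) (auto simp: power2_eq_square norm_mult abs_mult diff_diff_eq exp_of_real algebra_simps)
  also have "\<dots> = h\<^sup>2 * (exp (- x * ?c + \<bar>h\<bar> * ?c + Re r * u) * ?c\<^sup>2)"
   by (simp add: K_ker_def norm_exp_eq_Re abs_mult power_mult_distrib cosh_real_nonneg algebra_simps exp_add[symmetric])
  also have "\<dots> \<le> h\<^sup>2 * (exp (- (x/2) * ?c + Re r * u) * ?c\<^sup>2)"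
  proof -
   have "(\<bar>h\<bar> - x / 2) * ?c \<le> 0" using h cosh_real_nonneg[of u] by (intro mult_nonpos_nonneg) auto
   then show ?thesis by (intro mult_left_mono mult_right_mono) (auto simp: algebra_simps)
  qed
  also have "exp (- (x/2) * ?c + Re r * u) * ?c\<^sup>2 = norm (of_real ?c * (of_real ?c * K_ker r (x/2) u))"
   by (simp add: K_ker_def norm_mult norm_exp_eq_Re power2_eq_square)
  also have "\<dots> \<le> M u"
  proof -
   have "of_real ?c * (of_real ?c * K_ker r (x/2) u)
     = (K_ker (r + 1 + 1) (x/2) u + 2 * K_ker r (x/2) u + K_ker (r - 1 - 1) (x/2) u) / 4"
    unfolding K_ker_shift(1) times_divide_eq_right distrib_left by (simp add: add_divide_distrib)
   also have "norm \<dots> \<le> M u / 4" unfolding M_def norm_divide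
    using norm_triangle_ineq[of "K_ker (r + 1 + 1) (x/2) u + 2 * K_ker r (x/2) u" "K_ker (r - 1 - 1) (x/2) u"]
     norm_triangle_ineq[of "K_ker (r + 1 + 1) (x/2) u" "2 * K_ker r (x/2) u"]
    by (simp add: norm_mult)
   also have "\<dots> \<le> M u" by (simp add: M_def)
   finally show ?thesis .
  qed
  finally show "norm (K_ker r (x + h) u - K_ker r x u - h *\<^sub>R (- (K_ker (r + 1) x u + K_ker (r - 1) x u) / 2)) \<le> h\<^sup>2 * M u"
   by (simp add: mult_left_mono)
 qed (use int M in \<open>auto intro!: Bochner_Integration.integrable_diff integrable_mult_right\<close>)
 also have "\<dots> = integral\<^sup>L lborel M * h\<^sup>2" using M by simp
 finally show "norm (K_int r (x + h) - K_int r x - h *\<^sub>R (- (K_int (r + 1) x + K_int (r - 1) x) / 2)) \<le> integral\<^sup>L lborel M * h\<^sup>2" .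
qed (use x in auto)

text \<open>The difference of the two sides is, up to a constant, the integral of the u-derivative
  (r - x sinh u) \<open>K_ker r x u\<close>, and the kernel vanishes at both ends.\<close>

lemma K_int_order_recurrence:
 assumes x: "x > 0"
 shows "2 * r * K_int r x = of_real x * (K_int (r + 1) x - K_int (r - 1) x)"
proof -
 let ?f = "\<lambda>u. r * K_ker r x u - of_real x / 2 * (K_ker (r + 1) x u - K_ker (r - 1) x u)"
 have int: "integrable lborel ?f" using x
  by (intro Bochner_Integration.integrable_diff integrable_mult_right K_ker_integrable) auto
 have lim: "(K_ker r x \<longlongrightarrow> 0) F" if F: "filterlim (\<lambda>u. 1 + u\<^sup>2) at_top F" for F
 proof (rule Lim_null_comparison)
  show "\<forall>\<^sub>F u in F. norm (K_ker r x u) \<le> 2 * exp ((\<bar>Re r\<bar> + 1)\<^sup>2 / x) / (1 + u\<^sup>2)"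
   using K_ker_bound[OF x, of r] by (intro always_eventually allI) (simp add: field_simps add_pos_nonneg)
  show "((\<lambda>u. 2 * exp ((\<bar>Re r\<bar> + 1)\<^sup>2 / x) / (1 + u\<^sup>2)) \<longlongrightarrow> 0) F"
   using F by (rule real_tendsto_divide_at_top[OF tendsto_const])
 qed
 have top: "filterlim (\<lambda>u::real. 1 + u\<^sup>2) at_top at_top" by real_asymp
 have bot: "filterlim (\<lambda>u::real. 1 + u\<^sup>2) at_top at_bot" by real_asymp
 have "(LBINT u=-\<infinity>..\<infinity>. ?f u) = 0 - 0"
 proof (rule interval_integral_FTC_integrable)
  fix u
  have "((\<lambda>u. complex_of_real (- x * cosh u) + r * of_real u) has_vector_derivative (of_real (- x * sinh u) + r * of_real 1)) (at u)"
   by (intro has_vector_derivative_add has_vector_derivative_mult_right has_vector_derivative_of_real)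
     (auto intro!: derivative_eq_intros)
  from field_vector_diff_chain_at[OF this DERIV_exp]
  have "(K_ker r x has_vector_derivative (of_real (- x * sinh u) + r * of_real 1) * K_ker r x u) (at u)"
   by (simp add: K_ker_def[abs_def] o_def)
  moreover have "(of_real (- x * sinh u) + r * of_real 1) * K_ker r x u = ?f u"
  proof -
   have "of_real x / 2 * (K_ker (r + 1) x u - K_ker (r - 1) x u) = of_real x * (of_real (sinh u) * K_ker r x u)"
    unfolding K_ker_shift(2) by simp
   then show ?thesis by (simp add: algebra_simps)
  qed
  ultimately show "(K_ker r x has_vector_derivative ?f u) (at u)" by simp
  show "isCont ?f u" using K_ker_continuous by (auto intro!: continuous_intros simp: continuous_on_eq_continuous_at)
 next
  show "set_integrable lborel (einterval (-\<infinity>) \<infinity>) ?f" using int by (simp add: set_integrable_def einterval_eq_UNIV)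
  show "((K_ker r x \<circ> real_of_ereal) \<longlongrightarrow> 0) (at_right (- \<infinity>))"
   using lim[OF bot] by (simp add: ereal_tendsto_simps1)
  show "((K_ker r x \<circ> real_of_ereal) \<longlongrightarrow> 0) (at_left \<infinity>)"
   using lim[OF top] by (simp add: ereal_tendsto_simps1)
 qed simp
 then have "(LBINT u. ?f u) = 0"
  by (simp add: interval_lebesgue_integral_def einterval_eq_UNIV set_lebesgue_integral_def)
 then have "r * K_int r x - of_real x / 2 * (K_int (r + 1) x - K_int (r - 1) x) = 0"
  unfolding K_int_def using K_ker_integrable[OF x] by simp
 then show ?thesis by (simp add: algebra_simps)
qed

section \<open>Gamma on vertical lines, Fourier inversion and the Mellin-Barnes integral\<close>

definition G_ker :: "complex => real => complex" where
 "G_ker s u = exp (- of_real (exp u) + s * of_real u)"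

lemma G_ker_continuous: "continuous_on UNIV (G_ker s)"
 unfolding G_ker_def[abs_def] by (intro continuous_intros)

lemma norm_G_ker: "norm (G_ker s u) = exp (- exp u + Re s * u)"
 by (simp add: G_ker_def norm_exp_eq_Re)

text \<open>For u \<ge> 0 the term - exp u wins, by exp u \<ge> 1 + u + u^2/2; for u < 0 the factor
  exp (Re s * u) beats 1 + u^2 up to 1 + 2/(Re s)^2. The stated bound is the sum of the two
  cases.\<close>

lemma G_ker_bound:
 assumes "Re s > 0"
 shows "norm (G_ker s u) * (1 + u\<^sup>2) \<le> 2 * exp ((Re s)\<^sup>2 / 2) + 1 + 2 / (Re s)\<^sup>2"
proof (cases "u \<ge> 0")
 case True
 let ?c = "Re s"
 have "norm (G_ker s u) * (1 + u\<^sup>2) \<le> exp (- exp u + ?c * u) * (2 * exp u)"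
  unfolding norm_G_ker using exp_mult_one_plus_square_le[of u] True by (intro mult_left_mono) auto
 also have "\<dots> = 2 * exp (- exp u + ?c * u + u)" by (simp add: exp_add)
 also have "- exp u + ?c * u + u \<le> ?c\<^sup>2 / 2"
 proof -
  have "1 + u + u\<^sup>2 / 2 \<le> exp u" using exp_lower_Taylor_quadratic[OF True] .
  moreover have "0 \<le> (u - ?c)\<^sup>2" by simp
  ultimately show ?thesis by (simp add: power2_eq_square algebra_simps)
 qed
 finally show ?thesis by (smt (verit) divide_nonneg_nonneg exp_le_cancel_iff zero_le_power2)
next
 case False
 let ?c = "Re s"
 have a: "1 + ?c * (- u) + (?c * (- u))\<^sup>2 / 2 \<le> exp (?c * (- u))"
  using assms False by (intro exp_lower_Taylor_quadratic mult_nonneg_nonneg) auto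
 then have b: "1 + (?c * u)\<^sup>2 / 2 \<le> exp (- (?c * u))"
  using mult_pos_pos[of ?c "-u"] assms False by simp
 have "norm (G_ker s u) * (1 + u\<^sup>2) \<le> exp (?c * u) * (1 + u\<^sup>2)"
  unfolding norm_G_ker by (intro mult_right_mono) auto
 also have "1 + u\<^sup>2 \<le> (1 + 2 / ?c\<^sup>2) * (1 + (?c * u)\<^sup>2 / 2)"
 proof -
  have "2 / ?c\<^sup>2 * ((?c * u)\<^sup>2 / 2) = u\<^sup>2" using assms by (simp add: power_mult_distrib)
  moreover have "(?c * u)\<^sup>2 / 2 \<ge> 0" "2 / ?c\<^sup>2 \<ge> 0" by auto
  ultimately show ?thesis unfolding distrib_left distrib_right by linarith
 qed
 also have "\<dots> \<le> (1 + 2 / ?c\<^sup>2) * exp (- (?c * u))"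
  by (intro mult_left_mono b) (auto simp: add_nonneg_nonneg)
 finally have "norm (G_ker s u) * (1 + u\<^sup>2) \<le> exp (?c * u) * ((1 + 2 / ?c\<^sup>2) * exp (- (?c * u)))"
  by (simp add: mult_left_mono)
 also have "\<dots> = 1 + 2 / ?c\<^sup>2" by (simp add: exp_minus)
 finally have "norm (G_ker s u) * (1 + u\<^sup>2) \<le> 1 + 2 / ?c\<^sup>2" .
 moreover have "0 \<le> 2 * exp (?c\<^sup>2 / 2)" by simp
 ultimately show ?thesis by linarith
qed

lemma G_ker_integrable: "Re s > 0 ==> integrable lborel (G_ker s)"
 by (rule integrable_one_plus_square_bound[OF G_ker_continuous G_ker_bound])

lemma Gamma_eq_G_ker:
 assumes s: "Re s > 0"
 shows "Gamma s = (LBINT u. G_ker s u)"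
proof -
 let ?f = "\<lambda>t. complex_of_real t powr (s - 1) / complex_of_real (exp t)"
 have e: "exp u *\<^sub>R ?f (exp u) = G_ker s u" for u
 proof -
  have "exp u *\<^sub>R ?f (exp u) = exp (of_real u) * exp ((s - 1) * of_real u) / exp (of_real (exp u))"
   unfolding complex_exp_powr by (simp add: scaleR_conv_of_real exp_of_real)
  also have "\<dots> = exp (of_real u + (s - 1) * of_real u - of_real (exp u))" by (simp only: exp_add exp_diff)
  also have "of_real u + (s - 1) * of_real u - of_real (exp u) = - of_real (exp u) + s * of_real u"
   by (simp add: algebra_simps)
  finally show ?thesis unfolding G_ker_def .
 qed
 have c: "continuous_on {0<..} ?f"
  by (intro continuous_intros continuous_on_powr_complex) (auto simp: complex_nonpos_Reals_iff)
 have i: "integrable lborel (\<lambda>u. exp u *\<^sub>R ?f (exp u))" unfolding e using G_ker_integrable[OF s] .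
 have "Gamma s = integral {0<..} ?f"
  using Gamma_integral_complex'[OF s] by (simp add: integral_unique)
 also have "\<dots> = (LBINT t:{0<..}. ?f t)"
  using set_borel_integral_eq_integral(2)[OF LBINT_exp_substitution(1)[OF c i]] by simp
 finally show ?thesis using LBINT_exp_substitution(2)[OF c i] unfolding e by simp
qed

lemma norm_Gamma_le: "Re s > 0 ==> norm (Gamma s) \<le> (LBINT u. norm (G_ker (of_real (Re s)) u))"
 unfolding Gamma_eq_G_ker
 using integral_norm_bound[of lborel "G_ker s"] by (simp add: norm_G_ker)

text \<open>Two uses of the functional equation give |s (s + 1)| |Gamma s| = |Gamma (s + 2)|, and
  the right-hand side is bounded along the line. The resulting quadratic decay makes Gamma
  integrable there.\<close>

lemma Gamma_vertical_bound:
 assumes "Re a > 0"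
 obtains C where "\<And>t. norm (Gamma (a + \<i> * of_real t)) * (1 + t\<^sup>2) \<le> C"
proof -
 define s where "s t = a + \<i> * of_real t" for t :: real
 define B where "B = (LBINT u. norm (G_ker (of_real (Re a + 2)) u))"
 have Re_s: "Re (s t) = Re a" "Im (s t) = Im a + t" for t by (simp_all add: s_def)
 have "norm (Gamma (s t)) * ((Re a)\<^sup>2 + (Im a + t)\<^sup>2) \<le> B" for t
 proof -
  have nz: "s t \<noteq> 0" "s t + 1 \<noteq> 0" using Re_s[of t] assms by (auto simp: complex_eq_iff)
  have "s t \<notin> \<int>\<^sub>\<le>\<^sub>0" "s t + 1 \<notin> \<int>\<^sub>\<le>\<^sub>0" using Re_s[of t] assms
   by (auto elim!: nonpos_Ints_cases simp: complex_eq_iff)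
  then have "Gamma (s t + 1 + 1) = (s t + 1) * (s t * Gamma (s t))"
   using Gamma_plus1[of "s t + 1"] Gamma_plus1[of "s t"] by simp
  then have "norm (s t * (s t + 1)) * norm (Gamma (s t)) = norm (Gamma (s t + 2))"
   by (simp add: norm_mult add.assoc mult_ac)
  also have "\<dots> \<le> B" using norm_Gamma_le[of "s t + 2"] assms Re_s[of t] by (simp add: B_def)
  finally have *: "norm (s t * (s t + 1)) * norm (Gamma (s t)) \<le> B" .
  have "norm (s t) \<le> norm (s t + 1)"
   using assms Re_s[of t] power_mono[of "Re a" "Re a + 1" 2] unfolding cmod_def by simp
  then have "norm (s t) * norm (s t) \<le> norm (s t * (s t + 1))"
   unfolding norm_mult by (intro mult_left_mono) auto
  moreover have "norm (s t) * norm (s t) = (Re a)\<^sup>2 + (Im a + t)\<^sup>2"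
   using Re_s[of t] by (simp add: cmod_def)
  ultimately have "((Re a)\<^sup>2 + (Im a + t)\<^sup>2) * norm (Gamma (s t)) \<le> norm (s t * (s t + 1)) * norm (Gamma (s t))"
   by (intro mult_right_mono) auto
  then show ?thesis using * by (simp add: mult.commute)
 qed note * = this
 \<comment> \<open>Compares 1 + t^2 with the quadratic centred at -Im a; \<open>?D\<close> comes
   from t^2 \<le> 2 (Im a + t)^2 + 2 (Im a)^2.\<close>
 obtain D where D: "D > 0" "\<And>t. 1 + t\<^sup>2 \<le> D * ((Re a)\<^sup>2 + (Im a + t)\<^sup>2)"
 proof
  let ?D = "2 + (1 + 2 * (Im a)\<^sup>2) / (Re a)\<^sup>2"
  show "?D > 0" using assms by (simp add: add_pos_nonneg)
  fix t
  have "0 \<le> (t + 2 * Im a)\<^sup>2" by simp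
  then have "t\<^sup>2 \<le> 2 * (Im a + t)\<^sup>2 + 2 * (Im a)\<^sup>2" by (simp add: power2_eq_square algebra_simps)
  moreover have "(1 + 2 * (Im a)\<^sup>2) = (1 + 2 * (Im a)\<^sup>2) / (Re a)\<^sup>2 * (Re a)\<^sup>2" using assms by simp
  moreover have "0 \<le> (1 + 2 * (Im a)\<^sup>2) / (Re a)\<^sup>2 * (Im a + t)\<^sup>2" "0 \<le> 2 * (Re a)\<^sup>2" by auto
  ultimately show "1 + t\<^sup>2 \<le> ?D * ((Re a)\<^sup>2 + (Im a + t)\<^sup>2)"
   unfolding distrib_left distrib_right by linarith
 qed
 show ?thesis
 proof (rule that[of "D * B"])
  fix t
  have "norm (Gamma (s t)) * (1 + t\<^sup>2) \<le> norm (Gamma (s t)) * (D * ((Re a)\<^sup>2 + (Im a + t)\<^sup>2))"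
   by (intro mult_left_mono D) auto
  also have "\<dots> \<le> D * B" using *[of t] D(1) by (simp add: mult.left_commute mult_left_mono)
  finally show "norm (Gamma (a + \<i> * of_real t)) * (1 + t\<^sup>2) \<le> D * B" by (simp add: s_def)
 qed
qed

lemma Gamma_vertical_continuous:
 assumes "Re a > 0"
 shows "continuous_on UNIV (\<lambda>t. Gamma (a + \<i> * of_real t))"
proof -
 have "a + \<i> * complex_of_real t \<notin> \<int>\<^sub>\<le>\<^sub>0" for t
  using assms by (auto elim!: nonpos_Ints_cases simp: complex_eq_iff)
 then show ?thesis
  by (intro continuous_on_compose2[OF continuous_on_Gamma, of "- \<int>\<^sub>\<le>\<^sub>0"]) (auto intro!: continuous_intros)
qed

lemma Gamma_vertical_integrable:
 assumes "Re a > 0"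
 shows "integrable lborel (\<lambda>t. Gamma (a + \<i> * of_real t))"
 using Gamma_vertical_bound[OF assms] integrable_one_plus_square_bound[OF Gamma_vertical_continuous[OF assms]]
 by metis

lemma std_normal_char: "(LBINT x. of_real (std_normal_density x) * exp (\<i> * of_real (t * x))) = complex_of_real (exp (- t\<^sup>2 / 2))"
proof -
 have "(LBINT x. std_normal_density x *\<^sub>R exp (\<i> * of_real (t * x))) = char std_normal_distribution t"
  unfolding char_def by (subst integral_density) (auto intro!: borel_measurable_continuous_onI continuous_intros)
 then show ?thesis by (simp add: char_std_normal_distribution scaleR_conv_of_real)
qed

text \<open>The double integral does not converge absolutely, so a damping factor in t has to make
  Fubini available. Integrating over t first then gives a Gaussian in u concentrated at a on the
  scale h. The limit uses continuity and boundedness of \<open>g\<close> on this side and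
  integrability of the transform on the other.\<close>

lemma fourier_inversion:
 fixes g :: "real => complex"
 assumes cont: "continuous_on UNIV g" and bdd: "\<And>u. norm (g u) \<le> B" and int: "integrable lborel g"
  and int': "integrable lborel (\<lambda>t. (LBINT u. g u * exp (\<i> * of_real (t * u))))"
 shows "(LBINT t. (LBINT u. g u * exp (\<i> * of_real (t * u))) * exp (- \<i> * of_real (t * a))) = of_real (2 * pi) * g a"
proof -
 define gh where "gh t = (LBINT u. g u * exp (\<i> * of_real (t * u)))" for t
 define N where "N = std_normal_density"
 have N_int: "integrable lborel N" unfolding N_def by (simp add: integrable_normal_density)
 have N_cont: "continuous_on UNIV N" unfolding N_def normal_density_def[abs_def] by (intro continuous_intros) auto
 have N_nonneg: "N x \<ge> 0" for x unfolding N_def by simp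
 have N_one: "(LBINT x. N x) = 1" using std_normal_char[of 0] by (simp add: N_def)
 have N_exp: "N x = exp (- x\<^sup>2 / 2) / sqrt (2 * pi)" for x unfolding N_def std_normal_density_def by simp
 have g_meas[measurable]: "g \<in> borel_measurable borel" using cont by (rule borel_measurable_continuous_onI)
 have N_meas[measurable]: "N \<in> borel_measurable borel" using N_cont by (rule borel_measurable_continuous_onI)
 have gh_meas[measurable]: "gh \<in> borel_measurable borel" using borel_measurable_integrable[OF int'] by (simp add: gh_def[abs_def])
 \<comment> \<open>Gaussian regularisation; the claim is the limit \<open>h \<rightarrow> 0\<close>.\<close>
 have key: "(LBINT t. gh t * exp (- \<i> * of_real (t * a)) * of_real (exp (- (h * t)\<^sup>2 / 2)))
   = of_real (2 * pi) * (LBINT v. of_real (N v) * g (a + h * v))" if h: "h > 0" for h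
 proof -
  let ?F = "\<lambda>t u. g u * exp (\<i> * of_real (t * (u - a))) * of_real (exp (- (h * t)\<^sup>2 / 2))"
  have exp_int: "integrable lborel (\<lambda>t. exp (- (h * t)\<^sup>2 / 2))"
   using integrable_mult_right[OF lborel_integrable_real_affine[OF N_int, of h 0], of "sqrt (2 * pi)"] h by (simp add: N_exp)
  have F_meas: "(\<lambda>(t, u). ?F t u) \<in> borel_measurable (lborel \<Otimes>\<^sub>M lborel)" by measurable
  have F_int: "integrable (lborel \<Otimes>\<^sub>M lborel) (\<lambda>(t, u). ?F t u)"
  proof (rule lborel_pair.Fubini_integrable[OF F_meas])
   have "norm (?F t u) = norm (g u) * exp (- (h * t)\<^sup>2 / 2)" for t u by (simp add: norm_mult)
   then show "integrable lborel (\<lambda>t. LBINT u. norm ((case (t, u) of (t, u) => ?F t u)))"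
    using int exp_int by (simp)
   have "integrable lborel (\<lambda>u. ?F t u)" for t
    by (rule Bochner_Integration.integrable_bound[OF integrable_mult_left[OF integrable_norm[OF int], of "exp (- (h * t)\<^sup>2 / 2)"]])
      (auto simp: norm_mult)
   then show "AE t in lborel. integrable lborel (\<lambda>u. case (t, u) of (t, u) => ?F t u)" by simp
  qed
  have inner: "(LBINT t. ?F t u) = of_real (2 * pi / h) * (g u * of_real (N ((u - a) / h)))" for u
  proof -
   have "(LBINT t. exp (\<i> * of_real (t * (u - a))) * of_real (exp (- (h * t)\<^sup>2 / 2)))
    = of_real (1 / h) * (LBINT x. exp (\<i> * of_real ((x / h) * (u - a))) * complex_of_real (exp (- (x)\<^sup>2 / 2)))"
    using h by (subst lborel_integral_real_affine[where c="1/h" and t=0]) (auto simp: scaleR_conv_of_real)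
   also have "(LBINT x. exp (\<i> * of_real ((x / h) * (u - a))) * complex_of_real (exp (- x\<^sup>2 / 2)))
     = of_real (sqrt (2 * pi)) * (LBINT x. of_real (std_normal_density x) * exp (\<i> * of_real (((u - a) / h) * x)))"
    unfolding std_normal_density_def
    by (subst integral_mult_right_zero[symmetric], intro Bochner_Integration.integral_cong) (auto simp: field_simps)
   also have "\<dots> = of_real (sqrt (2 * pi) * sqrt (2 * pi)) * of_real (N ((u - a) / h))"
   proof -
    have "c * c * (E / c) = c * E" if "c \<noteq> 0" for c E :: real using that by simp
    from this[of "sqrt (2 * pi)" "exp (- ((u - a) / h)\<^sup>2 / 2)"]
    show ?thesis unfolding std_normal_char N_exp of_real_mult[symmetric] by simp
   qed
   finally show ?thesis by (simp add: mult.assoc)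
  qed
  have "(LBINT t. gh t * exp (- \<i> * of_real (t * a)) * of_real (exp (- (h * t)\<^sup>2 / 2))) = (LBINT t. LBINT u. ?F t u)"
  proof (intro Bochner_Integration.integral_cong refl)
   fix t
   have "?F t u = g u * exp (\<i> * of_real (t * u)) * (exp (- \<i> * of_real (t * a)) * of_real (exp (- (h * t)\<^sup>2 / 2)))" for u
    by (simp add: algebra_simps exp_diff exp_minus field_simps)
   then have "(LBINT u. ?F t u) = (LBINT u. g u * exp (\<i> * of_real (t * u)) * (exp (- \<i> * of_real (t * a)) * of_real (exp (- (h * t)\<^sup>2 / 2))))"
    by (intro Bochner_Integration.integral_cong refl)
   also have "\<dots> = gh t * (exp (- \<i> * of_real (t * a)) * of_real (exp (- (h * t)\<^sup>2 / 2)))"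
    unfolding gh_def by (rule integral_mult_left_zero)
   finally show "gh t * exp (- \<i> * of_real (t * a)) * of_real (exp (- (h * t)\<^sup>2 / 2)) = (LBINT u. ?F t u)"
    by (simp only: mult.assoc)
  qed
  also have "\<dots> = (LBINT u. LBINT t. ?F t u)"
   using lborel_pair.Fubini_integral[OF F_int] by simp
  also have "\<dots> = of_real (2 * pi) * (of_real (1 / h) * (LBINT u. g u * of_real (N ((u - a) / h))))"
   unfolding inner by simp
  also have "(LBINT u. g u * of_real (N ((u - a) / h))) = of_real h * (LBINT v. of_real (N v) * g (a + h * v))"
   using h by (subst lborel_integral_real_affine[where c=h and t=a]) (auto simp: scaleR_conv_of_real mult.commute)
  finally show ?thesis using h by simp
 qed
 let ?h = "\<lambda>n. 1 / real (Suc n)"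
 have h0: "?h \<longlonglongrightarrow> 0" by (rule LIMSEQ_Suc[OF lim_1_over_n])
 have "(\<lambda>n. LBINT t. gh t * exp (- \<i> * of_real (t * a)) * of_real (exp (- (?h n * t)\<^sup>2 / 2)))
   \<longlonglongrightarrow> (LBINT t. gh t * exp (- \<i> * of_real (t * a)))"
 proof (rule integral_dominated_convergence[where w="\<lambda>t. norm (gh t)"])
  show "integrable lborel (\<lambda>t. norm (gh t))" using int' by (simp add: gh_def[abs_def])
  show "AE t in lborel. (\<lambda>n. gh t * exp (- \<i> * of_real (t * a)) * of_real (exp (- (?h n * t)\<^sup>2 / 2))) \<longlonglongrightarrow> gh t * exp (- \<i> * of_real (t * a))"
  proof (intro AE_I2)
   fix t
   have "(\<lambda>n. gh t * exp (- \<i> * of_real (t * a)) * of_real (exp (- (?h n * t)\<^sup>2 / 2))) \<longlonglongrightarrow> gh t * exp (- \<i> * of_real (t * a)) * of_real (exp (- (0 * t)\<^sup>2 / 2))"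
    by (intro tendsto_intros h0) auto
   then show "(\<lambda>n. gh t * exp (- \<i> * of_real (t * a)) * of_real (exp (- (?h n * t)\<^sup>2 / 2))) \<longlonglongrightarrow> gh t * exp (- \<i> * of_real (t * a))" by simp
  qed
 qed (auto simp: norm_mult mult_left_le)
 moreover have "(\<lambda>n. of_real (2 * pi) * (LBINT v. of_real (N v) * g (a + ?h n * v))) \<longlonglongrightarrow> of_real (2 * pi) * (LBINT v. of_real (N v) * g a)"
 proof (intro tendsto_mult tendsto_const, rule integral_dominated_convergence[where w="\<lambda>v. N v * B"])
  show "integrable lborel (\<lambda>v. N v * B)" using N_int by simp
  show "AE v in lborel. (\<lambda>n. of_real (N v) * g (a + ?h n * v)) \<longlonglongrightarrow> of_real (N v) * g a"
  proof (intro AE_I2 tendsto_mult tendsto_const)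
   fix v
   have "(\<lambda>n. a + ?h n * v) \<longlonglongrightarrow> a + 0 * v" by (intro tendsto_intros h0)
   then show "(\<lambda>n. g (a + ?h n * v)) \<longlonglongrightarrow> g a"
    using cont by (intro isCont_tendsto_compose[of a g]) (auto simp: continuous_on_eq_continuous_at)
  qed
  show "\<And>n. AE v in lborel. norm (of_real (N v) * g (a + ?h n * v)) \<le> N v * B"
   using bdd N_nonneg by (auto simp: norm_mult intro!: mult_left_mono)
 qed measurable
 moreover have "(\<lambda>n. LBINT t. gh t * exp (- \<i> * of_real (t * a)) * of_real (exp (- (?h n * t)\<^sup>2 / 2)))
   = (\<lambda>n. of_real (2 * pi) * (LBINT v. of_real (N v) * g (a + ?h n * v)))"
  by (intro ext key) simp
 ultimately have "(LBINT t. gh t * exp (- \<i> * of_real (t * a))) = of_real (2 * pi) * (LBINT v. of_real (N v) * g a)"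
  by (metis (lifting) LIMSEQ_unique)
 also have "(LBINT v. of_real (N v) * g a) = of_real (LBINT v. N v) * g a" by simp
 finally show ?thesis unfolding N_one gh_def by simp
qed

text \<open>Multiplying \<open>G_ker b\<close> by exp(\<i> t u) only replaces b by b + \<i> t, so
  Gamma on the line through b is the Fourier transform of \<open>G_ker b\<close>.\<close>

lemma Gamma_inversion:
 assumes b: "Re b > 0"
 shows "(LBINT t. Gamma (b + \<i> * of_real t) * exp (- \<i> * of_real (t * a))) = of_real (2 * pi) * G_ker b a"
proof -
 have e: "G_ker b u * exp (\<i> * of_real (t * u)) = G_ker (b + \<i> * of_real t) u" for t u
  by (simp add: G_ker_def exp_add[symmetric] algebra_simps)
 have G: "(LBINT u. G_ker b u * exp (\<i> * of_real (t * u))) = Gamma (b + \<i> * of_real t)" for t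
  unfolding e using b by (subst Gamma_eq_G_ker) auto
 have bd: "norm (G_ker b u) \<le> 2 * exp ((Re b)\<^sup>2 / 2) + 1 + 2 / (Re b)\<^sup>2" for u
  using G_ker_bound[OF b, of u] mult_left_mono[of 1 "1 + u\<^sup>2" "norm (G_ker b u)"] by simp
 show ?thesis
  using fourier_inversion[OF G_ker_continuous bd G_ker_integrable[OF b], of a] Gamma_vertical_integrable[OF b]
  unfolding G by simp
qed

text \<open>The shift v = ln (sqrt x) + u turns exp v + x exp (- v) into 2 sqrt x cosh u.\<close>

lemma K_int_G_ker:
 assumes x: "x > 0"
 shows "(LBINT v. G_ker s v * of_real (exp (- x * exp (- v)))) = of_real (sqrt x) powr s * K_int s (2 * sqrt x)"
proof -
 let ?l = "ln (sqrt x)"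
 have "(LBINT v. G_ker s v * of_real (exp (- x * exp (- v)))) = (LBINT u. G_ker s (?l + 1 * u) * of_real (exp (- x * exp (- (?l + 1 * u)))))"
  by (subst lborel_integral_real_affine[where c=1 and t="?l"]) auto
 also have "\<dots> = (LBINT u. of_real (sqrt x) powr s * K_ker s (2 * sqrt x) u)"
 proof (intro Bochner_Integration.integral_cong refl)
  fix u
  have e1: "exp (?l + u) = sqrt x * exp u" using x by (simp add: exp_add)
  have e2: "x * exp (- (?l + u)) = sqrt x * exp (- u)"
  proof -
   have "exp (- (?l + u)) = exp (- u) / sqrt x" using x exp_minus[of ?l] by (simp only: minus_add_distrib exp_add) (simp add: field_simps)
   then have "x * exp (- (?l + u)) = (x / sqrt x) * exp (- u)" by (simp only:) simp
   then show ?thesis using x real_div_sqrt[of x] by (simp only:)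
  qed
  have "G_ker s (?l + u) * of_real (exp (- (x * exp (- (?l + u))))) = exp (s * of_real ?l) * exp (- of_real (sqrt x * exp u) - of_real (sqrt x * exp (- u)) + s * of_real u)"
   unfolding G_ker_def e1 e2 by (simp add: exp_add[symmetric] exp_of_real[symmetric] algebra_simps)
  also have "- of_real (sqrt x * exp u) - of_real (sqrt x * exp (- u)) = complex_of_real (- (2 * sqrt x) * cosh u)"
   by (simp add: cosh_def algebra_simps)
  also have "exp (s * of_real ?l) = of_real (sqrt x) powr s"
   using complex_exp_powr[of "?l" s] x by simp
  finally show "G_ker s (?l + 1 * u) * of_real (exp (- x * exp (- (?l + 1 * u)))) = of_real (sqrt x) powr s * K_ker s (2 * sqrt x) u"
   by (simp add: K_ker_def)
 qed
 finally show ?thesis by (simp add: K_int_def)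
qed

text \<open>Only the first Gamma factor is opened into its integral; the decay of the second makes
  the double integral converge absolutely. The integral over t is then
  \<open>Gamma_inversion\<close> at ln x - v, and the product of the two kernels is the integrand of
  \<open>K_int_G_ker\<close> for the order a - b.\<close>

lemma mellin_barnes_Gamma_Gamma:
 assumes a: "Re a > 0" and b: "Re b > 0" and x: "x > 0"
 shows "(LBINT t. Gamma (a + \<i> * of_real t) * Gamma (b + \<i> * of_real t) * exp (- \<i> * of_real (t * ln x)))
  = of_real (2 * pi) * of_real x powr ((a + b) / 2) * K_int (a - b) (2 * sqrt x)"
proof -
 let ?F = "\<lambda>t v. G_ker (a + \<i> * of_real t) v * (Gamma (b + \<i> * of_real t) * exp (- \<i> * of_real (t * ln x)))"
 have gm: "(\<lambda>t. Gamma (b + \<i> * of_real t)) \<in> borel_measurable borel"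
  using Gamma_vertical_continuous[OF b] by (rule borel_measurable_continuous_onI)
 have F_meas: "(\<lambda>(t, v). ?F t v) \<in> borel_measurable (lborel \<Otimes>\<^sub>M lborel)"
  using gm unfolding G_ker_def by measurable
 have nF: "norm (?F t v) = norm (G_ker a v) * norm (Gamma (b + \<i> * of_real t))" for t v
  by (simp add: norm_mult norm_G_ker)
 have F_int: "integrable (lborel \<Otimes>\<^sub>M lborel) (\<lambda>(t, v). ?F t v)"
 proof (rule lborel_pair.Fubini_integrable[OF F_meas])
  show "integrable lborel (\<lambda>t. LBINT v. norm ((case (t, v) of (t, v) => ?F t v)))"
   unfolding prod.case nF using integrable_norm[OF Gamma_vertical_integrable[OF b]] by simp
  show "AE t in lborel. integrable lborel (\<lambda>v. case (t, v) of (t, v) => ?F t v)"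
   unfolding prod.case using G_ker_integrable a by (intro AE_I2 integrable_mult_left) simp
 qed
 have "(LBINT t. Gamma (a + \<i> * of_real t) * Gamma (b + \<i> * of_real t) * exp (- \<i> * of_real (t * ln x))) = (LBINT t. LBINT v. ?F t v)"
  using a by (subst Gamma_eq_G_ker) (auto simp: mult.assoc)
 also have "\<dots> = (LBINT v. LBINT t. ?F t v)"
  using lborel_pair.Fubini_integral[OF F_int] by simp
 also have "\<dots> = (LBINT v. of_real (2 * pi) * of_real x powr b * (G_ker (a - b) v * of_real (exp (- x * exp (- v)))))"
 proof (intro Bochner_Integration.integral_cong refl)
  fix v
  have "?F t v = G_ker a v * (Gamma (b + \<i> * of_real t) * exp (- \<i> * of_real (t * (ln x - v))))" for t
  proof -
   have "G_ker (a + \<i> * of_real t) v * exp (- \<i> * of_real (t * ln x)) = G_ker a v * exp (- \<i> * of_real (t * (ln x - v)))"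
    unfolding G_ker_def exp_add[symmetric] by (intro arg_cong[where f=exp]) (simp add: algebra_simps)
   then show ?thesis by (metis mult.assoc mult.commute)
  qed
  then have "(LBINT t. ?F t v) = (LBINT t. G_ker a v * (Gamma (b + \<i> * of_real t) * exp (- \<i> * of_real (t * (ln x - v)))))"
   by (intro Bochner_Integration.integral_cong refl)
  also have "\<dots> = G_ker a v * (LBINT t. Gamma (b + \<i> * of_real t) * exp (- \<i> * of_real (t * (ln x - v))))"
   by (rule integral_mult_right_zero)
  also have "\<dots> = of_real (2 * pi) * (G_ker a v * G_ker b (ln x - v))"
   unfolding Gamma_inversion[OF b] by simp
  also have "G_ker a v * G_ker b (ln x - v) = of_real x powr b * (G_ker (a - b) v * of_real (exp (- x * exp (- v))))"
  proof -
   have "exp (ln x - v) = x * exp (- v)" using x by (simp add: exp_diff exp_minus field_simps)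
   moreover have "of_real x powr b = exp (b * of_real (ln x))" using complex_exp_powr[of "ln x" b] x by simp
   ultimately show ?thesis
    by (simp add: G_ker_def exp_add[symmetric] exp_of_real[symmetric] algebra_simps)
  qed
  finally show "(LBINT t. ?F t v) = of_real (2 * pi) * of_real x powr b * (G_ker (a - b) v * of_real (exp (- x * exp (- v))))"
   by (simp add: mult.assoc)
 qed
 also have "\<dots> = of_real (2 * pi) * of_real x powr b * (of_real (sqrt x) powr (a - b) * K_int (a - b) (2 * sqrt x))"
  unfolding K_int_G_ker[OF x, symmetric] by simp
 also have "of_real (sqrt x) powr (a - b) = complex_of_real x powr ((a - b) / 2)"
 proof -
  have "sqrt x = exp (ln x / 2)" using x by (simp add: ln_sqrt[symmetric])
  moreover have "x = exp (ln x)" using x by simp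
  ultimately show ?thesis using complex_exp_powr[of "ln x / 2" "a - b"] complex_exp_powr[of "ln x" "(a - b) / 2"]
   by (simp only:) simp
 qed
 also have "of_real (2 * pi) * of_real x powr b * (of_real x powr ((a - b) / 2) * K_int (a - b) (2 * sqrt x))
  = of_real (2 * pi) * (of_real x powr (b + (a - b) / 2)) * K_int (a - b) (2 * sqrt x)"
  by (simp only: powr_add mult.assoc)
 also have "b + (a - b) / 2 = (a + b) / 2" by (simp add: field_simps)
 finally show ?thesis .
qed

text \<open>In \<open>K_int_G_ker\<close> the factor exp (- x exp (- v)) is at most 1 and tends to 1
  with x, leaving the integral for Gamma. This is the behaviour of K near 0, taken along the
  sequence z = 2/(n + 1).\<close>

lemma K_int_asymptotic:
 assumes s: "Re s > 0"
 shows "(\<lambda>n. of_real (1 / real (Suc n)) powr s * K_int s (2 / real (Suc n))) \<longlonglongrightarrow> Gamma s"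
proof -
 let ?x = "\<lambda>n. (1 / real (Suc n))\<^sup>2"
 have "(\<lambda>n. LBINT v. G_ker s v * of_real (exp (- ?x n * exp (- v)))) \<longlonglongrightarrow> (LBINT v. G_ker s v)"
 proof (rule integral_dominated_convergence[where w="\<lambda>v. norm (G_ker s v)"])
  have m: "G_ker s \<in> borel_measurable borel" using G_ker_continuous by (rule borel_measurable_continuous_onI)
  show "G_ker s \<in> borel_measurable lborel" using m by simp
  show "\<And>n. (\<lambda>v. G_ker s v * of_real (exp (- ?x n * exp (- v)))) \<in> borel_measurable lborel" using m by measurable
  show "integrable lborel (\<lambda>v. norm (G_ker s v))" using G_ker_integrable[OF s] by simp
  show "AE v in lborel. (\<lambda>n. G_ker s v * of_real (exp (- ?x n * exp (- v)))) \<longlonglongrightarrow> G_ker s v"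
  proof (intro AE_I2)
   fix v
   have "(\<lambda>n. G_ker s v * of_real (exp (- ?x n * exp (- v)))) \<longlonglongrightarrow> G_ker s v * of_real (exp (- 0\<^sup>2 * exp (- v)))"
    by (intro tendsto_intros LIMSEQ_Suc[OF lim_1_over_n])
   then show "(\<lambda>n. G_ker s v * of_real (exp (- ?x n * exp (- v)))) \<longlonglongrightarrow> G_ker s v" by simp
  qed
 qed (auto simp: norm_mult mult_left_le)
 moreover have "(LBINT v. G_ker s v * of_real (exp (- ?x n * exp (- v)))) = of_real (1 / real (Suc n)) powr s * K_int s (2 / real (Suc n))" for n
 proof -
  have "sqrt (?x n) = 1 / real (Suc n)" by (rule real_sqrt_unique) auto
  then show ?thesis using K_int_G_ker[of "?x n" s] by (simp only:) simp
 qed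
 ultimately show ?thesis by (simp only: Gamma_eq_G_ker[OF s])
qed

section \<open>The pair for K, recurrences in the order and the relation between K and I\<close>

lemma bessel_pair_K_int: "bessel_pair r (K_int r) (K_int (r + 1))"
 unfolding bessel_pair_def
proof (intro allI impI conjI)
 fix z :: real assume z: "z > 0"
 have "2 * r * K_int r z = of_real z * (K_int (r + 1) z - K_int (r - 1) z)"
  using K_int_order_recurrence[OF z] .
 then have "- (K_int (r + 1) z + K_int (r - 1) z) / 2 = r / of_real z * K_int r z - K_int (r + 1) z"
  using z by (simp add: field_simps)
 then show "(K_int r has_vector_derivative r / of_real z * K_int r z - K_int (r + 1) z) (at z)"
  using K_int_deriv[OF z, of r] by metis
 have "2 * (r + 1) * K_int (r + 1) z = of_real z * (K_int (r + 1 + 1) z - K_int (r + 1 - 1) z)"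
  using K_int_order_recurrence[OF z] .
 then have "- (K_int (r + 1 + 1) z + K_int (r + 1 - 1) z) / 2 = - K_int r z - (r + 1) / of_real z * K_int (r + 1) z"
  using z by (simp add: field_simps)
 then show "(K_int (r + 1) has_vector_derivative - K_int r z - (r + 1) / of_real z * K_int (r + 1) z) (at z)"
  using K_int_deriv[OF z, of "r + 1"] by metis
qed

text \<open>\<open>H\<close> is the second component of a pair of order r and the first of one of
  order r + 1; the two expressions for its derivative are equated.\<close>

lemma bessel_pair_recurrence:
 assumes "bessel_pair r F H" "bessel_pair (r + 1) H L" "z > 0"
 shows "L z = F z + 2 * (r + 1) / of_real z * H z"
proof -
 have "- F z - (r + 1) / of_real z * H z = (r + 1) / of_real z * H z - L z"
  using assms unfolding bessel_pair_def by (metis vector_derivative_unique_at)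
 then show ?thesis by (simp add: algebra_simps add_divide_distrib)
qed

lemma bessel_I_hat_recurrence:
 assumes r: "r \<notin> \<int>" and z: "z > 0"
 shows "bessel_I_hat (r + 2) (of_real z) = bessel_I_hat r (of_real z) + 2 * (r + 1) / of_real z * bessel_I_hat (r + 1) (of_real z)"
  "bessel_I_hat (- r - 2) (of_real z) = bessel_I_hat (- r) (of_real z) + 2 * (r + 1) / of_real z * bessel_I_hat (- r - 1) (of_real z)"
proof -
 have r1: "r + 1 \<notin> \<int>" using r by (metis Ints_1 Ints_diff add_diff_cancel_right')
 show "bessel_I_hat (r + 2) (of_real z) = bessel_I_hat r (of_real z) + 2 * (r + 1) / of_real z * bessel_I_hat (r + 1) (of_real z)"
  using bessel_pair_recurrence[OF bessel_pair_I_hat[OF r] bessel_pair_I_hat[OF r1] z] by (simp add: add.assoc)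
 have "- (r + 1) = - r - 1" "- (r + 1) - 1 = - r - 2" by simp_all
 then have "bessel_pair (r + 1) (\<lambda>z. bessel_I_hat (- r - 1) (of_real z)) (\<lambda>z. bessel_I_hat (- r - 2) (of_real z))"
  using bessel_pair_I_hat_neg[OF r1] by (simp only:)
 from bessel_pair_recurrence[OF bessel_pair_I_hat_neg[OF r] this z]
 show "bessel_I_hat (- r - 2) (of_real z) = bessel_I_hat (- r) (of_real z) + 2 * (r + 1) / of_real z * bessel_I_hat (- r - 1) (of_real z)" .
qed

lemma K_int_recurrence:
 assumes z: "z > 0"
 shows "K_int (r + 2) z = K_int r z + 2 * (r + 1) / of_real z * K_int (r + 1) z"
 using bessel_pair_recurrence[OF bessel_pair_K_int bessel_pair_K_int z, of r] by (simp add: add.assoc)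

text \<open>After multiplication by (z/2)^s the solution of order s dies like (z/2)^(2 s) as z tends
  to 0, while the one of order -s tends to Gamma s. The left-hand side has this same limit, so the
  limit detects \<open>b\<close> but not \<open>a\<close>.\<close>

lemma K_int_I_hat_coeff:
 assumes s: "s \<notin> \<int>" "Re s > 0"
  and eq: "\<And>z::real. z > 0 ==> K_int s z = a * bessel_I_hat s (of_real z) + b * bessel_I_hat (- s) (of_real z)"
 shows "b = 1"
proof -
 have ms: "- s \<notin> \<int>" using notin_Ints_shift[OF s(1), of 0] by simp
 let ?h = "\<lambda>n. 1 / real (Suc n)"
 let ?w = "\<lambda>n. complex_of_real ((?h n)\<^sup>2)"
 have h0: "?h \<longlonglongrightarrow> 0" by (rule LIMSEQ_Suc[OF lim_1_over_n])
 have "?w \<longlonglongrightarrow> of_real (0\<^sup>2)" by (intro tendsto_intros h0)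
 then have w0: "?w \<longlonglongrightarrow> 0" by simp
 have cont: "isCont (I_hat_series t) 0" if "t \<notin> \<int>" for t
  using I_hat_series_deriv[OF that] by (rule DERIV_isCont)
 have "(\<lambda>n. of_real (?h n) powr s) \<longlonglongrightarrow> 0"
 proof (rule tendsto_norm_zero_cancel)
  have "(\<lambda>n. ?h n powr Re s) \<longlonglongrightarrow> 0 powr Re s"
   using s(2) by (intro tendsto_powr' h0 tendsto_const) auto
  moreover have "norm (complex_of_real (?h n) powr s) = ?h n powr Re s" for n
   by (subst norm_powr_real_powr) auto
  ultimately show "(\<lambda>n. norm (complex_of_real (?h n) powr s)) \<longlonglongrightarrow> 0" using s(2) by (simp del: of_real_divide)
 qed
 then have "(\<lambda>n. a * (of_real (?h n) powr s * of_real (?h n) powr s * I_hat_series s (?w n)) + b * I_hat_series (- s) (?w n))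
   \<longlonglongrightarrow> a * (0 * 0 * I_hat_series s 0) + b * I_hat_series (- s) 0"
  by (intro tendsto_intros isCont_tendsto_compose[OF cont] w0 s ms)
 moreover have "of_real (?h n) powr s * K_int s (2 / real (Suc n)) = a * (of_real (?h n) powr s * of_real (?h n) powr s * I_hat_series s (?w n)) + b * I_hat_series (- s) (?w n)" for n
 proof -
  have z: "2 / real (Suc n) > 0" by simp
  have q: "2 / real (Suc n) / 2 = ?h n" "(2 / real (Suc n))\<^sup>2 / 4 = (?h n)\<^sup>2" by (simp_all add: power_divide field_simps)
  have "of_real (?h n) powr s * complex_of_real (?h n) powr (- s) = 1"
  proof -
   have "complex_of_real (?h n) \<noteq> 0" unfolding of_real_eq_0_iff by simp
   then show ?thesis unfolding powr_minus by (intro right_inverse) (simp only: powr_eq_0_iff not_False_eq_True)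
  qed
  then show ?thesis unfolding eq[OF z] bessel_I_hat_eq[OF s(1) z] bessel_I_hat_eq[OF ms z] q by (simp only: distrib_left mult.left_commute mult.assoc) simp
 qed
 ultimately have "(\<lambda>n. of_real (?h n) powr s * K_int s (2 / real (Suc n))) \<longlonglongrightarrow> b * I_hat_series (- s) 0" by simp
 then have "Gamma s = b * I_hat_series (- s) 0"
  using K_int_asymptotic[OF s(2)] LIMSEQ_unique by blast
 also have "I_hat_series (- s) 0 = Gamma s"
  unfolding I_hat_series_def using powser_zero[of "I_hat_coeff (- s)"] by (simp add: I_hat_coeff_def)
 finally have e: "Gamma s = b * Gamma s" .
 have "Gamma s \<noteq> 0" using s(1) nonpos_Ints_Int by (auto simp: Gamma_eq_zero_iff)
 then show ?thesis using e by simp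
qed

text \<open>The coefficients a and b stay the same when the order moves by an integer, because all
  functions involved obey one recurrence. At order r + n with n large the limit at 0 gives b = 1. At
  order n - r, where the two solutions have changed roles and \<open>K_int\<close> is even in the
  order, it gives a = 1.\<close>

lemma K_int_eq_I_hat:
 assumes r: "r \<notin> \<int>" and z: "z > 0"
 shows "K_int r z = bessel_I_hat r (of_real z) + bessel_I_hat (- r) (of_real z)"
proof -
 \<comment> \<open>Two consecutive orders are carried along because the recurrence has three
   terms.\<close>
 define P where "P r a b \<longleftrightarrow> (\<forall>z>0. K_int r z = a * bessel_I_hat r (of_real z) + b * bessel_I_hat (- r) (of_real z) \<and>
  K_int (r + 1) z = a * bessel_I_hat (r + 1) (of_real z) + b * bessel_I_hat (- r - 1) (of_real z))" for r a b
 have w: "- (2 * Gamma (- r) * Gamma (r + 1)) \<noteq> 0"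
 proof -
  have "- r \<notin> \<int>" "r + 1 \<notin> \<int>" using r notin_Ints_shift[OF r, of 0] by (simp, metis Ints_1 Ints_diff add_diff_cancel_right')
  then show ?thesis using nonpos_Ints_Int by (auto simp: Gamma_eq_zero_iff)
 qed
 have w2: "2 * Gamma (- r) * Gamma (r + 1) \<noteq> 0" using w by simp
 obtain a b where ab: "P r a b"
  using bessel_pair_basis[OF bessel_pair_K_int bessel_pair_I_hat[OF r] bessel_pair_I_hat_neg[OF r] w2 I_hat_wronskian[OF r]]
  unfolding P_def by metis
 have up: "P (r + 1) a b" if "P r a b" "r \<notin> \<int>" for r
  unfolding P_def
 proof (intro allI impI)
  fix z :: real assume z: "z > 0"
  have e: "r + 1 + 1 = r + 2" "- (r + 1) = - r - 1" "- r - 1 - 1 = - r - 2" by simp_all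
  show "K_int (r + 1) z = a * bessel_I_hat (r + 1) (of_real z) + b * bessel_I_hat (- (r + 1)) (of_real z) \<and>
   K_int (r + 1 + 1) z = a * bessel_I_hat (r + 1 + 1) (of_real z) + b * bessel_I_hat (- (r + 1) - 1) (of_real z)"
   using that(1) z unfolding P_def e bessel_I_hat_recurrence[OF that(2) z] K_int_recurrence[OF z]
   by (simp add: algebra_simps)
 qed
 have down: "P (r - 1) a b" if "P r a b" "r \<notin> \<int>" for r
  unfolding P_def
 proof (intro allI impI)
  fix z :: real assume z: "z > 0"
  have r1: "r - 1 \<notin> \<int>" using that(2) by (metis Ints_1 Ints_add diff_add_cancel)
  have e: "r - 1 + 1 = r" "r - 1 + 2 = r + 1" "- (r - 1) = - r + 1" "- (r - 1) - 1 = - r" "- (r - 1) - 2 = - r - 1" "- r + 1 - 1 = - r" "- r + 1 - 2 = - r - 1" by simp_all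
  have K: "K_int (r - 1) z = K_int (r + 1) z - 2 * r / of_real z * K_int r z"
   using K_int_recurrence[OF z, of "r - 1"] unfolding e by simp
  have I: "bessel_I_hat (r - 1) (of_real z) = bessel_I_hat (r + 1) (of_real z) - 2 * r / of_real z * bessel_I_hat r (of_real z)"
   "bessel_I_hat (- r + 1) (of_real z) = bessel_I_hat (- r - 1) (of_real z) - 2 * r / of_real z * bessel_I_hat (- r) (of_real z)"
   using bessel_I_hat_recurrence[OF r1 z, unfolded e] by (simp_all only: add_diff_cancel_right')
  show "K_int (r - 1) z = a * bessel_I_hat (r - 1) (of_real z) + b * bessel_I_hat (- (r - 1)) (of_real z) \<and>
   K_int (r - 1 + 1) z = a * bessel_I_hat (r - 1 + 1) (of_real z) + b * bessel_I_hat (- (r - 1) - 1) (of_real z)"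
   using that(1) z unfolding P_def e K I by (simp add: algebra_simps)
 qed
 have sh: "r + of_int n \<notin> \<int>" for n using r by (metis Ints_diff Ints_of_int add_diff_cancel_right')
 have upn: "P (r + of_nat n) a b" for n
 proof (induction n)
  case (Suc n)
  show ?case using up[OF Suc] sh[of "int n"] by (simp add: algebra_simps)
 qed (use ab in simp)
 have downn: "P (r - of_nat n) a b" for n
 proof (induction n)
  case (Suc n)
  have "r - of_nat n \<notin> \<int>" using sh[of "- int n"] by simp
  from down[OF Suc this] show ?case by (simp add: algebra_simps)
 qed (use ab in simp)
 obtain n where n: "\<bar>Re r\<bar> < real n" using reals_Archimedean2 by blast
 have "b = 1"
  using upn[of n] sh[of "int n"] n unfolding P_def
  by (intro K_int_I_hat_coeff[of "r + of_nat n" a b]) auto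
 moreover have "a = 1"
 proof (rule K_int_I_hat_coeff)
  show "of_nat n - r \<notin> \<int>" using sh[of "- int n"] by (metis Ints_minus minus_diff_eq of_int_minus of_int_of_nat_eq uminus_add_conv_diff add.commute)
  show "Re (of_nat n - r) > 0" using n by simp
  fix z :: real assume "z > 0"
  then show "K_int (of_nat n - r) z = b * bessel_I_hat (of_nat n - r) (of_real z) + a * bessel_I_hat (- (of_nat n - r)) (of_real z)"
   using downn[of n] K_int_minus[of "of_nat n - r" z] unfolding P_def by (simp add: add.commute)
 qed
 ultimately show ?thesis using ab z unfolding P_def by simp
qed

text \<open>\<open>Gamma_R\<close> halves its argument, so the line is traversed at half speed,
  which contributes a factor 2, and the powers of pi and y combine into x = (pi y)^2. The powers
  containing c cancel in the end.\<close>

lemma Gamma_R_mellin: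
 assumes c: "c > - Re a" "c > - Re b" and y: "y > 0"
 shows "has_bochner_integral lborel
   (\<lambda>t. \<i> * (Gamma_R (Complex c t + a) * Gamma_R (Complex c t + b) * of_real y powr (- Complex c t)))
   (4 * of_real pi * \<i> * of_real y powr ((a + b) / 2) * K_int ((a - b) / 2) (2 * pi * y))"
proof -
 let ?a = "(of_real c + a) / 2" and ?b = "(of_real c + b) / 2" and ?x = "(pi * y)\<^sup>2"
 have ab: "Re ?a > 0" "Re ?b > 0" using c by auto
 have x: "?x > 0" using y by simp
 let ?f = "\<lambda>t. Gamma (?a + \<i> * of_real t) * Gamma (?b + \<i> * of_real t) * exp (- \<i> * of_real (t * ln ?x))"
 obtain A where A: "\<And>t. norm (Gamma (?a + \<i> * of_real t)) * (1 + t\<^sup>2) \<le> A" using Gamma_vertical_bound[OF ab(1)] by metis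
 obtain B where B: "\<And>t. norm (Gamma (?b + \<i> * of_real t)) * (1 + t\<^sup>2) \<le> B" using Gamma_vertical_bound[OF ab(2)] by metis
 have int: "integrable lborel ?f"
 proof (rule integrable_one_plus_square_bound)
  show "continuous_on UNIV ?f"
   by (intro continuous_intros Gamma_vertical_continuous ab)
  fix t
  have "norm (Gamma (?b + \<i> * of_real t)) \<le> norm (Gamma (?b + \<i> * of_real t)) * (1 + t\<^sup>2)"
   by (simp add: mult_le_cancel_left1)
  also have "\<dots> \<le> B" by (rule B)
  finally have "norm (Gamma (?b + \<i> * of_real t)) \<le> B" .
  then have "(norm (Gamma (?a + \<i> * of_real t)) * (1 + t\<^sup>2)) * norm (Gamma (?b + \<i> * of_real t)) \<le> A * B"
   by (intro mult_mono A) (auto intro: order_trans[OF _ A])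
  then show "norm (?f t) * (1 + t\<^sup>2) \<le> A * B" by (simp add: norm_mult mult_ac)
 qed
 define k where "k = \<i> * (of_real pi powr (- (of_real c + (a + b) / 2)) * of_real y powr (- of_real c))"
 have eq: "\<i> * (Gamma_R (Complex c t + a) * Gamma_R (Complex c t + b) * of_real y powr (- Complex c t)) = k * ?f (0 + (1/2) * t)" for t
 proof -
  have lx: "ln ?x = 2 * ln pi + 2 * ln y" using y by (simp add: ln_realpow ln_mult)
  have C: "Complex c t = of_real c + \<i> * of_real t" by (simp add: complex_eq_iff)
  have p: "of_real u powr s = exp (s * of_real (ln u))" if "u > 0" for u and s :: complex
   using complex_exp_powr[of "ln u" s] that by simp
  have g: "(Complex c t + a) / 2 = ?a + \<i> * of_real (0 + 1 / 2 * t)" "(Complex c t + b) / 2 = ?b + \<i> * of_real (0 + 1 / 2 * t)"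
   by (simp_all add: C field_simps)
  have "of_real pi powr (- (Complex c t + a) / 2) * of_real pi powr (- (Complex c t + b) / 2) * of_real y powr (- Complex c t)
    = of_real pi powr (- (of_real c + (a + b) / 2)) * of_real y powr (- of_real c) * exp (- \<i> * of_real ((0 + (1/2) * t) * ln ?x))"
   unfolding p[OF pi_gt_zero] p[OF y] exp_add[symmetric] lx C
   by (intro arg_cong[where f=exp]) (simp add: field_simps)
  then have *: "\<i> * ((of_real pi powr (- (Complex c t + a) / 2) * of_real pi powr (- (Complex c t + b) / 2) * of_real y powr (- Complex c t)) * (G * H))
    = k * (G * H * exp (- \<i> * of_real ((0 + (1/2) * t) * ln ?x)))" for G H
   unfolding k_def by (simp only: mult_ac)
  show ?thesis unfolding Gamma_R_def g using *[of "Gamma (?a + \<i> * of_real (0 + 1 / 2 * t))" "Gamma (?b + \<i> * of_real (0 + 1 / 2 * t))"]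
   by (simp only: mult_ac)
 qed
 have "integrable lborel (\<lambda>t. ?f (0 + (1/2) * t))"
  using lborel_integrable_real_affine[OF int, of "1/2" 0] by simp
 moreover have "(LBINT t. ?f (0 + (1/2) * t)) = 2 * (LBINT t. ?f t)"
 proof -
  have "(LBINT t. ?f t) = \<bar>1/2\<bar> *\<^sub>R (LBINT t. ?f (0 + (1/2) * t))" by (rule lborel_integral_real_affine) simp
  then show ?thesis by (simp only: scaleR_conv_of_real) simp
 qed
 moreover have "(LBINT t. ?f t) = of_real (2 * pi) * of_real ?x powr ((?a + ?b) / 2) * K_int (?a - ?b) (2 * sqrt ?x)"
  using mellin_barnes_Gamma_Gamma[OF ab x] .
 moreover have "k * (2 * (of_real (2 * pi) * of_real ?x powr ((?a + ?b) / 2) * K_int (?a - ?b) (2 * sqrt ?x)))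
   = 4 * of_real pi * \<i> * of_real y powr ((a + b) / 2) * K_int ((a - b) / 2) (2 * pi * y)"
 proof -
  have p: "of_real u powr s = exp (s * of_real (ln u))" if "u > 0" for u and s :: complex
   using complex_exp_powr[of "ln u" s] that by simp
  have lx: "ln ?x = 2 * ln pi + 2 * ln y" using y by (simp add: ln_realpow ln_mult)
  have s: "2 * sqrt ?x = 2 * pi * y" using y by simp
  have d: "?a - ?b = (a - b) / 2" by (simp add: field_simps)
  have "of_real pi powr (- (of_real c + (a + b) / 2)) * of_real y powr (- of_real c) * of_real ?x powr ((?a + ?b) / 2) = of_real y powr ((a + b) / 2)"
   unfolding p[OF pi_gt_zero] p[OF y] p[OF x] exp_add[symmetric] lx
   by (intro arg_cong[where f=exp]) (simp add: field_simps)
  then show ?thesis unfolding k_def d s by (simp add: mult_ac) 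
 qed
 ultimately show ?thesis unfolding eq has_bochner_integral_iff
  by simp
qed

section \<open>Functions of a given weight on \<open>G\<close>\<close>

lemma mat2_mult_nth: "(A ** B)$i$j = A$i$1 * B$1$j + A$i$2 * B$2$j" for A B :: "'a::semiring_1^2^2"
 unfolding matrix_matrix_mult_def by (simp only: vec_lambda_beta sum_2)

lemma mat2_eqI:
 fixes A B :: "'a^2^2"
 assumes "A$1$1 = B$1$1" "A$1$2 = B$1$2" "A$2$1 = B$2$1" "A$2$2 = B$2$2"
 shows "A = B"
 unfolding vec_eq_iff forall_2 using assms by (intro conjI)

lemma mat2_eq_iff: fixes A B :: "'a^2^2" shows "A = B \<longleftrightarrow> A$1$1 = B$1$1 \<and> A$1$2 = B$1$2 \<and> A$2$1 = B$2$1 \<and> A$2$2 = B$2$2"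
 by (metis mat2_eqI)

lemma diag2_nth [simp]: "diag2 a b$1$1 = a" "diag2 a b$1$2 = 0" "diag2 a b$2$1 = 0" "diag2 a b$2$2 = b"
 by (simp_all add: diag2_def)

lemma rot_nth [simp]: "rot t$1$1 = cos t" "rot t$1$2 = sin t" "rot t$2$1 = - sin t" "rot t$2$2 = cos t"
 by (simp_all add: rot_def)

lemma mat_one_nth [simp]: "(mat 1 :: 'a::{zero,one}^2^2)$1$1 = 1" "(mat 1 :: 'a^2^2)$1$2 = 0" "(mat 1 :: 'a^2^2)$2$1 = 0" "(mat 1 :: 'a^2^2)$2$2 = 1"
 by (simp_all add: mat_def)

lemma G_grp_det: "g \<in> G_grp \<longleftrightarrow> det g \<noteq> 0"
 by (simp add: G_grp_def invertible_det_nz)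

definition refl2 :: mat2 where "refl2 = diag2 (-1) 1"

lemma refl2_nth [simp]: "refl2$1$1 = -1" "refl2$1$2 = 0" "refl2$2$1 = 0" "refl2$2$2 = 1"
 by (simp_all add: refl2_def)

lemma refl2_refl2 [simp]: "refl2 ** refl2 = mat 1" by (simp add: mat2_eq_iff mat2_mult_nth)

lemma det_refl2 [simp]: "det (g ** refl2) = - det g" by (simp add: det_2 mat2_mult_nth)

text \<open>Iwasawa coordinates as rational functions of the entries. For g = x diag(y1 y2, y2)
  k_\<theta> with y1, y2 > 0 the second row is y2 (- sin \<theta>, cos \<theta>), so
  \<open>row_norm2 g\<close> is y2^2, \<open>iwa_x g\<close> is the entry of x and
  \<open>iwa_y g\<close> is y1.\<close>

definition row_norm2 :: "mat2 => real" where "row_norm2 g = (g$2$1)\<^sup>2 + (g$2$2)\<^sup>2"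
definition row_cplx :: "mat2 => complex" where "row_cplx g = Complex (g$2$2) (- (g$2$1))"
definition iwa_x :: "mat2 => real" where "iwa_x g = (g$1$1 * g$2$1 + g$1$2 * g$2$2) / row_norm2 g"
definition iwa_y :: "mat2 => real" where "iwa_y g = det g / row_norm2 g"

text \<open>For \<open>g = x diag(y\<^sub>1 y\<^sub>2, y\<^sub>2) k\<^sub>\<theta>\<close> of positive determinant the value is
 \<open>exp(2 \<pi> \<i> l x\<^sub>1\<^sub>2) w(y\<^sub>1) y\<^sub>2 powr \<mu> exp(\<i> q \<theta>)\<close>, because \<open>row_cplx g = y\<^sub>2 exp(\<i> \<theta>)\<close>.
 The case \<open>l = 1\<close> gives Whittaker functions, the case \<open>l = 0\<close> the induced picture.\<close>

definition weight_fn :: "real => complex => (real => complex) => int => mat2 => complex" where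
 "weight_fn l \<mu> w q g = exp (2 * of_real pi * \<i> * of_real l * of_real (iwa_x g)) * w (iwa_y g) *
   (of_real (row_norm2 g) powr ((\<mu> - of_int q) / 2) * row_cplx g powi q)"

lemma row_norm2_pos: "det g \<noteq> 0 ==> row_norm2 g > 0"
 by (auto simp: row_norm2_def det_2 sum_power2_gt_zero_iff)

lemma row_cplx_nz: "det g \<noteq> 0 ==> row_cplx g \<noteq> 0"
 by (auto simp: row_cplx_def det_2 complex_eq_iff)

lemma row_cplx_cnj: "row_cplx g * cnj (row_cplx g) = of_real (row_norm2 g)"
 by (simp add: row_cplx_def row_norm2_def complex_eq_iff power2_eq_square)

lemma iwa_y_pos: "det g > 0 ==> iwa_y g > 0"
 using row_norm2_pos[of g] by (simp add: iwa_y_def)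

lemma has_vector_derivative_mat2_nth:
 "((\<gamma> :: real => mat2) has_vector_derivative V) F ==> ((\<lambda>t. \<gamma> t$i$j) has_vector_derivative V$i$j) F"
 by (rule bounded_linear.has_vector_derivative[OF bounded_linear_compose[OF bounded_linear_vec_nth bounded_linear_vec_nth]])

lemma log_deriv_mult:
 fixes f g :: "real => complex"
 assumes "(f has_vector_derivative a * f t) (at t)" "(g has_vector_derivative b * g t) (at t)"
 shows "((\<lambda>t. f t * g t) has_vector_derivative (a + b) * (f t * g t)) (at t)"
 using has_vector_derivative_mult[OF assms] by (simp add: algebra_simps)

text \<open>X is split into its central part \<alpha>, its rotation part \<beta> and its symmetric
  traceless part \<omega>. With u = \<open>row_cplx g\<close> and N = \<open>row_norm2 g\<close>,
  multiplication by u^2/N raises the weight by 2 and multiplication by the conjugate lowers it, so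
  the three summands belong to the weights q, q + 2 and q - 2.\<close>

lemma weight_fn_deriv:
 fixes \<gamma> :: "real => mat2" and X :: mat2 and l :: real and \<mu> :: complex and q :: int
 assumes \<gamma>: "(\<gamma> has_vector_derivative g ** X) (at t)" and g: "\<gamma> t = g" "det g > 0"
  and w: "(w has_vector_derivative w') (at (iwa_y g))"
 defines "\<alpha> \<equiv> of_real ((X$1$1 + X$2$2) / 2)" and "\<beta> \<equiv> of_real ((X$1$2 - X$2$1) / 2)"
  and "\<omega> \<equiv> Complex ((X$1$1 - X$2$2) / 2) ((X$1$2 + X$2$1) / 2)" and "y \<equiv> complex_of_real (iwa_y g)"
  and "e \<equiv> exp (2 * of_real pi * \<i> * of_real l * of_real (iwa_x g)) *
   (of_real (row_norm2 g) powr ((\<mu> - of_int q) / 2) * row_cplx g powi q)"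
 shows "((\<lambda>t. weight_fn l \<mu> w q (\<gamma> t)) has_vector_derivative
   e * ((\<mu> * \<alpha> + \<i> * of_int q * \<beta>) * w (iwa_y g)
    + cnj \<omega> / 2 * (row_cplx g)\<^sup>2 / of_real (row_norm2 g) * (2 * y * w' - 4 * of_real pi * of_real l * y * w (iwa_y g) + (of_int q - \<mu>) * w (iwa_y g))
    + \<omega> / 2 * (cnj (row_cplx g))\<^sup>2 / of_real (row_norm2 g) * (2 * y * w' + 4 * of_real pi * of_real l * y * w (iwa_y g) + (- of_int q - \<mu>) * w (iwa_y g))))
   (at t)"
proof -
 define N where "N = row_norm2 g"
 define u where "u = row_cplx g"
 have N: "N > 0" unfolding N_def using row_norm2_pos g(2) by simp
 have u: "u \<noteq> 0" unfolding u_def using row_cplx_nz g(2) by simp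
 define a b c d where abcd: "a = g$1$1" "b = g$1$2" "c = g$2$1" "d = g$2$2"
 \<comment> \<open>\<open>r\<close> and \<open>m\<close> are N times the real and imaginary parts of
   \<open>E\<close>; the derivatives of the real coordinates produce them directly.\<close>
 define r where "r = (X$1$1 - X$2$2) / 2 * (d\<^sup>2 - c\<^sup>2) - (X$1$2 + X$2$1) * c * d"
 define m where "m = - (X$1$1 - X$2$2) * c * d - (X$1$2 + X$2$1) / 2 * (d\<^sup>2 - c\<^sup>2)"
 define E where "E = cnj \<omega> * u\<^sup>2 / of_real N"
 define E' where "E' = \<omega> * (cnj u)\<^sup>2 / of_real N"
 have N_eq: "N = c\<^sup>2 + d\<^sup>2" by (simp add: N_def row_norm2_def abcd)
 have u_eq: "u = Complex d (- c)" by (simp add: u_def row_cplx_def abcd)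
 have uN: "u * cnj u = of_real N" unfolding u_def N_def by (rule row_cplx_cnj)
 have E_eq: "E = Complex (r / N) (m / N)"
 proof -
  have *: "cnj (Complex p k) * (Complex d (- c))\<^sup>2 = Complex (p * (d\<^sup>2 - c\<^sup>2) - 2 * k * c * d) (- 2 * p * c * d - k * (d\<^sup>2 - c\<^sup>2))" for p k
   by (simp add: complex_eq_iff power2_eq_square algebra_simps)
  have "cnj \<omega> * u\<^sup>2 = Complex r m"
   unfolding \<omega>_def u_eq r_def m_def * by (simp add: complex_eq_iff field_simps)
  then show ?thesis unfolding E_def by (simp add: complex_eq_iff)
 qed
 have E'_eq: "E' = cnj E" by (simp add: E_def E'_def)
 have G: "((\<lambda>t. \<gamma> t$i$j) has_real_derivative (g ** X)$i$j) (at t)" for i j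
  using has_vector_derivative_mat2_nth[OF \<gamma>] by (simp add: has_real_derivative_iff_has_vector_derivative)
 note nth = mat2_mult_nth abcd[symmetric]
 have gt: "\<gamma> t$1$1 = a" "\<gamma> t$1$2 = b" "\<gamma> t$2$1 = c" "\<gamma> t$2$2 = d" by (simp_all add: g(1) abcd)
 have N': "((\<lambda>t. row_norm2 (\<gamma> t)) has_real_derivative ((X$1$1 + X$2$2) * N - 2 * r)) (at t)"
  unfolding row_norm2_def
  by (auto intro!: derivative_eq_intros G simp: gt nth N_eq r_def power2_eq_square algebra_simps add_divide_distrib diff_divide_distrib)
 have D': "((\<lambda>t. det (\<gamma> t)) has_real_derivative ((X$1$1 + X$2$2) * det g)) (at t)"
  unfolding det_2 by (auto intro!: derivative_eq_intros G simp: gt nth algebra_simps)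
 have M': "((\<lambda>t. \<gamma> t$1$1 * \<gamma> t$2$1 + \<gamma> t$1$2 * \<gamma> t$2$2) has_real_derivative
   ((a * X$1$1 + b * X$2$1) * c + a * (c * X$1$1 + d * X$2$1) + (a * X$1$2 + b * X$2$2) * d + b * (c * X$1$2 + d * X$2$2))) (at t)"
  by (auto intro!: derivative_eq_intros G simp: gt nth algebra_simps)
 have Nt: "row_norm2 (\<gamma> t) = N" by (simp add: g N_def)
 have y': "((\<lambda>t. iwa_y (\<gamma> t)) has_real_derivative (iwa_y g * 2 * r / N)) (at t)"
 proof -
  have "((\<lambda>t. iwa_y (\<gamma> t)) has_real_derivative
   ((X$1$1 + X$2$2) * det g * N - det g * ((X$1$1 + X$2$2) * N - 2 * r)) / (N * N)) (at t)"
   unfolding iwa_y_def using DERIV_divide[OF D' N'] N by (simp add: Nt g N_def[symmetric])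
  moreover have "((X$1$1 + X$2$2) * det g * N - det g * ((X$1$1 + X$2$2) * N - 2 * r)) / (N * N) = iwa_y g * 2 * r / N"
   using N by (simp add: iwa_y_def N_def[symmetric] field_simps)
  ultimately show ?thesis by simp
 qed
 have x': "((\<lambda>t. iwa_x (\<gamma> t)) has_real_derivative (- 2 * iwa_y g * m / N)) (at t)"
 proof -
  let ?M' = "(a * X$1$1 + b * X$2$1) * c + a * (c * X$1$1 + d * X$2$1) + (a * X$1$2 + b * X$2$2) * d + b * (c * X$1$2 + d * X$2$2)"
  have "((\<lambda>t. iwa_x (\<gamma> t)) has_real_derivative
   (?M' * N - (a * c + b * d) * ((X$1$1 + X$2$2) * N - 2 * r)) / (N * N)) (at t)"
   unfolding iwa_x_def using DERIV_divide[OF M' N'] N by (simp add: Nt gt)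
  moreover have "?M' * N - (a * c + b * d) * ((X$1$1 + X$2$2) * N - 2 * r) = - 2 * det g * m"
   unfolding N_eq r_def m_def det_2 abcd[symmetric] by (simp add: field_simps power2_eq_square)
  ultimately show ?thesis using N by (simp add: iwa_y_def N_def[symmetric])
 qed
 have u': "((\<lambda>t. row_cplx (\<gamma> t)) has_vector_derivative (\<alpha> + \<i> * \<beta> - E') * u) (at t)"
 proof -
  have "(\<lambda>t. row_cplx (\<gamma> t)) = (\<lambda>t. of_real (\<gamma> t$2$2) - \<i> * of_real (\<gamma> t$2$1))"
   by (simp add: row_cplx_def complex_eq_iff fun_eq_iff)
  moreover have "((\<lambda>t. of_real (\<gamma> t$2$2) - \<i> * of_real (\<gamma> t$2$1)) has_vector_derivative
    of_real ((g ** X)$2$2) - \<i> * of_real ((g ** X)$2$1)) (at t)"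
   by (intro has_vector_derivative_diff has_vector_derivative_mult_right has_vector_derivative_of_real G)
  moreover have "of_real ((g ** X)$2$2) - \<i> * of_real ((g ** X)$2$1) = (\<alpha> + \<i> * \<beta>) * u - \<omega> * cnj u"
   by (simp add: nth u_eq \<alpha>_def \<beta>_def \<omega>_def complex_eq_iff field_simps)
  moreover have "E' * u = \<omega> * cnj u"
   unfolding E'_def using uN N by (simp add: power2_eq_square field_simps)
  ultimately show ?thesis by (simp add: algebra_simps)
 qed
 define s where "s = (\<mu> - of_int q) / 2"
 have L1: "((\<lambda>t. exp (2 * of_real pi * \<i> * of_real l * of_real (iwa_x (\<gamma> t)))) has_vector_derivative
   (2 * of_real pi * \<i> * of_real l * of_real (- 2 * iwa_y g * m / N)) * exp (2 * of_real pi * \<i> * of_real l * of_real (iwa_x (\<gamma> t)))) (at t)"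
 proof -
  have "((\<lambda>t. 2 * of_real pi * \<i> * of_real l * of_real (iwa_x (\<gamma> t))) has_vector_derivative
    2 * of_real pi * \<i> * of_real l * of_real (- 2 * iwa_y g * m / N)) (at t)"
   by (intro has_vector_derivative_mult_right has_vector_derivative_of_real x')
  from field_vector_diff_chain_at[OF this DERIV_exp] show ?thesis by (simp add: o_def)
 qed
 have L2: "((\<lambda>t. of_real (row_norm2 (\<gamma> t)) powr s) has_vector_derivative
   (s * of_real ((X$1$1 + X$2$2) - 2 * r / N)) * of_real (row_norm2 (\<gamma> t)) powr s) (at t)"
 proof -
  have 1: "((\<lambda>t. complex_of_real (row_norm2 (\<gamma> t))) has_vector_derivative of_real ((X$1$1 + X$2$2) * N - 2 * r)) (at t)"
   by (intro has_vector_derivative_of_real N')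
  have 2: "((\<lambda>z. z powr s) has_field_derivative s * of_real (row_norm2 (\<gamma> t)) powr (s - 1)) (at (of_real (row_norm2 (\<gamma> t))))"
   using N by (intro has_field_derivative_powr) (auto simp: Nt complex_nonpos_Reals_iff)
  have "of_real ((X$1$1 + X$2$2) * N - 2 * r) * (s * of_real N powr (s - 1)) = (s * of_real ((X$1$1 + X$2$2) - 2 * r / N)) * complex_of_real N powr s"
   using N by (simp add: powr_diff field_simps)
  then show ?thesis using field_vector_diff_chain_at[OF 1 2] by (simp only: o_def Nt)
 qed
 have L3: "((\<lambda>t. row_cplx (\<gamma> t) powi q) has_vector_derivative
   (of_int q * (\<alpha> + \<i> * \<beta> - E')) * row_cplx (\<gamma> t) powi q) (at t)"
 proof -
  have ut: "row_cplx (\<gamma> t) = u" by (simp add: g u_def)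
  have 2: "((\<lambda>z. z powi q) has_field_derivative of_int q * u powi (q - 1)) (at (row_cplx (\<gamma> t)))"
   unfolding ut using u by (auto intro!: derivative_eq_intros)
  have "(\<alpha> + \<i> * \<beta> - E') * u * (of_int q * u powi (q - 1)) = of_int q * (\<alpha> + \<i> * \<beta> - E') * u powi q"
   using u by (simp add: power_int_diff)
  then show ?thesis using field_vector_diff_chain_at[OF u' 2] by (simp only: o_def ut)
 qed
 have L4: "((\<lambda>t. w (iwa_y (\<gamma> t))) has_vector_derivative (iwa_y g * 2 * r / N) *\<^sub>R w') (at t)"
  using vector_diff_chain_at[of "\<lambda>t. iwa_y (\<gamma> t)" "iwa_y g * 2 * r / N" t w w'] y' w
  by (simp add: g o_def has_real_derivative_iff_has_vector_derivative)
 \<comment> \<open>Sum of the logarithmic derivatives of the factors other than \<open>w\<close>. In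
   terms of E and E' the coordinates satisfy y' = y (E + E'), x' = \<i> y (E - E'), N'/N = 2
   \<alpha> - E - E' and u'/u = \<alpha> + \<i> \<beta> - E'.\<close>
 define L where "L = 2 * of_real pi * \<i> * of_real l * of_real (- 2 * iwa_y g * m / N) +
   ((s * of_real ((X$1$1 + X$2$2) - 2 * r / N)) + (of_int q * (\<alpha> + \<i> * \<beta> - E')))"
 have "((\<lambda>t. exp (2 * of_real pi * \<i> * of_real l * of_real (iwa_x (\<gamma> t))) *
   (of_real (row_norm2 (\<gamma> t)) powr s * row_cplx (\<gamma> t) powi q)) has_vector_derivative L * e) (at t)"
  using log_deriv_mult[OF L1 log_deriv_mult[OF L2 L3]] unfolding e_def s_def g L_def by (simp add: g)
 from has_vector_derivative_mult[OF this L4]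
 have "((\<lambda>t. weight_fn l \<mu> w q (\<gamma> t)) has_vector_derivative
   (e * (of_real (iwa_y g * 2 * r / N) * w') + L * e * w (iwa_y g))) (at t)"
  unfolding weight_fn_def s_def e_def by (simp add: g scaleR_conv_of_real mult_ac)
 moreover have "e * (of_real (iwa_y g * 2 * r / N) * w') + L * e * w (iwa_y g)
   = e * ((\<mu> * \<alpha> + \<i> * of_int q * \<beta>) * w (iwa_y g)
    + E / 2 * (2 * y * w' - 4 * of_real pi * of_real l * y * w (iwa_y g) + (of_int q - \<mu>) * w (iwa_y g))
    + E' / 2 * (2 * y * w' + 4 * of_real pi * of_real l * y * w (iwa_y g) + (- of_int q - \<mu>) * w (iwa_y g)))"
 proof -
  have 1: "complex_of_real (iwa_y g * 2 * r / N) = y * (E + E')"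
   unfolding E'_eq E_eq y_def by (simp add: complex_eq_iff)
  have 2: "complex_of_real (- 2 * iwa_y g * m / N) = \<i> * y * (E - E')"
   unfolding E'_eq E_eq y_def by (simp add: complex_eq_iff)
  have 3: "complex_of_real ((X$1$1 + X$2$2) - 2 * r / N) = 2 * \<alpha> - E - E'"
   unfolding E'_eq E_eq \<alpha>_def by (simp add: complex_eq_iff)
  have q: "of_int q = \<mu> - 2 * s" by (simp add: s_def diff_divide_distrib)
  have ii: "\<i> * (\<i> * z) = - z" for z by simp
  show ?thesis unfolding L_def 1 2 3 q
   by (simp add: algebra_simps ii)
 qed
 moreover have "E / 2 = cnj \<omega> / 2 * (row_cplx g)\<^sup>2 / of_real (row_norm2 g)"
  "E' / 2 = \<omega> / 2 * (cnj (row_cplx g))\<^sup>2 / of_real (row_norm2 g)"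
  by (simp_all add: E_def E'_def u_def N_def)
 ultimately show ?thesis by (simp only:)
qed

text \<open>The two brackets of \<open>weight_fn_deriv\<close> are identified with multiples of the
  neighbouring radial parts. The factors \<nu> + 1 \<plusminus> q are those of the principal series,
  which itself solves the system for l = 0.\<close>

definition whittaker_system :: "real => complex => complex => int => (int => real => complex) => bool" where
 "whittaker_system l \<mu> \<nu> \<delta> w \<longleftrightarrow> (\<forall>q. even (q - \<delta>) \<longrightarrow> (\<forall>y>0. \<exists>D. (w q has_vector_derivative D) (at y) \<and>
   2 * of_real y * D - 4 * of_real pi * of_real l * of_real y * w q y + (of_int q - \<mu>) * w q y = (\<nu> + 1 + of_int q) * w (q + 2) y \<and>
   2 * of_real y * D + 4 * of_real pi * of_real l * of_real y * w q y + (- of_int q - \<mu>) * w q y = (\<nu> + 1 - of_int q) * w (q - 2) y))"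

text \<open>On the component of negative determinant the value is dictated by the reflection
  \<open>refl2\<close>, which reverses rotations and so exchanges the weights q and -q;
  \<open>s\<close> is the sign by which it acts.\<close>

definition weight_family :: "real => complex => complex => (int => real => complex) => int => mat2 => complex" where
 "weight_family l \<mu> s w q g = (if det g > 0 then weight_fn l \<mu> (w q) q g
   else if det g < 0 then s * weight_fn l \<mu> (w (- q)) (- q) (g ** refl2) else 0)"

text \<open>Since cnj u = N/u, multiplication by u^2/N moves both exponents to those of q + 2, and
  (cnj u)^2/N = N/u^2 moves them to those of q - 2.\<close>

lemma weight_fn_shift:
 assumes "det g > 0"
 shows "exp (2 * of_real pi * \<i> * of_real l * of_real (iwa_x g)) *
   (of_real (row_norm2 g) powr ((\<mu> - of_int q) / 2) * row_cplx g powi q) *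
   ((row_cplx g)\<^sup>2 / of_real (row_norm2 g) * w (iwa_y g)) = weight_fn l \<mu> w (q + 2) g"
  "exp (2 * of_real pi * \<i> * of_real l * of_real (iwa_x g)) *
   (of_real (row_norm2 g) powr ((\<mu> - of_int q) / 2) * row_cplx g powi q) *
   ((cnj (row_cplx g))\<^sup>2 / of_real (row_norm2 g) * w (iwa_y g)) = weight_fn l \<mu> w (q - 2) g"
proof -
 let ?N = "complex_of_real (row_norm2 g)" and ?u = "row_cplx g"
 have N: "?N \<noteq> 0" and u: "?u \<noteq> 0" using row_norm2_pos[of g] row_cplx_nz[of g] assms by auto
 have c: "cnj ?u = ?N / ?u" using row_cplx_cnj[of g] u by (simp add: field_simps)
 have e: "(\<mu> - of_int (q + 2)) / 2 = (\<mu> - of_int q) / 2 - 1" "(\<mu> - of_int (q - 2)) / 2 = (\<mu> - of_int q) / 2 + 1"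
  by (simp_all add: field_simps)
 show "exp (2 * of_real pi * \<i> * of_real l * of_real (iwa_x g)) *
   (?N powr ((\<mu> - of_int q) / 2) * ?u powi q) * (?u\<^sup>2 / ?N * w (iwa_y g)) = weight_fn l \<mu> w (q + 2) g"
  unfolding weight_fn_def e powr_diff using N u by (simp add: power_int_add field_simps)
 show "exp (2 * of_real pi * \<i> * of_real l * of_real (iwa_x g)) *
   (?N powr ((\<mu> - of_int q) / 2) * ?u powi q) * ((cnj ?u)\<^sup>2 / ?N * w (iwa_y g)) = weight_fn l \<mu> w (q - 2) g"
  unfolding weight_fn_def e c powr_add using N u by (simp add: power_int_diff power2_eq_square field_simps)
qed

lemma weight_fn_system_deriv:
 fixes \<gamma> :: "real => mat2"
 assumes sys: "whittaker_system l \<mu> \<nu> \<delta> w" and q: "even (q - \<delta>)"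
  and \<gamma>: "(\<gamma> has_vector_derivative g ** X) (at t)" "\<gamma> t = g" and g: "det g > 0"
 shows "((\<lambda>t. weight_fn l \<mu> (w q) q (\<gamma> t)) has_vector_derivative
  (\<mu> * of_real ((X$1$1 + X$2$2) / 2) + \<i> * of_int q * of_real ((X$1$2 - X$2$1) / 2)) * weight_fn l \<mu> (w q) q g
  + Complex ((X$1$1 - X$2$2) / 2) (- ((X$1$2 + X$2$1) / 2)) / 2 * ((\<nu> + 1 + of_int q) * weight_fn l \<mu> (w (q + 2)) (q + 2) g)
  + Complex ((X$1$1 - X$2$2) / 2) ((X$1$2 + X$2$1) / 2) / 2 * ((\<nu> + 1 - of_int q) * weight_fn l \<mu> (w (q - 2)) (q - 2) g)) (at t)"
proof -
 let ?y = "iwa_y g"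
 obtain D where D: "(w q has_vector_derivative D) (at ?y)"
   "2 * of_real ?y * D - 4 * of_real pi * of_real l * of_real ?y * w q ?y + (of_int q - \<mu>) * w q ?y = (\<nu> + 1 + of_int q) * w (q + 2) ?y"
   "2 * of_real ?y * D + 4 * of_real pi * of_real l * of_real ?y * w q ?y + (- of_int q - \<mu>) * w q ?y = (\<nu> + 1 - of_int q) * w (q - 2) ?y"
  using sys q iwa_y_pos[OF g] unfolding whittaker_system_def by blast
 have c: "cnj (Complex a b) = Complex a (- b)" for a b by (simp add: complex_eq_iff)
 let ?e = "exp (2 * of_real pi * \<i> * of_real l * of_real (iwa_x g)) * (of_real (row_norm2 g) powr ((\<mu> - of_int q) / 2) * row_cplx g powi q)"
 have alg: "e * (a * x + b / 2 * u / N * (c * x1) + b' / 2 * u' / N * (c' * x2))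
   = a * (e * x) + b / 2 * (c * (e * (u / N * x1))) + b' / 2 * (c' * (e * (u' / N * x2)))"
  for e a x b u N c x1 b' u' c' x2 :: complex
  by (simp add: algebra_simps)
 have 0: "?e * w q ?y = weight_fn l \<mu> (w q) q g" unfolding weight_fn_def by (simp add: mult_ac)
 show ?thesis
  using weight_fn_deriv[OF \<gamma> g D(1), of l \<mu> q]
  unfolding D(2,3) c alg weight_fn_shift[OF g, where q=q] 0 .
qed

text \<open>A curve in the component of negative determinant is moved to the other one by
  \<open>refl2\<close>. Conjugation by \<open>refl2\<close> negates the off-diagonal entries of X
  while the weight changes sign, so the raising and lowering terms trade places and the formula
  keeps its shape.\<close>

lemma weight_family_deriv:
 fixes \<gamma> :: "real => mat2"
 assumes sys: "whittaker_system l \<mu> \<nu> \<delta> w" and q: "even (q - \<delta>)"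
  and \<gamma>: "(\<gamma> has_vector_derivative g ** X) (at t)" "\<gamma> t = g" and g: "det g \<noteq> 0"
 shows "((\<lambda>t. weight_family l \<mu> s w q (\<gamma> t)) has_vector_derivative
  (\<mu> * of_real ((X$1$1 + X$2$2) / 2) + \<i> * of_int q * of_real ((X$1$2 - X$2$1) / 2)) * weight_family l \<mu> s w q g
  + Complex ((X$1$1 - X$2$2) / 2) (- ((X$1$2 + X$2$1) / 2)) / 2 * ((\<nu> + 1 + of_int q) * weight_family l \<mu> s w (q + 2) g)
  + Complex ((X$1$1 - X$2$2) / 2) ((X$1$2 + X$2$1) / 2) / 2 * ((\<nu> + 1 - of_int q) * weight_family l \<mu> s w (q - 2) g)) (at t)"
  (is "(_ has_vector_derivative ?D) _")
proof -
 have "continuous (at t) (\<lambda>t. \<gamma> t$i$j)" for i j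
  using has_vector_derivative_continuous[OF has_vector_derivative_mat2_nth[OF \<gamma>(1)]] .
 note c = this
 have cont: "isCont (\<lambda>t. det (\<gamma> t)) t" unfolding det_2 by (intro continuous_diff continuous_mult c)
 show ?thesis
 proof (cases "det g > 0")
  case True
  have ev: "\<forall>\<^sub>F t in at t. weight_fn l \<mu> (w q) q (\<gamma> t) = weight_family l \<mu> s w q (\<gamma> t)"
   using order_tendstoD(1)[OF cont[unfolded isCont_def], of 0] True \<gamma>(2)
   by (auto elim!: eventually_mono simp: weight_family_def)
  have W: "weight_family l \<mu> s w r g = weight_fn l \<mu> (w r) r g" for r
   using True by (simp add: weight_family_def)
  from weight_fn_system_deriv[OF sys q \<gamma> True] show ?thesis
   unfolding has_vector_derivative_def W
   by (rule has_derivative_transform_eventually[OF _ ev]) (use True \<gamma>(2) in \<open>auto simp: weight_family_def\<close>)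
 next
  case False
  then have neg: "det g < 0" using g by simp
  then have g': "det (g ** refl2) > 0" by simp
  let ?X = "refl2 ** X ** refl2"
  have q': "even (- q - \<delta>)" using q by presburger
  have bl: "bounded_linear (\<lambda>A :: mat2. A ** refl2)"
   unfolding linear_conv_bounded_linear[symmetric]
   by (auto intro!: linearI simp: mat2_eq_iff mat2_mult_nth)
  have \<gamma>': "((\<lambda>t. \<gamma> t ** refl2) has_vector_derivative (g ** refl2) ** ?X) (at t)"
   using bounded_linear.has_vector_derivative[OF bl \<gamma>(1)]
   by (simp add: matrix_mul_assoc) (simp add: matrix_mul_assoc[symmetric])
  have X: "?X$1$1 = X$1$1" "?X$2$2 = X$2$2" "?X$1$2 = - X$1$2" "?X$2$1 = - X$2$1"
   by (simp_all add: mat2_mult_nth)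
  have ev: "\<forall>\<^sub>F t in at t. s * weight_fn l \<mu> (w (- q)) (- q) (\<gamma> t ** refl2) = weight_family l \<mu> s w q (\<gamma> t)"
   using order_tendstoD(2)[OF cont[unfolded isCont_def], of 0] neg \<gamma>(2)
   by (auto elim!: eventually_mono simp: weight_family_def)
  have e: "- q - 2 = - (q + 2)" "- q + 2 = - (q - 2)" by simp_all
  have W: "weight_family l \<mu> s w r g = s * weight_fn l \<mu> (w (- r)) (- r) (g ** refl2)" for r
   using neg by (simp add: weight_family_def)
  have "((\<lambda>t. s * weight_fn l \<mu> (w (- q)) (- q) (\<gamma> t ** refl2)) has_vector_derivative
    ?D) (at t)"
  proof -
   have k: "(- X$1$2 + - X$2$1) / 2 = - ((X$1$2 + X$2$1) / 2)" "(- X$1$2 - - X$2$1) / 2 = - ((X$1$2 - X$2$1) / 2)"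
    by (simp_all add: field_simps)
   have alg: "s * ((m * a + \<i> * (- r) * (- b)) * A + c1 / 2 * ((n + 1 + - r) * B) + c2 / 2 * ((n + 1 - - r) * B'))
    = (m * a + \<i> * r * b) * (s * A) + c2 / 2 * ((n + 1 + r) * (s * B')) + c1 / 2 * ((n + 1 - r) * (s * B))"
    for m a r b A c1 n B c2 B' :: complex by (simp add: algebra_simps)
   have \<gamma>'': "\<gamma> t ** refl2 = g ** refl2" using \<gamma>(2) by simp
   show ?thesis
    using has_vector_derivative_mult_right[OF weight_fn_system_deriv[OF sys q' \<gamma>' \<gamma>'' g'], of s]
    unfolding X e W k of_int_minus of_real_minus minus_minus alg .
  qed
  then show ?thesis
   unfolding has_vector_derivative_def
   by (rule has_derivative_transform_eventually[OF _ ev]) (use neg \<gamma>(2) in \<open>auto simp: weight_family_def\<close>)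
 qed
qed

section \<open>Equivariance under N, rotations and the reflection\<close>

lemma matrix_mul_N_nth:
 fixes x g :: mat2
 assumes "x \<in> N_grp"
 shows "(x ** g)$2$1 = g$2$1" "(x ** g)$2$2 = g$2$2" "(x ** g)$1$1 = g$1$1 + x$1$2 * g$2$1" "(x ** g)$1$2 = g$1$2 + x$1$2 * g$2$2"
 using assms by (simp_all add: N_grp_def mat2_mult_nth)

lemma weight_fn_N:
 assumes x: "x \<in> N_grp" and g: "det g \<noteq> 0"
 shows "weight_fn l \<mu> w q (x ** g) = exp (2 * of_real pi * \<i> * of_real l * of_real (x$1$2)) * weight_fn l \<mu> w q g"
proof -
 have N: "row_norm2 (x ** g) = row_norm2 g" "row_cplx (x ** g) = row_cplx g"
  by (simp_all add: row_norm2_def row_cplx_def matrix_mul_N_nth[OF x])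
 have d: "det (x ** g) = det g" by (simp add: det_2 matrix_mul_N_nth[OF x] algebra_simps)
 have "iwa_x (x ** g) = x$1$2 + iwa_x g"
  using row_norm2_pos[OF g] unfolding iwa_x_def N
  by (simp add: matrix_mul_N_nth[OF x] field_simps) (simp add: row_norm2_def power2_eq_square algebra_simps)
 then show ?thesis unfolding weight_fn_def N iwa_y_def d
  by (simp add: exp_add[symmetric] algebra_simps)
qed

lemma weight_family_N:
 assumes x: "x \<in> N_grp"
 shows "weight_family l \<mu> s w q (x ** g) = exp (2 * of_real pi * \<i> * of_real l * of_real (x$1$2)) * weight_family l \<mu> s w q g"
proof -
 have d: "det (x ** g) = det g" by (simp add: det_2 matrix_mul_N_nth[OF x] algebra_simps)
 show ?thesis unfolding weight_family_def d
  using weight_fn_N[OF x, of g] weight_fn_N[OF x, of "g ** refl2"]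
  by (simp add: matrix_mul_assoc[symmetric])
qed

lemma det_rot [simp]: "det (rot t) = 1"
 using sin_cos_squared_add3[of t] by (simp add: det_2)

abbreviation expi :: "int => real => complex" where
 "expi q \<theta> \<equiv> exp (\<i> * of_int q * of_real \<theta>)"

lemma weight_fn_rot: "weight_fn l \<mu> w q (g ** rot t) = expi q t * weight_fn l \<mu> w q g"
proof -
 have cs: "cos t * cos t + sin t * sin t = 1" using sin_cos_squared_add2[of t] by (simp add: power2_eq_square add.commute)
 have cs': "sin t * sin t = 1 - cos t * cos t" using cs by linarith
 have cs'': "sin t * (sin t * z) = z - cos t * (cos t * z)" for z
  unfolding mult.assoc[symmetric] cs' by (simp add: algebra_simps)
 have d: "det (g ** rot t) = det g"
  by (simp add: det_mul)
 have N: "row_norm2 (g ** rot t) = row_norm2 g"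
  by (simp add: row_norm2_def mat2_mult_nth power2_eq_square cs'' algebra_simps)
 have x: "iwa_x (g ** rot t) = iwa_x g"
  unfolding iwa_x_def N by (simp add: mat2_mult_nth cs'' algebra_simps)
 have u: "row_cplx (g ** rot t) = exp (\<i> * of_real t) * row_cplx g"
  unfolding cis_conv_exp[symmetric] by (simp add: row_cplx_def mat2_mult_nth complex_eq_iff algebra_simps)
 have "exp (\<i> * of_real t) powi q = expi q t"
  by (simp add: exp_power_int mult_ac)
 then show ?thesis unfolding weight_fn_def iwa_y_def d N x u by (simp add: power_int_mult_distrib)
qed

lemma rot_refl2: "rot t ** refl2 = refl2 ** rot (- t)"
 by (simp add: mat2_eq_iff mat2_mult_nth)

lemma weight_family_rot: "weight_family l \<mu> s w q (g ** rot t) = expi q t * weight_family l \<mu> s w q g"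
proof -
 have "g ** rot t ** refl2 = (g ** refl2) ** rot (- t)"
  by (simp add: matrix_mul_assoc[symmetric] rot_refl2)
 then show ?thesis unfolding weight_family_def by (simp add: det_mul weight_fn_rot)
qed

lemma weight_family_refl2:
 assumes "s * s = 1"
 shows "weight_family l \<mu> s w q (g ** refl2) = s * weight_family l \<mu> s w (- q) g"
proof -
 have "g ** refl2 ** refl2 = g" by (simp add: matrix_mul_assoc[symmetric])
 then show ?thesis unfolding weight_family_def
  using assms by (simp add: mult.assoc[symmetric])
qed

text \<open>A class of formulas large enough to contain the weight functions. Once it is stable
  under one directional derivative, differentiability of all orders follows by a single induction.
  The rule \<open>comp\<close> admits only weights of the right parity, since the system gives
  derivatives only for these.\<close>

inductive smooth_gen :: "(int => real => complex) => int => mat2 set => (mat2 => complex) => bool"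
 for w \<delta> S where
 const: "smooth_gen w \<delta> S (\<lambda>g. c)"
| coord: "smooth_gen w \<delta> S (\<lambda>g. of_real (g$i$j))"
| add: "smooth_gen w \<delta> S f ==> smooth_gen w \<delta> S h ==> smooth_gen w \<delta> S (\<lambda>g. f g + h g)"
| mult: "smooth_gen w \<delta> S f ==> smooth_gen w \<delta> S h ==> smooth_gen w \<delta> S (\<lambda>g. f g * h g)"
| inv: "smooth_gen w \<delta> S f ==> (\<And>g. g \<in> S ==> f g \<noteq> 0) ==> smooth_gen w \<delta> S (\<lambda>g. inverse (f g))"
| exp: "smooth_gen w \<delta> S f ==> smooth_gen w \<delta> S (\<lambda>g. exp (f g))"
| powr: "smooth_gen w \<delta> S f ==> (\<And>g. g \<in> S ==> f g \<notin> \<real>\<^sub>\<le>\<^sub>0) ==> smooth_gen w \<delta> S (\<lambda>g. f g powr c)"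
| comp: "even (q - \<delta>) ==> smooth_gen w \<delta> S f ==> (\<And>g. g \<in> S ==> Im (f g) = 0 \<and> Re (f g) > 0) ==>
  smooth_gen w \<delta> S (\<lambda>g. w q (Re (f g)))"

text \<open>The generated class is closed under directional derivatives, because the derivative of
 \<open>w q\<close> is a combination of \<open>w q\<close> and \<open>w (q + 2)\<close>.\<close>

lemma smooth_gen_deriv:
 assumes sys: "whittaker_system l \<mu> \<nu> \<delta> w" and S: "open S" and f: "smooth_gen w \<delta> S f"
 shows "\<exists>f'. (\<forall>g\<in>S. (f has_derivative f' g) (at g)) \<and> (\<forall>v. smooth_gen w \<delta> S (\<lambda>g. f' g v))"
 using f
proof (induction rule: smooth_gen.induct)
 case (const c)
 show ?case by (rule exI[of _ "\<lambda>g v. 0"]) (auto intro: smooth_gen.const)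
next
 case (coord i j)
 have "((\<lambda>g. complex_of_real (g$i$j)) has_derivative (\<lambda>v. of_real (v$i$j))) (at g)" for g :: mat2
  by (intro bounded_linear_imp_has_derivative bounded_linear_compose[OF bounded_linear_of_real]
    bounded_linear_compose[OF bounded_linear_vec_nth bounded_linear_vec_nth])
 then show ?case by (intro exI[of _ "\<lambda>g v. of_real (v$i$j)"]) (auto intro: smooth_gen.const)
next
 case (add f h)
 then obtain f' h' where "\<forall>g\<in>S. (f has_derivative f' g) (at g)" "\<forall>v. smooth_gen w \<delta> S (\<lambda>g. f' g v)"
  "\<forall>g\<in>S. (h has_derivative h' g) (at g)" "\<forall>v. smooth_gen w \<delta> S (\<lambda>g. h' g v)" by blast
 then show ?case by (intro exI[of _ "\<lambda>g v. f' g v + h' g v"]) (auto intro!: smooth_gen.add has_derivative_add)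
next
 case (mult f h)
 then obtain f' h' where "\<forall>g\<in>S. (f has_derivative f' g) (at g)" "\<forall>v. smooth_gen w \<delta> S (\<lambda>g. f' g v)"
  "\<forall>g\<in>S. (h has_derivative h' g) (at g)" "\<forall>v. smooth_gen w \<delta> S (\<lambda>g. h' g v)" by blast
 then show ?case using mult.hyps
  by (intro exI[of _ "\<lambda>g v. f g * h' g v + f' g v * h g"]) (auto intro!: smooth_gen.add smooth_gen.mult has_derivative_mult)
next
 case (inv f)
 then obtain f' where f': "\<forall>g\<in>S. (f has_derivative f' g) (at g)" "\<forall>v. smooth_gen w \<delta> S (\<lambda>g. f' g v)" by blast
 have "((\<lambda>g. inverse (f g)) has_derivative (\<lambda>v. (-1) * (inverse (f g) * inverse (f g)) * f' g v)) (at g)" if "g \<in> S" for g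
  using has_derivative_compose[OF f'(1)[rule_format, OF that] has_field_derivative_imp_has_derivative[OF DERIV_inverse[OF inv.hyps(2)[OF that]]]]
  by simp
 moreover have "smooth_gen w \<delta> S (\<lambda>g. (-1) * (inverse (f g) * inverse (f g)) * f' g v)" for v
  by (intro smooth_gen.mult smooth_gen.const smooth_gen.inv inv.hyps f'(2)[rule_format])
 ultimately show ?case by (intro exI[of _ "\<lambda>g v. (-1) * (inverse (f g) * inverse (f g)) * f' g v"]) auto
next
 case (exp f)
 then obtain f' where f': "\<forall>g\<in>S. (f has_derivative f' g) (at g)" "\<forall>v. smooth_gen w \<delta> S (\<lambda>g. f' g v)" by blast
 have "((\<lambda>g. exp (f g)) has_derivative (\<lambda>v. exp (f g) * f' g v)) (at g)" if "g \<in> S" for g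
  using has_derivative_compose[OF f'(1)[rule_format, OF that] has_field_derivative_imp_has_derivative[OF DERIV_exp]] .
 moreover have "smooth_gen w \<delta> S (\<lambda>g. exp (f g) * f' g v)" for v
  by (intro smooth_gen.mult smooth_gen.exp exp.hyps f'(2)[rule_format])
 ultimately show ?case by (intro exI[of _ "\<lambda>g v. exp (f g) * f' g v"]) auto
next
 case (powr f c)
 then obtain f' where f': "\<forall>g\<in>S. (f has_derivative f' g) (at g)" "\<forall>v. smooth_gen w \<delta> S (\<lambda>g. f' g v)" by blast
 have "((\<lambda>g. f g powr c) has_derivative (\<lambda>v. (c * f g powr (c - 1)) * f' g v)) (at g)" if "g \<in> S" for g
  using has_derivative_compose[OF f'(1)[rule_format, OF that] has_field_derivative_imp_has_derivative[OF has_field_derivative_powr[OF powr.hyps(2)[OF that]]]] .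
 moreover have "smooth_gen w \<delta> S (\<lambda>g. (c * f g powr (c - 1)) * f' g v)" for v
  by (intro smooth_gen.mult smooth_gen.const smooth_gen.powr powr.hyps f'(2)[rule_format])
 ultimately show ?case by (intro exI[of _ "\<lambda>g v. (c * f g powr (c - 1)) * f' g v"]) auto
next
 case (comp q f)
 then obtain f' where f': "\<forall>g\<in>S. (f has_derivative f' g) (at g)" "\<forall>v. smooth_gen w \<delta> S (\<lambda>g. f' g v)" by blast
 \<comment> \<open>\<open>f\<close> is real on the open set S, hence so is its derivative; this
   allows Re to be dropped in the chain rule below.\<close>
 have Imf': "Im (f' g v) = 0" if "g \<in> S" for g v
 proof -
  have "((\<lambda>g. Im (f g)) has_derivative (\<lambda>v. Im (f' g v))) (at g)"
   using f'(1) that by (auto intro!: derivative_eq_intros)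
  moreover have "((\<lambda>g. Im (f g)) has_derivative (\<lambda>v. 0)) (at g)"
   by (rule has_derivative_transform_within_open[OF has_derivative_const[of 0] S that]) (use comp.hyps in auto)
  ultimately show ?thesis using has_derivative_unique by metis
 qed
 \<comment> \<open>The raising relation solved for the derivative of \<open>w q\<close> at y = f
   g.\<close>
 define D where "D g = inverse (2 * f g) * ((\<nu> + 1 + of_int q) * w (q + 2) (Re (f g)) + (4 * of_real pi * of_real l * (f g * w q (Re (f g)))
   + (\<mu> - of_int q) * w q (Re (f g))))" for g
 have "((\<lambda>g. w q (Re (f g))) has_derivative (\<lambda>v. D g * f' g v)) (at g)" if g: "g \<in> S" for g
 proof -
  let ?y = "Re (f g)"
  have y: "?y > 0" "f g = of_real ?y" using comp.hyps(3)[OF g] by (auto simp: complex_eq_iff)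
  obtain d where d: "(w q has_vector_derivative d) (at ?y)"
    "2 * of_real ?y * d - 4 * of_real pi * of_real l * of_real ?y * w q ?y + (of_int q - \<mu>) * w q ?y = (\<nu> + 1 + of_int q) * w (q + 2) ?y"
   using sys comp.hyps(1) y(1) unfolding whittaker_system_def by blast
  have dD: "d = D g"
  proof -
   have "2 * of_real ?y * d = (\<nu> + 1 + of_int q) * w (q + 2) ?y + (4 * of_real pi * of_real l * (of_real ?y * w q ?y) + (\<mu> - of_int q) * w q ?y)"
    unfolding d(2)[symmetric] by (simp add: algebra_simps)
   moreover have "2 * complex_of_real ?y \<noteq> 0" using y(1) by simp
   ultimately have "d = inverse (2 * of_real ?y) * ((\<nu> + 1 + of_int q) * w (q + 2) ?y + (4 * of_real pi * of_real l * (of_real ?y * w q ?y) + (\<mu> - of_int q) * w q ?y))"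
    by (metis left_inverse mult.assoc mult_1)
   then show ?thesis unfolding D_def using y(2) by simp
  qed
  have "((\<lambda>g. Re (f g)) has_derivative (\<lambda>v. Re (f' g v))) (at g)"
   using f'(1) g by (auto intro!: derivative_eq_intros)
  from has_derivative_compose[OF this d(1)[unfolded has_vector_derivative_def]]
  have "((\<lambda>g. w q (Re (f g))) has_derivative (\<lambda>v. Re (f' g v) *\<^sub>R d)) (at g)" .
  moreover have "Re (f' g v) *\<^sub>R d = D g * f' g v" for v
   using Imf'[OF g, of v] unfolding dD by (simp add: scaleR_conv_of_real complex_eq_iff)
  ultimately show ?thesis by simp
 qed
 moreover have "smooth_gen w \<delta> S (\<lambda>g. D g * f' g v)" for v
 proof -
  have nz: "2 * f g \<noteq> 0" if "g \<in> S" for g using comp.hyps(3)[OF that] by auto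
  have q2: "even (q + 2 - \<delta>)" using comp.hyps(1) by simp
  show ?thesis unfolding D_def
   by (intro smooth_gen.mult smooth_gen.add smooth_gen.const smooth_gen.inv smooth_gen.comp[OF q2] smooth_gen.comp[OF comp.hyps(1)] comp.hyps(2,3) f'(2)[rule_format] nz)
 qed
 ultimately show ?case by (intro exI[of _ "\<lambda>g v. D g * f' g v"]) auto
qed

lemma Ck_on_cong:
 assumes "open S" "\<And>x. x \<in> S ==> f x = h x" "Ck_on n S f"
 shows "Ck_on n S h"
 using assms(2,3)
proof (induction n arbitrary: f h)
 case 0
 have "continuous_on S f \<longleftrightarrow> continuous_on S h" by (rule continuous_on_cong) (use 0 in auto)
 with 0 show ?case by simp
next
 case (Suc n)
 have d: "(h has_derivative frechet_derivative f (at x)) (at x)" if "x \<in> S" for x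
 proof -
  have "f differentiable (at x)" using Suc.prems(2) that unfolding Ck_on.simps by blast
  then have "(f has_derivative frechet_derivative f (at x)) (at x)" by (simp only: frechet_derivative_works)
  from has_derivative_transform_within_open[OF this assms(1) that, of h] show ?thesis using Suc.prems(1) by blast
 qed
 have e: "frechet_derivative h (at x) = frechet_derivative f (at x)" if "x \<in> S" for x
  using frechet_derivative_at[OF d[OF that]] by simp
 show ?case
  unfolding Ck_on.simps
 proof (intro conjI ballI allI)
  show "h differentiable at x" if "x \<in> S" for x
   using d[OF that] unfolding differentiable_def by blast
  show "Ck_on n S (\<lambda>x. frechet_derivative h (at x) v)" for v
  proof (rule Suc.IH)
   show "Ck_on n S (\<lambda>x. frechet_derivative f (at x) v)" using Suc.prems(2) by simp
  qed (simp add: e)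
 qed
qed

text \<open>The two components of \<open>G_grp\<close> are open and carry different formulas for a
  weight family.\<close>

lemma Ck_on_Un:
 assumes "open S" "open T" "Ck_on n S f" "Ck_on n T f"
 shows "Ck_on n (S \<union> T) f"
 using assms(3,4) by (induction n arbitrary: f) (auto intro: continuous_on_open_Un assms(1,2))

lemma smooth_gen_smooth_on:
 assumes sys: "whittaker_system l \<mu> \<nu> \<delta> w" and S: "open S" and f: "smooth_gen w \<delta> S f"
 shows "smooth_on S f"
 unfolding smooth_on_def
proof
 fix n
 show "Ck_on n S f"
  using f
 proof (induction n arbitrary: f)
  case 0
  obtain f' where "\<forall>g\<in>S. (f has_derivative f' g) (at g)" using smooth_gen_deriv[OF sys S 0] by blast
  then show ?case by (auto intro!: continuous_at_imp_continuous_on has_derivative_continuous)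
 next
  case (Suc n)
  obtain f' where f': "\<forall>g\<in>S. (f has_derivative f' g) (at g)" "\<forall>v. smooth_gen w \<delta> S (\<lambda>g. f' g v)"
   using smooth_gen_deriv[OF sys S Suc.prems] by blast
  have "f' g = frechet_derivative f (at g)" if "g \<in> S" for g
   using frechet_derivative_at f'(1) that by blast
  note e = this
  show ?case
   unfolding Ck_on.simps
  proof (intro conjI ballI allI)
   show "f differentiable at g" if "g \<in> S" for g
    using f'(1) that unfolding differentiable_def by blast
   show "Ck_on n S (\<lambda>g. frechet_derivative f (at g) v)" for v
    using Suc.IH[OF f'(2)[rule_format, of v]] by (rule Ck_on_cong[OF S, rotated]) (simp add: e)
  qed
 qed
qed

lemma smooth_gen_diff: "smooth_gen w \<delta> S f ==> smooth_gen w \<delta> S h ==> smooth_gen w \<delta> S (\<lambda>g. f g - h g)"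
 using smooth_gen.add[of w \<delta> S f "\<lambda>g. (-1) * h g"] smooth_gen.mult[OF smooth_gen.const[of w \<delta> S "-1"]] by simp

lemma smooth_gen_powi:
 assumes "smooth_gen w \<delta> S f" "\<And>g. g \<in> S ==> f g \<noteq> 0"
 shows "smooth_gen w \<delta> S (\<lambda>g. f g powi q)"
proof -
 have n: "smooth_gen w \<delta> S (\<lambda>g. h g ^ n)" if "smooth_gen w \<delta> S h" for h n
  by (induction n) (auto intro: smooth_gen.const smooth_gen.mult that)
 show ?thesis
 proof (cases "q \<ge> 0")
  case True
  then show ?thesis using n[OF assms(1), of "nat q"] by (simp add: power_int_def)
 next
  case False
  then show ?thesis using n[OF smooth_gen.inv[OF assms], of "nat (- q)"] by (simp add: power_int_def)
 qed
qed

text \<open>The map \<open>h\<close> is the identity on the component of positive determinant and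
  right multiplication by \<open>refl2\<close> on the other.\<close>

lemma weight_fn_smooth_gen:
 fixes h :: "mat2 => mat2"
 assumes q: "even (q - \<delta>)" and h: "\<And>i j. smooth_gen w \<delta> S (\<lambda>g. of_real (h g$i$j))" and pos: "\<And>g. g \<in> S ==> det (h g) > 0"
 shows "smooth_gen w \<delta> S (\<lambda>g. weight_fn l \<mu> (w q) q (h g))"
proof -
 have Npos: "row_norm2 (h g) > 0" if "g \<in> S" for g using row_norm2_pos[of "h g"] pos[OF that] by simp
 have N: "smooth_gen w \<delta> S (\<lambda>g. of_real (row_norm2 (h g)))"
  unfolding row_norm2_def power2_eq_square of_real_add of_real_mult by (intro smooth_gen.add smooth_gen.mult h)
 have u: "smooth_gen w \<delta> S (\<lambda>g. row_cplx (h g))"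
 proof -
  have "row_cplx (h g) = of_real (h g$2$2) - \<i> * of_real (h g$2$1)" for g by (simp add: row_cplx_def complex_eq_iff)
  then show ?thesis using h by (auto intro!: smooth_gen_diff smooth_gen.mult smooth_gen.const)
 qed
 have iN: "smooth_gen w \<delta> S (\<lambda>g. inverse (of_real (row_norm2 (h g))))"
  using Npos by (intro smooth_gen.inv N) force
 have x: "smooth_gen w \<delta> S (\<lambda>g. of_real (iwa_x (h g)))"
  unfolding iwa_x_def divide_inverse of_real_add of_real_mult of_real_inverse
  by (intro smooth_gen.mult smooth_gen.add h iN)
 have y: "smooth_gen w \<delta> S (\<lambda>g. of_real (iwa_y (h g)))"
  unfolding iwa_y_def divide_inverse det_2 of_real_diff of_real_mult of_real_inverse
  by (intro smooth_gen.mult smooth_gen_diff h iN)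
 have "smooth_gen w \<delta> S (\<lambda>g. exp (2 * of_real pi * \<i> * of_real l * of_real (iwa_x (h g))) * w q (Re (of_real (iwa_y (h g)))) *
   (of_real (row_norm2 (h g)) powr ((\<mu> - of_int q) / 2) * row_cplx (h g) powi q))"
  using pos iwa_y_pos Npos row_cplx_nz
  by (intro smooth_gen.mult smooth_gen.exp smooth_gen.const x smooth_gen.comp[OF q y] smooth_gen.powr[OF N] smooth_gen_powi[OF u])
    (force simp: complex_nonpos_Reals_iff)+
 then show ?thesis unfolding weight_fn_def by simp
qed

lemma continuous_on_mat2_nth: "continuous_on S (\<lambda>g :: mat2. g$i$j)"
 by (intro linear_continuous_on bounded_linear_compose[OF bounded_linear_vec_nth bounded_linear_vec_nth])

lemma continuous_on_det2: "continuous_on S (\<lambda>g :: mat2. det g)"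
 unfolding det_2 by (intro continuous_on_diff continuous_on_mult continuous_on_mat2_nth)

lemma open_det_pos: "open {g :: mat2. det g > 0}" "open {g :: mat2. det g < 0}"
 by (intro open_Collect_less continuous_on_det2 continuous_on_const)+

lemma open_G_grp: "open G_grp"
proof -
 have "G_grp = {g :: mat2. det g > 0} \<union> {g. det g < 0}" by (auto simp: G_grp_det)
 then show ?thesis using open_Un[OF open_det_pos] by simp
qed

lemma weight_family_smooth:
 assumes sys: "whittaker_system l \<mu> \<nu> \<delta> w" and q: "even (q - \<delta>)"
 shows "smooth_on G_grp (weight_family l \<mu> s w q)"
proof -
 let ?P = "{g :: mat2. det g > 0}" and ?M = "{g :: mat2. det g < 0}"
 have G: "G_grp = ?P \<union> ?M" by (auto simp: G_grp_det)
 have q': "even (- q - \<delta>)" using q by presburger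
 have "smooth_gen w \<delta> ?P (\<lambda>g. weight_fn l \<mu> (w q) q g)"
  by (rule weight_fn_smooth_gen[OF q, where h="\<lambda>g. g"]) (auto intro: smooth_gen.coord)
 then have P: "Ck_on n ?P (weight_family l \<mu> s w q)" for n
  using smooth_gen_smooth_on[OF sys open_det_pos(1)] unfolding smooth_on_def
  by (auto intro: Ck_on_cong[OF open_det_pos(1)] simp: weight_family_def)
 have c: "smooth_gen w \<delta> ?M (\<lambda>g. of_real ((g ** refl2)$i$j))" for i j
  unfolding mat2_mult_nth of_real_add of_real_mult
  by (intro smooth_gen.add smooth_gen.mult smooth_gen.coord smooth_gen.const)
 have "smooth_gen w \<delta> ?M (\<lambda>g. s * weight_fn l \<mu> (w (- q)) (- q) (g ** refl2))"
  by (intro smooth_gen.mult smooth_gen.const weight_fn_smooth_gen[OF q'] c) auto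
 then have M: "Ck_on n ?M (weight_family l \<mu> s w q)" for n
  using smooth_gen_smooth_on[OF sys open_det_pos(2)] unfolding smooth_on_def
  by (auto intro: Ck_on_cong[OF open_det_pos(2)] simp: weight_family_def)
 show ?thesis unfolding smooth_on_def G using Ck_on_Un[OF open_det_pos P M] by blast
qed

section \<open>The exponential map and the Iwasawa decomposition\<close>

definition mat2_l1 :: "mat2 => real" where
 "mat2_l1 A = \<bar>A$1$1\<bar> + \<bar>A$1$2\<bar> + \<bar>A$2$1\<bar> + \<bar>A$2$2\<bar>"

lemma norm_mat2_le: "norm (A :: mat2) \<le> mat2_l1 A"
proof -
 have "norm A \<le> (\<Sum>i\<in>UNIV. norm (A$i))" unfolding norm_vec_def by (rule L2_set_le_sum) simp
 also have "\<dots> \<le> (\<Sum>i\<in>UNIV. \<Sum>j\<in>UNIV. \<bar>A$i$j\<bar>)" by (intro sum_mono norm_le_l1_cart)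
 finally show ?thesis by (simp only: sum_2 mat2_l1_def add.assoc)
qed

lemma mat2_nth_le_norm: "\<bar>(A :: mat2)$i$j\<bar> \<le> norm A"
 by (rule order_trans[OF component_le_norm_cart Finite_Cartesian_Product.norm_nth_le])

definition mat2_pow :: "mat2 => nat => mat2" where "mat2_pow X n = (((**) X) ^^ n) (mat 1)"

lemma mat2_pow_simps [simp]: "mat2_pow X 0 = mat 1" "mat2_pow X (Suc n) = X ** mat2_pow X n"
 by (simp_all add: mat2_pow_def)

lemma forall_2_I: "P 1 ==> P 2 ==> P (i :: 2)" by (metis exhaust_2)

lemma mat2_pow_bound: "\<bar>mat2_pow X n$i$j\<bar> \<le> mat2_l1 X ^ n"
proof (induction n arbitrary: i j)
 case 0
 show ?case by (simp add: mat_def)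
next
 case (Suc n)
 have l: "\<bar>X$i$1\<bar> + \<bar>X$i$2\<bar> \<le> mat2_l1 X"
  by (rule forall_2_I[where P="\<lambda>i. \<bar>X$i$1\<bar> + \<bar>X$i$2\<bar> \<le> mat2_l1 X"]) (simp_all add: mat2_l1_def)
 have "\<bar>mat2_pow X (Suc n)$i$j\<bar> \<le> \<bar>X$i$1\<bar> * \<bar>mat2_pow X n$1$j\<bar> + \<bar>X$i$2\<bar> * \<bar>mat2_pow X n$2$j\<bar>"
  by (simp add: mat2_mult_nth abs_mult[symmetric])
 also have "\<dots> \<le> \<bar>X$i$1\<bar> * mat2_l1 X ^ n + \<bar>X$i$2\<bar> * mat2_l1 X ^ n"
  by (intro add_mono mult_left_mono Suc) auto
 also have "\<dots> = (\<bar>X$i$1\<bar> + \<bar>X$i$2\<bar>) * mat2_l1 X ^ n" by (simp add: algebra_simps)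
 also have "\<dots> \<le> mat2_l1 X * mat2_l1 X ^ n"
  by (intro mult_right_mono l) (simp add: mat2_l1_def)
 finally show ?case by simp
qed

lemma mat2_pow_scaleR: "mat2_pow (t *\<^sub>R X) n = t ^ n *\<^sub>R mat2_pow X n"
proof (induction n)
 case (Suc n)
 have "(t *\<^sub>R X) ** (c *\<^sub>R B) = (t * c) *\<^sub>R (X ** B)" for c and B :: mat2
  by (rule mat2_eqI) (simp_all add: mat2_mult_nth algebra_simps)
 then show ?case using Suc by simp
qed simp

lemma mat2_pow_norm: "norm (mat2_pow X n) \<le> 4 * mat2_l1 X ^ n"
 using norm_mat2_le[of "mat2_pow X n"] mat2_pow_bound[of X n 1 1] mat2_pow_bound[of X n 1 2]
  mat2_pow_bound[of X n 2 1] mat2_pow_bound[of X n 2 2] unfolding mat2_l1_def[of "mat2_pow X n"]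
 by linarith

lemma mat_exp_eq: "mat_exp X = (\<Sum>n. (1 / fact n) *\<^sub>R mat2_pow X n)"
 by (simp add: mat_exp_def mat2_pow_def)

lemma mat_exp_term_norm: "norm ((1 / fact n) *\<^sub>R mat2_pow X n) \<le> 4 * (inverse (fact n) * mat2_l1 X ^ n)"
proof -
 have "norm ((1 / fact n) *\<^sub>R mat2_pow X n) = inverse (fact n) * norm (mat2_pow X n)" by (simp add: inverse_eq_divide)
 also have "\<dots> \<le> inverse (fact n) * (4 * mat2_l1 X ^ n)" by (intro mult_left_mono mat2_pow_norm) simp
 finally show ?thesis by simp
qed

lemma summable_mat_exp: "summable (\<lambda>n. (1 / fact n) *\<^sub>R mat2_pow X n)"
 by (rule summable_comparison_test'[OF summable_mult[OF summable_exp[of "mat2_l1 X"], of 4]])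
   (use mat_exp_term_norm in auto)

text \<open>The remainder is dominated by t^2 times the tail of the exponential series of
  \<open>mat2_l1 X\<close>, with a 4 for the four entries. The value and derivative at 0 and the
  uniform estimate over K are all read off from this expansion.\<close>

lemma mat_exp_quadratic:
 obtains C where "\<And>t. \<bar>t\<bar> \<le> 1 ==> norm (mat_exp (t *\<^sub>R X) - mat 1 - t *\<^sub>R X) \<le> C * t\<^sup>2"
proof -
 let ?b = "\<lambda>n. 4 * (inverse (fact (n + 2)) * mat2_l1 X ^ (n + 2))"
 have sb: "summable ?b"
  using summable_ignore_initial_segment[OF summable_mult[OF summable_exp[of "mat2_l1 X"], of 4], of 2] by simp
 show ?thesis
 proof (rule that[of "suminf ?b"])
  fix t :: real assume t: "\<bar>t\<bar> \<le> 1"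
  let ?a = "\<lambda>n. (1 / fact n) *\<^sub>R mat2_pow (t *\<^sub>R X) n"
  have "X ** mat 1 = X" by simp
  then have "mat_exp (t *\<^sub>R X) = (\<Sum>n. ?a (n + 2)) + (mat 1 + t *\<^sub>R X)"
   unfolding mat_exp_eq using suminf_split_initial_segment[OF summable_mat_exp[of "t *\<^sub>R X"], of 2]
   by (simp add: numeral_2_eq_2 mat2_pow_scaleR)
  then have "mat_exp (t *\<^sub>R X) - mat 1 - t *\<^sub>R X = (\<Sum>n. ?a (n + 2))" by simp
  also have "norm \<dots> \<le> (\<Sum>n. ?b n * t\<^sup>2)"
  proof (rule norm_suminf_le)
   show "summable (\<lambda>n. ?b n * t\<^sup>2)" by (intro summable_mult2 sb)
  next
   fix n
   have "norm (?a (n + 2)) = \<bar>t\<bar> ^ (n + 2) * norm ((1 / fact (n + 2)) *\<^sub>R mat2_pow X (n + 2))"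
    by (simp only: mat2_pow_scaleR norm_scaleR power_abs abs_mult) (simp add: power_abs)
   also have "\<dots> \<le> t\<^sup>2 * ?b n"
   proof (intro mult_mono mat_exp_term_norm)
    have "\<bar>t\<bar> ^ (n + 2) \<le> \<bar>t\<bar> ^ 2" using t by (intro power_decreasing) auto
    then show "\<bar>t\<bar> ^ (n + 2) \<le> t\<^sup>2" by simp
   qed auto
   finally show "norm (?a (n + 2)) \<le> ?b n * t\<^sup>2" by (simp only: mult.commute)
  qed
  also have "\<dots> = suminf ?b * t\<^sup>2" using suminf_mult2[OF sb] by simp
  finally show "norm (mat_exp (t *\<^sub>R X) - mat 1 - t *\<^sub>R X) \<le> suminf ?b * t\<^sup>2" .
 qed
qed

lemma mat_exp_0 [simp]: "mat_exp 0 = mat 1"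
 using mat_exp_quadratic[of 0] by (metis abs_0 diff_0_right eq_iff_diff_eq_0 mult_zero_right norm_le_zero_iff power_zero_numeral scaleR_zero_right zero_le_one)

lemma mat_exp_deriv: "((\<lambda>t. mat_exp (t *\<^sub>R X)) has_vector_derivative X) (at 0)"
proof -
 obtain C where C: "\<And>t. \<bar>t\<bar> \<le> 1 ==> norm (mat_exp (t *\<^sub>R X) - mat 1 - t *\<^sub>R X) \<le> C * t\<^sup>2"
  using mat_exp_quadratic by blast
 show ?thesis
  by (rule has_vector_derivative_quadratic_bound[of 1 _ _ _ C]) (use C in auto)
qed

lemma bounded_linear_mat2_mult: "bounded_linear (\<lambda>A :: mat2. (g :: mat2) ** A)" "bounded_linear (\<lambda>A :: mat2. A ** (g :: mat2))"
 unfolding linear_conv_bounded_linear[symmetric]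
 by (auto intro!: linearI mat2_eqI simp: mat2_mult_nth algebra_simps)

lemma mat_exp_curve_deriv: "((\<lambda>t. (g :: mat2) ** mat_exp (t *\<^sub>R X)) has_vector_derivative g ** X) (at 0)"
 by (rule bounded_linear.has_vector_derivative[OF bounded_linear_mat2_mult(1) mat_exp_deriv])

section \<open>The group O(2) and the Iwasawa decomposition\<close>

lemma K_grp_cases:
 assumes "k \<in> K_grp"
 obtains \<theta> where "k = rot \<theta>" | \<theta> where "k = refl2 ** rot \<theta>"
proof -
 have o: "transpose k ** k = mat 1" "k ** transpose k = mat 1"
  using assms by (auto simp: K_grp_def orthogonal_matrix_def)
 have e: "k$1$1 * k$1$1 + k$1$2 * k$1$2 = 1" "k$1$1 * k$2$1 + k$1$2 * k$2$2 = 0" "k$2$1 * k$2$1 + k$2$2 * k$2$2 = 1"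
  using o(2) by (simp_all add: mat2_eq_iff mat2_mult_nth transpose_def)
 have f: "k$1$1 * k$1$1 + k$2$1 * k$2$1 = 1" "k$1$1 * k$1$2 + k$2$1 * k$2$2 = 0" "k$1$2 * k$1$2 + k$2$2 * k$2$2 = 1"
  using o(1) by (simp_all add: mat2_eq_iff mat2_mult_nth transpose_def)
 \<comment> \<open>The second row fixes the angle; the first row is then determined up to the sign
   D, the determinant.\<close>
 obtain \<theta> where \<theta>: "k$2$2 = cos \<theta>" "- (k$2$1) = sin \<theta>"
  using sincos_total_2pi[of "k$2$2" "- (k$2$1)"] e(3) by (auto simp: power2_eq_square add.commute)
 define D where "D = k$1$1 * k$2$2 - k$1$2 * k$2$1"
 have D2: "D * D = 1"
 proof -
  have "D * D = (k$1$1 * k$1$1 + k$1$2 * k$1$2) * (k$2$1 * k$2$1 + k$2$2 * k$2$2) - (k$1$1 * k$2$1 + k$1$2 * k$2$2) * (k$1$1 * k$2$1 + k$1$2 * k$2$2)"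
   unfolding D_def by (simp add: algebra_simps)
  then show ?thesis unfolding e by simp
 qed
 have k1: "k$1$1 = D * k$2$2" 
 proof -
  have "D * k$2$2 = k$1$1 * (k$1$2 * k$1$2 + k$2$2 * k$2$2) - k$1$2 * (k$1$1 * k$1$2 + k$2$1 * k$2$2)"
   unfolding D_def by (simp add: algebra_simps)
  then show ?thesis unfolding f by simp
 qed
 have k2: "k$1$2 = - D * k$2$1"
 proof -
  have "- D * k$2$1 = k$1$2 * (k$1$1 * k$1$1 + k$2$1 * k$2$1) - k$1$1 * (k$1$1 * k$1$2 + k$2$1 * k$2$2)"
   unfolding D_def by (simp add: algebra_simps)
  then show ?thesis unfolding f by simp
 qed
 have "D = 1 \<or> D = -1" using D2 by (simp add: square_eq_1_iff)
 then show ?thesis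
 proof
  assume "D = 1"
  then have "k = rot \<theta>" using k1 k2 \<theta> by (simp add: mat2_eq_iff)
  then show ?thesis using that by blast
 next
  assume "D = -1"
  then have "k = refl2 ** rot \<theta>" using k1 k2 \<theta> by (simp add: mat2_eq_iff mat2_mult_nth)
  then show ?thesis using that by blast
 qed
qed

lemma rot_in_K [simp]: "rot t \<in> K_grp"
proof -
 have "cos t * cos t + sin t * sin t = 1" by (simp add: power2_eq_square[symmetric])
 then show ?thesis
  by (simp add: K_grp_def orthogonal_matrix_def mat2_eq_iff mat2_mult_nth transpose_def add.commute)
qed

lemma refl2_in_K [simp]: "refl2 \<in> K_grp"
 by (simp add: K_grp_def orthogonal_matrix_def mat2_eq_iff mat2_mult_nth transpose_def)

lemma K_mult [simp]: "k \<in> K_grp ==> k' \<in> K_grp ==> k ** k' \<in> K_grp"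
 by (simp add: K_grp_def orthogonal_matrix_mul)

lemma one_in_K [simp]: "mat 1 \<in> K_grp"
 by (simp add: K_grp_def orthogonal_matrix_id)

lemma K_transpose: "k \<in> K_grp ==> transpose k \<in> K_grp \<and> k ** transpose k = mat 1 \<and> transpose k ** k = mat 1"
 by (auto simp: K_grp_def orthogonal_matrix_def)

lemma det_K: "k \<in> K_grp ==> det k = 1 \<or> det k = -1"
 by (simp add: K_grp_def det_orthogonal_matrix)

lemma K_in_G: "k \<in> K_grp ==> k \<in> G_grp"
 using det_K[of k] by (auto simp: G_grp_det)

lemma G_mult: "g \<in> G_grp ==> h \<in> G_grp ==> g ** h \<in> G_grp"
 by (simp add: G_grp_det det_mul)

lemma rot_add: "rot (s + t) = rot s ** rot t"
 by (simp add: mat2_eq_iff mat2_mult_nth cos_add sin_add algebra_simps)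

lemma rot_0 [simp]: "rot 0 = mat 1" by (simp add: mat2_eq_iff)

lemma P_grp_iff: "p \<in> P_grp \<longleftrightarrow> p$2$1 = 0 \<and> p$1$1 \<noteq> 0 \<and> p$2$2 \<noteq> 0"
proof
 assume "p \<in> P_grp"
 then show "p$2$1 = 0 \<and> p$1$1 \<noteq> 0 \<and> p$2$2 \<noteq> 0"
  by (auto simp: P_grp_def N_grp_def M_grp_def mat2_mult_nth)
next
 assume p: "p$2$1 = 0 \<and> p$1$1 \<noteq> 0 \<and> p$2$2 \<noteq> 0"
 let ?x = "(\<chi> i j. if i = j then 1 else if i = 1 then p$1$2 / p$2$2 else 0) :: mat2"
 have x: "?x$1$1 = 1" "?x$1$2 = p$1$2 / p$2$2" "?x$2$1 = 0" "?x$2$2 = 1" by auto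
 have "p = ?x ** diag2 (p$1$1) (p$2$2)"
  unfolding mat2_eq_iff mat2_mult_nth x using p by simp
 moreover have "?x \<in> N_grp" unfolding N_grp_def using x by blast
 moreover have "diag2 (p$1$1) (p$2$2) \<in> M_grp" unfolding M_grp_def using p by blast
 ultimately show "p \<in> P_grp" unfolding P_grp_def by blast
qed

text \<open>If h = p k with p upper triangular and positive on the diagonal, the second row of k is
  the normalised second row of h. Orthogonality gives the first row up to a sign, which is the sign
  of det h.\<close>

definition K_part :: "mat2 => mat2" where
 "K_part h = (let r = sqrt (row_norm2 h) in
   vector [vector [sgn (det h) * h$2$2 / r, - sgn (det h) * h$2$1 / r], vector [h$2$1 / r, h$2$2 / r]])"

definition P_part :: "mat2 => mat2" where "P_part h = h ** transpose (K_part h)"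

lemma K_part_nth: "K_part h$1$1 = sgn (det h) * h$2$2 / sqrt (row_norm2 h)" "K_part h$1$2 = - sgn (det h) * h$2$1 / sqrt (row_norm2 h)"
 "K_part h$2$1 = h$2$1 / sqrt (row_norm2 h)" "K_part h$2$2 = h$2$2 / sqrt (row_norm2 h)"
 by (simp_all add: K_part_def Let_def)

lemma K_part_in_K:
 assumes "det h \<noteq> 0"
 shows "K_part h \<in> K_grp"
proof -
 define r where "r = sqrt (row_norm2 h)"
 have r: "r \<noteq> 0" "r * r = h$2$1 * h$2$1 + h$2$2 * h$2$2" using row_norm2_pos[OF assms]
  by (auto simp: r_def row_norm2_def power2_eq_square)
 have s: "sgn (det h) * sgn (det h) = 1" using assms by (simp add: sgn_if)
 have s': "sgn (det h) * (sgn (det h) * z) = z" for z using s by (simp add: mult.assoc[symmetric])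
 define a b where "a = h$2$1 / r" and "b = h$2$2 / r"
 have "a * a + b * b = (h$2$1 * h$2$1 + h$2$2 * h$2$2) / (r * r)" by (simp add: a_def b_def add_divide_distrib)
 then have ab: "a * a + b * b = 1" unfolding r(2)[symmetric] using r(1) by simp
 have K: "K_part h$1$1 = sgn (det h) * b" "K_part h$1$2 = - sgn (det h) * a" "K_part h$2$1 = a" "K_part h$2$2 = b"
  by (simp_all add: K_part_nth r_def[symmetric] a_def b_def)
 have "K_part h ** transpose (K_part h) = mat 1"
  unfolding mat2_eq_iff mat2_mult_nth transpose_def
  using ab s' assms by (simp add: K algebra_simps)
 then show ?thesis unfolding K_grp_def orthogonal_matrix by (simp add: matrix_left_right_inverse)
qed

lemma P_part_nth:
 assumes "det h \<noteq> 0"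
 shows "P_part h$2$1 = 0" "P_part h$1$1 = \<bar>det h\<bar> / sqrt (row_norm2 h)" "P_part h$2$2 = sqrt (row_norm2 h)"
proof -
 define r where "r = sqrt (row_norm2 h)"
 have r: "r > 0" "r * r = h$2$1 * h$2$1 + h$2$2 * h$2$2" using row_norm2_pos[OF assms]
  by (auto simp: r_def row_norm2_def power2_eq_square)
 show "P_part h$2$1 = 0" "P_part h$2$2 = sqrt (row_norm2 h)"
  unfolding P_part_def mat2_mult_nth using r
  by (simp_all add: K_part_nth transpose_def r_def[symmetric] field_simps)
 have "P_part h$1$1 = sgn (det h) * det h / r"
  unfolding P_part_def mat2_mult_nth by (simp add: K_part_nth transpose_def r_def[symmetric] det_2 algebra_simps diff_divide_distrib)
 then show "P_part h$1$1 = \<bar>det h\<bar> / sqrt (row_norm2 h)" by (simp add: r_def abs_sgn mult.commute)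
qed

lemma P_part_K_part: "det h \<noteq> 0 ==> P_part h ** K_part h = h"
 using K_transpose[OF K_part_in_K] by (simp add: P_part_def matrix_mul_assoc[symmetric])

lemma iwasawa_unique:
 assumes p: "p$2$1 = 0" "p$1$1 > 0" "p$2$2 > 0" and k: "k \<in> K_grp"
 shows "K_part (p ** k) = k" "P_part (p ** k) = p"
proof -
 have R: "row_norm2 (p ** k) = (p$2$2)\<^sup>2"
 proof -
  have "k ** transpose k = mat 1" using K_transpose[OF k] by blast
  then have e: "k$2$1 * k$2$1 + k$2$2 * k$2$2 = 1" by (simp add: mat2_eq_iff mat2_mult_nth transpose_def)
  have "row_norm2 (p ** k) = (p$2$2)\<^sup>2 * (k$2$1 * k$2$1 + k$2$2 * k$2$2)"
   using p(1) by (simp add: row_norm2_def mat2_mult_nth power2_eq_square algebra_simps)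
  then show ?thesis unfolding e by simp
 qed
 have r: "sqrt (row_norm2 (p ** k)) = p$2$2" using p unfolding R by simp
 have dp: "det p = p$1$1 * p$2$2" using p by (simp add: det_2)
 have d: "sgn (det (p ** k)) = det k"
  using p det_K[OF k] by (auto simp: det_mul dp sgn_mult)
 have kk: "k$1$1 = det k * k$2$2 \<and> k$1$2 = - det k * k$2$1"
  using k
 proof (cases rule: K_grp_cases)
  case (1 \<theta>)
  then show ?thesis by simp
 next
  case (2 \<theta>)
  have "det refl2 = -1" by (simp add: det_2)
  with 2 show ?thesis by (simp add: det_mul mat2_mult_nth)
 qed
 show "K_part (p ** k) = k"
  unfolding mat2_eq_iff K_part_nth r d using p kk by (simp add: mat2_mult_nth)
 then show "P_part (p ** k) = p"
  using K_transpose[OF k] by (simp add: P_part_def matrix_mul_assoc[symmetric])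
qed

lemma iwasawa_eq:
 assumes "det h \<noteq> 0"
 shows "iwasawa h = (P_part h, K_part h)"
 unfolding iwasawa_def
proof (rule the_equality)
 have r: "sqrt (row_norm2 h) > 0" using row_norm2_pos[OF assms] by simp
 have "P_part h$1$1 > 0" "P_part h$2$2 > 0" using assms r by (simp_all add: P_part_nth)
 then show "case (P_part h, K_part h) of (p, k') => p \<in> P_grp \<and> 0 < p$1$1 \<and> 0 < p$2$2 \<and> k' \<in> K_grp \<and> h = p ** k'"
  using assms P_part_nth[OF assms] K_part_in_K P_part_K_part by (auto simp: P_grp_iff)
next
 fix x assume "case x of (p, k') => p \<in> P_grp \<and> 0 < p$1$1 \<and> 0 < p$2$2 \<and> k' \<in> K_grp \<and> h = p ** k'"
 then show "x = (P_part h, K_part h)" using iwasawa_unique by (cases x) (auto simp: P_grp_iff)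
qed

lemma K_part_K: "k \<in> K_grp ==> K_part k = k" "k \<in> K_grp ==> P_part k = mat 1"
 using iwasawa_unique[of "mat 1" k] by simp_all

section \<open>Haar measure and the action of \<open>G\<close> on functions on \<open>K\<close>\<close>

lemma continuous_on_mat2:
 fixes f :: "'a::topological_space => mat2"
 assumes "\<And>i j. continuous_on S (\<lambda>x. f x$i$j)"
 shows "continuous_on S f"
proof -
 have "continuous_on S (\<lambda>x. \<chi> i. \<chi> j. f x$i$j)"
  by (intro continuous_on_vec_lambda assms)
 then show ?thesis by simp
qed

lemma forall_22_I: "P 1 1 ==> P 1 2 ==> P 2 1 ==> P 2 2 ==> P (i :: 2) (j :: 2)"
 by (metis exhaust_2)

lemma continuous_on_rot: "continuous_on S rot"
 by (rule continuous_on_mat2, rule forall_22_I[where P="\<lambda>i j. continuous_on S (\<lambda>x. rot x$i$j)"])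
   (simp_all add: continuous_on_cos continuous_on_sin continuous_on_minus)

lemma continuous_on_mat2_mult:
 fixes f h :: "'a::topological_space => mat2"
 assumes "continuous_on S f" "continuous_on S h"
 shows "continuous_on S (\<lambda>x. f x ** h x)"
 by (rule continuous_on_mat2, unfold mat2_mult_nth)
   (intro continuous_on_add continuous_on_mult continuous_on_compose2[OF continuous_on_mat2_nth[of UNIV] assms(1)] continuous_on_compose2[OF continuous_on_mat2_nth[of UNIV] assms(2)] subset_UNIV)

lemma closed_K_grp: "closed K_grp"
proof -
 have t: "continuous_on UNIV (transpose :: mat2 => mat2)"
  by (rule continuous_on_mat2) (simp add: transpose_def continuous_on_mat2_nth)
 have "K_grp = {k :: mat2. transpose k ** k = mat 1}" by (auto simp: K_grp_def orthogonal_matrix)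
 moreover have "closed {k :: mat2. transpose k ** k = mat 1}"
  by (intro closed_Collect_eq continuous_on_mat2_mult t continuous_on_id continuous_on_const)
 ultimately show ?thesis by simp
qed

lemma compact_K_grp: "compact K_grp"
proof -
 have K_eq: "K_grp = rot ` {0..2*pi} \<union> (\<lambda>t. refl2 ** rot t) ` {0..2*pi}"
 proof
  have period: "\<exists>t\<in>{0..2*pi}. rot \<theta> = rot t" for \<theta>
  proof -
   obtain t where "0 \<le> t" "t < 2 * pi" "cos \<theta> = cos t" "sin \<theta> = sin t"
    using sincos_total_2pi[of "cos \<theta>" "sin \<theta>"] by (metis sin_cos_squared_add2)
   then show ?thesis by (auto simp: mat2_eq_iff intro!: bexI[of _ t])
  qed
  show "K_grp \<subseteq> rot ` {0..2*pi} \<union> (\<lambda>t. refl2 ** rot t) ` {0..2*pi}"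
  proof
   fix k assume "k \<in> K_grp"
   then show "k \<in> rot ` {0..2*pi} \<union> (\<lambda>t. refl2 ** rot t) ` {0..2*pi}"
    by (cases rule: K_grp_cases) (use period in \<open>metis UnI1 UnI2 image_eqI\<close>)+
  qed
 qed auto
 have "continuous_on {0..2*pi} (\<lambda>t. refl2 ** rot t)"
  by (intro continuous_on_mat2_mult continuous_on_const continuous_on_rot)
 then have "compact ((\<lambda>t. refl2 ** rot t) ` {0..2*pi})" by (rule compact_continuous_image) simp
 moreover have "compact (rot ` {0..2*pi})" by (rule compact_continuous_image[OF continuous_on_rot]) simp
 ultimately show ?thesis unfolding K_eq by (rule compact_Un[rotated])
qed

lemma borel_K_grp [measurable]: "K_grp \<in> sets borel" using closed_K_grp by simp

lemma haar_map_measurable: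
 "(\<lambda>(\<theta>, \<epsilon>). diag2 \<epsilon> 1 ** rot \<theta>) \<in> measurable (uniform_measure lborel {0..<2*pi} \<Otimes>\<^sub>M uniform_count_measure {1, -1::real}) borel"
proof -
 have c: "continuous_on UNIV (\<lambda>x :: real \<times> real. diag2 (snd x) 1 ** rot (fst x))"
 proof (intro continuous_on_mat2_mult)
  show "continuous_on UNIV (\<lambda>x :: real \<times> real. diag2 (snd x) 1)"
   by (rule continuous_on_mat2, rule forall_22_I[where P="\<lambda>i j. continuous_on UNIV (\<lambda>x :: real \<times> real. diag2 (snd x) 1$i$j)"])
     (simp_all add: continuous_on_snd)
  show "continuous_on UNIV (\<lambda>x :: real \<times> real. rot (fst x))"
   by (rule continuous_on_compose2[OF continuous_on_rot continuous_on_fst]) auto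
 qed
 have "(\<lambda>x :: real \<times> real. diag2 (snd x) 1 ** rot (fst x)) \<in> borel_measurable (borel \<Otimes>\<^sub>M borel)"
  unfolding borel_prod using c by (rule borel_measurable_continuous_onI)
 moreover have "(\<lambda>x. (fst x, snd x)) \<in> measurable (uniform_measure lborel {0..<2*pi} \<Otimes>\<^sub>M uniform_count_measure {1, -1::real}) (borel \<Otimes>\<^sub>M borel)"
 proof (intro measurable_Pair)
  show "fst \<in> measurable (uniform_measure lborel {0..<2*pi} \<Otimes>\<^sub>M uniform_count_measure {1, -1::real}) borel"
   by (rule measurable_compose[OF measurable_fst]) (simp add: measurable_def)
  have id: "(\<lambda>x. x) \<in> measurable (uniform_count_measure {1, -1::real}) borel" by (auto simp: measurable_def)
  show "snd \<in> measurable (uniform_measure lborel {0..<2*pi} \<Otimes>\<^sub>M uniform_count_measure {1, -1::real}) borel"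
   by (rule measurable_compose[OF measurable_snd id])
 qed
 ultimately show ?thesis
  using measurable_compose[of "\<lambda>x. (fst x, snd x)"] by (fastforce simp: case_prod_unfold)
qed

lemma sets_haar_K [simp, measurable_cong]: "sets haar_K = sets borel" by (simp add: haar_K_def)
lemma space_haar_K [simp]: "space haar_K = UNIV" by (simp add: haar_K_def)

lemma rot_measurable: "rot \<in> borel_measurable borel" "(\<lambda>t. refl2 ** rot t) \<in> borel_measurable borel"
 by (intro borel_measurable_continuous_onI continuous_on_mat2_mult continuous_on_const continuous_on_rot)+

text \<open>The constant 4 pi is the total length of the two circles of angles that make up
  O(2).\<close>

lemma nn_integral_haar_K:
 assumes f: "f \<in> borel_measurable borel"
 shows "(\<integral>\<^sup>+k. f k \<partial>haar_K) = (\<integral>\<^sup>+\<theta>. (f (rot \<theta>) + f (refl2 ** rot \<theta>)) * indicator {0..<2*pi} \<theta> \<partial>lborel) / ennreal (4 * pi)"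
proof -
 let ?U = "uniform_measure lborel {0..<2*pi}" and ?C = "uniform_count_measure {1, -1::real}"
 let ?T = "\<lambda>(\<theta>, \<epsilon>). diag2 \<epsilon> 1 ** rot \<theta>"
 have em: "emeasure lborel {0..<2*pi} = ennreal (2 * pi)" by simp
 interpret C: prob_space ?C by (rule prob_space_uniform_count_measure) auto
 have [measurable]: "f \<in> borel_measurable borel" by fact
 have m: "(\<lambda>x. f (?T x)) \<in> borel_measurable (?U \<Otimes>\<^sub>M ?C)"
  by (rule measurable_compose[OF haar_map_measurable f])
 have "(\<integral>\<^sup>+k. f k \<partial>haar_K) = (\<integral>\<^sup>+x. f (?T x) \<partial>(?U \<Otimes>\<^sub>M ?C))"
  unfolding haar_K_def by (rule nn_integral_distr[OF haar_map_measurable]) (simp add: f)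
 also have "\<dots> = (\<integral>\<^sup>+\<theta>. \<integral>\<^sup>+\<epsilon>. f (?T (\<theta>, \<epsilon>)) \<partial>?C \<partial>?U)"
  by (rule C.nn_integral_fst[OF m, symmetric])
 also have "\<dots> = (\<integral>\<^sup>+\<theta>. (f (rot \<theta>) + f (refl2 ** rot \<theta>)) / 2 \<partial>?U)"
 proof (intro nn_integral_cong)
  fix \<theta>
  have d: "diag2 1 1 = (mat 1 :: mat2)" "diag2 (-1) 1 = refl2" by (simp_all add: mat2_eq_iff)
  have "(\<integral>\<^sup>+\<epsilon>. f (?T (\<theta>, \<epsilon>)) \<partial>?C) = (\<Sum>\<epsilon>\<in>{1, -1::real}. ennreal (1/2) * f (diag2 \<epsilon> 1 ** rot \<theta>))"
   unfolding uniform_count_measure_def by (subst nn_integral_point_measure_finite) auto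
  also have "\<dots> = (f (rot \<theta>) + f (refl2 ** rot \<theta>)) / 2"
  proof -
   have h: "ennreal (1/2) = inverse 2" using inverse_ennreal[of 2] by (simp add: inverse_eq_divide)
   have "(\<Sum>\<epsilon>\<in>{1, -1::real}. ennreal (1/2) * f (diag2 \<epsilon> 1 ** rot \<theta>)) = inverse 2 * f (rot \<theta>) + inverse 2 * f (refl2 ** rot \<theta>)"
    unfolding h by (simp add: d)
   then show ?thesis by (simp only: divide_ennreal_def distrib_right mult.commute[of "inverse 2"])
  qed
  finally show "(\<integral>\<^sup>+\<epsilon>. f (?T (\<theta>, \<epsilon>)) \<partial>?C) = (f (rot \<theta>) + f (refl2 ** rot \<theta>)) / 2" .
 qed
 also have "\<dots> = (\<integral>\<^sup>+\<theta>. (f (rot \<theta>) + f (refl2 ** rot \<theta>)) / 2 * indicator {0..<2*pi} \<theta> \<partial>lborel) / ennreal (2 * pi)"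
 proof (subst nn_integral_uniform_measure)
  show "(\<lambda>\<theta>. (f (rot \<theta>) + f (refl2 ** rot \<theta>)) / 2) \<in> borel_measurable lborel"
   using measurable_compose[OF rot_measurable(1) f] measurable_compose[OF rot_measurable(2) f] by measurable
 qed (auto simp: em)
 also have "\<dots> = (\<integral>\<^sup>+\<theta>. (f (rot \<theta>) + f (refl2 ** rot \<theta>)) * indicator {0..<2*pi} \<theta> / 2 \<partial>lborel) / ennreal (2 * pi)"
  by (simp add: divide_ennreal_def mult_ac)
 also have "\<dots> = (\<integral>\<^sup>+\<theta>. (f (rot \<theta>) + f (refl2 ** rot \<theta>)) * indicator {0..<2*pi} \<theta> \<partial>lborel) / 2 / ennreal (2 * pi)"
  using measurable_compose[OF rot_measurable(1) f] measurable_compose[OF rot_measurable(2) f]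
  by (subst nn_integral_divide) (auto)
 also have "\<dots> = (\<integral>\<^sup>+\<theta>. (f (rot \<theta>) + f (refl2 ** rot \<theta>)) * indicator {0..<2*pi} \<theta> \<partial>lborel) / ennreal (4 * pi)"
 proof -
  have "x / 2 / ennreal (2 * pi) = x / ennreal (4 * pi)" for x :: ennreal
  proof -
   have "inverse (ennreal 2) * inverse (ennreal (2 * pi)) = inverse (ennreal (4 * pi))"
    using pi_gt_zero by (simp only: inverse_ennreal mult_pos_pos zero_less_numeral ennreal_mult[symmetric] inverse_nonnegative_iff_nonnegative zero_le_numeral less_imp_le) (simp add: field_simps)
   then have "inverse 2 * inverse (ennreal (2 * pi)) = inverse (ennreal (4 * pi))" by simp
   then show ?thesis by (simp add: divide_ennreal_def mult.assoc)
  qed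
  then show ?thesis by simp
 qed
 finally show ?thesis .
qed

lemma prob_space_haar_K: "prob_space haar_K"
proof
 have "emeasure haar_K UNIV = (\<integral>\<^sup>+k. 1 \<partial>haar_K)" by simp
 also have "\<dots> = (\<integral>\<^sup>+\<theta>. 2 * indicator {0..<2*pi} \<theta> \<partial>lborel) / ennreal (4 * pi)"
  by (subst nn_integral_haar_K) (auto simp: one_add_one)
 also have "(\<integral>\<^sup>+\<theta>. 2 * indicator {0..<2*pi} \<theta> \<partial>lborel) = ennreal (4 * pi)"
  by (subst nn_integral_cmult_indicator) (auto simp: ennreal_mult[symmetric] simp flip: ennreal_numeral)
 also have "ennreal (4 * pi) / ennreal (4 * pi) = 1" by (rule ennreal_divide_self) auto
 finally show "emeasure haar_K (space haar_K) = 1" by simp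
qed

text \<open>The part of the shifted period that lies beyond 2 pi is moved back by
  periodicity.\<close>

lemma nn_integral_periodic_shift:
 fixes h :: "real => ennreal"
 assumes h[measurable]: "h \<in> borel_measurable borel" and per: "\<And>t. h (t + 2 * pi) = h t" and \<tau>: "0 \<le> \<tau>" "\<tau> \<le> 2 * pi"
 shows "(\<integral>\<^sup>+t. h (t + \<tau>) * indicator {0..<2*pi} t \<partial>lborel) = (\<integral>\<^sup>+t. h t * indicator {0..<2*pi} t \<partial>lborel)"
proof -
 have shift: "(\<integral>\<^sup>+t. f (t + c) \<partial>lborel) = (\<integral>\<^sup>+t. f t \<partial>lborel)" if "f \<in> borel_measurable borel" for f :: "real => ennreal" and c
  using nn_integral_real_affine[of f 1 c] that by (simp add: add.commute)
 have "(\<integral>\<^sup>+t. h (t + \<tau>) * indicator {0..<2*pi} t \<partial>lborel) = (\<integral>\<^sup>+t. h (t + \<tau>) * indicator {\<tau>..<2*pi+\<tau>} (t + \<tau>) \<partial>lborel)"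
  by (intro nn_integral_cong) (auto simp: indicator_def)
 also have "\<dots> = (\<integral>\<^sup>+t. h t * indicator {\<tau>..<2*pi+\<tau>} t \<partial>lborel)"
  by (rule shift[of "\<lambda>t. h t * indicator {\<tau>..<2*pi+\<tau>} t"]) measurable
 also have "\<dots> = (\<integral>\<^sup>+t. h t * indicator {\<tau>..<2*pi} t + h t * indicator {2*pi..<2*pi+\<tau>} t \<partial>lborel)"
  using \<tau> by (intro nn_integral_cong) (auto simp: indicator_def)
 also have "\<dots> = (\<integral>\<^sup>+t. h t * indicator {\<tau>..<2*pi} t \<partial>lborel) + (\<integral>\<^sup>+t. h t * indicator {2*pi..<2*pi+\<tau>} t \<partial>lborel)"
  by (rule nn_integral_add) measurable
 also have "(\<integral>\<^sup>+t. h t * indicator {2*pi..<2*pi+\<tau>} t \<partial>lborel) = (\<integral>\<^sup>+t. h (t + 2*pi) * indicator {2*pi..<2*pi+\<tau>} (t + 2*pi) \<partial>lborel)"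
  by (rule shift[of "\<lambda>t. h t * indicator {2*pi..<2*pi+\<tau>} t", symmetric]) measurable
 also have "\<dots> = (\<integral>\<^sup>+t. h t * indicator {0..<\<tau>} t \<partial>lborel)"
  by (intro nn_integral_cong) (auto simp: indicator_def per)
 also have "(\<integral>\<^sup>+t. h t * indicator {\<tau>..<2*pi} t \<partial>lborel) + (\<integral>\<^sup>+t. h t * indicator {0..<\<tau>} t \<partial>lborel)
   = (\<integral>\<^sup>+t. h t * indicator {\<tau>..<2*pi} t + h t * indicator {0..<\<tau>} t \<partial>lborel)"
  by (rule nn_integral_add[symmetric]) measurable
 also have "\<dots> = (\<integral>\<^sup>+t. h t * indicator {0..<2*pi} t \<partial>lborel)"
  using \<tau> by (intro nn_integral_cong) (auto simp: indicator_def)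
 finally show ?thesis .
qed

lemma mult_rot_measurable: "(\<lambda>k :: mat2. k ** rot \<tau>) \<in> borel_measurable borel"
 by (intro borel_measurable_continuous_onI continuous_on_mat2_mult continuous_on_const continuous_on_id)

lemma rot_periodic: "rot (t + 2 * pi) = rot t" by (simp add: mat2_eq_iff)

lemma distr_haar_K_rot:
 assumes \<tau>: "0 \<le> \<tau>" "\<tau> \<le> 2 * pi"
 shows "distr haar_K haar_K (\<lambda>k. k ** rot \<tau>) = haar_K"
proof (rule measure_eqI)
 fix A assume "A \<in> sets (distr haar_K haar_K (\<lambda>k. k ** rot \<tau>))"
 then have A: "A \<in> sets borel" by simp
 have m: "(\<lambda>k. k ** rot \<tau>) \<in> measurable haar_K haar_K" using mult_rot_measurable by measurable
 let ?f = "\<lambda>k. indicator A k :: ennreal"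
 let ?h = "\<lambda>t. ?f (rot t) + ?f (refl2 ** rot t)"
 have f: "?f \<in> borel_measurable borel" using A by measurable
 have h: "?h \<in> borel_measurable borel"
  using measurable_compose[OF rot_measurable(1) f] measurable_compose[OF rot_measurable(2) f] by measurable
 have "emeasure (distr haar_K haar_K (\<lambda>k. k ** rot \<tau>)) A = (\<integral>\<^sup>+k. ?f k \<partial>distr haar_K haar_K (\<lambda>k. k ** rot \<tau>))"
  using A by simp
 also have "\<dots> = (\<integral>\<^sup>+k. ?f (k ** rot \<tau>) \<partial>haar_K)"
  using m by (rule nn_integral_distr) (use f in simp)
 also have "\<dots> = (\<integral>\<^sup>+t. ?h (t + \<tau>) * indicator {0..<2*pi} t \<partial>lborel) / ennreal (4 * pi)"
  using measurable_compose[OF mult_rot_measurable f]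
  by (subst nn_integral_haar_K) (auto simp: rot_add matrix_mul_assoc)
 also have "\<dots> = (\<integral>\<^sup>+t. ?h t * indicator {0..<2*pi} t \<partial>lborel) / ennreal (4 * pi)"
  by (subst nn_integral_periodic_shift[OF h _ \<tau>]) (auto simp: rot_periodic)
 also have "\<dots> = (\<integral>\<^sup>+k. ?f k \<partial>haar_K)" using f by (subst nn_integral_haar_K) auto
 also have "\<dots> = emeasure haar_K A" using A by simp
 finally show "emeasure (distr haar_K haar_K (\<lambda>k. k ** rot \<tau>)) A = emeasure haar_K A" .
qed simp

text \<open>Null sets of K are tested on all real angles instead of one period, so that they can be
  transported by changes of angle that are smooth but not periodic; countably many translates of one
  period cover the line.\<close>

lemma AE_haar_K_iff:
 assumes P: "{k. \<not> P k} \<in> sets borel"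
 shows "(AE k in haar_K. P k) \<longleftrightarrow> negligible {t. \<not> P (rot t) \<or> \<not> P (refl2 ** rot t)}"
proof -
 let ?N = "{k. \<not> P k}"
 let ?B = "{t. \<not> P (rot t) \<or> \<not> P (refl2 ** rot t)}"
 let ?h = "\<lambda>t. (indicator ?N (rot t) + indicator ?N (refl2 ** rot t)) :: ennreal"
 have B: "?B \<in> sets borel"
 proof -
  have "?B = rot -` ?N \<union> (\<lambda>t. refl2 ** rot t) -` ?N" by auto
  then show ?thesis using measurable_sets[OF rot_measurable(1) P] measurable_sets[OF rot_measurable(2) P] by simp
 qed
 have f: "(indicator ?N :: mat2 => ennreal) \<in> borel_measurable borel" using P by measurable
 have h: "?h \<in> borel_measurable borel"
  using measurable_compose[OF rot_measurable(1) f] measurable_compose[OF rot_measurable(2) f] by measurable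
 have "(AE k in haar_K. P k) \<longleftrightarrow> emeasure haar_K ?N = 0"
  using P by (subst AE_iff_measurable[of ?N]) auto
 also have "emeasure haar_K ?N = (\<integral>\<^sup>+k. indicator ?N k \<partial>haar_K)" using P by simp
 also have "\<dots> = (\<integral>\<^sup>+t. ?h t * indicator {0..<2*pi} t \<partial>lborel) / ennreal (4 * pi)"
  by (rule nn_integral_haar_K[OF f])
 also have "\<dots> = 0 \<longleftrightarrow> (\<integral>\<^sup>+t. ?h t * indicator {0..<2*pi} t \<partial>lborel) = 0"
  by (simp add: ennreal_divide_eq_0_iff)
 also have "\<dots> \<longleftrightarrow> (AE t in lborel. ?h t * indicator {0..<2*pi} t = 0)"
  using h by (subst nn_integral_0_iff_AE) auto
 also have "\<dots> \<longleftrightarrow> (AE t in lborel. t \<notin> ?B \<inter> {0..<2*pi})"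
  by (intro AE_cong) (auto simp: indicator_def)
 also have "\<dots> \<longleftrightarrow> ?B \<inter> {0..<2*pi} \<in> null_sets lborel"
  using B by (subst AE_iff_null_sets) auto
 also have "\<dots> \<longleftrightarrow> negligible (?B \<inter> {0..<2*pi})"
  using B by (simp add: negligible_iff_null_sets null_sets_completion_iff)
 also have "\<dots> \<longleftrightarrow> negligible ?B"
 proof
  assume n: "negligible (?B \<inter> {0..<2*pi})"
  have "?B \<subseteq> (\<Union>n::int. (\<lambda>t. 2 * pi * of_int n + t) ` (?B \<inter> {0..<2*pi}))"
  proof
   fix t assume t: "t \<in> ?B"
   define n where "n = \<lfloor>t / (2 * pi)\<rfloor>"
   define t0 where "t0 = t - 2 * pi * of_int n"
   have "t0 \<in> {0..<2*pi}"
    using floor_divide_lower[of "2 * pi" t] floor_divide_upper[of "2 * pi" t]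
    unfolding t0_def n_def by (auto simp: algebra_simps)
   moreover have r: "rot t = rot t0"
   proof -
    have "sin t = sin t0 \<and> cos t = cos t0" unfolding sin_cos_eq_iff t0_def by (intro exI[of _ n]) simp
    then show ?thesis by (simp add: mat2_eq_iff)
   qed
   ultimately have "t0 \<in> ?B \<inter> {0..<2*pi}" using t by auto
   moreover have "t = 2 * pi * of_int n + t0" by (simp add: t0_def)
   ultimately show "t \<in> (\<Union>n::int. (\<lambda>t. 2 * pi * of_int n + t) ` (?B \<inter> {0..<2*pi}))" by blast
  qed
  moreover have "negligible (\<Union>n::int. (\<lambda>t. 2 * pi * of_int n + t) ` (?B \<inter> {0..<2*pi}))"
  proof (rule negligible_countable_Union)
   fix S assume "S \<in> range (\<lambda>n::int. (\<lambda>t. 2 * pi * of_int n + t) ` (?B \<inter> {0..<2*pi}))"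
   then show "negligible S" using negligible_translation[OF n] by blast
  qed simp
  ultimately show "negligible ?B" using negligible_subset by blast
 qed (auto intro: negligible_subset)
 finally show ?thesis .
qed

section \<open>Null sets of K under the action of G\<close>

lemma row_cplx_rot: "row_cplx (rot \<theta>) = exp (\<i> * of_real \<theta>)"
 unfolding cis_conv_exp[symmetric] by (simp add: row_cplx_def complex_eq_iff)

lemma row_cplx_refl2: "row_cplx (refl2 ** g) = row_cplx g"
 by (simp add: row_cplx_def mat2_mult_nth)

lemma row_cplx_upper: "p$2$1 = 0 ==> row_cplx (p ** g) = of_real (p$2$2) * row_cplx g"
 by (simp add: row_cplx_def mat2_mult_nth complex_eq_iff)

text \<open>With U the row vector as a complex number, \<theta> is up to 2 pi n the imaginary part
  of Ln U, or pi plus that of Ln (- U) where U is on the cut of the logarithm. The set is therefore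
  covered by countably many differentiable images of subsets of B.\<close>

lemma negligible_angle_image:
 assumes g: "det g \<noteq> 0" and B: "negligible B"
 shows "negligible {\<theta>. \<exists>\<tau>\<in>B. \<exists>r>0. exp (\<i> * of_real \<theta>) = of_real r * row_cplx (rot \<tau> ** g)}"
proof -
 define U where "U \<tau> = row_cplx (rot \<tau> ** g)" for \<tau>
 have U_nz: "U \<tau> \<noteq> 0" for \<tau> unfolding U_def using row_cplx_nz[of "rot \<tau> ** g"] g by (simp add: det_mul)
 define U' where "U' \<tau> = complex_of_real (- cos \<tau> * 0 + (- (cos \<tau>) * g$1$2 - sin \<tau> * g$2$2)) - \<i> * of_real (- (cos \<tau>) * g$1$1 - sin \<tau> * g$2$1)" for \<tau>
 have dU: "(U has_vector_derivative U' \<tau>) (at \<tau>)" for \<tau>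
 proof -
  have "U = (\<lambda>\<tau>. of_real (- sin \<tau> * g$1$2 + cos \<tau> * g$2$2) - \<i> * of_real (- sin \<tau> * g$1$1 + cos \<tau> * g$2$1))"
   by (simp add: U_def row_cplx_def mat2_mult_nth complex_eq_iff fun_eq_iff)
  moreover have "((\<lambda>\<tau>. of_real (- sin \<tau> * g$1$2 + cos \<tau> * g$2$2) - \<i> * of_real (- sin \<tau> * g$1$1 + cos \<tau> * g$2$1)) has_vector_derivative U' \<tau>) (at \<tau>)"
   unfolding U'_def
   by (intro has_vector_derivative_diff has_vector_derivative_mult_right has_vector_derivative_of_real)
     (auto intro!: derivative_eq_intros)
  ultimately show ?thesis by simp
 qed
 have im: "negligible ((\<lambda>\<tau>. Im (Ln (e * U \<tau>)) + c) ` (B \<inter> {\<tau>. e * U \<tau> \<notin> \<real>\<^sub>\<le>\<^sub>0}))" for e c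
 proof (rule negligible_differentiable_image_negligible)
  show "negligible (B \<inter> {\<tau>. e * U \<tau> \<notin> \<real>\<^sub>\<le>\<^sub>0})" using B by (rule negligible_subset) auto
  show "(\<lambda>\<tau>. Im (Ln (e * U \<tau>)) + c) differentiable_on (B \<inter> {\<tau>. e * U \<tau> \<notin> \<real>\<^sub>\<le>\<^sub>0})"
   unfolding differentiable_on_def
  proof
   fix \<tau> assume "\<tau> \<in> B \<inter> {\<tau>. e * U \<tau> \<notin> \<real>\<^sub>\<le>\<^sub>0}"
   then have nr: "e * U \<tau> \<notin> \<real>\<^sub>\<le>\<^sub>0" by simp
   from field_vector_diff_chain_at[OF has_vector_derivative_mult_right[OF dU] has_field_derivative_Ln[OF nr]]
   have "((\<lambda>\<tau>. Ln (e * U \<tau>)) has_vector_derivative (e * U' \<tau> * inverse (e * U \<tau>))) (at \<tau>)" by (simp add: o_def)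
   from bounded_linear.has_vector_derivative[OF bounded_linear_Im this]
   have "(\<lambda>\<tau>. Im (Ln (e * U \<tau>))) differentiable (at \<tau>)"
    unfolding has_vector_derivative_def differentiable_def by blast
   then show "(\<lambda>\<tau>. Im (Ln (e * U \<tau>)) + c) differentiable (at \<tau> within B \<inter> {\<tau>. e * U \<tau> \<notin> \<real>\<^sub>\<le>\<^sub>0})"
    by (rule differentiable_at_withinI[OF differentiable_add[OF _ differentiable_const]])
  qed
 qed simp
 let ?I = "\<lambda>e c. (\<lambda>\<tau>. Im (Ln (e * U \<tau>)) + c) ` (B \<inter> {\<tau>. e * U \<tau> \<notin> \<real>\<^sub>\<le>\<^sub>0})"
 have "{\<theta>. \<exists>\<tau>\<in>B. \<exists>r>0. exp (\<i> * of_real \<theta>) = of_real r * U \<tau>} \<subseteq> (\<Union>n::int. ?I 1 (2 * pi * of_int n)) \<union> (\<Union>n::int. ?I (-1) (pi + 2 * pi * of_int n))"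
 proof
  fix \<theta> assume "\<theta> \<in> {\<theta>. \<exists>\<tau>\<in>B. \<exists>r>0. exp (\<i> * of_real \<theta>) = of_real r * U \<tau>}"
  then obtain \<tau> r where \<tau>: "\<tau> \<in> B" "r > 0" "exp (\<i> * of_real \<theta>) = of_real r * U \<tau>" by blast
  have er: "complex_of_real r = exp (of_real (ln r))" using \<tau>(2) by (simp add: exp_of_real)
  show "\<theta> \<in> (\<Union>n::int. ?I 1 (2 * pi * of_int n)) \<union> (\<Union>n::int. ?I (-1) (pi + 2 * pi * of_int n))"
  proof (cases "U \<tau> \<in> \<real>\<^sub>\<le>\<^sub>0")
   case False
   have "exp (\<i> * of_real \<theta>) = exp (of_real (ln r) + Ln (U \<tau>))"
    unfolding \<tau>(3) exp_add er[symmetric] using U_nz by simp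
   then obtain n :: int where "\<i> * of_real \<theta> = of_real (ln r) + Ln (U \<tau>) + of_real (2 * of_int n * pi) * \<i>"
    unfolding exp_eq by auto
   then have "\<theta> = Im (Ln (1 * U \<tau>)) + 2 * pi * of_int n" by (simp add: complex_eq_iff)
   then show ?thesis using \<tau>(1) False by fastforce
  next
   case True
   then have m: "- 1 * U \<tau> \<notin> \<real>\<^sub>\<le>\<^sub>0" using U_nz[of \<tau>] by (auto simp: complex_nonpos_Reals_iff complex_eq_iff)
   have "exp (\<i> * of_real \<theta>) = exp (of_real (ln r) + Ln (- 1 * U \<tau>) + \<i> * of_real pi)"
    unfolding \<tau>(3) exp_add er[symmetric] using U_nz[of \<tau>] by (simp add: mult.commute[of \<i>])
   then obtain n :: int where "\<i> * of_real \<theta> = of_real (ln r) + Ln (- 1 * U \<tau>) + \<i> * of_real pi + of_real (2 * of_int n * pi) * \<i>"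
    unfolding exp_eq by auto
   then have "\<theta> = Im (Ln (- 1 * U \<tau>)) + (pi + 2 * pi * of_int n)" by (simp add: complex_eq_iff)
   then show ?thesis using \<tau>(1) m by blast
  qed
 qed
 moreover have "negligible ((\<Union>n::int. ?I 1 (2 * pi * of_int n)) \<union> (\<Union>n::int. ?I (-1) (pi + 2 * pi * of_int n)))"
 proof (rule negligible_Un; rule negligible_countable_Union)
  show "negligible S" if "S \<in> range (\<lambda>n::int. ?I 1 (2 * pi * of_int n))" for S using that im by blast
  show "negligible S" if "S \<in> range (\<lambda>n::int. ?I (-1) (pi + 2 * pi * of_int n))" for S using that im by blast
 qed simp_all
 ultimately show ?thesis unfolding U_def using negligible_subset by blast
qed

lemma borel_measurable_mat2:
 fixes f :: "'a => mat2"
 assumes "\<And>i j. (\<lambda>x. f x$i$j) \<in> borel_measurable M"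
 shows "f \<in> borel_measurable M"
proof (subst borel_measurable_euclidean_space, intro ballI)
 fix b :: mat2 assume "b \<in> Basis"
 then obtain i j where "b = axis i (axis j 1)" unfolding Basis_vec_def by auto
 then show "(\<lambda>x. f x \<bullet> b) \<in> borel_measurable M" using assms by (simp add: inner_axis)
qed

lemma mat2_nth_measurable [measurable]: "(\<lambda>g :: mat2. g$i$j) \<in> borel_measurable borel"
 by (intro borel_measurable_continuous_onI continuous_on_mat2_nth)

lemma det2_measurable [measurable]: "(\<lambda>g :: mat2. det g) \<in> borel_measurable borel"
 by (intro borel_measurable_continuous_onI continuous_on_det2)

lemma row_norm2_measurable [measurable]: "row_norm2 \<in> borel_measurable borel"
 unfolding row_norm2_def by measurable

lemma K_part_measurable [measurable]: "K_part \<in> borel_measurable borel"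
 by (rule borel_measurable_mat2, rule forall_22_I[where P="\<lambda>i j. (\<lambda>x. K_part x$i$j) \<in> borel_measurable borel"])
   (simp_all only: K_part_nth, measurable)

lemma mult_right_measurable [measurable]: "(\<lambda>k :: mat2. k ** (g :: mat2)) \<in> borel_measurable borel"
 by (intro borel_measurable_continuous_onI continuous_on_mat2_mult continuous_on_const continuous_on_id)

text \<open>Since \<open>K_part\<close> identifies \<open>K\<close> with a space of cosets of \<open>G\<close>, this says that the action of \<open>g\<close>
 there preserves null sets; the point is that \<open>prin_act\<close> acts on representatives.\<close>

lemma AE_haar_K_K_part:
 assumes g: "g \<in> G_grp" and P: "{k. \<not> P k} \<in> sets borel" and AE: "AE k in haar_K. P k"
 shows "AE k in haar_K. P (K_part (k ** g))"
proof -
 obtain g' where g': "g ** g' = mat 1" "g' ** g = mat 1" using g unfolding G_grp_def invertible_def by auto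
 have dg': "det g' \<noteq> 0" using g'(1) by (metis det_I det_mul mult_zero_right zero_neq_one)
 have P': "{k. \<not> P (K_part (k ** g))} \<in> sets borel"
 proof -
  have m: "(\<lambda>k. K_part (k ** g)) \<in> borel_measurable borel" by measurable
  have "{k. \<not> P (K_part (k ** g))} = (\<lambda>k. K_part (k ** g)) -` {k. \<not> P k}" by auto
  then show ?thesis using measurable_sets[OF m P] by simp
 qed
 let ?B = "{t. \<not> P (rot t) \<or> \<not> P (refl2 ** rot t)}"
 have B: "negligible ?B" using AE unfolding AE_haar_K_iff[OF P] .
 \<comment> \<open>The bad set is described backwards: since k = (k g) g', the angle of k is that of
   \<open>K_part (k ** g)\<close> moved by the inverse g', so bad elements k come from the null set
   of bad angles.\<close>
 have key: "\<exists>\<tau>\<in>?B. \<exists>r>0. row_cplx k = of_real r * row_cplx (rot \<tau> ** g')"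
  if k: "k \<in> K_grp" and nP: "\<not> P (K_part (k ** g))" for k
 proof -
  let ?h = "k ** g"
  have dh: "det ?h \<noteq> 0" using k g K_in_G G_mult G_grp_det by blast
  have "k = ?h ** g'" using g' by (simp add: matrix_mul_assoc[symmetric])
  also have "?h = P_part ?h ** K_part ?h" using P_part_K_part[OF dh] by simp
  finally have "k = P_part ?h ** (K_part ?h ** g')" by (simp only: matrix_mul_assoc)
  then have rc: "row_cplx k = of_real (P_part ?h$2$2) * row_cplx (K_part ?h ** g')"
   using row_cplx_upper[of "P_part ?h" "K_part ?h ** g'"] P_part_nth[OF dh] by metis
  have pos: "P_part ?h$2$2 > 0" using P_part_nth[OF dh] row_norm2_pos[OF dh] by simp
  from K_part_in_K[OF dh] obtain \<tau> where "\<tau> \<in> ?B" "row_cplx (K_part ?h ** g') = row_cplx (rot \<tau> ** g')"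
  proof (cases rule: K_grp_cases)
   case (1 \<tau>)
   then show ?thesis using that[of \<tau>] nP by auto
  next
   case (2 \<tau>)
   then show ?thesis using that[of \<tau>] nP by (auto simp: matrix_mul_assoc[symmetric] row_cplx_refl2)
  qed
  then show ?thesis using rc pos by auto
 qed
 have "{t. \<not> P (K_part (rot t ** g)) \<or> \<not> P (K_part ((refl2 ** rot t) ** g))}
   \<subseteq> {\<theta>. \<exists>\<tau>\<in>?B. \<exists>r>0. exp (\<i> * of_real \<theta>) = of_real r * row_cplx (rot \<tau> ** g')}"
  using key[of "rot _"] key[of "refl2 ** rot _"] by (auto simp only: row_cplx_rot row_cplx_refl2 rot_in_K refl2_in_K K_mult)
 then show ?thesis
  unfolding AE_haar_K_iff[OF P'] by (rule negligible_subset[OF negligible_angle_image[OF dg' B]])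
qed

section \<open>The principal series on representatives\<close>

lemma AE_haar_K_in_K: "AE k in haar_K. k \<in> K_grp"
 by (subst AE_haar_K_iff) (auto simp: Compl_eq[symmetric])

text \<open>The product \<rho> \<sigma> at \<open>P_part h\<close>; the diagonal there is positive,
  so the signs in \<open>chi\<close> disappear.\<close>

definition sigma_factor :: "complex => complex => mat2 => complex" where
 "sigma_factor \<nu>1 \<nu>2 h = exp ((\<nu>1 + 1/2) * of_real (ln (\<bar>det h\<bar> / sqrt (row_norm2 h))) + (\<nu>2 - 1/2) * of_real (ln (sqrt (row_norm2 h))))"

lemma prin_act_eq:
 assumes k: "k \<in> K_grp" and g: "g \<in> G_grp"
 shows "prin_act (sigma_char \<nu>1 \<delta>1 \<nu>2 \<delta>2) g f k = sigma_factor \<nu>1 \<nu>2 (k ** g) * f (K_part (k ** g))"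
proof -
 let ?h = "k ** g"
 have dh: "det ?h \<noteq> 0" using k g K_in_G G_mult G_grp_det by blast
 define a where "a = P_part ?h$1$1"
 define d where "d = P_part ?h$2$2"
 have ad: "a > 0" "d > 0" using P_part_nth[OF dh] row_norm2_pos[OF dh] dh by (simp_all add: a_def d_def)
 have rp: "of_real x powr z = exp (z * complex_of_real (ln x))" if "x > 0" for x z
  using that by (simp add: powr_def Ln_of_real)
 have rr: "complex_of_real (x powr z) = exp (of_real z * of_real (ln x))" if "x > 0" for x z
  using that by (simp add: powr_def exp_of_real[symmetric])
 have "of_real (rho_char (P_part ?h)) * sigma_char \<nu>1 \<delta>1 \<nu>2 \<delta>2 (P_part ?h)
   = (of_real (a powr (1/2)) * of_real (d powr (-1/2))) * (of_real a powr \<nu>1 * of_real d powr \<nu>2)"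
  using ad by (simp add: rho_char_def sigma_char_def chi_def a_def[symmetric] d_def[symmetric])
 also have "\<dots> = exp ((\<nu>1 + 1/2) * of_real (ln a) + (\<nu>2 - 1/2) * of_real (ln d))"
  unfolding rp[OF ad(1)] rp[OF ad(2)] rr[OF ad(1)] rr[OF ad(2)] exp_add[symmetric]
  by (intro arg_cong[where f=exp]) (simp add: algebra_simps)
 also have "\<dots> = sigma_factor \<nu>1 \<nu>2 ?h"
  unfolding sigma_factor_def a_def d_def P_part_nth[OF dh] ..
 finally show ?thesis using k by (simp add: prin_act_def iwasawa_eq[OF dh])
qed

lemma prin_act_outside: "k \<notin> K_grp ==> prin_act \<sigma> g f k = 0"
 by (simp add: prin_act_def)

lemma sigma_factor_K: "k \<in> K_grp ==> sigma_factor \<nu>1 \<nu>2 k = 1"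
 using K_part_K(2)[of k] P_part_nth[of k] K_in_G[of k] by (simp add: sigma_factor_def G_grp_det)

lemma prin_act_K:
 assumes "k \<in> K_grp" "\<kappa> \<in> K_grp"
 shows "prin_act (sigma_char \<nu>1 \<delta>1 \<nu>2 \<delta>2) \<kappa> f k = f (k ** \<kappa>)"
 using assms by (simp add: prin_act_eq K_in_G sigma_factor_K K_part_K)

lemma sigma_factor_measurable [measurable]: "sigma_factor \<nu>1 \<nu>2 \<in> borel_measurable borel"
 unfolding sigma_factor_def by measurable

lemma prin_act_measurable:
 assumes g: "g \<in> G_grp" and f: "f \<in> borel_measurable borel"
 shows "prin_act (sigma_char \<nu>1 \<delta>1 \<nu>2 \<delta>2) g f \<in> borel_measurable borel"
proof -
 have [measurable]: "f \<in> borel_measurable borel" by fact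
 have "prin_act (sigma_char \<nu>1 \<delta>1 \<nu>2 \<delta>2) g f = (\<lambda>k. if k \<in> K_grp then sigma_factor \<nu>1 \<nu>2 (k ** g) * f (K_part (k ** g)) else 0)"
  using g by (auto simp: prin_act_eq prin_act_outside)
 also have "\<dots> \<in> borel_measurable borel" by measurable
 finally show ?thesis .
qed

lemma prin_act_ae_eq:
 assumes g: "g \<in> G_grp" and f: "f \<in> borel_measurable borel" and h: "h \<in> borel_measurable borel" and eq: "ae_eq f h"
 shows "ae_eq (prin_act (sigma_char \<nu>1 \<delta>1 \<nu>2 \<delta>2) g f) (prin_act (sigma_char \<nu>1 \<delta>1 \<nu>2 \<delta>2) g h)"
proof -
 have "{k. f k \<noteq> h k} \<in> sets borel" using f h by measurable
 from AE_haar_K_K_part[OF g, of "\<lambda>k. f k = h k"] this eq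
 have "AE k in haar_K. f (K_part (k ** g)) = h (K_part (k ** g))" by (simp add: ae_eq_def)
 then show ?thesis unfolding ae_eq_def
 proof eventually_elim
  case (elim k)
  then show ?case by (cases "k \<in> K_grp") (simp_all add: prin_act_eq[OF _ g] prin_act_outside)
 qed
qed

text \<open>The extension of \<open>\<zeta>\<^sub>q\<close> to \<open>G\<close> that transforms under \<open>P\<close> on the left by \<open>\<rho> \<sigma>\<close>.\<close>

definition ind_fn :: "complex => complex => nat => int => mat2 => complex" where
 "ind_fn \<nu>1 \<nu>2 \<delta>1 = weight_family 0 (\<nu>1 + \<nu>2) ((-1) ^ \<delta>1) (\<lambda>q y. of_real y powr (\<nu>1 + 1/2))"

text \<open>All weights share one radial function, on which y d/dy acts by \<nu>1 + 1/2, and 2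
  \<nu>1 + 1 - (\<nu>1 + \<nu>2) = \<nu>1 - \<nu>2 + 1.\<close>

lemma ind_fn_system: "whittaker_system 0 (\<nu>1 + \<nu>2) (\<nu>1 - \<nu>2) \<delta> (\<lambda>q y. of_real y powr (\<nu>1 + 1/2))"
 unfolding whittaker_system_def
proof (intro allI impI, rule exI, intro conjI)
 fix q :: int and y :: real assume y: "y > 0"
 show "((\<lambda>y. of_real y powr (\<nu>1 + 1/2)) has_vector_derivative ((\<nu>1 + 1/2) / of_real y * of_real y powr (\<nu>1 + 1/2))) (at y)"
  using has_vector_derivative_powr_real[OF y, of 1 "\<nu>1 + 1/2"] by simp
qed (auto simp: field_simps)

lemma ind_fn_one: "ind_fn \<nu>1 \<nu>2 \<delta>1 q (mat 1) = 1"
 by (simp add: ind_fn_def weight_family_def weight_fn_def iwa_y_def row_norm2_def row_cplx_def complex_eq_iff power_int_def)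

lemma ind_fn_rot: "ind_fn \<nu>1 \<nu>2 \<delta>1 q (g ** rot \<theta>) = expi q \<theta> * ind_fn \<nu>1 \<nu>2 \<delta>1 q g"
 unfolding ind_fn_def by (rule weight_family_rot)

lemma ind_fn_refl2: "ind_fn \<nu>1 \<nu>2 \<delta>1 q (g ** refl2) = (-1) ^ \<delta>1 * ind_fn \<nu>1 \<nu>2 \<delta>1 (- q) g"
 unfolding ind_fn_def by (rule weight_family_refl2) (simp flip: power_mult_distrib)

lemma ind_fn_on_K:
 "ind_fn \<nu>1 \<nu>2 \<delta>1 q (rot \<theta>) = expi q \<theta>"
 "ind_fn \<nu>1 \<nu>2 \<delta>1 q (refl2 ** rot \<theta>) = (-1) ^ \<delta>1 * expi q \<theta>"
 using ind_fn_rot[of \<nu>1 \<nu>2 \<delta>1 q "mat 1" \<theta>] ind_fn_rot[of \<nu>1 \<nu>2 \<delta>1 q refl2 \<theta>] ind_fn_refl2[of \<nu>1 \<nu>2 \<delta>1 q "mat 1"]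
 by (simp_all add: ind_fn_one)

lemma weight_fn_upper:
 assumes p: "p$2$1 = 0" "p$1$1 > 0" "p$2$2 > 0" and h: "det h > 0"
 shows "weight_fn 0 (\<nu>1 + \<nu>2) (\<lambda>y. of_real y powr (\<nu>1 + 1/2)) q (p ** h)
  = exp ((\<nu>1 + 1/2) * of_real (ln (p$1$1)) + (\<nu>2 - 1/2) * of_real (ln (p$2$2))) * weight_fn 0 (\<nu>1 + \<nu>2) (\<lambda>y. of_real y powr (\<nu>1 + 1/2)) q h"
proof -
 have N: "row_norm2 (p ** h) = (p$2$2)\<^sup>2 * row_norm2 h"
  using p by (simp add: row_norm2_def mat2_mult_nth power2_eq_square algebra_simps)
 have Np: "row_norm2 h > 0" using row_norm2_pos h by simp
 have d: "det (p ** h) = p$1$1 * p$2$2 * det h" using p by (simp add: det_mul) (simp add: det_2)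
 have y: "iwa_y (p ** h) = p$1$1 / p$2$2 * iwa_y h"
  unfolding iwa_y_def N d using p by (simp add: power2_eq_square)
 have yp: "iwa_y h > 0" using iwa_y_pos[OF h] .
 have rp: "of_real x powr z = exp (z * complex_of_real (ln x))" if "x > 0" for x z
  using that by (simp add: powr_def Ln_of_real)
 have pq: "of_real (p$2$2) powi q = exp (of_int q * complex_of_real (ln (p$2$2)))"
 proof -
  have "complex_of_real (p$2$2) = exp (of_real (ln (p$2$2)))" using p by (simp add: exp_of_real)
  then show ?thesis by (metis exp_power_int mult.commute)
 qed
 have l: "ln (iwa_y (p ** h)) = ln (p$1$1) - ln (p$2$2) + ln (iwa_y h)" "ln (row_norm2 (p ** h)) = 2 * ln (p$2$2) + ln (row_norm2 h)"
  unfolding y N using p yp Np by (simp_all add: ln_mult ln_div ln_realpow)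
 have pos: "iwa_y (p ** h) > 0" "row_norm2 (p ** h) > 0" unfolding y N using p yp Np by auto
 have "exp ((\<nu>1 + 1/2) * of_real (ln (iwa_y (p ** h)))) * (exp ((\<nu>1 + \<nu>2 - of_int q) / 2 * of_real (ln (row_norm2 (p ** h)))) * exp (of_int q * complex_of_real (ln (p$2$2))))
  = exp ((\<nu>1 + 1/2) * of_real (ln (p$1$1)) + (\<nu>2 - 1/2) * of_real (ln (p$2$2))) * (exp ((\<nu>1 + 1/2) * of_real (ln (iwa_y h))) * exp ((\<nu>1 + \<nu>2 - of_int q) / 2 * of_real (ln (row_norm2 h))))"
  unfolding l exp_add[symmetric] by (intro arg_cong[where f=exp]) (simp add: field_simps)
 then show ?thesis
  unfolding weight_fn_def row_cplx_upper[OF p(1)] rp[OF pos(1)] rp[OF pos(2)] rp[OF yp] rp[OF Np] power_int_mult_distrib pq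
  by simp
qed

lemma ind_fn_upper:
 assumes p: "p$2$1 = 0" "p$1$1 > 0" "p$2$2 > 0" and h: "det h \<noteq> 0"
 shows "ind_fn \<nu>1 \<nu>2 \<delta>1 q (p ** h) = exp ((\<nu>1 + 1/2) * of_real (ln (p$1$1)) + (\<nu>2 - 1/2) * of_real (ln (p$2$2))) * ind_fn \<nu>1 \<nu>2 \<delta>1 q h"
proof -
 have d: "det (p ** h) = p$1$1 * p$2$2 * det h" using p by (simp add: det_mul) (simp add: det_2)
 have s: "det (p ** h) > 0 \<longleftrightarrow> det h > 0" "det (p ** h) < 0 \<longleftrightarrow> det h < 0"
  unfolding d using p by (simp_all add: zero_less_mult_iff mult_less_0_iff)
 show ?thesis unfolding ind_fn_def weight_family_def s
  using weight_fn_upper[OF p, of h] weight_fn_upper[OF p, of "h ** refl2"] h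
  by (simp add: matrix_mul_assoc[symmetric])
qed

text \<open>The matrix diag(-1, -1) is the rotation by pi, where the weight q takes the value
  (-1)^q. The parity condition makes this agree with the sign (-1)^(\<delta>1 + \<delta>2), which is
  why \<open>zeta_fn\<close> is well defined.\<close>

lemma ind_fn_diag:
 assumes q: "even (q - (int \<delta>1 - int \<delta>2))" and e: "\<epsilon>1 \<in> {1, -1}" "\<epsilon>2 \<in> {1, -1}"
 shows "ind_fn \<nu>1 \<nu>2 \<delta>1 q (diag2 \<epsilon>1 \<epsilon>2 ** rot \<theta>) = complex_of_real (\<epsilon>1 ^ \<delta>1 * \<epsilon>2 ^ \<delta>2) * expi q \<theta>"
proof -
 define k where "k = diag2 \<epsilon>1 \<epsilon>2 ** rot \<theta>"
 note keq = k_def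
 have par: "(-1) ^ \<delta>1 * (-1) ^ \<delta>2 = expi q pi"
 proof -
  have "expi q pi = (exp (\<i> * of_real pi)) powi q" by (simp only: exp_power_int mult_ac)
  also have "\<dots> = (-1) powi q" by (simp only: exp_pi_i')
  also have "\<dots> = (if even q then 1 else -1)" by (simp add: power_int_minus_one_minus power_int_minus_left)
  also have "\<dots> = (-1) ^ \<delta>1 * (-1) ^ \<delta>2" using q by (auto simp: power_add[symmetric] minus_one_power_iff)
  finally show ?thesis by simp
 qed
 have ph: "rot (\<theta> + pi) = diag2 (-1) (-1) ** rot \<theta>" for \<theta> by (simp add: mat2_eq_iff mat2_mult_nth)
 have ex: "exp (\<i> * of_int q * of_real (\<theta> + pi)) = (-1) ^ \<delta>1 * (-1) ^ \<delta>2 * expi q \<theta>" for \<theta>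
  unfolding par by (simp add: exp_add[symmetric] algebra_simps)
 have ss: "(-1) ^ \<delta>1 * ((-1) ^ \<delta>1 * z) = z" for z :: complex by (simp flip: power_mult_distrib mult.assoc)
 have "complex_of_real (\<epsilon>1 ^ \<delta>1 * \<epsilon>2 ^ \<delta>2) * expi q \<theta> = ind_fn \<nu>1 \<nu>2 \<delta>1 q k"
 proof -
  consider "\<epsilon>1 = 1" "\<epsilon>2 = 1" | "\<epsilon>1 = -1" "\<epsilon>2 = 1" | "\<epsilon>1 = -1" "\<epsilon>2 = -1" | "\<epsilon>1 = 1" "\<epsilon>2 = -1" using e by auto
  then show ?thesis
  proof cases
   case 1
   then have "k = rot \<theta>" using keq by (simp add: mat2_eq_iff mat2_mult_nth)
   then show ?thesis using 1 by (simp add: ind_fn_on_K)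
  next
   case 2
   then have "k = refl2 ** rot \<theta>" using keq by (simp add: mat2_eq_iff mat2_mult_nth)
   then show ?thesis using 2 by (simp add: ind_fn_on_K)
  next
   case 3
   then have "k = rot (\<theta> + pi)" using keq ph by simp
   then show ?thesis using 3 ex[of \<theta>] by (simp only: ind_fn_on_K) simp
  next
   case 4
   then have "k = refl2 ** rot (\<theta> + pi)" using keq by (simp add: mat2_eq_iff mat2_mult_nth)
   then show ?thesis using 4 ex[of \<theta>] ss by (simp only: ind_fn_on_K) (simp add: mult.assoc)
  qed
 qed
 then show ?thesis by (simp add: k_def)
qed

text \<open>On K the function \<open>ind_fn\<close> takes the same values for all \<nu>1 and \<nu>2,
  so these are free here.\<close>

lemma zeta_fn_eq:
 assumes k: "k \<in> K_grp" and q: "even (q - (int \<delta>1 - int \<delta>2))"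
 shows "zeta_fn \<delta>1 \<delta>2 q k = ind_fn \<nu>1 \<nu>2 \<delta>1 q k"
proof -
 have val: "complex_of_real (\<epsilon>1 ^ \<delta>1 * \<epsilon>2 ^ \<delta>2) * expi q \<theta> = ind_fn \<nu>1 \<nu>2 \<delta>1 q k"
  if "\<epsilon>1 \<in> {1, -1}" "\<epsilon>2 \<in> {1, -1}" "k = diag2 \<epsilon>1 \<epsilon>2 ** rot \<theta>" for \<epsilon>1 \<epsilon>2 \<theta>
  using ind_fn_diag[OF q that(1,2)] that(3) by simp
 have "(THE z. \<exists>\<epsilon>1 \<epsilon>2 \<theta>. \<epsilon>1 \<in> {1, -1} \<and> \<epsilon>2 \<in> {1, -1} \<and> k = diag2 \<epsilon>1 \<epsilon>2 ** rot \<theta> \<and>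
       z = complex_of_real (\<epsilon>1 ^ \<delta>1 * \<epsilon>2 ^ \<delta>2) * expi q \<theta>) = ind_fn \<nu>1 \<nu>2 \<delta>1 q k"
 proof (rule the_equality)
  obtain \<epsilon>1 \<epsilon>2 \<theta> where e: "\<epsilon>1 \<in> {1, -1}" "\<epsilon>2 \<in> {1, -1::real}" "k = diag2 \<epsilon>1 \<epsilon>2 ** rot \<theta>"
   using k
  proof (cases rule: K_grp_cases)
   case (1 \<theta>)
   then show ?thesis by (intro that[of 1 1 \<theta>]) (auto simp: mat2_eq_iff mat2_mult_nth)
  next
   case (2 \<theta>)
   then show ?thesis by (intro that[of "-1" 1 \<theta>]) (auto simp: mat2_eq_iff mat2_mult_nth)
  qed
  show "\<exists>\<epsilon>1 \<epsilon>2 \<theta>. \<epsilon>1 \<in> {1, -1} \<and> \<epsilon>2 \<in> {1, -1} \<and> k = diag2 \<epsilon>1 \<epsilon>2 ** rot \<theta> \<and>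
       ind_fn \<nu>1 \<nu>2 \<delta>1 q k = complex_of_real (\<epsilon>1 ^ \<delta>1 * \<epsilon>2 ^ \<delta>2) * expi q \<theta>"
   using e val[OF e] by metis
 qed (use val in metis)
 then show ?thesis using k by (simp add: zeta_fn_def)
qed

lemma zeta_fn_outside: "k \<notin> K_grp ==> zeta_fn \<delta>1 \<delta>2 q k = 0"
 by (simp add: zeta_fn_def)

text \<open>Turns the action on functions on K into right translation of a smooth function on the
  open set G, where derivatives along exp(tX) can be taken.\<close>

lemma prin_act_zeta:
 assumes k: "k \<in> K_grp" and g: "g \<in> G_grp" and q: "even (q - (int \<delta>1 - int \<delta>2))"
 shows "prin_act (sigma_char \<nu>1 \<delta>1 \<nu>2 \<delta>2) g (zeta_fn \<delta>1 \<delta>2 q) k = ind_fn \<nu>1 \<nu>2 \<delta>1 q (k ** g)"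
proof -
 let ?h = "k ** g"
 have dh: "det ?h \<noteq> 0" using k g K_in_G G_mult G_grp_det by blast
 have pos: "P_part ?h$1$1 > 0" "P_part ?h$2$2 > 0" using P_part_nth[OF dh] row_norm2_pos[OF dh] dh by simp_all
 have dK: "det (K_part ?h) \<noteq> 0" using K_in_G[OF K_part_in_K[OF dh]] by (simp add: G_grp_det)
 have "ind_fn \<nu>1 \<nu>2 \<delta>1 q ?h = ind_fn \<nu>1 \<nu>2 \<delta>1 q (P_part ?h ** K_part ?h)" by (simp add: P_part_K_part[OF dh])
 also have "\<dots> = sigma_factor \<nu>1 \<nu>2 ?h * ind_fn \<nu>1 \<nu>2 \<delta>1 q (K_part ?h)"
  unfolding ind_fn_upper[OF P_part_nth(1)[OF dh] pos dK] unfolding sigma_factor_def P_part_nth[OF dh] ..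
 finally show ?thesis
  by (simp add: prin_act_eq[OF k g] zeta_fn_eq[OF K_part_in_K[OF dh] q, of \<nu>1 \<nu>2])
qed

text \<open>The spanning sets in \<open>H_fin\<close> and \<open>whittaker_fin\<close> are sets of
  functions, whereas expansions are indexed by weights; coefficients of equal functions have to be
  collected.\<close>

lemma sum_image_coeff:
 fixes d :: "'i => complex" and v :: "'i => 'a => complex"
 assumes "finite Q"
 shows "\<exists>c. \<forall>k. (\<Sum>q\<in>Q. d q * v q k) = (\<Sum>b\<in>v ` Q. c b * b k)"
proof (intro exI allI)
 fix k
 have "(\<Sum>q\<in>Q. d q * v q k) = (\<Sum>b\<in>v ` Q. \<Sum>q\<in>{q \<in> Q. v q = b}. d q * v q k)"
  by (rule sum.image_gen[OF assms])
 also have "\<dots> = (\<Sum>b\<in>v ` Q. (\<Sum>q\<in>{q \<in> Q. v q = b}. d q) * b k)"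
  by (intro sum.cong refl) (auto simp: sum_distrib_right)
 finally show "(\<Sum>q\<in>Q. d q * v q k) = (\<Sum>b\<in>v ` Q. (\<lambda>b. \<Sum>q\<in>{q \<in> Q. v q = b}. d q) b * b k)" .
qed

text \<open>Gaussian elimination: a pivot p removes the equation b together with the unknown p,
  which keeps the number of equations below the number of unknowns.\<close>

lemma homogeneous_system_nontrivial:
 fixes M :: "'b => 'q => complex"
 assumes "finite B" "finite Q" "card B < card Q"
 shows "\<exists>x. (\<exists>q\<in>Q. x q \<noteq> 0) \<and> (\<forall>b\<in>B. (\<Sum>q\<in>Q. x q * M b q) = 0)"
 using assms
proof (induction B arbitrary: Q M rule: finite_induct)
 case empty
 then obtain q where "q \<in> Q" by fastforce
 then show ?case by (intro exI[of _ "\<lambda>q. 1"]) auto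
next
 case (insert b B)
 show ?case
 proof (cases "\<forall>q\<in>Q. M b q = 0")
  case True
  have "card B < card Q" using insert.prems insert.hyps by simp
  from insert.IH[OF insert.prems(1) this, of M] show ?thesis using True by auto
 next
  case False
  then obtain p where p: "p \<in> Q" "M b p \<noteq> 0" by blast
  have "card B < card (Q - {p})" using insert.prems insert.hyps p by simp
  from insert.IH[OF _ this, of "\<lambda>a q. M a q - M a p * (M b q / M b p)"] insert.prems
  obtain x where x: "\<exists>q\<in>Q - {p}. x q \<noteq> 0" "\<forall>a\<in>B. (\<Sum>q\<in>Q - {p}. x q * (M a q - M a p * (M b q / M b p))) = 0"
   by auto
  \<comment> \<open>The pivot unknown, recovered from the equation b.\<close>
  define x0 where "x0 = - (\<Sum>q\<in>Q - {p}. x q * (M b q / M b p))"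
  define y where "y q = (if q = p then x0 else x q)" for q
  have y: "(\<Sum>q\<in>Q. y q * M a q) = x0 * M a p + (\<Sum>q\<in>Q - {p}. x q * M a q)" for a
  proof -
   have "(\<Sum>q\<in>Q. y q * M a q) = y p * M a p + (\<Sum>q\<in>Q - {p}. y q * M a q)"
    using insert.prems p by (simp add: sum.remove)
   also have "(\<Sum>q\<in>Q - {p}. y q * M a q) = (\<Sum>q\<in>Q - {p}. x q * M a q)"
    by (intro sum.cong) (auto simp: y_def)
   finally show ?thesis by (simp add: y_def)
  qed
  have y': "(\<Sum>q\<in>Q. y q * M a q) = (\<Sum>q\<in>Q - {p}. x q * (M a q - M a p * (M b q / M b p)))" for a
   unfolding y x0_def by (simp add: sum_subtractf algebra_simps sum_distrib_left)
  have "(\<Sum>q\<in>Q. y q * M b q) = 0" unfolding y' using p(2) by simp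
  moreover have "\<exists>q\<in>Q. y q \<noteq> 0" using x(1) by (auto simp: y_def)
  ultimately show ?thesis using x(2) y' by (intro exI[of _ y]) auto
 qed
qed

section \<open>Trigonometric polynomials on the circle of rotations\<close>

inductive trig_poly :: "(int => bool) => (real => complex) => bool" for P where
 zero: "trig_poly P (\<lambda>\<theta>. 0)"
| add_term: "trig_poly P F ==> P n ==> trig_poly P (\<lambda>\<theta>. F \<theta> + c * expi n \<theta>)"

lemma trig_poly_term: "P n ==> trig_poly P (\<lambda>\<theta>. c * expi n \<theta>)"
 using trig_poly.add_term[OF trig_poly.zero, of P n c] by simp

lemma trig_poly_add:
 assumes "trig_poly P F" "trig_poly P H"
 shows "trig_poly P (\<lambda>\<theta>. F \<theta> + H \<theta>)"
 using assms(2)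
proof induction
 case (add_term H n c)
 from trig_poly.add_term[OF add_term.IH add_term.hyps(2), of c] show ?case by (simp add: add.assoc)
qed (use assms in simp)

abbreviation "trig_poly_all \<equiv> trig_poly (\<lambda>n. True)"

lemma trig_poly_mult_term:
 assumes "trig_poly_all F"
 shows "trig_poly_all (\<lambda>\<theta>. F \<theta> * (c * expi n \<theta>))"
 using assms
proof induction
 case (add_term F m d)
 have "(\<lambda>\<theta>. (F \<theta> + d * expi m \<theta>) * (c * expi n \<theta>))
  = (\<lambda>\<theta>. F \<theta> * (c * expi n \<theta>) + (d * c) * exp (\<i> * of_int (m + n) * of_real \<theta>))"
  by (simp add: fun_eq_iff algebra_simps exp_add)
 then show ?case using trig_poly.add_term[OF add_term.IH TrueI, of "d * c" "m + n"] by simp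
qed (simp add: trig_poly.zero)

lemma trig_poly_mult:
 assumes "trig_poly_all F" "trig_poly_all H"
 shows "trig_poly_all (\<lambda>\<theta>. F \<theta> * H \<theta>)"
 using assms(2)
proof induction
 case (add_term H n c)
 from trig_poly_add[OF add_term.IH trig_poly_mult_term[OF assms(1), of c n]] show ?case by (simp add: distrib_left)
qed (simp add: trig_poly.zero)

lemma trig_poly_const: "trig_poly_all (\<lambda>\<theta>. c)"
 using trig_poly_term[of "\<lambda>n. True" 0 c] by simp

lemma trig_poly_cos_sin: "trig_poly_all (\<lambda>\<theta>. of_real (cos \<theta>))" "trig_poly_all (\<lambda>\<theta>. of_real (sin \<theta>))"
proof -
 have e: "expi 1 \<theta> = cos (complex_of_real \<theta>) + \<i> * sin (of_real \<theta>)"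
  "expi (-1) \<theta> = cos (complex_of_real \<theta>) - \<i> * sin (of_real \<theta>)" for \<theta>
  using exp_Euler[of "of_real \<theta>"] exp_Euler[of "- of_real \<theta>"] by simp_all
 have c: "(\<lambda>\<theta>. complex_of_real (cos \<theta>)) = (\<lambda>\<theta>. 1/2 * expi 1 \<theta> + 1/2 * expi (-1) \<theta>)"
  unfolding e by (simp add: fun_eq_iff cos_of_real add_divide_distrib diff_divide_distrib)
 have s: "(\<lambda>\<theta>. complex_of_real (sin \<theta>)) = (\<lambda>\<theta>. (-\<i>/2) * expi 1 \<theta> + (\<i>/2) * expi (-1) \<theta>)"
  unfolding e by (simp add: fun_eq_iff sin_of_real algebra_simps add_divide_distrib diff_divide_distrib)
 show "trig_poly_all (\<lambda>\<theta>. of_real (cos \<theta>))" "trig_poly_all (\<lambda>\<theta>. of_real (sin \<theta>))"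
  unfolding c s by (rule trig_poly_add[OF trig_poly_term[OF TrueI] trig_poly_term[OF TrueI]])+
qed

lemma real_polynomial_function_trig_poly:
 fixes p :: "mat2 => real"
 assumes "real_polynomial_function p"
 shows "trig_poly_all (\<lambda>\<theta>. of_real (p (rot \<theta>)))"
 using assms
proof induction
 case (linear f)
 have "rot \<theta> = cos \<theta> *\<^sub>R rot 0 + sin \<theta> *\<^sub>R rot (pi/2)" for \<theta> by (simp add: mat2_eq_iff)
 then have fe: "f (rot \<theta>) = cos \<theta> * f (rot 0) + sin \<theta> * f (rot (pi/2))" for \<theta>
  using linear_add[OF bounded_linear.linear[OF linear]] linear_scale[OF bounded_linear.linear[OF linear]] by (metis real_scaleR_def)
 have "(\<lambda>\<theta>. complex_of_real (f (rot \<theta>))) = (\<lambda>\<theta>. of_real (cos \<theta>) * of_real (f (rot 0)) + of_real (sin \<theta>) * of_real (f (rot (pi/2))))"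
  by (rule ext, subst fe) (simp only: of_real_add of_real_mult)
 then show ?case using trig_poly_add[OF trig_poly_mult[OF trig_poly_cos_sin(1) trig_poly_const] trig_poly_mult[OF trig_poly_cos_sin(2) trig_poly_const]] by simp
next
 case (const c)
 show ?case by (rule trig_poly_const)
next
 case (add f g)
 then show ?case using trig_poly_add by simp
next
 case (mult f g)
 then show ?case using trig_poly_mult by simp
qed

lemma polynomial_function_trig_poly:
 fixes p :: "mat2 => complex"
 assumes "polynomial_function p"
 shows "trig_poly_all (\<lambda>\<theta>. p (rot \<theta>))"
proof -
 have "real_polynomial_function (\<lambda>x. Re (p x))" "real_polynomial_function (\<lambda>x. Im (p x))"
  using assms bounded_linear_Re bounded_linear_Im by (auto simp: polynomial_function_def o_def)
 note t = real_polynomial_function_trig_poly[OF this(1)] real_polynomial_function_trig_poly[OF this(2)]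
 have "(\<lambda>\<theta>. p (rot \<theta>)) = (\<lambda>\<theta>. of_real (Re (p (rot \<theta>))) + of_real (Im (p (rot \<theta>))) * \<i>)"
  by (simp add: complex_eq_iff fun_eq_iff)
 then show ?thesis using trig_poly_add[OF t(1) trig_poly_mult[OF t(2) trig_poly_const[of \<i>]]] by simp
qed

lemma exp_int_pi: "expi n pi = (if even n then 1 else -1 :: complex)"
proof -
 have "expi n pi = (exp (\<i> * of_real pi)) powi n" by (simp only: exp_power_int mult_ac)
 also have "\<dots> = (-1) powi n" by (simp only: exp_pi_i')
 finally show ?thesis by (simp add: power_int_minus_left)
qed

text \<open>A shift by pi multiplies the frequency n by (-1)^n, so this average keeps exactly the
  frequencies with the parity of d.\<close>

lemma trig_poly_parity_part:
 assumes "trig_poly_all F" "s = (if even d then 1 else -1)"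
 shows "trig_poly (\<lambda>n. even (n - d)) (\<lambda>\<theta>. (F \<theta> + s * F (\<theta> + pi)) / 2)"
 using assms(1)
proof induction
 case zero
 show ?case using trig_poly.zero by simp
next
 case (add_term F n c)
 let ?e = "\<lambda>\<theta>. expi n \<theta>"
 have ee: "?e (\<theta> + pi) = ?e \<theta> * (if even n then 1 else -1)" for \<theta>
  unfolding exp_int_pi[symmetric] by (simp add: exp_add[symmetric] algebra_simps)
 show ?case
 proof (cases "even (n - d)")
  case True
  then have "s * (if even n then 1 else -1) = 1" unfolding assms(2) by auto
  then have h: "s * (c * ?e (\<theta> + pi)) = c * ?e \<theta>" for \<theta> unfolding ee by (metis mult.left_commute mult.right_neutral)
  have "(\<lambda>\<theta>. (F \<theta> + c * ?e \<theta> + s * (F (\<theta> + pi) + c * ?e (\<theta> + pi))) / 2) = (\<lambda>\<theta>. (F \<theta> + s * F (\<theta> + pi)) / 2 + c * ?e \<theta>)"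
   unfolding distrib_left h by (simp add: fun_eq_iff add_divide_distrib)
  then show ?thesis using trig_poly.add_term[OF add_term.IH True, of c] by simp
 next
  case False
  then have sm: "s * (if even n then 1 else -1) = -1" unfolding assms(2) by auto
  have h: "s * (c * ?e (\<theta> + pi)) = - (c * ?e \<theta>)" for \<theta>
  proof -
   have "s * (c * ?e (\<theta> + pi)) = (s * (if even n then 1 else -1)) * (c * ?e \<theta>)" unfolding ee by (simp only: mult_ac)
   then show ?thesis unfolding sm by simp
  qed
  have "(\<lambda>\<theta>. (F \<theta> + c * ?e \<theta> + s * (F (\<theta> + pi) + c * ?e (\<theta> + pi))) / 2) = (\<lambda>\<theta>. (F \<theta> + s * F (\<theta> + pi)) / 2)"
   unfolding distrib_left h by (simp add: fun_eq_iff add_divide_distrib)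
  then show ?thesis using add_term.IH by simp
 qed
qed

lemma cnj_measurable [measurable]:
 assumes "f \<in> borel_measurable M"
 shows "(\<lambda>x. cnj (f x)) \<in> borel_measurable M"
proof -
 have "cnj \<in> borel_measurable borel" by (intro borel_measurable_continuous_onI continuous_on_cnj continuous_on_id)
 from measurable_compose[OF assms this] show ?thesis .
qed

section \<open>\<open>K\<close>-finite vectors\<close>

locale principal_series =
 fixes \<nu>1 \<nu>2 :: complex and \<delta>1 \<delta>2 :: nat
begin

abbreviation "\<sigma> \<equiv> sigma_char \<nu>1 \<delta>1 \<nu>2 \<delta>2"
abbreviation "Z \<equiv> zeta_fn \<delta>1 \<delta>2"
abbreviation "F \<equiv> ind_fn \<nu>1 \<nu>2 \<delta>1"
abbreviation "\<delta> \<equiv> int \<delta>1 - int \<delta>2"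
abbreviation "sg \<equiv> (-1 :: complex) ^ \<delta>1"

lemma sg_sg: "sg * sg = 1" by (simp flip: power_mult_distrib)

lemma Z_eq: "k \<in> K_grp ==> even (q - \<delta>) ==> Z q k = F q k"
 by (rule zeta_fn_eq)

lemma Z_rot:
 assumes "k \<in> K_grp" "even (q - \<delta>)"
 shows "Z q (k ** rot \<tau>) = expi q \<tau> * Z q k"
 using assms by (simp add: Z_eq ind_fn_rot)

lemma Z_refl2:
 assumes "k \<in> K_grp" "even (q - \<delta>)"
 shows "Z q (k ** refl2) = sg * Z (- q) k"
proof -
 have "even (- q - \<delta>)" using assms(2) by presburger
 then show ?thesis using assms by (simp add: Z_eq ind_fn_refl2)
qed

lemma Z_on_K:
 assumes "even (q - \<delta>)"
 shows "Z q (rot \<theta>) = expi q \<theta>" "Z q (refl2 ** rot \<theta>) = sg * expi q \<theta>"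
 using assms by (simp_all add: Z_eq ind_fn_on_K)

lemma norm_Z:
 assumes k: "k \<in> K_grp" and q: "even (q - \<delta>)"
 shows "norm (Z q k) = 1"
 using k
proof (cases rule: K_grp_cases)
 case (1 \<theta>)
 then show ?thesis by (simp add: Z_on_K[OF q])
next
 case (2 \<theta>)
 then show ?thesis by (simp add: Z_on_K[OF q] norm_mult norm_power)
qed

lemma norm_Z_le: "even (q - \<delta>) ==> norm (Z q k) \<le> 1"
 by (cases "k \<in> K_grp") (auto simp: norm_Z zeta_fn_outside)

lemma F_smooth: "even (q - \<delta>) ==> smooth_on G_grp (F q)"
 unfolding ind_fn_def by (rule weight_family_smooth[OF ind_fn_system])

lemma F_continuous: "even (q - \<delta>) ==> continuous_on K_grp (F q)"
 using F_smooth[of q] K_in_G unfolding smooth_on_def by (metis Ck_on.simps(1) continuous_on_subset subsetI)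

lemma Z_continuous: "even (q - \<delta>) ==> continuous_on K_grp (Z q)"
 using continuous_on_cong[of K_grp K_grp "Z q" "F q"] F_continuous Z_eq by blast

lemma Z_measurable: "even (q - \<delta>) ==> Z q \<in> borel_measurable borel"
proof -
 assume "even (q - \<delta>)"
 then have "(\<lambda>k. indicator K_grp k *\<^sub>R Z q k) \<in> borel_measurable borel"
  using borel_measurable_continuous_on_indicator[OF borel_K_grp Z_continuous] by simp
 moreover have "(\<lambda>k. indicator K_grp k *\<^sub>R Z q k) = Z q" by (auto simp: indicator_def zeta_fn_outside)
 ultimately show ?thesis by simp
qed

lemma sigma_diag: "\<epsilon>1 \<in> {1, -1} ==> \<epsilon>2 \<in> {1, -1} ==> \<sigma> (diag2 \<epsilon>1 \<epsilon>2) = complex_of_real (\<epsilon>1 ^ \<delta>1 * \<epsilon>2 ^ \<delta>2)"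
 by (auto simp: sigma_char_def chi_def)

lemma K_M_cases:
 assumes "m \<in> K_grp \<inter> M_grp"
 obtains \<epsilon>1 \<epsilon>2 where "\<epsilon>1 \<in> {1, -1}" "\<epsilon>2 \<in> {1, -1}" "m = diag2 \<epsilon>1 \<epsilon>2"
proof -
 obtain a b where m: "m = diag2 a b" using assms unfolding M_grp_def by blast
 have "transpose m ** m = mat 1" using assms K_transpose by blast
 then have "a * a = 1" "b * b = 1" using m by (simp_all add: mat2_eq_iff mat2_mult_nth transpose_def)
 then show ?thesis using that[of a b] m by (auto simp: square_eq_1_iff)
qed

lemma Z_equivariant:
 assumes q: "even (q - \<delta>)" and m: "m \<in> K_grp \<inter> M_grp" and k: "k \<in> K_grp"
 shows "Z q (m ** k) = \<sigma> m * Z q k"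
proof -
 obtain \<epsilon>1 \<epsilon>2 where e: "\<epsilon>1 \<in> {1, -1}" "\<epsilon>2 \<in> {1, -1}" "m = diag2 \<epsilon>1 \<epsilon>2" using K_M_cases[OF m] .
 have mk: "m ** k \<in> K_grp" using m k by simp
 show ?thesis using k
 proof (cases rule: K_grp_cases)
  case (1 \<theta>)
  then show ?thesis using mk q e(3) by (simp add: Z_eq ind_fn_diag[OF q e(1,2)] sigma_diag[OF e(1,2)] ind_fn_on_K)
 next
  case (2 \<theta>)
  have "diag2 \<epsilon>1 \<epsilon>2 ** refl2 = diag2 (- \<epsilon>1) \<epsilon>2" by (simp add: mat2_eq_iff mat2_mult_nth)
  then have mk2: "m ** k = diag2 (- \<epsilon>1) \<epsilon>2 ** rot \<theta>" using 2 e(3) by (simp add: matrix_mul_assoc)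
  have e': "- \<epsilon>1 \<in> {1, -1}" using e(1) by auto
  have "Z q (m ** k) = F q (diag2 (- \<epsilon>1) \<epsilon>2 ** rot \<theta>)" using Z_eq[OF mk q] mk2 by simp
  also have "\<dots> = \<sigma> m * Z q k"
   unfolding ind_fn_diag[OF q e' e(2)] e(3) sigma_diag[OF e(1,2)] 2 Z_on_K[OF q]
   by (subst power_minus) simp
  finally show ?thesis .
 qed
qed

sublocale haar: prob_space haar_K by (rule prob_space_haar_K)

lemma bounded_integrable:
 fixes f :: "mat2 => 'a::{banach, second_countable_topology}"
 assumes "f \<in> borel_measurable borel" "AE k in haar_K. norm (f k) \<le> C"
 shows "integrable haar_K f"
 using assms by (intro haar.integrable_const_bound[of _ C]) auto

lemma L2_K_bounded:
 assumes "f \<in> borel_measurable borel" "AE k in haar_K. norm (f k) \<le> C"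
 shows "f \<in> L2_K"
proof -
 have [measurable]: "f \<in> borel_measurable borel" by fact
 have "AE k in haar_K. norm ((cmod (f k))\<^sup>2) \<le> C\<^sup>2"
  using assms(2) by eventually_elim (auto intro: power_mono)
 then show ?thesis using assms(1) by (auto simp: L2_K_def intro!: bounded_integrable[of _ "C\<^sup>2"])
qed

lemma L2_K_lin:
 assumes "f \<in> L2_K" "h \<in> L2_K"
 shows "(\<lambda>k. a * f k + b * h k) \<in> L2_K"
proof -
 have [measurable]: "f \<in> borel_measurable borel" "h \<in> borel_measurable borel" using assms by (auto simp: L2_K_def)
 have i: "integrable haar_K (\<lambda>k. 2 * ((cmod a)\<^sup>2 * (cmod (f k))\<^sup>2) + 2 * ((cmod b)\<^sup>2 * (cmod (h k))\<^sup>2))"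
  using assms by (auto simp: L2_K_def)
 have "integrable haar_K (\<lambda>k. (cmod (a * f k + b * h k))\<^sup>2)"
 proof (rule Bochner_Integration.integrable_bound[OF i])
  have "(cmod (a * f k + b * h k))\<^sup>2 \<le> 2 * ((cmod a)\<^sup>2 * (cmod (f k))\<^sup>2) + 2 * ((cmod b)\<^sup>2 * (cmod (h k))\<^sup>2)" for k
  proof -
   have "(cmod (a * f k + b * h k))\<^sup>2 \<le> (cmod (a * f k) + cmod (b * h k))\<^sup>2"
    by (intro power_mono norm_triangle_ineq) auto
   also have "\<dots> \<le> 2 * (cmod (a * f k))\<^sup>2 + 2 * (cmod (b * h k))\<^sup>2"
    using zero_le_power2[of "cmod (a * f k) - cmod (b * h k)"] by (simp add: power2_eq_square algebra_simps)
   finally show ?thesis by (simp add: norm_mult power_mult_distrib)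
  qed
  then show "AE k in haar_K. norm ((cmod (a * f k + b * h k))\<^sup>2) \<le> norm (2 * ((cmod a)\<^sup>2 * (cmod (f k))\<^sup>2) + 2 * ((cmod b)\<^sup>2 * (cmod (h k))\<^sup>2))"
   by (auto intro!: order_trans[OF _ abs_ge_self])
 qed measurable
 then show ?thesis by (simp add: L2_K_def)
qed

lemma L2_mult_bounded_integrable:
 assumes f: "f \<in> L2_K" and h: "h \<in> borel_measurable borel" "\<And>k. norm (h k) \<le> C"
 shows "integrable haar_K (\<lambda>k. f k * cnj (h k))"
proof -
 have [measurable]: "f \<in> borel_measurable borel" "h \<in> borel_measurable borel" using assms by (auto simp: L2_K_def)
 have i: "integrable haar_K (\<lambda>k. (cmod (f k))\<^sup>2 + C\<^sup>2)" using f by (auto simp: L2_K_def)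
 show ?thesis
 proof (rule Bochner_Integration.integrable_bound[OF i])
  have "norm (f k * cnj (h k)) \<le> norm ((cmod (f k))\<^sup>2 + C\<^sup>2)" for k
  proof -
   have "C \<ge> 0" using h(2)[of k] norm_ge_zero order_trans by blast
   have "norm (f k * cnj (h k)) \<le> norm (f k) * C" using h(2)[of k] by (simp add: norm_mult mult_left_mono)
   also have "\<dots> \<le> (cmod (f k))\<^sup>2 + C\<^sup>2"
   proof -
    have "2 * (norm (f k) * C) \<le> (cmod (f k))\<^sup>2 + C\<^sup>2" using zero_le_power2[of "norm (f k) - C"] by (simp add: power2_eq_square algebra_simps)
    moreover have "0 \<le> norm (f k) * C" using \<open>C \<ge> 0\<close> by simp
    ultimately show ?thesis by linarith
   qed
   finally show ?thesis by simp
  qed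
  then show "AE k in haar_K. norm (f k * cnj (h k)) \<le> norm ((cmod (f k))\<^sup>2 + C\<^sup>2)" by simp
 qed measurable
qed

definition coef :: "(mat2 => complex) => int => complex" where
 "coef f q = (\<integral>k. f k * cnj (Z q k) \<partial>haar_K)"

lemma coef_integrable: "f \<in> L2_K ==> even (q - \<delta>) ==> integrable haar_K (\<lambda>k. f k * cnj (Z q k))"
 by (rule L2_mult_bounded_integrable[OF _ Z_measurable norm_Z_le])

lemma coef_cong:
 assumes "f \<in> borel_measurable borel" "h \<in> borel_measurable borel" "ae_eq f h" "even (q - \<delta>)"
 shows "coef f q = coef h q"
proof -
 have [measurable]: "f \<in> borel_measurable borel" "h \<in> borel_measurable borel" "Z q \<in> borel_measurable borel"
  using assms Z_measurable by auto
 show ?thesis unfolding coef_def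
  using assms(3) unfolding ae_eq_def by (intro integral_cong_AE) auto
qed

lemma coef_lin:
 assumes "f \<in> L2_K" "h \<in> L2_K" "even (q - \<delta>)"
 shows "coef (\<lambda>k. a * f k + b * h k) q = a * coef f q + b * coef h q"
 using coef_integrable[OF assms(1,3)] coef_integrable[OF assms(2,3)]
 unfolding coef_def by (simp add: distrib_right mult.assoc)

lemma Z_L2: "even (q - \<delta>) ==> Z q \<in> L2_K"
 using Z_measurable norm_Z_le by (intro L2_K_bounded[of _ 1]) auto

lemma L2_sum: "finite I ==> (\<And>i. i \<in> I ==> f i \<in> L2_K) ==> (\<lambda>k. \<Sum>i\<in>I. c i * f i k) \<in> L2_K"
proof (induction I rule: finite_induct)
 case empty
 show ?case by (auto intro: L2_K_bounded[of _ 0])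
next
 case (insert i I)
 then show ?case using L2_K_lin[of "f i" "\<lambda>k. \<Sum>i\<in>I. c i * f i k" "c i" 1] by simp
qed

lemma coef_sum:
 assumes "finite I" "\<And>i. i \<in> I ==> f i \<in> L2_K" "even (q - \<delta>)"
 shows "coef (\<lambda>k. \<Sum>i\<in>I. c i * f i k) q = (\<Sum>i\<in>I. c i * coef (f i) q)"
 using assms(1,2)
proof (induction I rule: finite_induct)
 case empty
 show ?case by (simp add: coef_def)
next
 case (insert i I)
 then show ?case using coef_lin[of "f i" "\<lambda>k. \<Sum>i\<in>I. c i * f i k" q "c i" 1] L2_sum[of I f c] assms(3) by simp
qed

lemma integral_rot:
 fixes f :: "mat2 => complex"
 assumes "f \<in> borel_measurable borel" "0 \<le> \<tau>" "\<tau> \<le> 2 * pi"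
 shows "(\<integral>k. f (k ** rot \<tau>) \<partial>haar_K) = (\<integral>k. f k \<partial>haar_K)"
proof -
 have m: "(\<lambda>k. k ** rot \<tau>) \<in> measurable haar_K haar_K" using mult_rot_measurable by measurable
 have "(\<integral>k. f k \<partial>haar_K) = (\<integral>k. f k \<partial>distr haar_K haar_K (\<lambda>k. k ** rot \<tau>))"
  by (simp add: distr_haar_K_rot[OF assms(2,3)])
 also have "\<dots> = (\<integral>k. f (k ** rot \<tau>) \<partial>haar_K)" using m by (rule integral_distr) (use assms(1) in simp)
 finally show ?thesis by simp
qed

text \<open>Invariance of the Haar measure moves the rotation onto \<open>Z q\<close>, where it acts
  by a character.\<close>

lemma coef_rot:
 assumes f: "f \<in> borel_measurable borel" and \<tau>: "0 \<le> \<tau>" "\<tau> \<le> 2 * pi" and q: "even (q - \<delta>)"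
 shows "coef (prin_act \<sigma> (rot \<tau>) f) q = expi q \<tau> * coef f q"
proof -
 have [measurable]: "f \<in> borel_measurable borel" "Z q \<in> borel_measurable borel" using f Z_measurable[OF q] by auto
 let ?e = "expi q \<tau>"
 have ee: "?e * cnj ?e = 1" by (simp add: exp_cnj exp_add[symmetric])
 have "coef (prin_act \<sigma> (rot \<tau>) f) q = (\<integral>k. ?e * (f (k ** rot \<tau>) * cnj (Z q (k ** rot \<tau>))) \<partial>haar_K)"
  unfolding coef_def
 proof (rule integral_cong_AE)
  show "(\<lambda>k. prin_act \<sigma> (rot \<tau>) f k * cnj (Z q k)) \<in> borel_measurable haar_K"
   using prin_act_measurable[OF K_in_G[OF rot_in_K] f] by measurable
  show "(\<lambda>k. ?e * (f (k ** rot \<tau>) * cnj (Z q (k ** rot \<tau>)))) \<in> borel_measurable haar_K" by measurable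
  show "AE k in haar_K. prin_act \<sigma> (rot \<tau>) f k * cnj (Z q k) = ?e * (f (k ** rot \<tau>) * cnj (Z q (k ** rot \<tau>)))"
   using AE_haar_K_in_K
  proof eventually_elim
   case (elim k)
   have "?e * (f (k ** rot \<tau>) * cnj (?e * Z q k)) = (?e * cnj ?e) * (f (k ** rot \<tau>) * cnj (Z q k))"
    by (simp only: complex_cnj_mult mult_ac)
   then show ?case using elim q ee by (simp only: prin_act_K rot_in_K Z_rot mult_1)
  qed
 qed
 also have "\<dots> = ?e * coef f q"
  unfolding coef_def using integral_rot[of "\<lambda>k. f k * cnj (Z q k)" \<tau>] \<tau> by simp
 finally show ?thesis .
qed

text \<open>Orthogonality comes from rotation invariance: for \<tau> = pi / |p - q| the coefficient
  is multiplied by two numbers whose ratio is -1, and both products are the same coefficient of the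
  rotated function.\<close>

lemma coef_Z:
 assumes p: "even (p - \<delta>)" and q: "even (q - \<delta>)"
 shows "coef (Z p) q = (if p = q then 1 else 0)"
proof (cases "p = q")
 case True
 have [measurable]: "Z q \<in> borel_measurable borel" using Z_measurable[OF q] .
 have "coef (Z q) q = (\<integral>k. 1 \<partial>haar_K)" unfolding coef_def
 proof (rule integral_cong_AE)
  show "AE k in haar_K. Z q k * cnj (Z q k) = 1"
   using AE_haar_K_in_K by eventually_elim (use norm_Z q in \<open>simp add: complex_norm_square[symmetric]\<close>)
 qed auto
 then show ?thesis using True haar.prob_space by simp
next
 case False
 define \<tau> where "\<tau> = pi / of_int \<bar>p - q\<bar>"
 have d: "real_of_int \<bar>p - q\<bar> \<ge> 1" using False by linarith
 have \<tau>: "0 \<le> \<tau>" "\<tau> \<le> 2 * pi"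
 proof -
  show "0 \<le> \<tau>" unfolding \<tau>_def by simp
  have "pi \<le> 2 * pi * real_of_int \<bar>p - q\<bar>" using d mult_left_mono[OF d, of "2 * pi"] pi_gt_zero by linarith
  then show "\<tau> \<le> 2 * pi" unfolding \<tau>_def using d by (simp add: divide_simps)
 qed
 have "coef (prin_act \<sigma> (rot \<tau>) (Z p)) q = expi p \<tau> * coef (Z p) q"
 proof -
  have "ae_eq (prin_act \<sigma> (rot \<tau>) (Z p)) (\<lambda>k. expi p \<tau> * Z p k + 0 * Z p k)"
   unfolding ae_eq_def using AE_haar_K_in_K by eventually_elim (simp add: prin_act_K Z_rot[OF _ p])
  then have "coef (prin_act \<sigma> (rot \<tau>) (Z p)) q = coef (\<lambda>k. expi p \<tau> * Z p k + 0 * Z p k) q"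
   using Z_measurable[OF p] by (intro coef_cong prin_act_measurable K_in_G q) auto
  then show ?thesis using coef_lin[OF Z_L2[OF p] Z_L2[OF p] q, of "expi p \<tau>" 0] by simp
 qed
 moreover have "coef (prin_act \<sigma> (rot \<tau>) (Z p)) q = expi q \<tau> * coef (Z p) q"
  by (rule coef_rot[OF Z_measurable[OF p] \<tau> q])
 ultimately have "expi p \<tau> * coef (Z p) q = expi q \<tau> * coef (Z p) q"
  by (simp only:)
 then have "(expi p \<tau> - expi q \<tau>) * coef (Z p) q = 0"
  by (simp only: left_diff_distrib diff_self)
 moreover have "expi p \<tau> \<noteq> expi q \<tau>"
 proof
  assume "expi p \<tau> = expi q \<tau>"
  then have e1: "exp (\<i> * of_int (p - q) * of_real \<tau>) = 1"
   by (simp add: algebra_simps exp_diff)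
  have e2: "\<i> * of_int (p - q) * of_real \<tau> = \<i> * of_int (sgn (p - q)) * of_real pi"
  proof -
   have "real_of_int (p - q) * \<tau> = of_int (sgn (p - q)) * pi"
    using False unfolding \<tau>_def by (auto simp: sgn_if abs_if field_simps)
   then have "complex_of_real (real_of_int (p - q) * \<tau>) = complex_of_real (of_int (sgn (p - q)) * pi)" by simp
   then show ?thesis by (simp only: of_real_mult of_real_of_int_eq mult.assoc)
  qed
  have "(if even (sgn (p - q)) then 1 else -1 :: complex) = 1" using e1 unfolding e2 exp_int_pi .
  moreover have "odd (sgn (p - q))" using False by (auto simp: sgn_if)
  ultimately show False by simp
 qed
 ultimately show ?thesis using False by simp
qed

lemma coef_Z_comb:
 assumes "finite Q" "\<And>p. p \<in> Q ==> even (p - \<delta>)" "even (q - \<delta>)"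
 shows "coef (\<lambda>k. \<Sum>p\<in>Q. c p * Z p k) q = (if q \<in> Q then c q else 0)"
proof -
 have "coef (\<lambda>k. \<Sum>p\<in>Q. c p * Z p k) q = (\<Sum>p\<in>Q. c p * coef (Z p) q)"
  by (rule coef_sum) (use assms Z_L2 in auto)
 also have "\<dots> = (\<Sum>p\<in>Q. if p = q then c q else 0)"
  by (intro sum.cong) (use assms coef_Z in auto)
 finally show ?thesis using assms by simp
qed

lemma H_cont_sum:
 assumes "finite Q" "\<And>p. p \<in> Q ==> even (p - \<delta>)"
 shows "(\<lambda>k. \<Sum>p\<in>Q. c p * Z p k) \<in> H_cont \<sigma>"
 unfolding H_cont_def
proof (safe)
 show "(\<lambda>k. \<Sum>p\<in>Q. c p * Z p k) \<in> L2_K" using L2_sum[of Q Z c] Z_L2 assms by auto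
 show "continuous_on K_grp (\<lambda>k. \<Sum>p\<in>Q. c p * Z p k)"
  by (intro continuous_on_sum continuous_on_mult continuous_on_const Z_continuous assms)
 fix m k assume "m \<in> K_grp" "m \<in> M_grp" "k \<in> K_grp"
 then show "(\<Sum>p\<in>Q. c p * Z p (m ** k)) = \<sigma> m * (\<Sum>p\<in>Q. c p * Z p k)"
  using assms Z_equivariant by (simp add: sum_distrib_left mult.left_commute)
qed

lemma Z_comb_of_trig_poly:
 assumes "trig_poly (\<lambda>n. even (n - \<delta>)) T"
 shows "\<exists>Q c. finite Q \<and> (\<forall>p\<in>Q. even (p - \<delta>)) \<and> (\<forall>\<theta>. (\<Sum>p\<in>Q. c p * Z p (rot \<theta>)) = T \<theta>)"
 using assms
proof induction
 case zero
 show ?case by (rule exI[of _ "{}"]) auto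
next
 case (add_term T n d)
 then obtain Q c where Q: "finite Q" "\<forall>p\<in>Q. even (p - \<delta>)" "\<And>\<theta>. (\<Sum>p\<in>Q. c p * Z p (rot \<theta>)) = T \<theta>" by blast
 define c' where "c' p = (if p \<in> Q then c p else 0) + (if p = n then d else 0)" for p
 have "(\<Sum>p\<in>insert n Q. c' p * Z p (rot \<theta>)) = T \<theta> + d * expi n \<theta>" for \<theta>
 proof -
  have "(\<Sum>p\<in>insert n Q. c' p * Z p (rot \<theta>)) = (\<Sum>p\<in>insert n Q. (if p \<in> Q then c p * Z p (rot \<theta>) else 0)) + (\<Sum>p\<in>insert n Q. (if p = n then d * Z p (rot \<theta>) else 0))"
   unfolding sum.distrib[symmetric] by (intro sum.cong) (auto simp: c'_def distrib_right)
  also have "(\<Sum>p\<in>insert n Q. (if p \<in> Q then c p * Z p (rot \<theta>) else 0)) = (\<Sum>p\<in>Q. c p * Z p (rot \<theta>))"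
   using Q(1) by (simp add: sum.inter_restrict[symmetric] Int_absorb1 subset_insertI insert_absorb)
  also have "(\<Sum>p\<in>insert n Q. (if p = n then d * Z p (rot \<theta>) else 0)) = d * Z n (rot \<theta>)"
   using Q(1) by simp
  finally show ?thesis using Q(3) Z_on_K[OF add_term.hyps(2)] by simp
 qed
 then show ?case using Q add_term.hyps(2) by (intro exI[of _ "insert n Q"] exI[of _ c']) auto
qed

text \<open>Stone-Weierstrass gives polynomials in the matrix entries, which are trigonometric
  polynomials on rotations. Averaging with the rotation by pi selects the admissible parity and
  keeps the error, because \<open>g\<close> has this symmetry itself; the reflected component
  follows by equivariance.\<close>

lemma H_cont_approx:
 assumes g: "g \<in> H_cont \<sigma>" and e: "e > 0"
 obtains Q c where "finite Q" "\<And>p. p \<in> Q ==> even (p - \<delta>)" "\<And>k. k \<in> K_grp ==> norm (g k - (\<Sum>p\<in>Q. c p * Z p k)) \<le> e"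
proof -
 have gc: "continuous_on K_grp g" and geq: "\<And>m k. m \<in> K_grp \<inter> M_grp ==> k \<in> K_grp ==> g (m ** k) = \<sigma> m * g k"
  using g by (auto simp: H_cont_def)
 obtain p where p: "polynomial_function p" "\<And>k. k \<in> K_grp ==> norm (g k - p k) < e"
  using Stone_Weierstrass_polynomial_function[OF compact_K_grp gc e] by blast
 define s :: complex where "s = (if even \<delta> then 1 else -1)"
 have s': "s = complex_of_real ((-1) ^ \<delta>1 * (-1) ^ \<delta>2)" unfolding s_def by (auto simp: minus_one_power_iff)
 have g\<pi>: "g (rot (\<theta> + pi)) = s * g (rot \<theta>)" for \<theta>
 proof -
  have "rot (\<theta> + pi) = diag2 (-1) (-1) ** rot \<theta>" by (simp add: mat2_eq_iff mat2_mult_nth)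
  moreover have "diag2 (-1) (-1) \<in> K_grp \<inter> M_grp"
  proof -
   have "diag2 (-1) (-1) = rot pi" by (simp add: mat2_eq_iff)
   moreover have "diag2 (-1) (-1) \<in> M_grp" unfolding M_grp_def by force
   ultimately show ?thesis using rot_in_K[of pi] by simp
  qed
  ultimately show ?thesis using geq sigma_diag[of "-1" "-1"] s' by simp
 qed
 have ss: "s * s = 1" "norm s = 1" unfolding s_def by auto
 obtain Q c where Q: "finite Q" "\<forall>p\<in>Q. even (p - \<delta>)" "\<And>\<theta>. (\<Sum>q\<in>Q. c q * Z q (rot \<theta>)) = (p (rot \<theta>) + s * p (rot (\<theta> + pi))) / 2"
  using Z_comb_of_trig_poly[OF trig_poly_parity_part[OF polynomial_function_trig_poly[OF p(1)] s_def]] by blast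
 have r: "norm (g (rot \<theta>) - (\<Sum>q\<in>Q. c q * Z q (rot \<theta>))) \<le> e" for \<theta>
 proof -
  have "g (rot \<theta>) = (g (rot \<theta>) + s * g (rot (\<theta> + pi))) / 2" unfolding g\<pi> using ss by (simp add: mult.assoc[symmetric])
  then have "g (rot \<theta>) - (\<Sum>q\<in>Q. c q * Z q (rot \<theta>)) = ((g (rot \<theta>) - p (rot \<theta>)) + s * (g (rot (\<theta> + pi)) - p (rot (\<theta> + pi)))) / 2"
   unfolding Q(3) by (simp add: diff_divide_distrib[symmetric] algebra_simps)
  also have "norm \<dots> \<le> (norm (g (rot \<theta>) - p (rot \<theta>)) + norm (s * (g (rot (\<theta> + pi)) - p (rot (\<theta> + pi))))) / 2"
   unfolding norm_divide by (simp add: norm_triangle_ineq)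
  also have "\<dots> \<le> e" using p(2)[OF rot_in_K, of \<theta>] p(2)[OF rot_in_K, of "\<theta> + pi"] ss(2) by (simp add: norm_mult)
  finally show ?thesis .
 qed
 show ?thesis
 proof (rule that[of Q c])
  fix k assume "k \<in> K_grp"
  then show "norm (g k - (\<Sum>p\<in>Q. c p * Z p k)) \<le> e"
  proof (cases rule: K_grp_cases)
   case (1 \<theta>)
   then show ?thesis using r by simp
  next
   case (2 \<theta>)
   have "refl2 \<in> M_grp" unfolding M_grp_def refl2_def by force
   then have m: "refl2 \<in> K_grp \<inter> M_grp" by simp
   have sr: "norm (\<sigma> refl2) = 1" unfolding refl2_def by (simp add: sigma_diag norm_power)
   have "g k - (\<Sum>p\<in>Q. c p * Z p k) = \<sigma> refl2 * (g (rot \<theta>) - (\<Sum>p\<in>Q. c p * Z p (rot \<theta>)))"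
    unfolding 2 geq[OF m rot_in_K] using Q(2) by (simp add: Z_equivariant[OF _ m rot_in_K] sum_distrib_left mult.left_commute right_diff_distrib)
   then show ?thesis using r[of \<theta>] sr by (simp add: norm_mult)
  qed
 qed (use Q in auto)
qed

end

section \<open>Differentiability uniform over the compact group\<close>

lemma linear_norm_bound_Basis:
 fixes L :: "'a::euclidean_space => 'b::real_normed_vector"
 assumes "linear L" "\<And>b. b \<in> Basis ==> norm (L b) \<le> \<eta>"
 shows "norm (L h) \<le> (of_nat DIM('a) * \<eta>) * norm h"
proof -
 have "L h = (\<Sum>b\<in>Basis. (h \<bullet> b) *\<^sub>R L b)"
  using linear_sum[OF assms(1), of "\<lambda>b. (h \<bullet> b) *\<^sub>R b" Basis] linear_scale[OF assms(1)] by (simp add: euclidean_representation)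
 also have "norm \<dots> \<le> (\<Sum>b\<in>(Basis :: 'a set). norm h * \<eta>)"
 proof (rule sum_norm_le)
  fix b :: 'a assume b: "b \<in> Basis"
  have "norm ((h \<bullet> b) *\<^sub>R L b) = \<bar>h \<bullet> b\<bar> * norm (L b)" by simp
  also have "\<dots> \<le> norm h * \<eta>" using b assms(2) by (intro mult_mono Basis_le_norm) auto
  finally show "norm ((h \<bullet> b) *\<^sub>R L b) \<le> norm h * \<eta>" .
 qed
 finally show ?thesis by (simp add: mult_ac)
qed

lemma smooth_on_derivative:
 assumes "smooth_on S f"
 shows "x \<in> S ==> (f has_derivative frechet_derivative f (at x)) (at x)"
  "continuous_on S (\<lambda>x. frechet_derivative f (at x) v)"
proof -
 have "Ck_on (Suc 0) S f" using assms unfolding smooth_on_def by blast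
 then have *: "\<And>x. x \<in> S ==> f differentiable (at x)" "\<And>v. continuous_on S (\<lambda>x. frechet_derivative f (at x) v)" by simp_all
 show "x \<in> S ==> (f has_derivative frechet_derivative f (at x)) (at x)" using *(1) frechet_derivative_works by blast
 show "continuous_on S (\<lambda>x. frechet_derivative f (at x) v)" by (rule *(2))
qed

text \<open>The derivative in each basis direction is uniformly continuous on a compact
  neighbourhood of K; the mean value inequality is then applied to the difference between \<phi> and
  its linear part at k.\<close>

lemma uniform_differentiability:
 fixes \<phi> :: "'a::euclidean_space => 'b::real_normed_vector"
 assumes sm: "smooth_on S \<phi>" and S: "open S" and K: "compact K" "K \<subseteq> S" and \<epsilon>: "\<epsilon> > 0"
 shows "\<exists>d>0. \<forall>k\<in>K. \<forall>v. norm v < d \<longrightarrow> norm (\<phi> (k + v) - \<phi> k - frechet_derivative \<phi> (at k) v) \<le> \<epsilon> * norm v"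
proof -
 define D where "D x = frechet_derivative \<phi> (at x)" for x
 have D: "(\<phi> has_derivative D x) (at x)" if "x \<in> S" for x unfolding D_def using smooth_on_derivative(1)[OF sm that] .
 have Dc: "continuous_on S (\<lambda>x. D x v)" for v unfolding D_def using smooth_on_derivative(2)[OF sm] .
 obtain r where r: "r > 0" "(\<Union>x\<in>K. ball x r) \<subseteq> S"
  using compact_subset_open_imp_ball_epsilon_subset[OF K(1) S K(2)] by blast
 define K' where "K' = {x + y | x y. x \<in> K \<and> y \<in> cball 0 (r/2)}"
 have K': "compact K'" unfolding K'_def by (rule compact_sums[OF K(1) compact_cball])
 have K'S: "K' \<subseteq> S"
 proof
  fix z assume "z \<in> K'"
  then obtain x y where "z = x + y" "x \<in> K" "norm y \<le> r/2" unfolding K'_def by auto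
  then have "z \<in> ball x r" "x \<in> K" using r(1) by (auto simp: dist_norm)
  then show "z \<in> S" using r(2) by blast
 qed
 \<comment> \<open>A bound on basis vectors passes to all vectors with the dimension as a
   factor.\<close>
 define \<eta> where "\<eta> = \<epsilon> / of_nat DIM('a)"
 have \<eta>: "\<eta> > 0" "of_nat DIM('a) * \<eta> = \<epsilon>" unfolding \<eta>_def using \<epsilon> by auto
 have "\<forall>b\<in>Basis. \<exists>d>0. \<forall>x\<in>K'. \<forall>y\<in>K'. dist y x < d \<longrightarrow> dist (D y b) (D x b) < \<eta>"
 proof
  fix b :: 'a
  have "uniformly_continuous_on K' (\<lambda>x. D x b)"
   by (rule compact_uniformly_continuous[OF continuous_on_subset[OF Dc K'S] K'])
  then show "\<exists>d>0. \<forall>x\<in>K'. \<forall>y\<in>K'. dist y x < d \<longrightarrow> dist (D y b) (D x b) < \<eta>"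
   using \<eta>(1) unfolding uniformly_continuous_on_def by blast
 qed
 then obtain d where d: "\<And>b. b \<in> Basis ==> d b > 0" "\<And>b x y. b \<in> Basis ==> x \<in> K' ==> y \<in> K' ==> dist y x < d b ==> dist (D y b) (D x b) < \<eta>"
  by metis
 define e where "e = min (Min (d ` Basis)) (r/2)"
 have e: "e > 0" "e \<le> r/2" "\<And>b. b \<in> Basis ==> e \<le> d b"
  using d(1) r(1) by (auto simp: e_def Min_gr_iff min.coboundedI1)
 show ?thesis
 proof (intro exI[of _ e] conjI ballI allI impI e(1))
  fix k v :: 'a assume k: "k \<in> K" and v: "norm v < e"
  define \<psi> where "\<psi> x = \<phi> (k + x) - D k x" for x
  have kK': "k \<in> K'" unfolding K'_def using k r(1) by force
  have lin: "bounded_linear (D x)" if "x \<in> S" for x using D[OF that] by (rule has_derivative_bounded_linear)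
  have kS: "k \<in> S" using k K(2) by blast
  have "norm (\<psi> v - \<psi> 0) \<le> \<epsilon> * norm (v - 0)"
  proof (rule differentiable_bound)
   show "convex (ball (0::'a) e)" by simp
   fix x assume "x \<in> ball (0::'a) e"
   then have x: "norm x < e" by simp
   have xK': "k + x \<in> K'" unfolding K'_def using k x e(2) by force
   then have xS: "k + x \<in> S" using K'S by blast
   have "((\<lambda>x. k + x) has_derivative (\<lambda>h. h)) (at x)" by (auto intro!: derivative_eq_intros)
   from has_derivative_compose[OF this D[OF xS]]
   have "((\<lambda>x. \<phi> (k + x)) has_derivative (\<lambda>h. D (k + x) h)) (at x)" .
   from has_derivative_diff[OF this bounded_linear_imp_has_derivative[OF lin[OF kS]]]
   have "(\<psi> has_derivative (\<lambda>h. D (k + x) h - D k h)) (at x)" unfolding \<psi>_def[abs_def] .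
   then show "(\<psi> has_derivative (\<lambda>h. D (k + x) h - D k h)) (at x within ball 0 e)"
    by (rule has_derivative_at_withinI)
   have "linear (\<lambda>h. D (k + x) h - D k h)"
    using lin[OF xS] lin[OF kS] by (intro bounded_linear.linear bounded_linear_sub)
   moreover have "norm (D (k + x) b - D k b) \<le> \<eta>" if b: "b \<in> Basis" for b
    using d(2)[OF b kK' xK'] x e(3)[OF b] by (simp add: dist_norm)
   ultimately have "norm (D (k + x) h - D k h) \<le> (of_nat DIM('a) * \<eta>) * norm h" for h
    by (rule linear_norm_bound_Basis[of "\<lambda>h. D (k + x) h - D k h"])
   then show "onorm (\<lambda>h. D (k + x) h - D k h) \<le> \<epsilon>" unfolding \<eta>(2) by (rule onorm_le)
  qed (use v e(1) in auto)
  moreover have "D k 0 = 0" using lin[OF kS] by (simp add: linear_simps)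
  ultimately show "norm (\<phi> (k + v) - \<phi> k - frechet_derivative \<phi> (at k) v) \<le> \<epsilon> * norm v"
   by (simp add: \<psi>_def D_def[symmetric] algebra_simps)
 qed
qed

lemma norm_K_mult_le:
 fixes k A :: mat2
 assumes "k \<in> K_grp"
 shows "norm (k ** A) \<le> 8 * norm A"
proof -
 have kb: "\<bar>k$i$j\<bar> \<le> 1" for i j
  using assms
 proof (cases rule: K_grp_cases)
  case (1 \<theta>)
  show ?thesis by (rule forall_22_I[where P="\<lambda>i j. \<bar>k$i$j\<bar> \<le> 1"]) (simp_all add: 1 abs_cos_le_one abs_sin_le_one)
 next
  case (2 \<theta>)
  show ?thesis by (rule forall_22_I[where P="\<lambda>i j. \<bar>k$i$j\<bar> \<le> 1"]) (simp_all add: 2 mat2_mult_nth abs_cos_le_one abs_sin_le_one)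
 qed
 have "\<bar>(k ** A)$i$j\<bar> \<le> 2 * norm A" for i j
 proof -
  have "\<bar>(k ** A)$i$j\<bar> \<le> \<bar>k$i$1\<bar> * \<bar>A$1$j\<bar> + \<bar>k$i$2\<bar> * \<bar>A$2$j\<bar>"
   by (simp add: mat2_mult_nth abs_mult[symmetric] abs_triangle_ineq)
  also have "\<dots> \<le> 1 * norm A + 1 * norm A" by (intro add_mono mult_mono kb mat2_nth_le_norm) auto
  finally show ?thesis by simp
 qed
 from this[of 1 1] this[of 1 2] this[of 2 1] this[of 2 2]
 show ?thesis using norm_mat2_le[of "k ** A"] unfolding mat2_l1_def by linarith
qed

text \<open>The increment k exp(tX) - k is t k X plus a remainder of size t^2. Replacing \<phi> by
  its linear part costs a uniformly small error, and \<open>L\<close> bounds that linear part on the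
  remainder. Uniformity over K is what later gives convergence in L2.\<close>

lemma uniform_lie_derivative:
 fixes \<phi> :: "mat2 => complex"
 assumes sm: "smooth_on G_grp \<phi>" and \<epsilon>: "\<epsilon> > 0"
 shows "\<forall>\<^sub>F t in at 0. \<forall>k\<in>K_grp. norm ((\<phi> (k ** mat_exp (t *\<^sub>R X)) - \<phi> k) / of_real t - frechet_derivative \<phi> (at k) (k ** X)) \<le> \<epsilon>"
proof -
 define D where "D x = frechet_derivative \<phi> (at x)" for x
 obtain C where C: "\<And>t. \<bar>t\<bar> \<le> 1 ==> norm (mat_exp (t *\<^sub>R X) - mat 1 - t *\<^sub>R X) \<le> C * t\<^sup>2" using mat_exp_quadratic by blast
 have C0: "C \<ge> 0" using order_trans[OF norm_ge_zero C[of 1]] by simp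
 have KG: "K_grp \<subseteq> G_grp" using K_in_G by blast
 have lin: "linear (D k)" if "k \<in> K_grp" for k
  unfolding D_def using smooth_on_derivative(1)[OF sm K_in_G[OF that]] by (rule has_derivative_linear)
 have "\<exists>\<eta>. \<forall>k\<in>K_grp. norm (D k b) \<le> \<eta>" for b
 proof -
  have "compact ((\<lambda>k. D k b) ` K_grp)" unfolding D_def
   by (rule compact_continuous_image[OF continuous_on_subset[OF smooth_on_derivative(2)[OF sm] KG] compact_K_grp])
  then show ?thesis using compact_imp_bounded bounded_iff by (metis imageI)
 qed
 then obtain \<eta> where \<eta>: "\<And>b k. k \<in> K_grp ==> norm (D k b) \<le> \<eta> b" by metis
 define L where "L = of_nat DIM(mat2) * (\<Sum>b\<in>(Basis :: mat2 set). \<bar>\<eta> b\<bar>)"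
 have L0: "L \<ge> 0" unfolding L_def by (simp add: sum_nonneg)
 have L: "norm (D k h) \<le> L * norm h" if k: "k \<in> K_grp" for k h
  unfolding L_def
 proof (rule linear_norm_bound_Basis[OF lin[OF k]])
  fix b :: mat2 assume b: "b \<in> Basis"
  have "norm (D k b) \<le> \<bar>\<eta> b\<bar>" using \<eta>[OF k, of b] by linarith
  also have "\<dots> \<le> (\<Sum>b\<in>(Basis :: mat2 set). \<bar>\<eta> b\<bar>)" using b by (intro member_le_sum) auto
  finally show "norm (D k b) \<le> (\<Sum>b\<in>(Basis :: mat2 set). \<bar>\<eta> b\<bar>)" .
 qed
 \<comment> \<open>M |t| bounds the increment \<open>v\<close>: the 8 comes from
   \<open>norm_K_mult_le\<close>, and the 1 keeps M positive.\<close>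
 define M where "M = 8 * (norm X + C) + 1"
 have M: "M > 0" unfolding M_def using C0 by (simp add: add_nonneg_pos)
 obtain d where d: "d > 0" "\<And>k v. k \<in> K_grp ==> norm v < d ==> norm (\<phi> (k + v) - \<phi> k - D k v) \<le> \<epsilon> / (2 * M) * norm v"
  using uniform_differentiability[OF sm open_G_grp compact_K_grp KG, of "\<epsilon> / (2 * M)"] \<epsilon> M unfolding D_def by auto
 \<comment> \<open>Half of \<epsilon> is spent on the linearisation error, which needs |t| < d/M,
   and half on the quadratic remainder.\<close>
 define e where "e = min 1 (min (d / M) (\<epsilon> / (2 * (L * (8 * C) + 1))))"
 have LC: "L * (8 * C) \<ge> 0" using L0 C0 by simp
 have "\<epsilon> / (2 * (L * (8 * C) + 1)) > 0" 
  using divide_pos_pos[OF \<epsilon> mult_pos_pos[OF zero_less_numeral add_nonneg_pos[OF LC zero_less_one]]] .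
 then have e: "e > 0" using divide_pos_pos[OF d(1) M] unfolding e_def by (simp only: min_less_iff_conj) simp
 show ?thesis
  unfolding eventually_at
 proof (intro exI[of _ e] conjI ballI impI e)
  fix t :: real and k assume t: "t \<noteq> 0 \<and> dist t 0 < e" and k: "k \<in> K_grp"
  then have t1: "\<bar>t\<bar> \<le> 1" "\<bar>t\<bar> < d / M" "\<bar>t\<bar> < \<epsilon> / (2 * (L * (8 * C) + 1))" "t \<noteq> 0" by (auto simp: e_def)
  define R where "R = mat_exp (t *\<^sub>R X) - mat 1 - t *\<^sub>R X"
  define v where "v = k ** (mat_exp (t *\<^sub>R X) - mat 1)"
  have R: "norm R \<le> C * t\<^sup>2" unfolding R_def by (rule C[OF t1(1)])
  have t2: "t\<^sup>2 \<le> \<bar>t\<bar>" using t1(1) mult_left_le_one_le[of "\<bar>t\<bar>" "\<bar>t\<bar>"] by (simp add: power2_eq_square abs_mult[symmetric])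
  have mR: "mat_exp (t *\<^sub>R X) - mat 1 = t *\<^sub>R X + R" by (simp add: R_def)
  have bl: "k ** (A + B) = k ** A + k ** B" "k ** (c *\<^sub>R A) = c *\<^sub>R (k ** A)" "k ** (A - B) = k ** A - k ** B" for A B :: mat2 and c
   using linear_add[OF bounded_linear.linear[OF bounded_linear_mat2_mult(1)[of k]]]
    linear_scale[OF bounded_linear.linear[OF bounded_linear_mat2_mult(1)[of k]]]
    linear_diff[OF bounded_linear.linear[OF bounded_linear_mat2_mult(1)[of k]]] by auto
  have "norm v \<le> 8 * norm (t *\<^sub>R X + R)" unfolding v_def mR by (rule norm_K_mult_le[OF k])
  also have "\<dots> \<le> 8 * (\<bar>t\<bar> * norm X + C * t\<^sup>2)" using norm_triangle_ineq[of "t *\<^sub>R X" R] R by simp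
  also have "\<dots> \<le> 8 * (\<bar>t\<bar> * norm X + C * \<bar>t\<bar>)" using C0 t2 by (simp add: mult_left_mono)
  also have "\<dots> \<le> M * \<bar>t\<bar>" unfolding M_def by (simp add: algebra_simps)
  finally have nv: "norm v \<le> M * \<bar>t\<bar>" .
  also have "M * \<bar>t\<bar> < d" using t1(2) M by (simp add: field_simps)
  finally have vd: "norm v < d" .
  have kv: "k ** mat_exp (t *\<^sub>R X) = k + v" unfolding v_def bl(3) by simp
  have Dv: "D k v = of_real t * D k (k ** X) + D k (k ** R)"
   unfolding v_def mR bl(1,2) using linear_add[OF lin[OF k]] linear_scale[OF lin[OF k]] by (simp add: scaleR_conv_of_real)
  have "(\<phi> (k ** mat_exp (t *\<^sub>R X)) - \<phi> k) / of_real t - D k (k ** X) = ((\<phi> (k + v) - \<phi> k - D k v) + D k (k ** R)) / of_real t"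
   unfolding kv Dv using t1(4) by (simp add: field_simps)
  also have "norm \<dots> \<le> (\<epsilon> / (2 * M) * (M * \<bar>t\<bar>) + L * (8 * (C * t\<^sup>2))) / \<bar>t\<bar>"
   unfolding norm_divide norm_of_real
  proof (intro divide_right_mono order_trans[OF norm_triangle_ineq] add_mono)
   show "norm (\<phi> (k + v) - \<phi> k - D k v) \<le> \<epsilon> / (2 * M) * (M * \<bar>t\<bar>)"
    using d(2)[OF k vd] mult_left_mono[OF nv, of "\<epsilon> / (2 * M)"] \<epsilon> M by simp
   have "norm (D k (k ** R)) \<le> L * norm (k ** R)" by (rule L[OF k])
   also have "\<dots> \<le> L * (8 * (C * t\<^sup>2))" using norm_K_mult_le[OF k, of R] R L0 by (intro mult_left_mono) auto
   finally show "norm (D k (k ** R)) \<le> L * (8 * (C * t\<^sup>2))" .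
  qed simp
  also have "\<dots> = \<epsilon> / 2 + L * (8 * C) * \<bar>t\<bar>"
   using t1(4) M by (simp add: field_simps power2_eq_square abs_mult[symmetric])
  also have "\<dots> \<le> \<epsilon> / 2 + \<epsilon> / 2"
  proof -
   have "(L * (8 * C) + 1) * \<bar>t\<bar> \<le> \<epsilon> / 2" using t1(3) LC by (simp add: field_simps)
   moreover have "L * (8 * C) * \<bar>t\<bar> \<le> (L * (8 * C) + 1) * \<bar>t\<bar>" by (simp add: distrib_right)
   ultimately show ?thesis by linarith
  qed
  finally show "norm ((\<phi> (k ** mat_exp (t *\<^sub>R X)) - \<phi> k) / of_real t - frechet_derivative \<phi> (at k) (k ** X)) \<le> \<epsilon>"
   by (simp add: D_def)
 qed
qed

lemma frechet_along_curve:
 fixes \<phi> :: "mat2 => complex"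
 assumes "(\<phi> has_derivative D) (at g)" "((\<lambda>t. \<phi> (g ** mat_exp (t *\<^sub>R X))) has_vector_derivative L) (at 0)"
 shows "D (g ** X) = L"
proof -
 have "g ** mat_exp (0 *\<^sub>R X) = g" by simp
 then have D: "(\<phi> has_derivative D) (at (g ** mat_exp (0 *\<^sub>R X)))" using assms(1) by simp
 from has_derivative_compose[OF mat_exp_curve_deriv[unfolded has_vector_derivative_def] D]
 have "((\<lambda>t. \<phi> (g ** mat_exp (t *\<^sub>R X))) has_derivative (\<lambda>t. D (t *\<^sub>R (g ** X)))) (at 0)" .
 then have "(\<lambda>t. D (t *\<^sub>R (g ** X))) = (\<lambda>t. t *\<^sub>R L)"
  using assms(2) has_derivative_unique unfolding has_vector_derivative_def by blast
 then have "D (1 *\<^sub>R (g ** X)) = 1 *\<^sub>R L" by metis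
 then show ?thesis by simp
qed

section \<open>Fourier expansion of K-finite vectors\<close>

context principal_series begin

lemma cmod_diff_square: "(cmod (a - b))\<^sup>2 = (cmod a)\<^sup>2 + (cmod b)\<^sup>2 - 2 * Re (a * cnj b)"
 unfolding cmod_power2 by (simp add: power2_eq_square algebra_simps)

text \<open>Completeness of the zeta_q: f is orthogonal to every finite combination T, hence its
  norm is at most that of f - T, and by \<open>H_cont_approx\<close> T can be chosen close to
  f.\<close>

lemma H_sp_zero:
 assumes f: "f \<in> H_sp \<sigma>" and z: "\<And>q. even (q - \<delta>) ==> coef f q = 0"
 shows "ae_eq f (\<lambda>k. 0)"
proof -
 have fL: "f \<in> L2_K" using f by (simp add: H_sp_def)
 have fm[measurable]: "f \<in> borel_measurable borel" and fi: "integrable haar_K (\<lambda>k. (cmod (f k))\<^sup>2)"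
  using fL by (auto simp: L2_K_def)
 have bound: "(\<integral>k. (cmod (f k))\<^sup>2 \<partial>haar_K) \<le> 4 * \<epsilon>\<^sup>2" if e: "\<epsilon> > 0" for \<epsilon>
 proof -
  obtain g where g: "g \<in> H_cont \<sigma>" "L2_norm (\<lambda>k. f k - g k) < \<epsilon>" using f e by (auto simp: H_sp_def)
  obtain Q c where Q: "finite Q" "\<And>p. p \<in> Q ==> even (p - \<delta>)" "\<And>k. k \<in> K_grp ==> norm (g k - (\<Sum>p\<in>Q. c p * Z p k)) \<le> \<epsilon>"
   using H_cont_approx[OF g(1) e] by blast
  let ?T = "\<lambda>k. \<Sum>p\<in>Q. c p * Z p k"
  have gL: "g \<in> L2_K" using g(1) by (simp add: H_cont_def)
  have TL: "?T \<in> L2_K" using H_cont_sum[OF Q(1,2)] by (simp add: H_cont_def)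
  have [measurable]: "g \<in> borel_measurable borel" "?T \<in> borel_measurable borel" using gL TL by (auto simp: L2_K_def)
  have d1: "(\<lambda>k. 1 * f k + (-1) * g k) \<in> L2_K" by (rule L2_K_lin[OF fL gL])
  have d2: "(\<lambda>k. 1 * f k + (-1) * ?T k) \<in> L2_K" by (rule L2_K_lin[OF fL TL])
  have d3: "(\<lambda>k. 1 * g k + (-1) * ?T k) \<in> L2_K" by (rule L2_K_lin[OF gL TL])
  have i1: "integrable haar_K (\<lambda>k. (cmod (f k - g k))\<^sup>2)" "integrable haar_K (\<lambda>k. (cmod (f k - ?T k))\<^sup>2)"
   "integrable haar_K (\<lambda>k. (cmod (g k - ?T k))\<^sup>2)"
   using d1 d2 d3 by (auto simp: L2_K_def)
  have iT: "integrable haar_K (\<lambda>k. (cmod (?T k))\<^sup>2)" using TL by (auto simp: L2_K_def)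
  have iZ: "integrable haar_K (\<lambda>k. f k * cnj (Z p k))" if "p \<in> Q" for p using coef_integrable[OF fL Q(2)[OF that]] .
  have fT: "(\<lambda>k. f k * cnj (?T k)) = (\<lambda>k. \<Sum>p\<in>Q. cnj (c p) * (f k * cnj (Z p k)))"
   by (simp add: fun_eq_iff sum_distrib_left mult_ac)
  have ifT: "integrable haar_K (\<lambda>k. f k * cnj (?T k))" unfolding fT using iZ by (intro Bochner_Integration.integrable_sum integrable_mult_right) auto
  have "(\<integral>k. f k * cnj (?T k) \<partial>haar_K) = (\<Sum>p\<in>Q. cnj (c p) * coef f p)"
   unfolding fT coef_def using iZ by (subst Bochner_Integration.integral_sum) auto
  also have "\<dots> = 0" using z Q(2) by simp
  finally have fT0: "(\<integral>k. f k * cnj (?T k) \<partial>haar_K) = 0" .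
  have "(\<integral>k. (cmod (f k - ?T k))\<^sup>2 \<partial>haar_K) = (\<integral>k. (cmod (f k))\<^sup>2 + (cmod (?T k))\<^sup>2 - 2 * Re (f k * cnj (?T k)) \<partial>haar_K)"
   unfolding cmod_diff_square ..
  also have "\<dots> = (\<integral>k. (cmod (f k))\<^sup>2 \<partial>haar_K) + (\<integral>k. (cmod (?T k))\<^sup>2 \<partial>haar_K) - 2 * Re (\<integral>k. f k * cnj (?T k) \<partial>haar_K)"
   using fi iT integral_Re[OF ifT] integrable_Re[OF ifT] by (simp del: complex_cnj_mult Re_complex_of_real times_complex.sel)
  finally have "(\<integral>k. (cmod (f k))\<^sup>2 \<partial>haar_K) \<le> (\<integral>k. (cmod (f k - ?T k))\<^sup>2 \<partial>haar_K)"
   using fT0 by simp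
  also have "\<dots> \<le> (\<integral>k. 2 * (cmod (f k - g k))\<^sup>2 + 2 * (cmod (g k - ?T k))\<^sup>2 \<partial>haar_K)"
  proof (rule integral_mono)
   fix k
   have "(cmod (f k - ?T k))\<^sup>2 \<le> (cmod (f k - g k) + cmod (g k - ?T k))\<^sup>2"
    using norm_triangle_ineq[of "f k - g k" "g k - ?T k"] by (intro power_mono) auto
   also have "\<dots> \<le> 2 * (cmod (f k - g k))\<^sup>2 + 2 * (cmod (g k - ?T k))\<^sup>2"
    using zero_le_power2[of "cmod (f k - g k) - cmod (g k - ?T k)"] by (simp add: power2_eq_square algebra_simps)
   finally show "(cmod (f k - ?T k))\<^sup>2 \<le> 2 * (cmod (f k - g k))\<^sup>2 + 2 * (cmod (g k - ?T k))\<^sup>2" .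
  qed (use i1 in auto)
  also have "\<dots> = 2 * (\<integral>k. (cmod (f k - g k))\<^sup>2 \<partial>haar_K) + 2 * (\<integral>k. (cmod (g k - ?T k))\<^sup>2 \<partial>haar_K)" using i1 by simp
  also have "(\<integral>k. (cmod (g k - ?T k))\<^sup>2 \<partial>haar_K) \<le> (\<integral>k. \<epsilon>\<^sup>2 \<partial>haar_K)"
  proof (rule integral_mono_AE)
   show "AE k in haar_K. (cmod (g k - ?T k))\<^sup>2 \<le> \<epsilon>\<^sup>2"
    using AE_haar_K_in_K by eventually_elim (use Q(3) in \<open>auto intro!: power_mono\<close>)
  qed (use i1 in auto)
  also have "(\<integral>k. \<epsilon>\<^sup>2 \<partial>haar_K) = \<epsilon>\<^sup>2" using haar.prob_space by simp
  also have "(\<integral>k. (cmod (f k - g k))\<^sup>2 \<partial>haar_K) \<le> \<epsilon>\<^sup>2"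
  proof -
   have "(L2_norm (\<lambda>k. f k - g k))\<^sup>2 \<le> \<epsilon>\<^sup>2" using g(2) by (intro power_mono) (auto simp: L2_norm_def)
   then show ?thesis by (simp add: L2_norm_def)
  qed
  finally show ?thesis by simp
 qed
 have "(\<integral>k. (cmod (f k))\<^sup>2 \<partial>haar_K) \<le> 0"
 proof (rule field_le_epsilon)
  fix e :: real assume "e > 0"
  then show "(\<integral>k. (cmod (f k))\<^sup>2 \<partial>haar_K) \<le> 0 + e" using bound[of "sqrt (e / 4)"] by simp
 qed
 then have "(\<integral>k. (cmod (f k))\<^sup>2 \<partial>haar_K) = 0" by (intro antisym integral_nonneg_AE) auto
 then have "AE k in haar_K. (cmod (f k))\<^sup>2 = 0" using fi by (subst (asm) integral_nonneg_eq_0_iff_AE) auto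
 then show ?thesis unfolding ae_eq_def by eventually_elim simp
qed

lemma H_sp_diff_comb:
 assumes f: "f \<in> H_sp \<sigma>" and Q: "finite Q" "\<And>p. p \<in> Q ==> even (p - \<delta>)"
 shows "(\<lambda>k. f k - (\<Sum>p\<in>Q. c p * Z p k)) \<in> H_sp \<sigma>"
proof -
 let ?T = "\<lambda>k. \<Sum>p\<in>Q. c p * Z p k"
 have T: "?T \<in> H_cont \<sigma>" by (rule H_cont_sum[OF Q])
 have L: "(\<lambda>k. g k - ?T k) \<in> L2_K" if "g \<in> L2_K" for g
  using L2_K_lin[OF that, of ?T 1 "-1"] T by (simp add: H_cont_def)
 show ?thesis
  unfolding H_sp_def
 proof (safe)
  show "(\<lambda>k. f k - ?T k) \<in> L2_K" using L f by (simp add: H_sp_def)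
  fix \<epsilon> :: real assume "\<epsilon> > 0"
  then obtain g where g: "g \<in> H_cont \<sigma>" "L2_norm (\<lambda>k. f k - g k) < \<epsilon>" using f by (auto simp: H_sp_def)
  have "(\<lambda>k. g k - ?T k) \<in> H_cont \<sigma>"
   using g(1) T L unfolding H_cont_def by (auto intro: continuous_on_diff simp: right_diff_distrib)
  moreover have "L2_norm (\<lambda>k. f k - ?T k - (g k - ?T k)) < \<epsilon>" using g(2) by simp
  ultimately show "\<exists>g\<in>H_cont \<sigma>. L2_norm (\<lambda>k. f k - ?T k - g k) < \<epsilon>"
   by (intro bexI[of _ "\<lambda>k. g k - ?T k"])
 qed
qed

definition support :: "(mat2 => complex) => int set" where
 "support f = {q. even (q - \<delta>) \<and> coef f q \<noteq> 0}"

lemma H_fin_borel: "f \<in> H_fin \<sigma> ==> f \<in> borel_measurable borel"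
 by (simp add: H_fin_def H_sp_def L2_K_def)

text \<open>If the translates of \<open>f\<close> lie in a space of dimension \<open>n\<close>, then some nontrivial
 combination of any \<open>n + 1\<close> Fourier coefficients annihilates that space; applied to all the
 translates of \<open>f\<close> it is a trigonometric polynomial, so one of the coefficients of \<open>f\<close> vanishes.\<close>

lemma finite_support:
 assumes f: "f \<in> H_fin \<sigma>"
 shows "finite (support f)"
proof (rule ccontr)
 assume inf: "infinite (support f)"
 obtain B where B: "finite B" "B \<subseteq> H_sp \<sigma>" "\<And>\<kappa>. \<kappa> \<in> K_grp ==> \<exists>c. ae_eq (prin_act \<sigma> \<kappa> f) (\<lambda>k. \<Sum>b\<in>B. c b * b k)"
  using f by (auto simp: H_fin_def)
 obtain Q where Q: "Q \<subseteq> support f" "finite Q" "card Q = Suc (card B)"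
  using infinite_arbitrarily_large[OF inf] by metis
 have Qe: "even (q - \<delta>)" if "q \<in> Q" for q using Q(1) that by (auto simp: support_def)
 obtain x where x: "\<exists>q\<in>Q. x q \<noteq> 0" "\<And>b. b \<in> B ==> (\<Sum>q\<in>Q. x q * coef b q) = 0"
  using homogeneous_system_nontrivial[OF B(1) Q(2), of coef] Q(3) by auto
 define a where "a q = x q * coef f q" for q
 have BL: "b \<in> L2_K" if "b \<in> B" for b using B(2) that by (auto simp: H_sp_def)
 have T0: "(\<Sum>q\<in>Q. a q * expi q \<tau>) = 0" if \<tau>: "0 \<le> \<tau>" "\<tau> \<le> 2 * pi" for \<tau>
 proof -
  obtain c where c: "ae_eq (prin_act \<sigma> (rot \<tau>) f) (\<lambda>k. \<Sum>b\<in>B. c b * b k)" using B(3)[OF rot_in_K] by blast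
  have cq: "expi q \<tau> * coef f q = (\<Sum>b\<in>B. c b * coef b q)" if "q \<in> Q" for q
  proof -
   have "expi q \<tau> * coef f q = coef (prin_act \<sigma> (rot \<tau>) f) q"
    using coef_rot[OF H_fin_borel[OF f] \<tau> Qe[OF that]] by simp
   also have "\<dots> = coef (\<lambda>k. \<Sum>b\<in>B. c b * b k) q"
    using L2_sum[of B "\<lambda>b. b" c] B(1) BL
    by (intro coef_cong[OF _ _ c Qe[OF that]] prin_act_measurable K_in_G rot_in_K H_fin_borel[OF f]) (auto simp: L2_K_def)
   also have "\<dots> = (\<Sum>b\<in>B. c b * coef b q)" by (rule coef_sum[OF B(1) BL Qe[OF that]])
   finally show ?thesis .
  qed
  have "(\<Sum>q\<in>Q. a q * expi q \<tau>) = (\<Sum>q\<in>Q. \<Sum>b\<in>B. c b * (x q * coef b q))"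
  proof (rule sum.cong[OF refl])
   fix q assume q: "q \<in> Q"
   have "a q * expi q \<tau> = x q * (expi q \<tau> * coef f q)" by (simp add: a_def)
   also have "\<dots> = (\<Sum>b\<in>B. c b * (x q * coef b q))" unfolding cq[OF q] by (simp add: sum_distrib_left mult.left_commute)
   finally show "a q * expi q \<tau> = (\<Sum>b\<in>B. c b * (x q * coef b q))" .
  qed
  also have "\<dots> = (\<Sum>b\<in>B. c b * (\<Sum>q\<in>Q. x q * coef b q))" by (subst sum.swap) (simp add: sum_distrib_left)
  also have "\<dots> = 0" using x(2) by simp
  finally show ?thesis .
 qed
 have T: "(\<Sum>q\<in>Q. a q * Z q k) = 0" for k
 proof (cases "k \<in> K_grp")
  case True
  have per: "\<exists>t. 0 \<le> t \<and> t \<le> 2 * pi \<and> rot \<theta> = rot t" for \<theta>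
  proof -
   obtain t where "0 \<le> t" "t < 2 * pi" "cos \<theta> = cos t" "sin \<theta> = sin t"
    using sincos_total_2pi[of "cos \<theta>" "sin \<theta>"] by (metis sin_cos_squared_add2)
   then show ?thesis by (intro exI[of _ t]) (auto simp: mat2_eq_iff)
  qed
  from True show ?thesis
  proof (cases rule: K_grp_cases)
   case (1 \<theta>)
   obtain t where t: "0 \<le> t" "t \<le> 2 * pi" "rot \<theta> = rot t" using per by blast
   have "(\<Sum>q\<in>Q. a q * Z q k) = (\<Sum>q\<in>Q. a q * expi q t)"
    unfolding 1 t(3) by (intro sum.cong refl) (simp add: Z_on_K(1)[OF Qe])
   then show ?thesis using T0[OF t(1,2)] by simp
  next
   case (2 \<theta>)
   obtain t where t: "0 \<le> t" "t \<le> 2 * pi" "rot \<theta> = rot t" using per by blast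
   have "(\<Sum>q\<in>Q. a q * Z q k) = sg * (\<Sum>q\<in>Q. a q * expi q t)"
    unfolding 2 t(3) sum_distrib_left by (intro sum.cong refl) (simp add: Z_on_K(2)[OF Qe])
   then show ?thesis using T0[OF t(1,2)] by simp
  qed
 qed (simp add: zeta_fn_outside)
 obtain q where q: "q \<in> Q" "x q \<noteq> 0" using x(1) by blast
 have "a q = coef (\<lambda>k. \<Sum>q\<in>Q. a q * Z q k) q" using coef_Z_comb[OF Q(2) Qe Qe[OF q(1)], of a] q(1) by simp
 also have "\<dots> = 0" unfolding T by (simp add: coef_def)
 finally show False using q Q(1) by (auto simp: a_def support_def)
qed

lemma H_fin_expand:
 assumes f: "f \<in> H_fin \<sigma>"
 shows "ae_eq f (\<lambda>k. \<Sum>q\<in>support f. coef f q * Z q k)"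
proof -
 let ?T = "\<lambda>k. \<Sum>q\<in>support f. coef f q * Z q k"
 have fin: "finite (support f)" by (rule finite_support[OF f])
 have ev: "\<And>q. q \<in> support f ==> even (q - \<delta>)" by (simp add: support_def)
 have fH: "f \<in> H_sp \<sigma>" using f by (simp add: H_fin_def)
 have fL: "f \<in> L2_K" using fH by (simp add: H_sp_def)
 have TL: "?T \<in> L2_K" using H_cont_sum[OF fin ev, of "coef f"] by (simp add: H_cont_def)
 have "ae_eq (\<lambda>k. f k - ?T k) (\<lambda>k. 0)"
 proof (rule H_sp_zero[OF H_sp_diff_comb[OF fH fin ev]])
  fix q assume q: "even (q - \<delta>)"
  have "coef (\<lambda>k. 1 * f k + (-1) * ?T k) q = 1 * coef f q + (-1) * coef ?T q" by (rule coef_lin[OF fL TL q])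
  also have "coef ?T q = coef f q" using coef_Z_comb[OF fin ev q, of "coef f"] q by (simp add: support_def)
  finally show "coef (\<lambda>k. f k - ?T k) q = 0" by simp
 qed
 then show ?thesis unfolding ae_eq_def by eventually_elim simp
qed

lemma prin_act_lin: "prin_act \<sigma> g (\<lambda>k. \<Sum>i\<in>I. c i * f i k) k = (\<Sum>i\<in>I. c i * prin_act \<sigma> g (f i) k)"
 unfolding prin_act_def by (cases "iwasawa (k ** g)") (simp add: sum_distrib_left mult.left_commute)

lemma Z_comb_borel:
 assumes "\<And>q. q \<in> Q ==> even (q - \<delta>)"
 shows "(\<lambda>k. \<Sum>q\<in>Q. c q * Z q k) \<in> borel_measurable borel"
proof -
 have "Z q \<in> borel_measurable borel" if "q \<in> Q" for q using Z_measurable[OF assms[OF that]] .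
 then show ?thesis by (intro borel_measurable_sum borel_measurable_times) auto
qed

text \<open>Converse of \<open>H_fin_expand\<close>. The translates lie in the span of the weights
  in Q and their negatives, because the reflection maps the weight q to -q.\<close>

lemma H_fin_I:
 assumes f: "f \<in> borel_measurable borel" and Q: "finite Q" "\<And>q. q \<in> Q ==> even (q - \<delta>)" and ae: "ae_eq f (\<lambda>k. \<Sum>q\<in>Q. c q * Z q k)"
 shows "f \<in> H_fin \<sigma>"
proof -
 let ?T = "\<lambda>k. \<Sum>q\<in>Q. c q * Z q k"
 have [measurable]: "f \<in> borel_measurable borel" by fact
 have Tm[measurable]: "?T \<in> borel_measurable borel" by (rule Z_comb_borel[OF Q(2)])
 have TH: "(\<lambda>k. \<Sum>q\<in>Q'. c' q * Z q k) \<in> H_cont \<sigma>" if "finite Q'" "\<And>q. q \<in> Q' ==> even (q - \<delta>)" for Q' c'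
  by (rule H_cont_sum[OF that])
 have ZH: "Z q \<in> H_cont \<sigma>" if "even (q - \<delta>)" for q using TH[of "{q}" "\<lambda>_. 1"] that by simp
 have n0: "L2_norm (\<lambda>k. 0) = 0" by (simp add: L2_norm_def)
 have cont_sp: "h \<in> H_sp \<sigma>" if "h \<in> H_cont \<sigma>" for h
  using that n0 unfolding H_sp_def by (auto simp: H_cont_def intro!: bexI[of _ h])
 have fL: "f \<in> L2_K"
 proof (rule L2_K_bounded[OF f])
  show "AE k in haar_K. norm (f k) \<le> (\<Sum>q\<in>Q. norm (c q))"
   using ae[unfolded ae_eq_def]
  proof eventually_elim
   case (elim k)
   have "norm (c q * Z q k) \<le> norm (c q)" if "q \<in> Q" for q
    using mult_left_mono[OF norm_Z_le[OF Q(2)[OF that], of k], of "norm (c q)"] by (simp add: norm_mult)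
   then show ?case unfolding elim by (rule sum_norm_le)
  qed
 qed
 have "L2_norm (\<lambda>k. f k - ?T k) = 0"
 proof -
  have "(\<integral>k. (cmod (f k - ?T k))\<^sup>2 \<partial>haar_K) = (\<integral>k. 0 \<partial>haar_K)"
   using ae unfolding ae_eq_def by (intro integral_cong_AE) auto
  then show ?thesis by (simp add: L2_norm_def)
 qed
 then have fH: "f \<in> H_sp \<sigma>" using fL TH[OF Q] unfolding H_sp_def by (auto intro!: bexI[of _ ?T])
 define Q' where "Q' = Q \<union> uminus ` Q"
 have Q'1: "finite Q'" unfolding Q'_def using Q(1) by simp
 have Q'2: "even (q - \<delta>)" if "q \<in> Q'" for q
 proof (cases "q \<in> Q")
  case False
  then have "- q \<in> Q" using that by (auto simp: Q'_def)
  then show ?thesis using Q(2)[of "- q"] by presburger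
 qed (rule Q(2))
 note Q' = Q'1 Q'2
 have "\<exists>c. ae_eq (prin_act \<sigma> \<kappa> f) (\<lambda>k. \<Sum>b\<in>Z ` Q'. c b * b k)" if \<kappa>: "\<kappa> \<in> K_grp" for \<kappa>
 proof -
  have ae1: "ae_eq (prin_act \<sigma> \<kappa> f) (prin_act \<sigma> \<kappa> ?T)" by (rule prin_act_ae_eq[OF K_in_G[OF \<kappa>] f Tm ae])
  have "\<exists>d. \<forall>k\<in>K_grp. ?T (k ** \<kappa>) = (\<Sum>q\<in>Q'. d q * Z q k)"
   using \<kappa>
  proof (cases rule: K_grp_cases)
   case (1 \<tau>)
   let ?d = "\<lambda>q. if q \<in> Q then c q * expi q \<tau> else 0"
   have "?T (k ** \<kappa>) = (\<Sum>q\<in>Q'. ?d q * Z q k)" if "k \<in> K_grp" for k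
   proof -
    have "?T (k ** \<kappa>) = (\<Sum>q\<in>Q. ?d q * Z q k)" unfolding 1 by (intro sum.cong refl) (simp add: Z_rot[OF that Q(2)])
    also have "\<dots> = (\<Sum>q\<in>Q'. ?d q * Z q k)" using Q'(1) by (intro sum.mono_neutral_left) (auto simp: Q'_def)
    finally show ?thesis .
   qed
   then show ?thesis by (intro exI[of _ ?d]) blast
  next
   case (2 \<tau>)
   let ?d = "\<lambda>q. if - q \<in> Q then c (- q) * expi (- q) \<tau> * sg else 0"
   have "?T (k ** \<kappa>) = (\<Sum>q\<in>Q'. ?d q * Z q k)" if "k \<in> K_grp" for k
   proof -
    have "?T (k ** \<kappa>) = (\<Sum>q\<in>Q. ?d (- q) * Z (- q) k)"
     unfolding 2 matrix_mul_assoc using that by (intro sum.cong refl) (simp add: Z_rot[OF _ Q(2)] Z_refl2[OF _ Q(2)])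
    also have "\<dots> = (\<Sum>q\<in>uminus ` Q. ?d q * Z q k)" by (subst sum.reindex) (auto simp: inj_on_def)
    also have "\<dots> = (\<Sum>q\<in>Q'. ?d q * Z q k)" using Q'(1) by (intro sum.mono_neutral_left) (auto simp: Q'_def dest: imageI[of _ _ uminus])
    finally show ?thesis .
   qed
   then show ?thesis by (intro exI[of _ ?d]) blast
  qed
  then obtain d where d: "\<And>k. k \<in> K_grp ==> ?T (k ** \<kappa>) = (\<Sum>q\<in>Q'. d q * Z q k)" by blast
  obtain c' where c': "\<And>k. (\<Sum>q\<in>Q'. d q * Z q k) = (\<Sum>b\<in>Z ` Q'. c' b * b k)" using sum_image_coeff[OF Q'(1), of d Z] by blast
  have "ae_eq (prin_act \<sigma> \<kappa> f) (\<lambda>k. \<Sum>b\<in>Z ` Q'. c' b * b k)"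
   unfolding ae_eq_def using ae1[unfolded ae_eq_def] AE_haar_K_in_K
   by eventually_elim (simp add: prin_act_K \<kappa> d c')
  then show ?thesis by blast
 qed
 moreover have "finite (Z ` Q')" "Z ` Q' \<subseteq> H_sp \<sigma>" using Q' cont_sp ZH by auto
 ultimately show ?thesis using fH unfolding H_fin_def by blast
qed

end

section \<open>Ladders of weights\<close>

abbreviation X_poly :: "complex poly" where "X_poly \<equiv> [:0, 1:]"

text \<open>A pair of polynomials \<open>(A, B)\<close> stands for the function \<open>A(z) F(z) + B(z) H(z)\<close>, where
 \<open>(F, H)\<close> is a Bessel pair of order \<open>r\<close>. On such functions \<open>z d/dz\<close> is an algebraic operation, and
 the raising (\<open>l = 1\<close>) and lowering (\<open>l = -1\<close>) operators \<open>2 z d/dz + k + q - 2 l z\<close> become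
 the following one.\<close>

definition ladder_op :: "complex => complex => complex => complex => complex poly \<times> complex poly => complex poly \<times> complex poly" where
 "ladder_op r k l q S = (case S of (A, B) =>
   (2 * (X_poly * pderiv A + [:r:] * A - X_poly * B) + ([:k:] + [:q:]) * A - 2 * [:l:] * X_poly * A,
   2 * (X_poly * pderiv B - X_poly * A - ([:r:] + 1) * B) + ([:k:] + [:q:]) * B - 2 * [:l:] * X_poly * B))"

definition pair_scale :: "complex => complex poly \<times> complex poly => complex poly \<times> complex poly" where
 "pair_scale c S = ([:c:] * fst S, [:c:] * snd S)"

definition pair_add :: "complex poly \<times> complex poly => complex poly \<times> complex poly => complex poly \<times> complex poly" where
 "pair_add S T = (fst S + fst T, snd S + snd T)"

lemma pderiv_X_poly: "pderiv X_poly = 1" by (simp add: pderiv_pCons)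
lemma pderiv_const_poly: "pderiv [:c:] = (0 :: complex poly)" by (simp add: pderiv_pCons)
lemma pderiv_2: "pderiv (2 :: complex poly) = 0" by (metis pderiv_const_poly numeral_poly)
lemma pderiv_one': "pderiv (1 :: complex poly) = 0" by (metis pderiv_const_poly one_pCons)

lemma const_poly_add: "[:a + b:] = [:a:] + [:b :: complex:]" "[:- a:] = - [:a :: complex:]" "[:a - b:] = [:a:] - [:b :: complex:]"
 "[:a * b:] = [:a:] * [:b :: complex:]" "[:numeral n:] = (numeral n :: complex poly)"
 by (simp_all add: numeral_poly)

text \<open>As in sl(2), the commutator of raising and lowering is a multiple of the weight; the
  arguments q + 2 and q - 2 record the weight reached after the first step. The identity is formal
  in all parameters.\<close>

lemma ladder_op_commutator:
 "ladder_op r k (- l) (- (q + 2)) (ladder_op r k l q S) =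
   pair_add (ladder_op r k l (q - 2) (ladder_op r k (- l) (- q) S)) (pair_scale (- (4 * q)) S)"
proof (cases S)
 case (Pair A B)
 obtain X :: "complex poly" where X: "X = X_poly" "pderiv X = 1" using pderiv_X_poly by blast
 obtain R K L Q :: "complex poly" where c: "R = [:r:]" "K = [:k:]" "L = [:l:]" "Q = [:q:]"
  "pderiv R = 0" "pderiv K = 0" "pderiv L = 0" "pderiv Q = 0" using pderiv_const_poly by blast
 show ?thesis
  unfolding Pair ladder_op_def pair_add_def pair_scale_def prod.case fst_conv snd_conv Pair_inject const_poly_add
   X(1)[symmetric] c(1-4)[symmetric]
  by (simp only: pderiv_add pderiv_diff pderiv_mult pderiv_minus X(2) c(5-8) pderiv_2 pderiv_one') (simp add: algebra_simps)
qed

lemma ladder_op_scale: "ladder_op r k l q (pair_scale c S) = pair_scale c (ladder_op r k l q S)"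
proof (cases S)
 case (Pair A B)
 obtain C :: "complex poly" where C: "C = [:c:]" "pderiv C = 0" using pderiv_const_poly by blast
 show ?thesis
  unfolding Pair ladder_op_def pair_scale_def prod.case fst_conv snd_conv Pair_inject C(1)[symmetric]
  by (simp only: pderiv_mult C(2)) (simp add: algebra_simps)
qed

lemma pair_scale_scale: "pair_scale a (pair_scale b S) = pair_scale (a * b) S"
 unfolding pair_scale_def fst_conv snd_conv const_poly_add mult.assoc ..

lemma pair_add_scale: "pair_add (pair_scale a S) (pair_scale b S) = pair_scale (a + b) S"
 unfolding pair_scale_def pair_add_def fst_conv snd_conv const_poly_add distrib_right ..

lemma pair_scale_1 [simp]: "pair_scale 1 S = S" by (simp add: pair_scale_def one_pCons[symmetric])

text \<open>Each step divides by the factor that the raising relation has to carry, so this relation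
  holds by construction. With l = -1 the same recursion runs through the negative weights.\<close>

primrec ladder :: "complex => complex => complex => complex => complex poly \<times> complex poly => int => nat => complex poly \<times> complex poly" where
 "ladder \<nu> r k l S p 0 = S"
| "ladder \<nu> r k l S p (Suc n) = pair_scale (1 / (\<nu> + 1 + of_int (p + 2 * int n))) (ladder_op r k l (of_int (p + 2 * int n)) (ladder \<nu> r k l S p n))"

text \<open>Raising followed by lowering has the eigenvalue \<nu>^2 - (q + 1)^2 at weight q, a form
  of the Casimir element. \<open>base\<close> is the first instance, the commutator carries it along
  the ladder, and cancelling \<nu> + 1 + q leaves the lowering relation.\<close>

lemma ladder_rel:
 assumes nz: "\<And>n. \<nu> + 1 + of_int (p + 2 * int n) \<noteq> 0"
  and base: "ladder_op r k (- l) (- (of_int p + 2)) (ladder_op r k l (of_int p) S) = pair_scale (\<nu>\<^sup>2 - (of_int p + 1)\<^sup>2) S"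
 defines "L \<equiv> ladder \<nu> r k l S p"
 shows "ladder_op r k l (of_int (p + 2 * int n)) (L n) = pair_scale (\<nu> + 1 + of_int (p + 2 * int n)) (L (Suc n))"
  "ladder_op r k (- l) (- (of_int (p + 2 * int n) + 2)) (L (Suc n)) = pair_scale (\<nu> - 1 - of_int (p + 2 * int n)) (L n)"
proof -
 let ?q = "\<lambda>n. of_int (p + 2 * int n) :: complex"
 have up: "ladder_op r k l (?q n) (L n) = pair_scale (\<nu> + 1 + ?q n) (L (Suc n))" for n
  unfolding L_def using nz[of n] by (simp add: pair_scale_scale)
 have inv: "ladder_op r k (- l) (- (?q n + 2)) (ladder_op r k l (?q n) (L n)) = pair_scale (\<nu>\<^sup>2 - (?q n + 1)\<^sup>2) (L n)" for n
 proof (induction n)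
  case 0
  show ?case using base by (simp add: L_def)
 next
  case (Suc n)
  have down: "ladder_op r k (- l) (- ?q (Suc n)) (L (Suc n)) = pair_scale (\<nu> - 1 - ?q n) (L n)"
  proof -
   have e: "?q (Suc n) = ?q n + 2" by simp
   have "L (Suc n) = pair_scale (1 / (\<nu> + 1 + ?q n)) (ladder_op r k l (?q n) (L n))" by (simp add: L_def)
   then have "ladder_op r k (- l) (- ?q (Suc n)) (L (Suc n)) = pair_scale (1 / (\<nu> + 1 + ?q n) * (\<nu>\<^sup>2 - (?q n + 1)\<^sup>2)) (L n)"
    unfolding e by (simp only: ladder_op_scale Suc pair_scale_scale)
   also have "1 / (\<nu> + 1 + ?q n) * (\<nu>\<^sup>2 - (?q n + 1)\<^sup>2) = \<nu> - 1 - ?q n"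
   proof -
    have "\<nu>\<^sup>2 - (?q n + 1)\<^sup>2 = (\<nu> + 1 + ?q n) * (\<nu> - 1 - ?q n)" by (simp add: power2_eq_square algebra_simps)
    then show ?thesis using nz[of n] by simp
   qed
   finally show ?thesis .
  qed
  have e2: "?q (Suc n) - 2 = ?q n" by simp
  have "ladder_op r k (- l) (- (?q (Suc n) + 2)) (ladder_op r k l (?q (Suc n)) (L (Suc n)))
    = pair_add (ladder_op r k l (?q n) (pair_scale (\<nu> - 1 - ?q n) (L n))) (pair_scale (- (4 * ?q (Suc n))) (L (Suc n)))"
   unfolding ladder_op_commutator down e2 ..
  also have "\<dots> = pair_scale ((\<nu> - 1 - ?q n) * (\<nu> + 1 + ?q n) + (- (4 * ?q (Suc n)))) (L (Suc n))"
   unfolding ladder_op_scale up pair_scale_scale pair_add_scale ..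
  also have "(\<nu> - 1 - ?q n) * (\<nu> + 1 + ?q n) + (- (4 * ?q (Suc n))) = \<nu>\<^sup>2 - (?q (Suc n) + 1)\<^sup>2"
   by (simp add: power2_eq_square algebra_simps)
  finally show ?case .
 qed
 show "ladder_op r k l (?q n) (L n) = pair_scale (\<nu> + 1 + ?q n) (L (Suc n))" by (rule up)
 have "L (Suc n) = pair_scale (1 / (\<nu> + 1 + ?q n)) (ladder_op r k l (?q n) (L n))" by (simp add: L_def)
 then have "ladder_op r k (- l) (- (?q n + 2)) (L (Suc n)) = pair_scale (1 / (\<nu> + 1 + ?q n) * (\<nu>\<^sup>2 - (?q n + 1)\<^sup>2)) (L n)"
  by (simp only: ladder_op_scale inv pair_scale_scale)
 also have "1 / (\<nu> + 1 + ?q n) * (\<nu>\<^sup>2 - (?q n + 1)\<^sup>2) = \<nu> - 1 - ?q n"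
 proof -
  have "\<nu>\<^sup>2 - (?q n + 1)\<^sup>2 = (\<nu> + 1 + ?q n) * (\<nu> - 1 - ?q n)" by (simp add: power2_eq_square algebra_simps)
  then show ?thesis using nz[of n] by simp
 qed
 finally show "ladder_op r k (- l) (- (?q n + 2)) (L (Suc n)) = pair_scale (\<nu> - 1 - ?q n) (L n)" .
qed

text \<open>Here \<open>d = \<delta>\<^sub>1 - \<delta>\<^sub>2 \<in> {0, 1}\<close>; the ladders start from weight \<open>0\<close> in the first case and from the
 weights \<open>\<plusminus>1\<close> in the second.\<close>

definition bessel_order :: "complex => int => complex" where
 "bessel_order \<nu> d = (\<nu> - of_int d) / 2"

text \<open>For d = 0 the weight 0 is F itself. For d = 1 the weights \<plusminus>1 are \<i> (F
  \<plusminus> H), which is \<i>^q (H + q F) with q the weight.\<close>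

definition base_pair :: "int => int => complex poly \<times> complex poly" where
 "base_pair d e = (if d = 0 then (1, 0) else ([:\<i>:], [:of_int e * \<i>:]))"

definition weight_pair :: "complex => int => int => complex poly \<times> complex poly" where
 "weight_pair \<nu> d q = (if q \<ge> 0 then ladder \<nu> (bessel_order \<nu> d) (1 + of_int d) 1 (base_pair d 1) d (nat ((q - d) div 2))
   else ladder \<nu> (bessel_order \<nu> d) (1 + of_int d) (-1) (base_pair d (-1)) d (nat ((- q - d) div 2)))"

text \<open>The weights 1 and -1 are neighbours, and the factor between them is \<nu> + 1 - 1 =
  \<nu> in both directions.\<close>

lemma base_pair_step:
 "ladder_op (bessel_order \<nu> 1) 2 1 (-1) (base_pair 1 (-1)) = pair_scale \<nu> (base_pair 1 1)"
 "ladder_op (bessel_order \<nu> 1) 2 (-1) (-1) (base_pair 1 1) = pair_scale \<nu> (base_pair 1 (-1))"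
 by (simp_all add: ladder_op_def base_pair_def pair_scale_def bessel_order_def pderiv_pCons numeral_poly one_pCons algebra_simps diff_divide_distrib)

text \<open>For d = 0 this is the modified Bessel equation of order \<nu>/2. For d = 1 it follows
  from the commutator, because going from one of the weights \<plusminus>1 to the other and back
  multiplies by \<nu>^2.\<close>

lemma base_pair_ODE:
 assumes d: "d \<in> {0, 1}" and l: "l \<in> {1, -1 :: int}"
 shows "ladder_op (bessel_order \<nu> d) (1 + of_int d) (- of_int l) (- (of_int d + 2)) (ladder_op (bessel_order \<nu> d) (1 + of_int d) (of_int l) (of_int d) (base_pair d l))
   = pair_scale (\<nu>\<^sup>2 - (of_int d + 1)\<^sup>2) (base_pair d l)"
proof (cases "d = 0")
 case True
 have "l = 1 \<or> l = -1" using l by auto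
 then show ?thesis using True
  by (auto simp: ladder_op_def base_pair_def pair_scale_def bessel_order_def pderiv_pCons numeral_poly one_pCons algebra_simps power2_eq_square)
next
 case False
 then have d1: "d = 1" using d by auto
 have e: "(1::complex) + 1 = 2" "(1::complex) - 2 = - 1" "- (- 1) = (1::complex)" by simp_all
 have "l = 1 \<or> l = -1" using l by auto
 then show ?thesis
 proof
  assume "l = 1"
  then show ?thesis unfolding d1 of_int_1 ladder_op_commutator e
   by (simp add: base_pair_step ladder_op_scale pair_scale_scale pair_add_scale power2_eq_square)
 next
  assume "l = -1"
  then show ?thesis unfolding d1 of_int_1 ladder_op_commutator e
   by (simp add: e base_pair_step ladder_op_scale pair_scale_scale pair_add_scale power2_eq_square)
 qed
qed

text \<open>One ladder covers q \<ge> d and the other q \<le> -d. They share the weight 0 if d = 0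
  and are joined by the step between -1 and 1 if d = 1; elsewhere each relation belongs to a single
  ladder.\<close>

lemma weight_pair_rel:
 assumes d: "d \<in> {0, 1}" and nz: "\<And>n::nat. \<nu> + 1 + of_int (d + 2 * int n) \<noteq> 0" and q: "even (q - d)"
 defines "T \<equiv> ladder_op (bessel_order \<nu> d) (1 + of_int d)"
 shows "T 1 (of_int q) (weight_pair \<nu> d q) = pair_scale (\<nu> + 1 + of_int q) (weight_pair \<nu> d (q + 2))"
  "T (-1) (- of_int q) (weight_pair \<nu> d q) = pair_scale (\<nu> + 1 - of_int q) (weight_pair \<nu> d (q - 2))"
proof -
 let ?r = "bessel_order \<nu> d" and ?k = "1 + of_int d :: complex"
 let ?U = "ladder \<nu> ?r ?k 1 (base_pair d 1) d" and ?D = "ladder \<nu> ?r ?k (-1) (base_pair d (-1)) d"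
 have U: "weight_pair \<nu> d (d + 2 * int n) = ?U n" for n using d by (auto simp: weight_pair_def)
 \<comment> \<open>At weight 0 the definition takes the upward ladder; both ladders start there from
   the same pair.\<close>
 have D: "weight_pair \<nu> d (- (d + 2 * int n)) = ?D n" for n
 proof (cases "d + 2 * int n = 0")
  case True
  then have "d = 0" "n = 0" using d by auto
  then show ?thesis by (simp add: weight_pair_def base_pair_def)
 next
  case False
  then show ?thesis using d by (auto simp: weight_pair_def)
 qed
 have bU: "ladder_op ?r ?k (- 1) (- (of_int d + 2)) (ladder_op ?r ?k 1 (of_int d) (base_pair d 1)) = pair_scale (\<nu>\<^sup>2 - (of_int d + 1)\<^sup>2) (base_pair d 1)"
  using base_pair_ODE[OF d, of 1] by simp
 have bD: "ladder_op ?r ?k (- (- 1)) (- (of_int d + 2)) (ladder_op ?r ?k (-1) (of_int d) (base_pair d (-1))) = pair_scale (\<nu>\<^sup>2 - (of_int d + 1)\<^sup>2) (base_pair d (-1))"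
  using base_pair_ODE[OF d, of "-1"] by simp
 note u = ladder_rel[OF nz bU] and v = ladder_rel[OF nz bD, unfolded minus_minus]
 have cases_q: "(\<exists>n. q = d + 2 * int n) \<or> (\<exists>n. q = - (d + 2 * int n))" if "even (q - d)" for q :: int
 proof (cases "q \<ge> d")
  case True
  then have "q = d + 2 * int (nat ((q - d) div 2))" using that by auto
  then show ?thesis by blast
 next
  case False
  have "d = 0 \<or> d = 1" using d by auto
  then have "- q \<ge> d" using False that by presburger
  moreover have "even (- q - d)" using that by presburger
  ultimately have "q = - (d + 2 * int (nat ((- q - d) div 2)))" by auto
  then show ?thesis by blast
 qed
 have raise_up: "T 1 (of_int (d + 2 * int n)) (?U n) = pair_scale (\<nu> + 1 + of_int (d + 2 * int n)) (?U (Suc n))" for n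
  unfolding T_def by (rule u(1))
 have lower_up: "T (-1) (- of_int (d + 2 * int (Suc n))) (?U (Suc n)) = pair_scale (\<nu> + 1 - of_int (d + 2 * int (Suc n))) (?U n)" for n
 proof -
  have "of_int (d + 2 * int (Suc n)) = (of_int (d + 2 * int n) + 2 :: complex)" by simp
  moreover have "\<nu> + 1 - (of_int (d + 2 * int n) + 2) = \<nu> - 1 - of_int (d + 2 * int n)" by simp
  ultimately show ?thesis unfolding T_def using u(2)[of n] by (simp only:)
 qed
 have lower_down: "T (-1) (of_int (d + 2 * int n)) (?D n) = pair_scale (\<nu> + 1 + of_int (d + 2 * int n)) (?D (Suc n))" for n
  unfolding T_def by (rule v(1))
 \<comment> \<open>On the downward ladder the operator with l = 1 is the one that steps
   back.\<close>
 have raise_down: "T 1 (- of_int (d + 2 * int (Suc n))) (?D (Suc n)) = pair_scale (\<nu> + 1 - of_int (d + 2 * int (Suc n))) (?D n)" for n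
 proof -
  have "of_int (d + 2 * int (Suc n)) = (of_int (d + 2 * int n) + 2 :: complex)" by simp
  moreover have "\<nu> + 1 - (of_int (d + 2 * int n) + 2) = \<nu> - 1 - of_int (d + 2 * int n)" by simp
  moreover have "ladder_op ?r ?k 1 (- (of_int (d + 2 * int n) + 2)) (?D (Suc n)) = pair_scale (\<nu> - 1 - of_int (d + 2 * int n)) (?D n)"
   by (rule v(2))
  ultimately show ?thesis unfolding T_def by (simp only:)
 qed
 have base0: "?U 0 = ?D 0" if "d = 0" using that by (simp add: base_pair_def)
 have base1: "T 1 (-1) (?D 0) = pair_scale \<nu> (?U 0)" "T (-1) (-1) (?U 0) = pair_scale \<nu> (?D 0)" if "d = 1"
  using base_pair_step[of \<nu>] that by (simp_all add: T_def)
 show "T 1 (of_int q) (weight_pair \<nu> d q) = pair_scale (\<nu> + 1 + of_int q) (weight_pair \<nu> d (q + 2))"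
  using cases_q[OF q]
 proof (elim disjE exE)
  fix n assume n: "q = d + 2 * int n"
  then have e: "q + 2 = d + 2 * int (Suc n)" by simp
  show ?thesis unfolding e U unfolding n U by (rule raise_up)
 next
  fix n assume n: "q = - (d + 2 * int n)"
  show ?thesis
  proof (cases n)
   case (Suc m)
   then have e: "q + 2 = - (d + 2 * int m)" "q = - (d + 2 * int (Suc m))" using n by simp_all
   show ?thesis unfolding e(1) D unfolding e(2) D using raise_down[of m] by (simp only: of_int_minus diff_conv_add_uminus)
  next
   case 0
   show ?thesis
   proof (cases "d = 0")
    case True
    then have e: "q = d + 2 * int 0" "q + 2 = d + 2 * int (Suc 0)" using 0 n by simp_all
    show ?thesis unfolding e(2) U unfolding e(1) U by (rule raise_up)
   next
    case False
    then have d1: "d = 1" using d by auto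
    then have e: "q + 2 = d + 2 * int 0" "q = - (d + 2 * int 0)" using 0 n by simp_all
    have f: "of_int q = (-1 :: complex)" using e d1 by simp
    show ?thesis unfolding f e(1) U unfolding e(2) D using base1(1)[OF d1] by simp
   qed
  qed
 qed
 show "T (-1) (- of_int q) (weight_pair \<nu> d q) = pair_scale (\<nu> + 1 - of_int q) (weight_pair \<nu> d (q - 2))"
  using cases_q[OF q]
 proof (elim disjE exE)
  fix n assume n: "q = - (d + 2 * int n)"
  then have e: "q - 2 = - (d + 2 * int (Suc n))" by simp
  show ?thesis unfolding e D unfolding n D using lower_down[of n] by (simp only: of_int_minus minus_minus diff_minus_eq_add)
 next
  fix n assume n: "q = d + 2 * int n"
  show ?thesis
  proof (cases n)
   case (Suc m)
   then have e: "q - 2 = d + 2 * int m" "q = d + 2 * int (Suc m)" using n by simp_all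
   show ?thesis unfolding e(1) U unfolding e(2) U using lower_up[of m] .
  next
   case 0
   show ?thesis
   proof (cases "d = 0")
    case True
    then have e: "q = - (d + 2 * int 0)" "q - 2 = - (d + 2 * int (Suc 0))" using 0 n by simp_all
    show ?thesis unfolding e(2) D unfolding e(1) D using lower_down[of 0] by (simp only: of_int_minus minus_minus diff_minus_eq_add)
   next
    case False
    then have d1: "d = 1" using d by auto
    then have e: "q - 2 = - (d + 2 * int 0)" "q = d + 2 * int 0" using 0 n by simp_all
    have f: "of_int q = (1 :: complex)" using e d1 by simp
    show ?thesis unfolding f e(1) D unfolding e(2) U using base1(2)[OF d1] by simp
   qed
  qed
 qed
qed

section \<open>From polynomial pairs to radial functions\<close>

definition pair_eval :: "(real => complex) => (real => complex) => complex poly \<times> complex poly => real => complex" where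
 "pair_eval F H S z = poly (fst S) (of_real z) * F z + poly (snd S) (of_real z) * H z"

text \<open>The exponent is chosen so that 2 y d/dy - \<mu>, applied to the power of y, leaves 1 +
  d, the constant k of the ladder operators. With z = 2 pi y the terms \<plusminus>4 pi y of the
  system become \<plusminus>2 z.\<close>

definition whittaker_weight :: "complex => complex => int => (real => complex) => (real => complex) => int => real => complex" where
 "whittaker_weight \<mu> \<nu> d F H q y = of_real y powr ((\<mu> + 1 + of_int d) / 2) * pair_eval F H (weight_pair \<nu> d q) (2 * pi * y)"

lemma pair_eval_scale: "pair_eval F H (pair_scale c S) z = c * pair_eval F H S z"
 by (simp add: pair_eval_def pair_scale_def algebra_simps)

lemma pair_eval_deriv:
 assumes BP: "bessel_pair r F H" and z: "z > 0"
 shows "\<exists>D. (pair_eval F H S has_vector_derivative D) (at z) \<and>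
   (\<forall>k l q. pair_eval F H (ladder_op r k l q S) z = 2 * of_real z * D + (k + q - 2 * l * of_real z) * pair_eval F H S z)"
proof -
 obtain A B where S: "S = (A, B)" by (cases S)
 let ?z = "complex_of_real z"
 have P: "((\<lambda>z. poly p (of_real z)) has_vector_derivative poly (pderiv p) ?z) (at z)" for p :: "complex poly"
  by (rule has_vector_derivative_real_field[OF poly_DERIV])
 have F: "(F has_vector_derivative r / ?z * F z - H z) (at z)" and H: "(H has_vector_derivative - F z - (r + 1) / ?z * H z) (at z)"
  using BP z unfolding bessel_pair_def by auto
 let ?D = "(poly A ?z * (r / ?z * F z - H z) + poly (pderiv A) ?z * F z) + (poly B ?z * (- F z - (r + 1) / ?z * H z) + poly (pderiv B) ?z * H z)"
 have "(pair_eval F H S has_vector_derivative ?D) (at z)"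
  unfolding pair_eval_def[abs_def] S fst_conv snd_conv
  by (intro has_vector_derivative_add has_vector_derivative_mult P F H)
 moreover have "pair_eval F H (ladder_op r k l q S) z = 2 * ?z * ?D + (k + q - 2 * l * ?z) * pair_eval F H S z" for k l q
 proof -
  have "?z \<noteq> 0" using z by simp
  then have "?z * ?D = (poly A ?z * (r * F z - ?z * H z) + ?z * poly (pderiv A) ?z * F z) + (poly B ?z * (- ?z * F z - (r + 1) * H z) + ?z * poly (pderiv B) ?z * H z)"
   by (simp add: field_simps)
  then have *: "2 * ?z * ?D = 2 * ((poly A ?z * (r * F z - ?z * H z) + ?z * poly (pderiv A) ?z * F z) + (poly B ?z * (- ?z * F z - (r + 1) * H z) + ?z * poly (pderiv B) ?z * H z))"
   by (simp only: mult.assoc)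
  show ?thesis unfolding * S ladder_op_def pair_eval_def prod.case fst_conv snd_conv
   by (simp add: algebra_simps)
 qed
 ultimately show ?thesis by blast
qed

lemma whittaker_weight_system:
 assumes BP: "bessel_pair (bessel_order \<nu> d) F H" and d: "d \<in> {0, 1}" and nz: "\<And>n::nat. \<nu> + 1 + of_int (d + 2 * int n) \<noteq> 0"
 shows "whittaker_system 1 \<mu> \<nu> d (whittaker_weight \<mu> \<nu> d F H)"
 unfolding whittaker_system_def
proof (intro allI impI)
 fix q :: int and y :: real assume q: "even (q - d)" and y: "y > 0"
 let ?a = "(\<mu> + 1 + of_int d) / 2" and ?S = "weight_pair \<nu> d q" and ?z = "2 * pi * y"
 have z: "?z > 0" using y by simp
 obtain D where D: "(pair_eval F H ?S has_vector_derivative D) (at ?z)"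
  "\<And>k l q. pair_eval F H (ladder_op (bessel_order \<nu> d) k l q ?S) ?z = 2 * of_real ?z * D + (k + q - 2 * l * of_real ?z) * pair_eval F H ?S ?z"
  using pair_eval_deriv[OF BP z] by blast
 have 1: "((\<lambda>y. of_real y powr ?a) has_vector_derivative (?a / of_real y * of_real y powr ?a)) (at y)"
  using has_vector_derivative_powr_real[OF y, of 1 ?a] by simp
 have 2: "((\<lambda>y. pair_eval F H ?S (2 * pi * y)) has_vector_derivative (2 * pi) *\<^sub>R D) (at y)"
 proof -
  have "((\<lambda>y. 2 * pi * y) has_vector_derivative 2 * pi) (at y)"
   using DERIV_cmult_Id[of "2 * pi" y UNIV] by (simp add: has_real_derivative_iff_has_vector_derivative)
  from vector_diff_chain_at[OF this D(1)] show ?thesis by (simp add: o_def)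
 qed
 let ?D = "of_real y powr ?a * ((2 * pi) *\<^sub>R D) + ?a / of_real y * of_real y powr ?a * pair_eval F H ?S ?z"
 have dw: "(whittaker_weight \<mu> \<nu> d F H q has_vector_derivative ?D) (at y)"
  using has_vector_derivative_mult[OF 1 2] unfolding whittaker_weight_def[abs_def] .
 have yD: "2 * of_real y * ?D = of_real y powr ?a * (2 * of_real ?z * D + (\<mu> + 1 + of_int d) * pair_eval F H ?S ?z)"
  using y by (simp add: scaleR_conv_of_real field_simps)
 have R: "of_real y powr ?a * (2 * of_real ?z * D + (1 + of_int d + of_int q - 2 * 1 * of_real ?z) * pair_eval F H ?S ?z)
   = (\<nu> + 1 + of_int q) * whittaker_weight \<mu> \<nu> d F H (q + 2) y"
  unfolding D(2)[symmetric] weight_pair_rel(1)[OF d nz q] pair_eval_scale whittaker_weight_def by (simp only: mult.left_commute)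
 have L: "of_real y powr ?a * (2 * of_real ?z * D + (1 + of_int d + - of_int q - 2 * (-1) * of_real ?z) * pair_eval F H ?S ?z)
   = (\<nu> + 1 - of_int q) * whittaker_weight \<mu> \<nu> d F H (q - 2) y"
  unfolding D(2)[symmetric] weight_pair_rel(2)[OF d nz q] pair_eval_scale whittaker_weight_def by (simp only: mult.left_commute)
 show "\<exists>D. (whittaker_weight \<mu> \<nu> d F H q has_vector_derivative D) (at y) \<and>
   2 * of_real y * D - 4 * of_real pi * of_real 1 * of_real y * whittaker_weight \<mu> \<nu> d F H q y + (of_int q - \<mu>) * whittaker_weight \<mu> \<nu> d F H q y = (\<nu> + 1 + of_int q) * whittaker_weight \<mu> \<nu> d F H (q + 2) y \<and>
   2 * of_real y * D + 4 * of_real pi * of_real 1 * of_real y * whittaker_weight \<mu> \<nu> d F H q y + (- of_int q - \<mu>) * whittaker_weight \<mu> \<nu> d F H q y = (\<nu> + 1 - of_int q) * whittaker_weight \<mu> \<nu> d F H (q - 2) y"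
  unfolding R[symmetric] L[symmetric]
  by (rule exI[of _ ?D], intro conjI dw; unfold yD; simp add: whittaker_weight_def algebra_simps)
qed

lemma pair_eval_lin: "pair_eval (\<lambda>z. a * F z + b * F' z) (\<lambda>z. a * H z + b * H' z) S z = a * pair_eval F H S z + b * pair_eval F' H' S z"
 by (simp add: pair_eval_def algebra_simps)

text \<open>The inequality v \<le> exp v for v = x cosh u / n gives exp (- x cosh u) \<le> (2 n /
  x)^n exp (- n |u|). The choice n \<ge> |Re r| + 1 leaves an integrable exp (- |u|) after the
  factor exp (Re r * u) is absorbed.\<close>

lemma K_int_poly_bound:
 obtains C N where "C \<ge> 0" "\<And>x. x > 0 ==> norm (K_int r x) \<le> C * (1 / x) ^ (N::nat)"
proof -
 obtain n :: nat where n: "real n \<ge> \<bar>Re r\<bar> + 1" "n > 0" using real_arch_simple[of "\<bar>Re r\<bar> + 1"] by (metis abs_ge_zero add_nonneg_pos less_numeral_extra(1) of_nat_0_less_iff order_less_le_trans)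
 define C where "C = (2 * real n) ^ n * (LBINT u::real. 2 / (1 + u\<^sup>2))"
 show ?thesis
 proof (rule that[of C n])
  show "C \<ge> 0" unfolding C_def by (intro mult_nonneg_nonneg integral_nonneg_AE) (auto intro!: divide_nonneg_nonneg add_nonneg_nonneg)
  fix x :: real assume x: "x > 0"
  have "norm (K_int r x) \<le> (LBINT u. (2 * real n / x) ^ n * (2 / (1 + u\<^sup>2)))"
   unfolding K_int_def
  proof (rule Bochner_Integration.integral_norm_bound_integral[OF K_ker_integrable[OF x]])
   show "integrable lborel (\<lambda>u::real. (2 * real n / x) ^ n * (2 / (1 + u\<^sup>2)))"
    by (intro integrable_mult_right integrable_inverse_one_plus_square)
   fix u :: real
   have c: "cosh u \<ge> exp \<bar>u\<bar> / 2" by (cases "u \<ge> 0") (auto simp: cosh_def)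
   define v where "v = x * cosh u / real n"
   have v: "v > 0" unfolding v_def using x n(2) c exp_gt_zero[of "\<bar>u\<bar>"] by (auto intro!: divide_pos_pos mult_pos_pos)
   have "v \<le> exp v" using exp_ge_add_one_self[of v] by linarith
   then have "v ^ n \<le> exp v ^ n" using v by (intro power_mono) auto
   also have "exp v ^ n = exp (x * cosh u)" using n(2) by (simp add: v_def exp_of_nat_mult[symmetric])
   finally have "exp (- (x * cosh u)) \<le> (1 / v) ^ n"
    using v by (simp add: exp_minus power_one_over field_simps)
   also have "\<dots> \<le> (2 * real n / x * exp (- \<bar>u\<bar>)) ^ n"
   proof (rule power_mono)
    have "1 / v = real n / (x * cosh u)" by (simp add: v_def)
    also have "\<dots> \<le> real n / (x * (exp \<bar>u\<bar> / 2))" using x c by (intro divide_left_mono mult_left_mono mult_pos_pos) (auto intro: less_le_trans[OF _ c])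
    also have "\<dots> = 2 * real n / x * exp (- \<bar>u\<bar>)" by (simp add: exp_minus field_simps)
    finally show "1 / v \<le> 2 * real n / x * exp (- \<bar>u\<bar>)" .
   qed (use v in simp)
   also have "\<dots> = (2 * real n / x) ^ n * exp (- (real n * \<bar>u\<bar>))"
    unfolding power_mult_distrib by (simp add: exp_of_nat_mult[symmetric])
   finally have e1: "exp (- (x * cosh u)) \<le> (2 * real n / x) ^ n * exp (- (real n * \<bar>u\<bar>))" .
   have "norm (K_ker r x u) = exp (- (x * cosh u)) * exp (Re r * u)" by (simp add: K_ker_def norm_exp_eq_Re exp_add[symmetric])
   also have "\<dots> \<le> (2 * real n / x) ^ n * exp (- (real n * \<bar>u\<bar>)) * exp (Re r * u)" by (intro mult_right_mono e1) simp
   also have "\<dots> = (2 * real n / x) ^ n * exp (- (real n * \<bar>u\<bar>) + Re r * u)" by (simp add: exp_add[symmetric] mult.assoc)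
   also have "\<dots> \<le> (2 * real n / x) ^ n * (2 / (1 + u\<^sup>2))"
   proof (intro mult_left_mono)
    have "Re r * u \<le> \<bar>Re r\<bar> * \<bar>u\<bar>" by (metis abs_ge_self abs_mult)
    moreover have "(\<bar>Re r\<bar> + 1) * \<bar>u\<bar> \<le> real n * \<bar>u\<bar>" by (intro mult_right_mono n) simp
    ultimately have "exp (- (real n * \<bar>u\<bar>) + Re r * u) \<le> exp (- \<bar>u\<bar>)" by (simp add: algebra_simps)
    also have "\<dots> \<le> 2 / (1 + u\<^sup>2)"
    proof -
     have "0 < 1 + u\<^sup>2" by (simp add: add_pos_nonneg)
     then show ?thesis using exp_mult_one_plus_square_le[of u] by (simp add: exp_minus field_simps)
    qed
    finally show "exp (- (real n * \<bar>u\<bar>) + Re r * u) \<le> 2 / (1 + u\<^sup>2)" .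
   qed (use x in simp)
   finally show "norm (K_ker r x u) \<le> (2 * real n / x) ^ n * (2 / (1 + u\<^sup>2))" .
  qed
  also have "\<dots> = C * (1 / x) ^ n" unfolding C_def by (subst integral_mult_right_zero) (simp add: power_divide)
  finally show "norm (K_int r x) \<le> C * (1 / x) ^ n" .
 qed
qed

section \<open>The action of the Lie algebra\<close>

context principal_series begin

text \<open>Coefficients of X on the weight q: \<open>lie_a\<close> comes from the centre and the
  rotations, \<open>lie_u\<close> and \<open>lie_d\<close> from the symmetric traceless part, read
  as a complex number whose conjugate raises and which itself lowers.\<close>

definition lie_a :: "mat2 => int => complex" where
 "lie_a X q = (\<nu>1 + \<nu>2) * of_real ((X$1$1 + X$2$2) / 2) + \<i> * of_int q * of_real ((X$1$2 - X$2$1) / 2)"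
definition lie_u :: "mat2 => int => complex" where
 "lie_u X q = Complex ((X$1$1 - X$2$2) / 2) (- ((X$1$2 + X$2$1) / 2)) / 2 * (\<nu>1 - \<nu>2 + 1 + of_int q)"
definition lie_d :: "mat2 => int => complex" where
 "lie_d X q = Complex ((X$1$1 - X$2$2) / 2) ((X$1$2 + X$2$1) / 2) / 2 * (\<nu>1 - \<nu>2 + 1 - of_int q)"

text \<open>The element \<open>X\<close> of the Lie algebra acts on the \<open>\<zeta>\<^sub>q\<close> and on their Whittaker images by this same formula,
 which is why maps defined coefficientwise on the \<open>\<zeta>\<^sub>q\<close> are equivariant.\<close>

definition lie_comb :: "mat2 => (int => mat2 => complex) => int => mat2 => complex" where
 "lie_comb X V q k = lie_a X q * V q k + lie_u X q * V (q + 2) k + lie_d X q * V (q - 2) k"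

lemma weight_family_lie:
 assumes sys: "whittaker_system l (\<nu>1 + \<nu>2) (\<nu>1 - \<nu>2) \<delta> w" and q: "even (q - \<delta>)" and g: "g \<in> G_grp"
 shows "((\<lambda>t. weight_family l (\<nu>1 + \<nu>2) s w q (g ** mat_exp (t *\<^sub>R X))) has_vector_derivative
   lie_comb X (weight_family l (\<nu>1 + \<nu>2) s w) q g) (at 0)"
 using weight_family_deriv[OF sys q mat_exp_curve_deriv _ , of g X s] g
 by (simp add: G_grp_det lie_comb_def lie_a_def lie_u_def lie_d_def mult.assoc)

lemma F_lie:
 assumes q: "even (q - \<delta>)" and g: "g \<in> G_grp"
 shows "frechet_derivative (F q) (at g) (g ** X) = lie_comb X F q g"
proof (rule frechet_along_curve)
 show "(F q has_derivative frechet_derivative (F q) (at g)) (at g)"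
  by (rule smooth_on_derivative(1)[OF F_smooth[OF q] g])
 show "((\<lambda>t. F q (g ** mat_exp (t *\<^sub>R X))) has_vector_derivative lie_comb X F q g) (at 0)"
  unfolding ind_fn_def by (rule weight_family_lie[OF ind_fn_system q g])
qed

lemma even_shift: "even (q - \<delta>) ==> even (q + 2 - \<delta>)" "even (q - \<delta>) ==> even (q - 2 - \<delta>)"
 by presburger+

lemma lie_comb_Z_F: "k \<in> K_grp ==> even (q - \<delta>) ==> lie_comb X Z q k = lie_comb X F q k"
 unfolding lie_comb_def by (simp only: Z_eq even_shift)

lemma det_mat_exp_near: "\<forall>\<^sub>F t in at 0. mat_exp (t *\<^sub>R X) \<in> G_grp"
proof -
 have "isCont (\<lambda>t. mat_exp (t *\<^sub>R X)) 0" using has_vector_derivative_continuous[OF mat_exp_deriv] .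
 then have "((\<lambda>t. mat_exp (t *\<^sub>R X)) \<longlongrightarrow> mat 1) (at 0)" unfolding isCont_def by simp
 moreover have "mat 1 \<in> G_grp" using K_in_G[OF one_in_K] .
 ultimately show ?thesis by (rule topological_tendstoD[OF _ open_G_grp])
qed

abbreviation "act_quot t X f k \<equiv> (prin_act \<sigma> (mat_exp (t *\<^sub>R X)) f k - f k) / complex_of_real t"

lemma uniform_lie_Z:
 assumes q: "even (q - \<delta>)" and \<epsilon>: "\<epsilon> > 0"
 shows "\<forall>\<^sub>F t in at 0. \<forall>k\<in>K_grp. norm (act_quot t X (Z q) k - lie_comb X Z q k) \<le> \<epsilon>"
 using uniform_lie_derivative[OF F_smooth[OF q] \<epsilon>, of X] det_mat_exp_near[of X]
proof eventually_elim
 case (elim t)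
 show ?case
 proof
  fix k assume k: "k \<in> K_grp"
  show "norm (act_quot t X (Z q) k - lie_comb X Z q k) \<le> \<epsilon>"
   using elim(1) k unfolding prin_act_zeta[OF k elim(2) q] Z_eq[OF k q] lie_comb_Z_F[OF k q] F_lie[OF q K_in_G[OF k], symmetric] by blast
 qed
qed

lemma L2_norm_nonneg: "0 \<le> L2_norm f" by (simp add: L2_norm_def)

lemma L2_norm_le_uniform:
 assumes f: "f \<in> borel_measurable borel" and \<epsilon>: "\<epsilon> \<ge> 0" and b: "AE k in haar_K. norm (f k) \<le> \<epsilon>"
 shows "L2_norm f \<le> \<epsilon>"
proof -
 have [measurable]: "f \<in> borel_measurable borel" by fact
 have b2: "AE k in haar_K. (cmod (f k))\<^sup>2 \<le> \<epsilon>\<^sup>2" using b by eventually_elim (auto intro: power_mono)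
 have "(\<integral>k. (cmod (f k))\<^sup>2 \<partial>haar_K) \<le> (\<integral>k. \<epsilon>\<^sup>2 \<partial>haar_K)"
  using b2 by (intro integral_mono_AE) (auto intro!: bounded_integrable[of _ "\<epsilon>\<^sup>2"])
 then have "(\<integral>k. (cmod (f k))\<^sup>2 \<partial>haar_K) \<le> \<epsilon>\<^sup>2" using haar.prob_space by simp
 then show ?thesis unfolding L2_norm_def by (rule real_le_lsqrt[OF \<epsilon>])
qed

text \<open>A vector equals its expansion only almost everywhere, so the uniform estimate for
  finitely many weights becomes one off a null set, and this set may depend on t.\<close>

lemma lie_quotient_small:
 assumes f: "f \<in> borel_measurable borel" and Q: "finite Q" "\<And>q. q \<in> Q ==> even (q - \<delta>)"
  and ae: "ae_eq f (\<lambda>k. \<Sum>q\<in>Q. c q * Z q k)" and \<epsilon>: "\<epsilon> > 0"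
 shows "\<forall>\<^sub>F t in at 0. AE k in haar_K. norm (act_quot t X f k - (\<Sum>q\<in>Q. c q * lie_comb X Z q k)) \<le> \<epsilon>"
proof -
 \<comment> \<open>The summand 1 keeps C positive when all coefficients vanish.\<close>
 define C where "C = (\<Sum>q\<in>Q. norm (c q)) + 1"
 have C: "C > 0" unfolding C_def by (simp add: add_nonneg_pos sum_nonneg)
 have "\<forall>\<^sub>F t in at 0. \<forall>q\<in>Q. \<forall>k\<in>K_grp. norm (act_quot t X (Z q) k - lie_comb X Z q k) \<le> \<epsilon> / C"
  using \<epsilon> C Q by (intro eventually_ball_finite ballI uniform_lie_Z) auto
 then show ?thesis using det_mat_exp_near[of X]
 proof eventually_elim
  case (elim t)
  have ae2: "ae_eq (prin_act \<sigma> (mat_exp (t *\<^sub>R X)) f) (prin_act \<sigma> (mat_exp (t *\<^sub>R X)) (\<lambda>k. \<Sum>q\<in>Q. c q * Z q k))"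
   by (rule prin_act_ae_eq[OF elim(2) f Z_comb_borel[OF Q(2)] ae])
  show ?case
   using ae[unfolded ae_eq_def] ae2[unfolded ae_eq_def] AE_haar_K_in_K
  proof eventually_elim
   case (elim k)
   let ?d = "\<lambda>q. act_quot t X (Z q) k - lie_comb X Z q k"
   have "act_quot t X f k - (\<Sum>q\<in>Q. c q * lie_comb X Z q k) = (\<Sum>q\<in>Q. c q * ?d q)"
    unfolding elim(1,2) prin_act_lin by (simp add: sum_subtractf[symmetric] sum_divide_distrib right_diff_distrib)
   also have "norm \<dots> \<le> (\<Sum>q\<in>Q. norm (c q) * (\<epsilon> / C))"
   proof (rule sum_norm_le)
    fix q assume "q \<in> Q"
    then have "norm (?d q) \<le> \<epsilon> / C" using \<open>\<forall>q\<in>Q. \<forall>k\<in>K_grp. _\<close> elim(3) by blast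
    then show "norm (c q * ?d q) \<le> norm (c q) * (\<epsilon> / C)" unfolding norm_mult by (intro mult_left_mono) auto
   qed
   also have "\<dots> = (C - 1) * (\<epsilon> / C)" unfolding sum_distrib_right[symmetric] by (simp add: C_def)
   also have "\<dots> \<le> C * (\<epsilon> / C)" using C \<epsilon> by (intro mult_right_mono) auto
   also have "\<dots> = \<epsilon>" using C by simp
   finally show ?case .
  qed
 qed
qed

lemma lie_comb_Z_borel:
 assumes "even (q - \<delta>)"
 shows "lie_comb X Z q \<in> borel_measurable borel"
proof -
 have [measurable]: "Z q \<in> borel_measurable borel" "Z (q + 2) \<in> borel_measurable borel" "Z (q - 2) \<in> borel_measurable borel"
  using Z_measurable assms even_shift by auto
 show ?thesis unfolding lie_comb_def[abs_def] by measurable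
qed

lemma lie_sum_borel:
 assumes "\<And>q. q \<in> Q ==> even (q - \<delta>)"
 shows "(\<lambda>k. \<Sum>q\<in>Q. c q * lie_comb X Z q k) \<in> borel_measurable borel"
 using lie_comb_Z_borel[OF assms] by (intro borel_measurable_sum borel_measurable_times) auto

lemma lie_quotient_L2:
 assumes f: "f \<in> borel_measurable borel" and Q: "finite Q" "\<And>q. q \<in> Q ==> even (q - \<delta>)"
  and ae: "ae_eq f (\<lambda>k. \<Sum>q\<in>Q. c q * Z q k)"
 shows "((\<lambda>t. L2_norm (\<lambda>k. act_quot t X f k - (\<Sum>q\<in>Q. c q * lie_comb X Z q k))) \<longlongrightarrow> 0) (at 0)"
proof (rule tendstoI)
 fix e :: real assume e: "e > 0"
 have [measurable]: "f \<in> borel_measurable borel" by fact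
 have [measurable]: "(\<lambda>k. \<Sum>q\<in>Q. c q * lie_comb X Z q k) \<in> borel_measurable borel" by (rule lie_sum_borel[OF Q(2)])
 have e2: "e / 2 > 0" using e by simp
 have ev: "\<forall>\<^sub>F t in at 0. AE k in haar_K. norm (act_quot t X f k - (\<Sum>q\<in>Q. c q * lie_comb X Z q k)) \<le> e / 2"
  by (rule lie_quotient_small[OF f Q ae e2])
 show "\<forall>\<^sub>F t in at 0. dist (L2_norm (\<lambda>k. act_quot t X f k - (\<Sum>q\<in>Q. c q * lie_comb X Z q k))) 0 < e"
  using ev det_mat_exp_near[of X]
 proof eventually_elim
  case (elim t)
  have [measurable]: "prin_act \<sigma> (mat_exp (t *\<^sub>R X)) f \<in> borel_measurable borel" by (rule prin_act_measurable[OF elim(2) f])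
  have "L2_norm (\<lambda>k. act_quot t X f k - (\<Sum>q\<in>Q. c q * lie_comb X Z q k)) \<le> e / 2"
   by (rule L2_norm_le_uniform[OF _ _ elim(1)]) (use e in auto)
  then show ?case using e L2_norm_nonneg by (simp add: dist_real_def abs_of_nonneg)
 qed
qed

text \<open>The coefficients do not depend on the family V. Used for \<open>Z\<close>, for the
  Whittaker functions and for the images of the \<open>Z q\<close> under a given homomorphism, this
  transports the Lie algebra action between them.\<close>

lemma lie_comb_expand:
 assumes Q: "finite Q" "\<And>q. q \<in> Q ==> even (q - \<delta>)"
 shows "\<exists>Q' c'. finite Q' \<and> (\<forall>q\<in>Q'. even (q - \<delta>)) \<and> (\<forall>V k. (\<Sum>q\<in>Q. c q * lie_comb X V q k) = (\<Sum>q\<in>Q'. c' q * V q k))"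
proof -
 define Q' where "Q' = Q \<union> (\<lambda>q. q + 2) ` Q \<union> (\<lambda>q. q - 2) ` Q"
 define c' where "c' q = (if q \<in> Q then c q * lie_a X q else 0) + (if q - 2 \<in> Q then c (q - 2) * lie_u X (q - 2) else 0)
   + (if q + 2 \<in> Q then c (q + 2) * lie_d X (q + 2) else 0)" for q
 have fin: "finite Q'" unfolding Q'_def using Q(1) by simp
 have ev: "\<forall>q\<in>Q'. even (q - \<delta>)" unfolding Q'_def using Q(2) even_shift by blast
 have "(\<Sum>q\<in>Q. c q * lie_comb X V q k) = (\<Sum>q\<in>Q'. c' q * V q k)" for V :: "int => mat2 => complex" and k
 proof -
  have 1: "(\<Sum>q\<in>Q. c q * lie_a X q * V q k) = (\<Sum>q\<in>Q'. (if q \<in> Q then c q * lie_a X q else 0) * V q k)"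
   using fin by (intro sum.mono_neutral_cong_left) (auto simp: Q'_def)
  have 2: "(\<Sum>q\<in>Q. c q * lie_u X q * V (q + 2) k) = (\<Sum>q\<in>Q'. (if q - 2 \<in> Q then c (q - 2) * lie_u X (q - 2) else 0) * V q k)"
  proof -
   have "(\<Sum>q\<in>Q. c q * lie_u X q * V (q + 2) k) = (\<Sum>q\<in>(\<lambda>q. q + 2) ` Q. (if q - 2 \<in> Q then c (q - 2) * lie_u X (q - 2) else 0) * V q k)"
    by (subst sum.reindex) (auto simp: inj_on_def)
   also have "\<dots> = (\<Sum>q\<in>Q'. (if q - 2 \<in> Q then c (q - 2) * lie_u X (q - 2) else 0) * V q k)"
   proof (intro sum.mono_neutral_left fin ballI)
    fix q assume "q \<in> Q' - (\<lambda>q. q + 2) ` Q"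
    then have "q - 2 \<notin> Q" by (metis DiffE diff_add_cancel imageI)
    then show "(if q - 2 \<in> Q then c (q - 2) * lie_u X (q - 2) else 0) * V q k = 0" by simp
   qed (auto simp: Q'_def)
   finally show ?thesis .
  qed
  have 3: "(\<Sum>q\<in>Q. c q * lie_d X q * V (q - 2) k) = (\<Sum>q\<in>Q'. (if q + 2 \<in> Q then c (q + 2) * lie_d X (q + 2) else 0) * V q k)"
  proof -
   have "(\<Sum>q\<in>Q. c q * lie_d X q * V (q - 2) k) = (\<Sum>q\<in>(\<lambda>q. q - 2) ` Q. (if q + 2 \<in> Q then c (q + 2) * lie_d X (q + 2) else 0) * V q k)"
    by (subst sum.reindex) (auto simp: inj_on_def)
   also have "\<dots> = (\<Sum>q\<in>Q'. (if q + 2 \<in> Q then c (q + 2) * lie_d X (q + 2) else 0) * V q k)"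
   proof (intro sum.mono_neutral_left fin ballI)
    fix q assume "q \<in> Q' - (\<lambda>q. q - 2) ` Q"
    then have "q + 2 \<notin> Q" by (metis DiffE add_diff_cancel_right' imageI)
    then show "(if q + 2 \<in> Q then c (q + 2) * lie_d X (q + 2) else 0) * V q k = 0" by simp
   qed (auto simp: Q'_def)
   finally show ?thesis .
  qed
  have "(\<Sum>q\<in>Q. c q * lie_comb X V q k) = (\<Sum>q\<in>Q. c q * lie_a X q * V q k) + (\<Sum>q\<in>Q. c q * lie_u X q * V (q + 2) k) + (\<Sum>q\<in>Q. c q * lie_d X q * V (q - 2) k)"
   unfolding lie_comb_def sum.distrib[symmetric] by (intro sum.cong) (simp_all add: distrib_left mult.assoc)
  also have "\<dots> = (\<Sum>q\<in>Q'. c' q * V q k)"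
   unfolding 1 2 3 sum.distrib[symmetric] c'_def by (intro sum.cong) (simp_all only: distrib_right)
  finally show ?thesis .
 qed
 then show ?thesis using fin ev by blast
qed

lemma H_fin_sp: "f \<in> H_fin \<sigma> ==> f \<in> H_sp \<sigma>" by (simp add: H_fin_def)

lemma Z_comb_H_fin:
 assumes "finite Q" "\<And>q. q \<in> Q ==> even (q - \<delta>)"
 shows "(\<lambda>k. \<Sum>q\<in>Q. c q * Z q k) \<in> H_fin \<sigma>"
 by (rule H_fin_I[OF Z_comb_borel[OF assms(2)] assms(1) assms(2)]) (auto simp: ae_eq_def)

lemma lie_sum_H_fin:
 assumes "finite Q" "\<And>q. q \<in> Q ==> even (q - \<delta>)"
 shows "(\<lambda>k. \<Sum>q\<in>Q. c q * lie_comb X Z q k) \<in> H_fin \<sigma>"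
proof -
 obtain Q' c' where Q': "finite Q'" "\<And>q. q \<in> Q' ==> even (q - \<delta>)" "\<And>V k. (\<Sum>q\<in>Q. c q * lie_comb X V q k) = (\<Sum>q\<in>Q'. c' q * V q k)"
  using lie_comb_expand[OF assms, of c X] by blast
 show ?thesis unfolding Q'(3) by (rule Z_comb_H_fin[OF Q'(1,2)])
qed

lemma has_lie_deriv_comb:
 assumes f: "f \<in> borel_measurable borel" and Q: "finite Q" "\<And>q. q \<in> Q ==> even (q - \<delta>)"
  and ae: "ae_eq f (\<lambda>k. \<Sum>q\<in>Q. c q * Z q k)"
 shows "has_lie_deriv \<sigma> X f (\<lambda>k. \<Sum>q\<in>Q. c q * lie_comb X Z q k)"
 unfolding has_lie_deriv_def using H_fin_sp[OF lie_sum_H_fin[OF Q]] lie_quotient_L2[OF f Q ae] by blast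

text \<open>The quotients converge to h in L2 and to the expected combination uniformly off null
  sets; the triangle inequality in squared form makes the L2 distance of the two limits
  vanish.\<close>

lemma has_lie_deriv_unique:
 assumes f: "f \<in> borel_measurable borel" and Q: "finite Q" "\<And>q. q \<in> Q ==> even (q - \<delta>)"
  and ae: "ae_eq f (\<lambda>k. \<Sum>q\<in>Q. c q * Z q k)" and h: "has_lie_deriv \<sigma> X f h"
 shows "ae_eq h (\<lambda>k. \<Sum>q\<in>Q. c q * lie_comb X Z q k)"
proof -
 let ?h0 = "\<lambda>k. \<Sum>q\<in>Q. c q * lie_comb X Z q k"
 let ?D = "\<lambda>t k. act_quot t X f k"
 have hL: "h \<in> L2_K" using h by (simp add: has_lie_deriv_def H_sp_def)
 have h0L: "?h0 \<in> L2_K" using H_fin_sp[OF lie_sum_H_fin[OF Q]] by (simp add: H_sp_def)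
 have hm[measurable]: "h \<in> borel_measurable borel" "?h0 \<in> borel_measurable borel" using hL h0L by (auto simp: L2_K_def)
 have dL: "(\<lambda>k. 1 * h k + (-1) * ?h0 k) \<in> L2_K" by (rule L2_K_lin[OF hL h0L])
 then have di: "integrable haar_K (\<lambda>k. (cmod (h k - ?h0 k))\<^sup>2)" by (auto simp: L2_K_def)
 have bound: "\<forall>\<^sub>F t in at 0. (\<integral>k. (cmod (h k - ?h0 k))\<^sup>2 \<partial>haar_K) \<le> 2 * (L2_norm (\<lambda>k. ?D t k - h k))\<^sup>2 + 2 * \<epsilon>\<^sup>2" if e: "\<epsilon> > 0" for \<epsilon>
 proof -
  have "\<forall>\<^sub>F t in at 0. AE k in haar_K. norm (?D t k - ?h0 k) \<le> \<epsilon>"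
   by (rule lie_quotient_small[OF f Q ae e])
  then show ?thesis using det_mat_exp_near[of X]
  proof eventually_elim
  case (elim t)
  have Dm[measurable]: "prin_act \<sigma> (mat_exp (t *\<^sub>R X)) f \<in> borel_measurable borel" by (rule prin_act_measurable[OF elim(2) f])
  have [measurable]: "f \<in> borel_measurable borel" by fact
  have rL: "(\<lambda>k. ?D t k - ?h0 k) \<in> L2_K" by (rule L2_K_bounded[OF _ elim(1)]) measurable
  have "(\<lambda>k. 1 * (?D t k - ?h0 k) + (-1) * (1 * h k + (-1) * ?h0 k)) \<in> L2_K" by (rule L2_K_lin[OF rL dL])
  then have i: "integrable haar_K (\<lambda>k. (cmod (?D t k - h k))\<^sup>2)" by (auto simp: L2_K_def algebra_simps)
  have i2: "integrable haar_K (\<lambda>k. (cmod (?D t k - ?h0 k))\<^sup>2)" using rL by (simp add: L2_K_def)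
  have "(\<integral>k. (cmod (h k - ?h0 k))\<^sup>2 \<partial>haar_K) \<le> (\<integral>k. 2 * (cmod (?D t k - h k))\<^sup>2 + 2 * (cmod (?D t k - ?h0 k))\<^sup>2 \<partial>haar_K)"
  proof (rule integral_mono[OF di])
   show "integrable haar_K (\<lambda>k. 2 * (cmod (?D t k - h k))\<^sup>2 + 2 * (cmod (?D t k - ?h0 k))\<^sup>2)" using i i2 by auto
   fix k
   have "(cmod (h k - ?h0 k))\<^sup>2 \<le> (cmod (?D t k - h k) + cmod (?D t k - ?h0 k))\<^sup>2"
    using norm_triangle_ineq4[of "?D t k - ?h0 k" "?D t k - h k"] by (intro power_mono) auto
   also have "\<dots> \<le> 2 * (cmod (?D t k - h k))\<^sup>2 + 2 * (cmod (?D t k - ?h0 k))\<^sup>2"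
    using zero_le_power2[of "cmod (?D t k - h k) - cmod (?D t k - ?h0 k)"] by (simp add: power2_eq_square algebra_simps)
   finally show "(cmod (h k - ?h0 k))\<^sup>2 \<le> 2 * (cmod (?D t k - h k))\<^sup>2 + 2 * (cmod (?D t k - ?h0 k))\<^sup>2" .
  qed
  also have "\<dots> = 2 * (\<integral>k. (cmod (?D t k - h k))\<^sup>2 \<partial>haar_K) + 2 * (\<integral>k. (cmod (?D t k - ?h0 k))\<^sup>2 \<partial>haar_K)" using i i2 by simp
  also have "(\<integral>k. (cmod (?D t k - ?h0 k))\<^sup>2 \<partial>haar_K) \<le> (\<integral>k. \<epsilon>\<^sup>2 \<partial>haar_K)"
   using elim(1) i2 by (intro integral_mono_AE) (auto elim!: eventually_mono intro!: power_mono)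
  also have "(\<integral>k. \<epsilon>\<^sup>2 \<partial>haar_K) = \<epsilon>\<^sup>2" using haar.prob_space by simp
  also have "(\<integral>k. (cmod (?D t k - h k))\<^sup>2 \<partial>haar_K) = (L2_norm (\<lambda>k. ?D t k - h k))\<^sup>2" by (simp add: L2_norm_def)
  finally show ?case by simp
  qed
 qed
 have lim: "((\<lambda>t. L2_norm (\<lambda>k. ?D t k - h k)) \<longlongrightarrow> 0) (at 0)" using h by (simp add: has_lie_deriv_def)
 have "(\<integral>k. (cmod (h k - ?h0 k))\<^sup>2 \<partial>haar_K) \<le> 0"
 proof (rule field_le_epsilon)
  fix e :: real assume e: "e > 0"
  let ?\<epsilon> = "sqrt (e / 4)"
  have "((\<lambda>t. 2 * (L2_norm (\<lambda>k. ?D t k - h k))\<^sup>2 + 2 * ?\<epsilon>\<^sup>2) \<longlongrightarrow> 2 * 0\<^sup>2 + 2 * ?\<epsilon>\<^sup>2) (at 0)" by (intro tendsto_intros lim)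
  moreover have "\<forall>\<^sub>F t in at 0. (\<integral>k. (cmod (h k - ?h0 k))\<^sup>2 \<partial>haar_K) \<le> 2 * (L2_norm (\<lambda>k. ?D t k - h k))\<^sup>2 + 2 * ?\<epsilon>\<^sup>2"
   using bound[of ?\<epsilon>] e by simp
  ultimately have "(\<integral>k. (cmod (h k - ?h0 k))\<^sup>2 \<partial>haar_K) \<le> 2 * 0\<^sup>2 + 2 * ?\<epsilon>\<^sup>2"
   by (intro tendsto_lowerbound[of _ _ "at (0::real)"]) auto
  then show "(\<integral>k. (cmod (h k - ?h0 k))\<^sup>2 \<partial>haar_K) \<le> 0 + e" using e by simp
 qed
 then have "(\<integral>k. (cmod (h k - ?h0 k))\<^sup>2 \<partial>haar_K) = 0" by (intro antisym integral_nonneg_AE) auto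
 then have "AE k in haar_K. (cmod (h k - ?h0 k))\<^sup>2 = 0" using di by (subst (asm) integral_nonneg_eq_0_iff_AE) auto
 then show ?thesis unfolding ae_eq_def by eventually_elim simp
qed

end

section \<open>Whittaker homomorphisms\<close>

lemma Ck_on_lin:
 fixes f h :: "'a::real_normed_vector => complex"
 assumes S: "open S" and "Ck_on n S f" "Ck_on n S h"
 shows "Ck_on n S (\<lambda>x. a * f x + b * h x)"
 using assms(2,3)
proof (induction n arbitrary: f h)
 case 0
 then show ?case by (auto intro!: continuous_intros)
next
 case (Suc n)
 have D: "((\<lambda>x. a * f x + b * h x) has_derivative (\<lambda>v. a * frechet_derivative f (at x) v + b * frechet_derivative h (at x) v)) (at x)"
  if "x \<in> S" for x
 proof -
  have "(f has_derivative frechet_derivative f (at x)) (at x)" "(h has_derivative frechet_derivative h (at x)) (at x)"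
   using Suc.prems that by (auto simp: frechet_derivative_works)
  then show ?thesis by (auto intro!: derivative_eq_intros)
 qed
 have "Ck_on n S (\<lambda>x. frechet_derivative (\<lambda>x. a * f x + b * h x) (at x) v)" for v
 proof (rule Ck_on_cong[OF S])
  show "Ck_on n S (\<lambda>x. a * frechet_derivative f (at x) v + b * frechet_derivative h (at x) v)"
   using Suc.prems by (intro Suc.IH) auto
  show "a * frechet_derivative f (at x) v + b * frechet_derivative h (at x) v = frechet_derivative (\<lambda>x. a * f x + b * h x) (at x) v" if "x \<in> S" for x
   using frechet_derivative_at[OF D[OF that]] by (metis (no_types))
 qed
 then show ?case using D by (auto simp: differentiable_def)
qed

lemma whittaker_space_lin:
 assumes "\<phi> \<in> whittaker_space" "\<eta> \<in> whittaker_space"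
 shows "(\<lambda>g. a * \<phi> g + b * \<eta> g) \<in> whittaker_space"
 using assms Ck_on_lin[OF open_G_grp] by (auto simp: whittaker_space_def smooth_on_def distrib_left mult.left_commute)

lemma whittaker_space_sum:
 assumes "finite Q" "\<And>q. q \<in> Q ==> V q \<in> whittaker_space"
 shows "(\<lambda>g. \<Sum>q\<in>Q. c q * V q g) \<in> whittaker_space"
 using assms
proof (induction Q rule: finite_induct)
 case empty
 have z: "Ck_on n G_grp (\<lambda>g::mat2. 0::complex)" for n by (induction n) simp_all
 show ?case using z by (auto simp: whittaker_space_def smooth_on_def)
next
 case (insert x Q)
 then have "(\<lambda>g. c x * V x g + 1 * (\<Sum>q\<in>Q. c q * V q g)) \<in> whittaker_space" by (intro whittaker_space_lin) auto
 then show ?case using insert by simp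
qed

context principal_series begin

abbreviation "W \<equiv> weight_family 1 (\<nu>1 + \<nu>2) sg"
abbreviation "sys \<equiv> whittaker_system 1 (\<nu>1 + \<nu>2) (\<nu>1 - \<nu>2) \<delta>"

definition whittaker_hom :: "(int => real => complex) => whittaker_map" where
 "whittaker_hom w f g = (if f \<in> H_fin \<sigma> then \<Sum>q\<in>support f. coef f q * W w q g else 0)"

text \<open>Fourier coefficients depend only on the class of f, so any almost everywhere expansion
  may be used, also one over more weights than \<open>support f\<close>. Linearity, equivariance
  under K and the Lie algebra action are reduced to this.\<close>

lemma whittaker_hom_eval:
 assumes f: "f \<in> borel_measurable borel" and Q: "finite Q" "\<And>q. q \<in> Q ==> even (q - \<delta>)"
  and ae: "ae_eq f (\<lambda>k. \<Sum>q\<in>Q. c q * Z q k)"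
 shows "whittaker_hom w f g = (\<Sum>q\<in>Q. c q * W w q g)"
proof -
 have fin: "f \<in> H_fin \<sigma>" by (rule H_fin_I[OF f Q ae])
 have c: "coef f q = (if q \<in> Q then c q else 0)" if "even (q - \<delta>)" for q
  using coef_cong[OF f Z_comb_borel[OF Q(2)] ae that] coef_Z_comb[OF Q that, of c] by simp
 have sub: "support f \<subseteq> Q"
 proof
  fix q assume "q \<in> support f"
  then have q: "even (q - \<delta>)" and nz: "coef f q \<noteq> 0" unfolding support_def by blast+
  show "q \<in> Q" using c[OF q] nz by presburger
 qed
 have "(\<Sum>q\<in>support f. coef f q * W w q g) = (\<Sum>q\<in>Q. c q * W w q g)"
 proof (rule sum.mono_neutral_cong_left[OF Q(1) sub])
  show "\<forall>q\<in>Q - support f. c q * W w q g = 0"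
  proof
   fix q assume q: "q \<in> Q - support f"
   then have e: "even (q - \<delta>)" using Q(2) by blast
   then have "coef f q = 0" using q unfolding support_def by blast
   then show "c q * W w q g = 0" using c[OF e] q by (metis DiffD1 mult_zero_left)
  qed
  show "coef f q * W w q g = c q * W w q g" if "q \<in> support f" for q
  proof -
   have q: "q \<in> Q" using that sub by blast
   show ?thesis unfolding c[OF Q(2)[OF q]] using q by (simp only: if_True)
  qed
 qed
 then show ?thesis using fin by (simp add: whittaker_hom_def)
qed

lemma whittaker_hom_Z: "even (q - \<delta>) ==> whittaker_hom w (Z q) g = W w q g"
 using whittaker_hom_eval[of "Z q" "{q}" "\<lambda>_. 1" w g] Z_measurable by (simp add: ae_eq_def)

lemma support_even: "q \<in> support f ==> even (q - \<delta>)" unfolding support_def by blast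

lemma H_fin_expand_superset:
 assumes f: "f \<in> H_fin \<sigma>" and Q: "finite Q" "support f \<subseteq> Q" "\<And>q. q \<in> Q ==> even (q - \<delta>)"
 shows "ae_eq f (\<lambda>k. \<Sum>q\<in>Q. coef f q * Z q k)"
proof -
 have "(\<Sum>q\<in>support f. coef f q * Z q k) = (\<Sum>q\<in>Q. coef f q * Z q k)" for k
  using Q by (intro sum.mono_neutral_left) (auto simp: support_def)
 then show ?thesis using H_fin_expand[OF f] by simp
qed

lemma whittaker_hom_lin:
 assumes f: "f \<in> H_fin \<sigma>" and h: "h \<in> H_fin \<sigma>"
 shows "whittaker_hom w (\<lambda>k. a * f k + b * h k) g = a * whittaker_hom w f g + b * whittaker_hom w h g"
proof -
 let ?Q = "support f \<union> support h"
 have Q: "finite ?Q" "\<And>q. q \<in> ?Q ==> even (q - \<delta>)" using finite_support f h support_even by auto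
 have ef: "ae_eq f (\<lambda>k. \<Sum>q\<in>?Q. coef f q * Z q k)" and eh: "ae_eq h (\<lambda>k. \<Sum>q\<in>?Q. coef h q * Z q k)"
  using H_fin_expand_superset[OF f Q(1) _ Q(2)] H_fin_expand_superset[OF h Q(1) _ Q(2)] by auto
 have m: "f \<in> borel_measurable borel" "h \<in> borel_measurable borel" using f h H_fin_borel by auto
 have m2: "(\<lambda>k. a * f k + b * h k) \<in> borel_measurable borel" using m by measurable
 have "ae_eq (\<lambda>k. a * f k + b * h k) (\<lambda>k. \<Sum>q\<in>?Q. (a * coef f q + b * coef h q) * Z q k)"
  unfolding ae_eq_def using ef[unfolded ae_eq_def] eh[unfolded ae_eq_def]
  by eventually_elim (simp add: sum.distrib sum_distrib_left distrib_right mult.assoc)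
 from whittaker_hom_eval[OF m2 Q this, of w g] whittaker_hom_eval[OF m(1) Q ef, of w g] whittaker_hom_eval[OF m(2) Q eh, of w g]
 show ?thesis by (simp add: sum.distrib sum_distrib_left distrib_right mult.assoc)
qed

lemma whittaker_hom_ae:
 assumes f: "f \<in> H_fin \<sigma>" and h: "h \<in> H_fin \<sigma>" and eq: "ae_eq f h"
 shows "whittaker_hom w f = whittaker_hom w h"
proof
 fix g
 have Q: "finite (support h)" "\<And>q. q \<in> support h ==> even (q - \<delta>)" using finite_support h support_even by auto
 have "ae_eq f (\<lambda>k. \<Sum>q\<in>support h. coef h q * Z q k)"
  using eq H_fin_expand[OF h] unfolding ae_eq_def by eventually_elim simp
 from whittaker_hom_eval[OF H_fin_borel[OF f] Q this] show "whittaker_hom w f g = whittaker_hom w h g"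
  using h by (simp add: whittaker_hom_def)
qed

text \<open>One choice of coefficients serves for all families, because \<open>Z\<close> and
  \<open>W w\<close> transform by the same characters under rotations and by the same sign under the
  reflection.\<close>

lemma K_translate_comb:
 assumes \<kappa>: "\<kappa> \<in> K_grp" and Q: "finite Q" "\<And>q. q \<in> Q ==> even (q - \<delta>)"
 obtains Q' c' where "finite Q'" "\<forall>q\<in>Q'. even (q - \<delta>)" "Q' \<subseteq> Q \<union> uminus ` Q"
  "\<forall>w g. (\<Sum>q\<in>Q. c q * W w q (g ** \<kappa>)) = (\<Sum>q\<in>Q'. c' q * W w q g)"
  "\<forall>k\<in>K_grp. (\<Sum>q\<in>Q. c q * Z q (k ** \<kappa>)) = (\<Sum>q\<in>Q'. c' q * Z q k)"
 using \<kappa>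
proof (cases rule: K_grp_cases)
 case (1 \<tau>)
 show ?thesis
 proof (rule that[of Q "\<lambda>q. c q * expi q \<tau>"]; (intro allI ballI)?)
  fix w g
  show "(\<Sum>q\<in>Q. c q * W w q (g ** \<kappa>)) = (\<Sum>q\<in>Q. c q * expi q \<tau> * W w q g)"
   unfolding 1 weight_family_rot mult.assoc ..
 next
  fix k assume k: "k \<in> K_grp"
  show "(\<Sum>q\<in>Q. c q * Z q (k ** \<kappa>)) = (\<Sum>q\<in>Q. c q * expi q \<tau> * Z q k)"
  proof (rule sum.cong[OF refl])
   fix q assume "q \<in> Q"
   then show "c q * Z q (k ** \<kappa>) = c q * expi q \<tau> * Z q k"
    unfolding 1 Z_rot[OF k Q(2)[OF \<open>q \<in> Q\<close>]] mult.assoc by blast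
  qed
 qed (use Q in blast)+
next
 case (2 \<tau>)
 have ev: "even (- q - \<delta>)" if "even (q - \<delta>)" for q using that by presburger
 have inj: "inj_on uminus Q" by (simp add: inj_on_def)
 show ?thesis
 proof (rule that[of "uminus ` Q" "\<lambda>q. c (- q) * (expi (- q) \<tau> * sg)"]; (intro allI ballI)?)
  fix w g
  show "(\<Sum>q\<in>Q. c q * W w q (g ** \<kappa>)) = (\<Sum>q\<in>uminus ` Q. c (- q) * (expi (- q) \<tau> * sg) * W w q g)"
   unfolding sum.reindex[OF inj] o_def minus_minus 2 matrix_mul_assoc weight_family_rot weight_family_refl2[OF sg_sg] mult.assoc ..
 next
  fix k assume k: "k \<in> K_grp"
  show "(\<Sum>q\<in>Q. c q * Z q (k ** \<kappa>)) = (\<Sum>q\<in>uminus ` Q. c (- q) * (expi (- q) \<tau> * sg) * Z q k)"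
   unfolding sum.reindex[OF inj] o_def minus_minus 2 matrix_mul_assoc
  proof (rule sum.cong[OF refl])
   fix q assume "q \<in> Q"
   note p = Q(2)[OF this]
   show "c q * Z q (k ** refl2 ** rot \<tau>) = c q * (expi q \<tau> * sg) * Z (- q) k"
    unfolding Z_rot[OF K_mult[OF k refl2_in_K] p] Z_refl2[OF k p] mult.assoc ..
  qed
 qed (use Q ev in blast)+
qed

lemma whittaker_hom_K:
 assumes f: "f \<in> H_fin \<sigma>" and \<kappa>: "\<kappa> \<in> K_grp"
 shows "whittaker_hom w (prin_act \<sigma> \<kappa> f) = (\<lambda>g. whittaker_hom w f (g ** \<kappa>))"
proof
 fix g
 have Q: "finite (support f)" "\<And>q. q \<in> support f ==> even (q - \<delta>)" using finite_support f support_even by auto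
 obtain Q' c' where Q'1: "finite Q'" "\<forall>q\<in>Q'. even (q - \<delta>)" and "Q' \<subseteq> support f \<union> uminus ` support f"
  and W: "\<forall>w g. (\<Sum>q\<in>support f. coef f q * W w q (g ** \<kappa>)) = (\<Sum>q\<in>Q'. c' q * W w q g)"
  and Z: "\<forall>k\<in>K_grp. (\<Sum>q\<in>support f. coef f q * Z q (k ** \<kappa>)) = (\<Sum>q\<in>Q'. c' q * Z q k)"
  by (rule K_translate_comb[OF \<kappa> Q(1), where c = "coef f"], erule Q(2), rule that)
 note Q' = Q'1(1) bspec[OF Q'1(2)]
 have "ae_eq (prin_act \<sigma> \<kappa> f) (prin_act \<sigma> \<kappa> (\<lambda>k. \<Sum>q\<in>support f. coef f q * Z q k))"
  by (rule prin_act_ae_eq[OF K_in_G[OF \<kappa>] H_fin_borel[OF f] Z_comb_borel[OF Q(2)] H_fin_expand[OF f]])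
 then have "ae_eq (prin_act \<sigma> \<kappa> f) (\<lambda>k. \<Sum>q\<in>Q'. c' q * Z q k)"
  unfolding ae_eq_def using AE_haar_K_in_K by eventually_elim (simp only: prin_act_K[OF _ \<kappa>] bspec[OF Z])
 from whittaker_hom_eval[OF prin_act_measurable[OF K_in_G[OF \<kappa>] H_fin_borel[OF f]] Q' this, of w g]
 show "whittaker_hom w (prin_act \<sigma> \<kappa> f) g = whittaker_hom w f (g ** \<kappa>)"
  using f W[rule_format, of w g] by (simp add: whittaker_hom_def)
qed

lemma W_space:
 assumes "sys w" "even (q - \<delta>)"
 shows "W w q \<in> whittaker_space"
 using weight_family_smooth[OF assms, of sg] weight_family_N[of _ 1 "\<nu>1 + \<nu>2" sg w q]
 by (auto simp: whittaker_space_def psi1_def G_grp_det weight_family_def)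

lemma whittaker_hom_fin:
 assumes w: "sys w" and f: "f \<in> H_fin \<sigma>"
 shows "whittaker_hom w f \<in> whittaker_fin"
proof -
 have Q: "finite (support f)" "\<And>q. q \<in> support f ==> even (q - \<delta>)" using finite_support f support_even by auto
 have e: "whittaker_hom w f = (\<lambda>g. \<Sum>q\<in>support f. coef f q * W w q g)" using f by (simp add: whittaker_hom_def fun_eq_iff)
 define Q2 where "Q2 = support f \<union> uminus ` support f"
 have ev: "even (- q - \<delta>)" if "even (q - \<delta>)" for q using that by presburger
 have Q2: "finite Q2" "\<And>q. q \<in> Q2 ==> even (q - \<delta>)" unfolding Q2_def using Q ev by auto
 have sp: "whittaker_hom w f \<in> whittaker_space" unfolding e using Q W_space[OF w] by (intro whittaker_space_sum) auto
 have "\<exists>c. \<forall>g. whittaker_hom w f (g ** \<kappa>) = (\<Sum>b\<in>W w ` Q2. c b * b g)" if \<kappa>: "\<kappa> \<in> K_grp" for \<kappa>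
 proof -
  obtain Q' c' where Q': "finite Q'" and "\<forall>q\<in>Q'. even (q - \<delta>)" and Q'2: "Q' \<subseteq> support f \<union> uminus ` support f"
   and W: "\<forall>w g. (\<Sum>q\<in>support f. coef f q * W w q (g ** \<kappa>)) = (\<Sum>q\<in>Q'. c' q * W w q g)"
   and "\<forall>k\<in>K_grp. (\<Sum>q\<in>support f. coef f q * Z q (k ** \<kappa>)) = (\<Sum>q\<in>Q'. c' q * Z q k)"
   by (rule K_translate_comb[OF \<kappa> Q(1), where c = "coef f"], erule Q(2), rule that)
  obtain c where c: "\<And>g. (\<Sum>q\<in>Q2. (if q \<in> Q' then c' q else 0) * W w q g) = (\<Sum>b\<in>W w ` Q2. c b * b g)"
   using sum_image_coeff[OF Q2(1), of "\<lambda>q. if q \<in> Q' then c' q else 0" "W w"] by blast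
  have x: "(\<Sum>q\<in>Q'. c' q * W w q g) = (\<Sum>q\<in>Q2. (if q \<in> Q' then c' q else 0) * W w q g)" for g
   using Q'2 Q2(1) unfolding Q2_def by (intro sum.mono_neutral_cong_left) auto
  have "whittaker_hom w f (g ** \<kappa>) = (\<Sum>b\<in>W w ` Q2. c b * b g)" for g
   unfolding e W[rule_format] by (rule trans[OF x c])
  then show ?thesis by blast
 qed
 moreover have "W w ` Q2 \<subseteq> whittaker_space" using W_space[OF w] Q2 by auto
 ultimately show ?thesis unfolding whittaker_fin_def using sp Q2(1) by blast
qed

lemma whittaker_hom_right_deriv:
 assumes w: "sys w" and f: "f \<in> H_fin \<sigma>" and g: "g \<in> G_grp"
 shows "right_deriv X (whittaker_hom w f) g = (\<Sum>q\<in>support f. coef f q * lie_comb X (W w) q g)"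
proof -
 have e: "whittaker_hom w f = (\<lambda>g. \<Sum>q\<in>support f. coef f q * W w q g)" using f by (simp add: whittaker_hom_def fun_eq_iff)
 show ?thesis unfolding right_deriv_def e
  by (intro vector_derivative_at has_vector_derivative_sum has_vector_derivative_mult_right weight_family_lie[OF w _ g] support_even)
qed

lemma whittaker_hom_lie_sum:
 assumes f: "f \<in> H_fin \<sigma>"
 shows "whittaker_hom w (\<lambda>k. \<Sum>q\<in>support f. coef f q * lie_comb X Z q k) g = (\<Sum>q\<in>support f. coef f q * lie_comb X (W w) q g)"
proof -
 have Q: "finite (support f)" "\<And>q. q \<in> support f ==> even (q - \<delta>)" using finite_support f support_even by auto
 obtain Q' c' where Q': "finite Q'" "\<And>q. q \<in> Q' ==> even (q - \<delta>)" "\<And>V k. (\<Sum>q\<in>support f. coef f q * lie_comb X V q k) = (\<Sum>q\<in>Q'. c' q * V q k)"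
  using lie_comb_expand[OF Q, of "coef f" X] by blast
 show ?thesis unfolding Q'(3) by (rule whittaker_hom_eval[OF Z_comb_borel[OF Q'(2)] Q'(1,2)]) (auto simp: ae_eq_def)
qed

text \<open>By uniqueness of L2 derivatives, h is almost everywhere the algebraic combination
  attached to the real and imaginary parts of Y; on such combinations both sides are given by
  \<open>lie_comb\<close>.\<close>

lemma whittaker_hom_lie:
 assumes w: "sys w" and f: "f \<in> H_fin \<sigma>" and h: "h \<in> H_fin \<sigma>" and L: "has_lie_deriv_C \<sigma> Y f h" and g: "g \<in> G_grp"
 shows "whittaker_hom w h g = right_deriv_C Y (whittaker_hom w f) g"
proof -
 have Q: "finite (support f)" "\<And>q. q \<in> support f ==> even (q - \<delta>)" using finite_support f support_even by auto
 obtain h1 h2 where h12: "has_lie_deriv \<sigma> (re_mat Y) f h1" "has_lie_deriv \<sigma> (im_mat Y) f h2" "ae_eq h (\<lambda>k. h1 k + \<i> * h2 k)"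
  using L unfolding has_lie_deriv_C_def by blast
 let ?S = "\<lambda>X k. \<Sum>q\<in>support f. coef f q * lie_comb X Z q k"
 have S: "?S X \<in> H_fin \<sigma>" for X by (rule lie_sum_H_fin[OF Q])
 have "ae_eq h1 (?S (re_mat Y))" by (rule has_lie_deriv_unique[OF H_fin_borel[OF f] Q H_fin_expand[OF f] h12(1)])
 moreover have "ae_eq h2 (?S (im_mat Y))" by (rule has_lie_deriv_unique[OF H_fin_borel[OF f] Q H_fin_expand[OF f] h12(2)])
 ultimately have ae: "ae_eq h (\<lambda>k. 1 * ?S (re_mat Y) k + \<i> * ?S (im_mat Y) k)"
  using h12(3) unfolding ae_eq_def by eventually_elim simp
 have fin: "(\<lambda>k. 1 * ?S (re_mat Y) k + \<i> * ?S (im_mat Y) k) \<in> H_fin \<sigma>"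
 proof -
  obtain Q1 c1 where Q1: "finite Q1" "\<And>q. q \<in> Q1 ==> even (q - \<delta>)" "\<And>k. ?S (re_mat Y) k = (\<Sum>q\<in>Q1. c1 q * Z q k)"
   using lie_comb_expand[OF Q, of "coef f" "re_mat Y"] by blast
  obtain Q2 c2 where Q2: "finite Q2" "\<And>q. q \<in> Q2 ==> even (q - \<delta>)" "\<And>k. ?S (im_mat Y) k = (\<Sum>q\<in>Q2. c2 q * Z q k)"
   using lie_comb_expand[OF Q, of "coef f" "im_mat Y"] by blast
  have s1: "(\<Sum>q\<in>Q1. c1 q * Z q k) = (\<Sum>q\<in>Q1 \<union> Q2. (if q \<in> Q1 then c1 q else 0) * Z q k)" for k
   using Q1(1) Q2(1) by (intro sum.mono_neutral_cong_left) auto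
  have s2: "(\<Sum>q\<in>Q2. c2 q * Z q k) = (\<Sum>q\<in>Q1 \<union> Q2. (if q \<in> Q2 then c2 q else 0) * Z q k)" for k
   using Q1(1) Q2(1) by (intro sum.mono_neutral_cong_left) auto
  have s: "1 * ?S (re_mat Y) k + \<i> * ?S (im_mat Y) k = (\<Sum>q\<in>Q1 \<union> Q2. ((if q \<in> Q1 then c1 q else 0) + \<i> * (if q \<in> Q2 then c2 q else 0)) * Z q k)" for k
   unfolding Q1(3) Q2(3) s1 s2 sum_distrib_left distrib_right sum.distrib by (simp only: mult.assoc mult_1)
  show ?thesis unfolding s using Q1(1,2) Q2(1,2) by (intro Z_comb_H_fin) auto
 qed
 have "whittaker_hom w h g = whittaker_hom w (\<lambda>k. 1 * ?S (re_mat Y) k + \<i> * ?S (im_mat Y) k) g"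
  by (simp only: whittaker_hom_ae[OF h fin ae])
 also have "\<dots> = 1 * whittaker_hom w (?S (re_mat Y)) g + \<i> * whittaker_hom w (?S (im_mat Y)) g"
  by (rule whittaker_hom_lin[OF S S])
 also have "\<dots> = right_deriv_C Y (whittaker_hom w f) g"
  unfolding whittaker_hom_lie_sum[OF f] right_deriv_C_def whittaker_hom_right_deriv[OF w f g] by simp
 finally show ?thesis .
qed

lemma whittaker_hom_in:
 assumes w: "sys w"
 shows "whittaker_hom w \<in> whittaker_homs \<sigma>"
 unfolding whittaker_homs_def mem_Collect_eq
proof (intro conjI allI ballI impI)
 show "whittaker_hom w f = (\<lambda>g. 0)" if "f \<notin> H_fin \<sigma>" for f using that by (simp add: whittaker_hom_def fun_eq_iff)
 fix f assume f: "f \<in> H_fin \<sigma>"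
 show "whittaker_hom w f \<in> whittaker_fin" by (rule whittaker_hom_fin[OF w f])
 show "whittaker_hom w (prin_act \<sigma> \<kappa> f) = (\<lambda>g. whittaker_hom w f (g ** \<kappa>))" if "\<kappa> \<in> K_grp" for \<kappa>
  by (rule whittaker_hom_K[OF f that])
 fix h assume h: "h \<in> H_fin \<sigma>"
 show "whittaker_hom w f = whittaker_hom w h" if "ae_eq f h" by (rule whittaker_hom_ae[OF f h that])
 show "whittaker_hom w (\<lambda>k. a * f k + b * h k) = (\<lambda>g. a * whittaker_hom w f g + b * whittaker_hom w h g)" for a b
  by (rule ext) (rule whittaker_hom_lin[OF f h])
 show "whittaker_hom w h g = right_deriv_C Y (whittaker_hom w f) g" if "has_lie_deriv_C \<sigma> Y f h" "g \<in> G_grp" for Y g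
  by (rule whittaker_hom_lie[OF w f h that])
qed

end

section \<open>Moderate growth\<close>

text \<open>Polynomial growth measured by a scale \<open>a\<close>. The scale y + 1/y, which is at
  least 1, controls y near 0 and near infinity at once.\<close>

definition pow_bounded :: "'a set => ('a => real) => ('a => complex) => bool" where
 "pow_bounded S a f \<longleftrightarrow> (\<exists>C\<ge>0. \<exists>N::nat. \<forall>x\<in>S. norm (f x) \<le> C * a x ^ N)"

lemma pow_bounded_add:
 assumes a: "\<And>x. x \<in> S ==> a x \<ge> 1" and f: "pow_bounded S a f" and h: "pow_bounded S a h"
 shows "pow_bounded S a (\<lambda>x. f x + h x)"
proof -
 obtain C N where C: "C \<ge> 0" "\<And>x. x \<in> S ==> norm (f x) \<le> C * a x ^ N" using f by (auto simp: pow_bounded_def)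
 obtain D M where D: "D \<ge> 0" "\<And>x. x \<in> S ==> norm (h x) \<le> D * a x ^ M" using h by (auto simp: pow_bounded_def)
 have "norm (f x + h x) \<le> (C + D) * a x ^ (N + M)" if x: "x \<in> S" for x
 proof -
  have "C * a x ^ N \<le> C * a x ^ (N + M)" "D * a x ^ M \<le> D * a x ^ (N + M)"
   using a[OF x] C(1) D(1) by (auto intro!: mult_left_mono power_increasing)
  then show ?thesis using C(2)[OF x] D(2)[OF x] norm_triangle_ineq[of "f x" "h x"] by (simp add: distrib_right)
 qed
 then show ?thesis unfolding pow_bounded_def using C(1) D(1) by (intro exI[of _ "C + D"] conjI exI[of _ "N + M"]) auto
qed

lemma pow_bounded_mult:
 assumes a: "\<And>x. x \<in> S ==> a x \<ge> 1" and f: "pow_bounded S a f" and h: "pow_bounded S a h"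
 shows "pow_bounded S a (\<lambda>x. f x * h x)"
proof -
 obtain C N where C: "C \<ge> 0" "\<And>x. x \<in> S ==> norm (f x) \<le> C * a x ^ N" using f by (auto simp: pow_bounded_def)
 obtain D M where D: "D \<ge> 0" "\<And>x. x \<in> S ==> norm (h x) \<le> D * a x ^ M" using h by (auto simp: pow_bounded_def)
 have "norm (f x * h x) \<le> (C * D) * a x ^ (N + M)" if x: "x \<in> S" for x
 proof -
  have "norm (f x * h x) \<le> (C * a x ^ N) * (D * a x ^ M)"
   unfolding norm_mult using C D x a[OF x] by (intro mult_mono) (auto intro!: mult_nonneg_nonneg zero_le_power order_trans[OF zero_le_one])
  then show ?thesis by (simp add: power_add algebra_simps)
 qed
 then show ?thesis unfolding pow_bounded_def using C(1) D(1) by (intro exI[of _ "C * D"] conjI exI[of _ "N + M"]) auto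
qed

lemma pow_bounded_const: "pow_bounded S a (\<lambda>x. c)"
 unfolding pow_bounded_def by (intro exI[of _ "norm c"] conjI exI[of _ 0]) auto

lemma pow_bounded_sum:
 assumes a: "\<And>x. x \<in> S ==> a x \<ge> 1" and "finite Q" "\<And>q. q \<in> Q ==> pow_bounded S a (f q)"
 shows "pow_bounded S a (\<lambda>x. \<Sum>q\<in>Q. f q x)"
 using assms(2,3) by (induction Q rule: finite_induct) (auto intro!: pow_bounded_const pow_bounded_add[OF a])

lemma powr_le_power:
 fixes x a s :: real
 assumes "x > 0" "x \<le> a" "1 / x \<le> a" "a \<ge> 1"
 shows "x powr s \<le> a ^ nat \<lceil>\<bar>s\<bar>\<rceil>"
proof -
 have "x powr s \<le> a powr \<bar>s\<bar>"
 proof (cases "s \<ge> 0")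
  case True
  then show ?thesis using assms by (simp add: powr_mono2)
 next
  case False
  have "x powr s = (1 / x) powr (- s)" using assms by (simp add: powr_def ln_div ln_inverse)
  also have "\<dots> \<le> a powr (- s)" using False assms by (intro powr_mono2) auto
  finally show ?thesis using False by simp
 qed
 also have "\<dots> \<le> a powr real (nat \<lceil>\<bar>s\<bar>\<rceil>)" using assms by (intro powr_mono) linarith+
 also have "\<dots> = a ^ nat \<lceil>\<bar>s\<bar>\<rceil>" by (rule powr_realpow) (use assms in simp)
 finally show ?thesis .
qed

lemma pow_bounded_powr:
 assumes "\<And>x. x \<in> S ==> f x > 0 \<and> f x \<le> a x \<and> 1 / f x \<le> a x \<and> a x \<ge> 1"
 shows "pow_bounded S a (\<lambda>x. complex_of_real (f x) powr s)"
 unfolding pow_bounded_def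
proof (intro exI[of _ "1::real"] conjI exI[of _ "nat \<lceil>\<bar>Re s\<bar>\<rceil>"] ballI)
 fix x assume "x \<in> S"
 then have "f x > 0" "f x \<le> a x" "1 / f x \<le> a x" "a x \<ge> 1" using assms by auto
 from powr_le_power[OF this, of "Re s"] this(1)
 show "norm (complex_of_real (f x) powr s) \<le> 1 * a x ^ nat \<lceil>\<bar>Re s\<bar>\<rceil>" by (simp add: norm_powr_real_powr)
qed simp

lemma plus_inverse_ge: "(y::real) > 0 ==> y + 1 / y \<ge> 1"
 using sum_squares_ge_zero[of "y - 1" 0] by (simp add: field_simps power2_eq_square)

lemma pow_bounded_poly: "pow_bounded {0<..} (\<lambda>y. y + 1 / y) (\<lambda>y. poly p (of_real (c * y)))"
proof (induction p)
 case 0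
 show ?case by (simp add: pow_bounded_const)
next
 case (pCons a p)
 have "pow_bounded {0<..} (\<lambda>y. y + 1 / y) (\<lambda>y. complex_of_real y)"
  unfolding pow_bounded_def by (intro exI[of _ 1] conjI exI[of _ 1]) auto
 then have "pow_bounded {0<..} (\<lambda>y. y + 1 / y) (\<lambda>y. a + of_real c * complex_of_real y * poly p (of_real (c * y)))"
  using pCons.IH by (intro pow_bounded_add pow_bounded_mult pow_bounded_const plus_inverse_ge) auto
 then show ?case by simp
qed

lemma pow_bounded_K_int: "pow_bounded {0<..} (\<lambda>y. y + 1 / y) (\<lambda>y. K_int r (2 * pi * y))"
proof -
 obtain C and N :: nat where C: "C \<ge> 0" "\<And>x. x > 0 ==> norm (K_int r x) \<le> C * (1 / x) ^ N" using K_int_poly_bound by blast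
 have "norm (K_int r (2 * pi * y)) \<le> C * (y + 1 / y) ^ N" if y: "y > 0" for y
 proof -
  have "1 * y \<le> (2 * pi) * y" using y pi_ge_two by (intro mult_right_mono) auto
  then have "1 / (2 * pi * y) \<le> 1 / y" using y by (intro divide_left_mono) auto
  then have "1 / (2 * pi * y) \<le> y + 1 / y" using y by simp
  then have "(1 / (2 * pi * y)) ^ N \<le> (y + 1 / y) ^ N" using y by (intro power_mono) auto
  then have "C * (1 / (2 * pi * y)) ^ N \<le> C * (y + 1 / y) ^ N" using C(1) by (intro mult_left_mono)
  then show ?thesis using C(2)[of "2 * pi * y"] y by simp
 qed
 then show ?thesis unfolding pow_bounded_def using C(1) by (intro exI[of _ C] conjI exI[of _ N]) auto
qed

lemma pow_bounded_whittaker_weight_K: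
 "pow_bounded {0<..} (\<lambda>y. y + 1 / y) (whittaker_weight \<mu> \<nu> d (K_int r) (K_int (r + 1)) q)"
 unfolding whittaker_weight_def[abs_def] pair_eval_def
 by (intro pow_bounded_add pow_bounded_mult pow_bounded_poly pow_bounded_K_int pow_bounded_powr plus_inverse_ge)
  (auto intro: plus_inverse_ge)

text \<open>On G each of the two factors is at least 1, so the product bounds both coordinates and
  their inverses. The unipotent coordinate enters a weight function only through a factor of modulus
  1.\<close>

definition growth_scale :: "mat2 => real" where
 "growth_scale g = (\<bar>iwa_y g\<bar> + 1 / \<bar>iwa_y g\<bar>) * (row_norm2 g + 1 / row_norm2 g)"

lemma growth_scale_bounds:
 assumes "det g \<noteq> 0"
 shows "\<bar>iwa_y g\<bar> + 1 / \<bar>iwa_y g\<bar> \<le> growth_scale g" "row_norm2 g + 1 / row_norm2 g \<le> growth_scale g" "growth_scale g \<ge> 1"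
proof -
 have p: "\<bar>iwa_y g\<bar> > 0" "row_norm2 g > 0" using assms row_norm2_pos[OF assms] by (auto simp: iwa_y_def)
 note a = plus_inverse_ge[OF p(1)] and b = plus_inverse_ge[OF p(2)]
 show "\<bar>iwa_y g\<bar> + 1 / \<bar>iwa_y g\<bar> \<le> growth_scale g" unfolding growth_scale_def using mult_left_mono[OF b, of "\<bar>iwa_y g\<bar> + 1 / \<bar>iwa_y g\<bar>"] a by simp
 show "row_norm2 g + 1 / row_norm2 g \<le> growth_scale g" unfolding growth_scale_def using mult_right_mono[OF a, of "row_norm2 g + 1 / row_norm2 g"] b by simp
 then show "growth_scale g \<ge> 1" using b by linarith
qed

text \<open>The modulus of \<open>row_cplx g\<close> is the square root of
  \<open>row_norm2 g\<close>, so the weight drops out.\<close>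

lemma norm_weight_factor:
 assumes "det g \<noteq> 0"
 shows "norm (of_real (row_norm2 g) powr ((\<mu> - of_int q) / 2) * row_cplx g powi q) = row_norm2 g powr (Re \<mu> / 2)"
proof -
 have N: "row_norm2 g > 0" by (rule row_norm2_pos[OF assms])
 have "norm (row_cplx g) = row_norm2 g powr (1/2)"
  by (simp add: row_cplx_def cmod_def row_norm2_def powr_half_sqrt add.commute)
 then have "norm (row_cplx g powi q) = row_norm2 g powr (of_int q / 2)"
  using N by (simp add: norm_power_int powr_real_of_int' [symmetric] powr_powr)
 then show ?thesis using N by (simp add: norm_mult norm_powr_real_powr powr_add[symmetric] add_divide_distrib[symmetric])
qed

lemma pow_bounded_weight_fn:
 assumes "pow_bounded {0<..} (\<lambda>y. y + 1 / y) w"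
 shows "pow_bounded {g. det g > 0} growth_scale (weight_fn l \<mu> w q)"
proof -
 obtain C and N :: nat where C: "C \<ge> 0" "\<And>y. y > 0 ==> norm (w y) \<le> C * (y + 1 / y) ^ N"
  using assms by (auto simp: pow_bounded_def)
 define M where "M = nat \<lceil>\<bar>Re \<mu> / 2\<bar>\<rceil>"
 have "norm (weight_fn l \<mu> w q g) \<le> C * growth_scale g ^ (N + M)" if g: "det g > 0" for g
 proof -
  have g0: "det g \<noteq> 0" using g by simp
  note s = growth_scale_bounds[OF g0]
  have y: "iwa_y g > 0" by (rule iwa_y_pos[OF g])
  have n: "row_norm2 g > 0" by (rule row_norm2_pos[OF g0])
  have n2: "row_norm2 g \<le> growth_scale g" "1 / row_norm2 g \<le> growth_scale g"
   using s(2) n divide_pos_pos[OF zero_less_one n] by linarith+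
  have 1: "norm (w (iwa_y g)) \<le> C * growth_scale g ^ N"
  proof -
   have "(iwa_y g + 1 / iwa_y g) ^ N \<le> growth_scale g ^ N" using s(1) y by (intro power_mono) auto
   then show ?thesis using C(2)[OF y] mult_left_mono[OF _ C(1)] by (meson order_trans)
  qed
  have 2: "row_norm2 g powr (Re \<mu> / 2) \<le> growth_scale g ^ M" unfolding M_def by (rule powr_le_power[OF n n2 s(3)])
  have "norm (exp (2 * of_real pi * \<i> * of_real l * of_real (iwa_x g))) = 1" by (simp add: norm_exp_eq_Re)
  then have "norm (weight_fn l \<mu> w q g) = norm (w (iwa_y g)) * row_norm2 g powr (Re \<mu> / 2)"
   unfolding weight_fn_def norm_mult[of _ "_ * _"] norm_weight_factor[OF g0] norm_mult[of "exp _"] by simp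
  also have "\<dots> \<le> (C * growth_scale g ^ N) * growth_scale g ^ M"
   using 1 2 C(1) s(3) by (intro mult_mono) auto
  finally show ?thesis by (simp add: power_add)
 qed
 then show ?thesis unfolding pow_bounded_def using C(1) by (intro exI[of _ C] conjI exI[of _ "N + M"]) auto
qed

lemma growth_scale_refl2: "growth_scale (g ** refl2) = growth_scale g"
 by (simp add: growth_scale_def iwa_y_def row_norm2_def mat2_mult_nth)

lemma pow_bounded_weight_family:
 assumes w: "\<And>q. pow_bounded {0<..} (\<lambda>y. y + 1 / y) (w q)"
 shows "pow_bounded G_grp growth_scale (weight_family l \<mu> s w q)"
proof -
 obtain C and N :: nat where C: "C \<ge> 0" "\<And>g. det g > 0 ==> norm (weight_fn l \<mu> (w q) q g) \<le> C * growth_scale g ^ N"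
  using pow_bounded_weight_fn[OF w] unfolding pow_bounded_def by blast
 obtain D and M :: nat where D: "D \<ge> 0" "\<And>g. det g > 0 ==> norm (weight_fn l \<mu> (w (- q)) (- q) g) \<le> D * growth_scale g ^ M"
  using pow_bounded_weight_fn[OF w] unfolding pow_bounded_def by blast
 have "norm (weight_family l \<mu> s w q g) \<le> (C + norm s * D) * growth_scale g ^ (N + M)" if g: "g \<in> G_grp" for g
 proof -
  have s: "growth_scale g \<ge> 1" using growth_scale_bounds(3) g by (simp add: G_grp_det)
  have i: "growth_scale g ^ N \<le> growth_scale g ^ (N + M)" "growth_scale g ^ M \<le> growth_scale g ^ (N + M)"
   using s by (auto intro: power_increasing)
  have p: "growth_scale g ^ (N + M) \<ge> 0" using s by auto
  consider "det g > 0" | "det g < 0" using g unfolding G_grp_det by linarith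
  then show ?thesis
  proof cases
   case 1
   have "norm (weight_fn l \<mu> (w q) q g) \<le> C * growth_scale g ^ (N + M)"
    using C(2)[OF 1] mult_left_mono[OF i(1) C(1)] by linarith
   moreover have "0 \<le> norm s * D * growth_scale g ^ (N + M)" using D(1) p by simp
   ultimately show ?thesis using 1 by (simp add: weight_family_def distrib_right)
  next
   case 2
   have "norm (weight_fn l \<mu> (w (- q)) (- q) (g ** refl2)) \<le> D * growth_scale g ^ (N + M)"
    using D(2)[of "g ** refl2"] mult_left_mono[OF i(2) D(1)] 2 by (simp add: growth_scale_refl2)
   then have "norm s * norm (weight_fn l \<mu> (w (- q)) (- q) (g ** refl2)) \<le> norm s * (D * growth_scale g ^ (N + M))"
    by (intro mult_left_mono) auto
   moreover have "0 \<le> C * growth_scale g ^ (N + M)" using C(1) p by simp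
   ultimately show ?thesis using 2 by (simp add: weight_family_def distrib_right norm_mult mult.assoc)
  qed
 qed
 then show ?thesis unfolding pow_bounded_def using C(1) D(1) by (intro exI[of _ "C + norm s * D"] conjI exI[of _ "N + M"]) auto
qed

lemma det_le_norm: "\<bar>det (g :: mat2)\<bar> \<le> 2 * (norm g)\<^sup>2"
proof -
 have "\<bar>g$1$1 * g$2$2\<bar> \<le> norm g * norm g" "\<bar>g$1$2 * g$2$1\<bar> \<le> norm g * norm g"
  unfolding abs_mult by (intro mult_mono mat2_nth_le_norm norm_ge_zero abs_ge_zero)+
 then show ?thesis unfolding det_2 power2_eq_square by linarith
qed

lemma row_norm2_le_norm: "row_norm2 g \<le> 2 * (norm g)\<^sup>2"
proof -
 have "\<bar>g$2$j\<bar>\<^sup>2 \<le> (norm g)\<^sup>2" for j by (intro power_mono mat2_nth_le_norm abs_ge_zero)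
 from this[of 1] this[of 2] show ?thesis by (simp add: row_norm2_def)
qed

text \<open>With T the sum of the two norms, |det g|, \<open>row_norm2 g\<close> and their inverses
  are at most 2 T^2: for the determinant through det of the inverse matrix, for the row norm through
  Cauchy-Schwarz in the lower right entry of g times its inverse. This gives (4 T^4 + 4 T^4) (4 T^2)
  = 32 T^6.\<close>

lemma growth_scale_le:
 assumes g: "g \<in> G_grp"
 shows "growth_scale g \<le> 32 * (norm g + norm (matrix_inv g)) ^ 6"
proof -
 define h T where "h = matrix_inv g" and "T = norm g + norm h"
 have gh: "g ** h = mat 1" using g unfolding h_def matrix_inv_def G_grp_def invertible_def mem_Collect_eq by (rule conjunct1[OF someI_ex])
 have d: "det g \<noteq> 0" using g by (simp add: G_grp_det)
 note n = row_norm2_pos[OF d]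
 have T: "norm g \<le> T" "norm h \<le> T" "T \<ge> 0" by (auto simp: T_def)
 have T2: "(norm g)\<^sup>2 \<le> T\<^sup>2" "(norm h)\<^sup>2 \<le> T\<^sup>2" using T by (auto intro: power_mono)
 have b1: "row_norm2 g \<le> 2 * T\<^sup>2" "\<bar>det g\<bar> \<le> 2 * T\<^sup>2" using row_norm2_le_norm[of g] det_le_norm[of g] T2 by linarith+
 have "det g * det h = 1" using gh by (metis det_I det_mul)
 then have "1 / \<bar>det g\<bar> = \<bar>det h\<bar>" using d by (metis abs_mult abs_one abs_zero nonzero_eq_divide_eq abs_eq_0 mult.commute)
 then have b2: "1 / \<bar>det g\<bar> \<le> 2 * T\<^sup>2" using det_le_norm[of h] T2 by linarith
 have e: "g$2$1 * h$1$2 + g$2$2 * h$2$2 = 1" using gh by (simp add: mat2_eq_iff mat2_mult_nth)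
 have "1 \<le> row_norm2 g * ((h$1$2)\<^sup>2 + (h$2$2)\<^sup>2)"
 proof -
  have "row_norm2 g * ((h$1$2)\<^sup>2 + (h$2$2)\<^sup>2) = (g$2$1 * h$1$2 + g$2$2 * h$2$2)\<^sup>2 + (g$2$1 * h$2$2 - g$2$2 * h$1$2)\<^sup>2"
   by (simp add: row_norm2_def power2_eq_square algebra_simps)
  then show ?thesis unfolding e by simp
 qed
 also have "\<dots> \<le> row_norm2 g * (2 * T\<^sup>2)"
 proof (intro mult_left_mono)
  have "\<bar>h$i$j\<bar>\<^sup>2 \<le> (norm h)\<^sup>2" for i j by (intro power_mono mat2_nth_le_norm abs_ge_zero)
  from this[of 1 2] this[of 2 2] show "(h$1$2)\<^sup>2 + (h$2$2)\<^sup>2 \<le> 2 * T\<^sup>2" using T2 by simp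
 qed (use n in simp)
 finally have b3: "1 / row_norm2 g \<le> 2 * T\<^sup>2" using n by (simp add: field_simps)
 have "\<bar>iwa_y g\<bar> = \<bar>det g\<bar> * (1 / row_norm2 g)" using n by (simp add: iwa_y_def)
 also have "\<dots> \<le> (2 * T\<^sup>2) * (2 * T\<^sup>2)" using b1(2) b3 n by (intro mult_mono) auto
 finally have c1: "\<bar>iwa_y g\<bar> \<le> (2 * T\<^sup>2) * (2 * T\<^sup>2)" .
 have "1 / \<bar>iwa_y g\<bar> = (1 / \<bar>det g\<bar>) * row_norm2 g" using n by (simp add: iwa_y_def)
 also have "\<dots> \<le> (2 * T\<^sup>2) * (2 * T\<^sup>2)" using b1(1) b2 n by (intro mult_mono) auto
 finally have c2: "1 / \<bar>iwa_y g\<bar> \<le> (2 * T\<^sup>2) * (2 * T\<^sup>2)" .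
 have "growth_scale g \<le> ((2 * T\<^sup>2) * (2 * T\<^sup>2) + (2 * T\<^sup>2) * (2 * T\<^sup>2)) * (2 * T\<^sup>2 + 2 * T\<^sup>2)"
  unfolding growth_scale_def using c1 c2 b1(1) b3 n by (intro mult_mono add_mono) auto
 also have "\<dots> = 32 * T ^ 6" by (simp add: power2_eq_square eval_nat_numeral algebra_simps)
 finally show ?thesis by (simp add: T_def h_def)
qed

lemma moderate_growthI:
 assumes "pow_bounded G_grp growth_scale \<phi>"
 shows "moderate_growth \<phi>"
proof -
 obtain C and N :: nat where C: "C \<ge> 0" "\<And>g. g \<in> G_grp ==> norm (\<phi> g) \<le> C * growth_scale g ^ N"
  using assms by (auto simp: pow_bounded_def)
 have "norm (\<phi> g) \<le> (C * 32 ^ N) * (norm g + norm (matrix_inv g)) ^ (6 * N)" if g: "g \<in> G_grp" for g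
 proof -
  have "growth_scale g ^ N \<le> (32 * (norm g + norm (matrix_inv g)) ^ 6) ^ N"
   using growth_scale_le[OF g] growth_scale_bounds(3)[of g] g by (intro power_mono) (auto simp: G_grp_det)
  then have "C * growth_scale g ^ N \<le> C * (32 ^ N * (norm g + norm (matrix_inv g)) ^ (6 * N))"
   using C(1) by (intro mult_left_mono) (auto simp: power_mult_distrib power_mult)
  then show ?thesis using C(2)[OF g] by (simp add: mult.assoc)
 qed
 then show ?thesis unfolding moderate_growth_def by blast
qed

lemma (in principal_series) whittaker_hom_mg:
 assumes w: "sys w" and b: "\<And>q. pow_bounded {0<..} (\<lambda>y. y + 1 / y) (w q)"
 shows "whittaker_hom w \<in> whittaker_homs_mg \<sigma>"
proof -
 have "moderate_growth (whittaker_hom w f)" if f: "f \<in> H_fin \<sigma>" for f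
 proof (rule moderate_growthI)
  have e: "whittaker_hom w f = (\<lambda>g. \<Sum>q\<in>support f. coef f q * W w q g)" using f by (simp add: whittaker_hom_def fun_eq_iff)
  have s: "growth_scale g \<ge> 1" if "g \<in> G_grp" for g using growth_scale_bounds(3) that by (simp add: G_grp_det)
  show "pow_bounded G_grp growth_scale (whittaker_hom w f)"
   unfolding e by (intro pow_bounded_sum pow_bounded_mult pow_bounded_const pow_bounded_weight_family b finite_support f s)
 qed
 then show ?thesis using whittaker_hom_in[OF w] by (simp add: whittaker_homs_mg_def)
qed

section \<open>Classification of the homomorphisms\<close>

lemma has_vector_derivative_along:
 fixes \<phi> :: "'a::real_normed_vector => 'b::real_normed_vector"
 assumes "(\<gamma> has_vector_derivative V) (at t)" "(\<phi> has_derivative D) (at (\<gamma> t))"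
 shows "((\<lambda>t. \<phi> (\<gamma> t)) has_vector_derivative D V) (at t)"
proof -
 have "D (x *\<^sub>R V) = x *\<^sub>R D V" for x by (rule linear_cmul[OF has_derivative_linear[OF assms(2)]])
 then show ?thesis
  using diff_chain_at[OF assms(1)[unfolded has_vector_derivative_def] assms(2)] by (simp add: has_vector_derivative_def o_def)
qed

text \<open>Reversing the sign of the weight exchanges the two relations of the system, so that
  results about going up also cover going down.\<close>

lemma whittaker_system_flip:
 assumes "whittaker_system l \<mu> \<nu> d w"
 shows "whittaker_system (- l) \<mu> \<nu> (- d) (\<lambda>q. w (- q))"
 unfolding whittaker_system_def
proof (intro allI impI)
 fix q :: int and y :: real assume q: "even (q - (- d))" and y: "y > 0"
 then have "even (- q - d)" by presburger
 then obtain D where "(w (- q) has_vector_derivative D) (at y)"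
   "2 * of_real y * D - 4 * of_real pi * of_real l * of_real y * w (- q) y + (of_int (- q) - \<mu>) * w (- q) y = (\<nu> + 1 + of_int (- q)) * w (- q + 2) y"
   "2 * of_real y * D + 4 * of_real pi * of_real l * of_real y * w (- q) y + (- of_int (- q) - \<mu>) * w (- q) y = (\<nu> + 1 - of_int (- q)) * w (- q - 2) y"
  using assms y unfolding whittaker_system_def by blast
 moreover have "- (q + 2) = - q - 2" "- (q - 2) = - q + 2" by simp_all
 ultimately show "\<exists>D. (w (- q) has_vector_derivative D) (at y) \<and>
   2 * of_real y * D - 4 * of_real pi * of_real (- l) * of_real y * w (- q) y + (of_int q - \<mu>) * w (- q) y = (\<nu> + 1 + of_int q) * w (- (q + 2)) y \<and>
   2 * of_real y * D + 4 * of_real pi * of_real (- l) * of_real y * w (- q) y + (- of_int q - \<mu>) * w (- q) y = (\<nu> + 1 - of_int q) * w (- (q - 2)) y"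
  by (intro exI[of _ D]) simp
qed

text \<open>The raising relation computes the weight q + 2 from the weight q and its derivative, its
  factor being nonzero.\<close>

lemma whittaker_system_unique_up:
 assumes w: "whittaker_system l \<mu> \<nu> d w" and v: "whittaker_system l \<mu> \<nu> d v"
  and p: "even (p - d)" and nz: "\<And>n::nat. \<nu> + 1 + of_int (p + 2 * int n) \<noteq> 0"
  and base: "\<And>y. y > 0 ==> w p y = v p y"
 shows "y > 0 ==> w (p + 2 * int n) y = v (p + 2 * int n) y"
proof (induction n arbitrary: y)
 case 0
 then show ?case using base by simp
next
 case (Suc n)
 let ?q = "p + 2 * int n"
 have q: "even (?q - d)" using p by presburger
 have e: "p + 2 * int (Suc n) = ?q + 2" by simp
 obtain D where D: "(w ?q has_vector_derivative D) (at y)"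
  "2 * of_real y * D - 4 * of_real pi * of_real l * of_real y * w ?q y + (of_int ?q - \<mu>) * w ?q y = (\<nu> + 1 + of_int ?q) * w (?q + 2) y"
  using w q Suc.prems unfolding whittaker_system_def by blast
 obtain E where E: "(v ?q has_vector_derivative E) (at y)"
  "2 * of_real y * E - 4 * of_real pi * of_real l * of_real y * v ?q y + (of_int ?q - \<mu>) * v ?q y = (\<nu> + 1 + of_int ?q) * v (?q + 2) y"
  using v q Suc.prems unfolding whittaker_system_def by blast
 have "(v ?q has_vector_derivative D) (at y)"
  by (rule has_vector_derivative_transform_within_open[OF D(1), of "{0<..}"]) (use Suc in auto)
 then have "D = E" using E(1) by (rule vector_derivative_unique_at)
 then have "(\<nu> + 1 + of_int ?q) * w (?q + 2) y = (\<nu> + 1 + of_int ?q) * v (?q + 2) y"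
  unfolding D(2)[symmetric] E(2)[symmetric] Suc.IH[OF Suc.prems] by simp
 then show ?case unfolding e using nz[of n] by (metis mult_cancel_left)
qed

lemma whittaker_system_unique:
 assumes w: "whittaker_system l \<mu> \<nu> d w" and v: "whittaker_system l \<mu> \<nu> d v" and d: "d \<in> {0, 1}"
  and nz: "\<And>n::nat. \<nu> + 1 + of_int (d + 2 * int n) \<noteq> 0"
  and base: "\<And>y. y > 0 ==> w d y = v d y" "\<And>y. y > 0 ==> w (- d) y = v (- d) y"
  and q: "even (q - d)" and y: "y > 0"
 shows "w q y = v q y"
proof (cases "q \<ge> d")
 case True
 then have e: "q = d + 2 * int (nat ((q - d) div 2))" using q by auto
 show ?thesis by (subst (1 2) e) (rule whittaker_system_unique_up[OF w v _ nz base(1) y]; simp)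
next
 case False
 have "d = 0 \<or> d = 1" using d by auto
 then have "- q \<ge> d" using False q by presburger
 moreover have "even (- q - d)" using q by presburger
 ultimately have "q = - (d + 2 * int (nat ((- q - d) div 2)))" by auto
 then obtain n where n: "q = - (d + 2 * int n)" by blast
 have "even (d - - d)" by simp
 from whittaker_system_unique_up[OF whittaker_system_flip[OF w] whittaker_system_flip[OF v] this nz base(2) y, of n]
 show ?thesis unfolding n by simp
qed

text \<open>The relations between the weights \<open>0, 2\<close> (for \<open>d = 0\<close>) or \<open>1, -1\<close> (for \<open>d = 1\<close>) are
 equivalent to those of a Bessel pair, up to a linear change of variables.\<close>

lemma whittaker_system_bessel_pair:
 assumes w: "whittaker_system 1 \<mu> \<nu> d w" and d: "d \<in> {0, 1}"
  and nz: "\<And>n::nat. \<nu> + 1 + of_int (d + 2 * int n) \<noteq> 0"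
 obtains F H where "bessel_pair (bessel_order \<nu> d) F H"
  "\<forall>q y. even (q - d) \<longrightarrow> y > 0 \<longrightarrow> w q y = whittaker_weight \<mu> \<nu> d F H q y"
proof -
 define s where "s = (\<mu> + 1 + of_int d) / 2"
 \<comment> \<open>Removes the power of y and rescales the variable, undoing the normalisation in
   \<open>whittaker_weight\<close>.\<close>
 define f where "f q z = complex_of_real (z / (2 * pi)) powr (- s) * w q (z / (2 * pi))" for q z
 have wf: "w q y = of_real y powr s * f q (2 * pi * y)" if "y > 0" for q y
  using that by (simp add: f_def powr_minus)
 have f: "\<exists>D. (f q has_vector_derivative D) (at z) \<and>
   2 * of_real z * D = 2 * of_real z * f q z - (1 + of_int d + of_int q) * f q z + (\<nu> + 1 + of_int q) * f (q + 2) z \<and>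
   2 * of_real z * D = - 2 * of_real z * f q z - (1 + of_int d - of_int q) * f q z + (\<nu> + 1 - of_int q) * f (q - 2) z"
  if q: "even (q - d)" and z: "z > 0" for q z
 proof -
  define y where "y = z / (2 * pi)"
  have y: "y > 0" and zy: "z = 2 * pi * y" using z by (simp_all add: y_def)
  obtain D where D: "(w q has_vector_derivative D) (at y)"
   "2 * of_real y * D - 4 * of_real pi * of_real 1 * of_real y * w q y + (of_int q - \<mu>) * w q y = (\<nu> + 1 + of_int q) * w (q + 2) y"
   "2 * of_real y * D + 4 * of_real pi * of_real 1 * of_real y * w q y + (- of_int q - \<mu>) * w q y = (\<nu> + 1 - of_int q) * w (q - 2) y"
   using w q y unfolding whittaker_system_def by blast
  let ?P = "complex_of_real y powr (- s)"
  have "((\<lambda>y. complex_of_real y powr (- s) * w q y) has_vector_derivative ?P * D + (- s / of_real y * ?P) * w q y) (at y)"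
   using has_vector_derivative_mult[OF has_vector_derivative_powr_real[OF y, of 1 "- s"] D(1)] by simp
  moreover have "((\<lambda>z. z / (2 * pi)) has_vector_derivative 1 / (2 * pi)) (at z)"
   by (simp flip: has_real_derivative_iff_has_vector_derivative) (auto intro!: derivative_eq_intros)
  ultimately have "((\<lambda>z. f q z) has_vector_derivative (1 / (2 * pi)) *\<^sub>R (?P * D + (- s / of_real y * ?P) * w q y)) (at z)"
   using vector_diff_chain_at[of "\<lambda>z. z / (2 * pi)" "1 / (2 * pi)" z "\<lambda>y. complex_of_real y powr (- s) * w q y"]
   by (simp add: f_def[abs_def] o_def y_def)
  moreover have "2 * of_real z * ((1 / (2 * pi)) *\<^sub>R (?P * D + (- s / of_real y * ?P) * w q y)) = ?P * (2 * of_real y * D) - 2 * s * (?P * w q y)"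
   using y unfolding zy by (simp add: scaleR_conv_of_real field_simps)
  moreover have "f p z = ?P * w p y" for p by (simp add: f_def y_def)
  moreover have "2 * of_real y * D = 4 * of_real pi * of_real y * w q y - (of_int q - \<mu>) * w q y + (\<nu> + 1 + of_int q) * w (q + 2) y"
   "2 * of_real y * D = - 4 * of_real pi * of_real y * w q y - (- of_int q - \<mu>) * w q y + (\<nu> + 1 - of_int q) * w (q - 2) y"
   using D(2,3) by (simp_all add: algebra_simps)
  moreover have "?P * (4 * of_real pi * of_real y * w q y - (of_int q - \<mu>) * w q y + (\<nu> + 1 + of_int q) * w (q + 2) y) - 2 * s * (?P * w q y)
    = 2 * of_real z * (?P * w q y) - (1 + of_int d + of_int q) * (?P * w q y) + (\<nu> + 1 + of_int q) * (?P * w (q + 2) y)"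
   unfolding zy s_def by (simp add: field_simps)
  moreover have "?P * (- 4 * of_real pi * of_real y * w q y - (- of_int q - \<mu>) * w q y + (\<nu> + 1 - of_int q) * w (q - 2) y) - 2 * s * (?P * w q y)
    = - 2 * of_real z * (?P * w q y) - (1 + of_int d - of_int q) * (?P * w q y) + (\<nu> + 1 - of_int q) * (?P * w (q - 2) y)"
   unfolding zy s_def by (simp add: field_simps)
  ultimately show ?thesis by (metis (no_types, lifting))
 qed
 have "\<exists>F H. bessel_pair (bessel_order \<nu> d) F H \<and> (\<forall>y>0. w d y = whittaker_weight \<mu> \<nu> d F H d y \<and> w (- d) y = whittaker_weight \<mu> \<nu> d F H (- d) y)"
 proof (cases "d = 0")
  case True
  \<comment> \<open>Forced by the first equation of a Bessel pair with F = f 0, whose derivative is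
    known from the raising relation between the weights 0 and 2.\<close>
  define H where "H z = ((\<nu> + 1) / (2 * of_real z) - 1) * f 0 z - (\<nu> + 1) / (2 * of_real z) * f 2 z" for z :: real
  have "bessel_pair (bessel_order \<nu> d) (f 0) H"
   unfolding bessel_pair_def bessel_order_def
  proof (intro allI impI)
   fix z :: real assume z: "z > 0"
   obtain D0 where D0: "(f 0 has_vector_derivative D0) (at z)" "2 * of_real z * D0 = 2 * of_real z * f 0 z - f 0 z + (\<nu> + 1) * f 2 z"
    using f[of 0 z] z True by auto
   obtain D2 where D2: "(f 2 has_vector_derivative D2) (at z)" "2 * of_real z * D2 = - 2 * of_real z * f 2 z + f 2 z + (\<nu> - 1) * f 0 z"
    using f[of 2 z] z True by (auto simp: algebra_simps)
   have z0: "complex_of_real z \<noteq> 0" using z by simp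
   have e0: "D0 = f 0 z - f 0 z / (2 * of_real z) + (\<nu> + 1) * f 2 z / (2 * of_real z)"
   proof -
    have "D0 = (2 * of_real z * D0) / (2 * of_real z)" using z0 by simp
    then show ?thesis unfolding D0(2) using z0 by (simp add: add_divide_distrib diff_divide_distrib)
   qed
   have e2: "D2 = - f 2 z + f 2 z / (2 * of_real z) + (\<nu> - 1) * f 0 z / (2 * of_real z)"
   proof -
    have "D2 = (2 * of_real z * D2) / (2 * of_real z)" using z0 by simp
    then show ?thesis unfolding D2(2) using z0 by (simp add: add_divide_distrib diff_divide_distrib)
   qed
   have i: "((\<lambda>z. (\<nu> + 1) / (2 * complex_of_real z)) has_vector_derivative - (\<nu> + 1) / (2 * (of_real z)\<^sup>2)) (at z)"
   proof -
    have "((\<lambda>z. (\<nu> + 1) / (2 * z)) has_field_derivative - (\<nu> + 1) / (2 * (of_real z)\<^sup>2)) (at (complex_of_real z))"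
     using z0 by (auto intro!: derivative_eq_intros simp: field_simps power2_eq_square)
    then show ?thesis by (rule has_vector_derivative_real_field)
   qed
   have h: "(H has_vector_derivative ((\<nu> + 1) / (2 * of_real z) - 1) * D0 + (- (\<nu> + 1) / (2 * (of_real z)\<^sup>2) - 0) * f 0 z
     - ((\<nu> + 1) / (2 * of_real z) * D2 + (- (\<nu> + 1) / (2 * (of_real z)\<^sup>2)) * f 2 z)) (at z)"
    unfolding H_def[abs_def] by (intro has_vector_derivative_diff has_vector_derivative_mult has_vector_derivative_const i D0 D2)
   have 1: "D0 = (\<nu> - of_int d) / 2 / of_real z * f 0 z - H z" unfolding e0 H_def True using z0 by (simp add: field_simps)
   have 2: "((\<nu> + 1) / (2 * of_real z) - 1) * D0 + (- (\<nu> + 1) / (2 * (of_real z)\<^sup>2) - 0) * f 0 z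
     - ((\<nu> + 1) / (2 * of_real z) * D2 + (- (\<nu> + 1) / (2 * (of_real z)\<^sup>2)) * f 2 z) = - f 0 z - ((\<nu> - of_int d) / 2 + 1) / of_real z * H z"
    unfolding e0 e2 H_def True using z0 by (simp add: field_simps power2_eq_square)
   show "(f 0 has_vector_derivative (\<nu> - of_int d) / 2 / of_real z * f 0 z - H z) (at z) \<and> (H has_vector_derivative - f 0 z - ((\<nu> - of_int d) / 2 + 1) / of_real z * H z) (at z)"
    using D0(1) h unfolding 2 unfolding 1 by blast
  qed
  moreover have "w 0 y = whittaker_weight \<mu> \<nu> d (f 0) H 0 y" if "y > 0" for y
   using wf[OF that, of 0] True by (simp add: whittaker_weight_def weight_pair_def base_pair_def pair_eval_def s_def)
  ultimately show ?thesis using True by (metis minus_zero)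
 next
  case False
  then have d1: "d = 1" using d by auto
  \<comment> \<open>\<open>F\<close> and \<open>H\<close> invert the weights of
    \<open>base_pair\<close> for d = 1: f 1 = \<i> F + \<i> H and f (-1) = \<i> F - \<i> H.\<close>
  define F where "F z = (f 1 z + f (-1) z) / (2 * \<i>)" for z
  define H where "H z = (f 1 z - f (-1) z) / (2 * \<i>)" for z
  have "bessel_pair (bessel_order \<nu> d) F H"
   unfolding bessel_pair_def bessel_order_def
  proof (intro allI impI)
   fix z :: real assume z: "z > 0"
   obtain D where D: "(f 1 has_vector_derivative D) (at z)" "2 * of_real z * D = - 2 * of_real z * f 1 z - f 1 z + \<nu> * f (-1) z"
    using f[of 1 z] z d1 by auto
   obtain E where E: "(f (-1) has_vector_derivative E) (at z)" "2 * of_real z * E = 2 * of_real z * f (-1) z - f (-1) z + \<nu> * f 1 z"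
    using f[of "-1" z] z d1 by auto
   have z0: "complex_of_real z \<noteq> 0" using z by simp
   have eD: "D = - f 1 z - f 1 z / (2 * of_real z) + \<nu> * f (-1) z / (2 * of_real z)"
   proof -
    have "D = (2 * of_real z * D) / (2 * of_real z)" using z0 by simp
    then show ?thesis unfolding D(2) using z0 by (simp add: add_divide_distrib diff_divide_distrib)
   qed
   have eE: "E = f (-1) z - f (-1) z / (2 * of_real z) + \<nu> * f 1 z / (2 * of_real z)"
   proof -
    have "E = (2 * of_real z * E) / (2 * of_real z)" using z0 by simp
    then show ?thesis unfolding E(2) using z0 by (simp add: add_divide_distrib diff_divide_distrib)
   qed
   have "(F has_vector_derivative (D + E) / (2 * \<i>)) (at z)" "(H has_vector_derivative (D - E) / (2 * \<i>)) (at z)"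
    unfolding F_def[abs_def] H_def[abs_def] by (intro has_vector_derivative_divide has_vector_derivative_add has_vector_derivative_diff D E)+
   moreover have "(D + E) / (2 * \<i>) = (\<nu> - of_int d) / 2 / of_real z * F z - H z" "(D - E) / (2 * \<i>) = - F z - ((\<nu> - of_int d) / 2 + 1) / of_real z * H z"
    unfolding eD eE F_def H_def d1 using z0 by (simp_all add: field_simps)
   ultimately show "(F has_vector_derivative (\<nu> - of_int d) / 2 / of_real z * F z - H z) (at z) \<and> (H has_vector_derivative - F z - ((\<nu> - of_int d) / 2 + 1) / of_real z * H z) (at z)"
    by simp
  qed
  moreover have "w 1 y = whittaker_weight \<mu> \<nu> d F H 1 y \<and> w (-1) y = whittaker_weight \<mu> \<nu> d F H (-1) y" if "y > 0" for y
  proof -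
   have "\<i> * F z + \<i> * H z = f 1 z" "\<i> * F z - \<i> * H z = f (-1) z" for z by (simp_all add: F_def H_def field_simps)
   then show ?thesis using wf[OF that, of 1] wf[OF that, of "-1"]
    by (simp add: d1 whittaker_weight_def weight_pair_def base_pair_def pair_eval_def s_def)
  qed
  ultimately show ?thesis using d1 by blast
 qed
 then obtain F H where FH: "bessel_pair (bessel_order \<nu> d) F H" "\<And>y. y > 0 ==> w d y = whittaker_weight \<mu> \<nu> d F H d y"
  "\<And>y. y > 0 ==> w (- d) y = whittaker_weight \<mu> \<nu> d F H (- d) y" by blast
 show ?thesis
  by (rule that[OF FH(1)], intro allI impI) (rule whittaker_system_unique[OF w whittaker_weight_system[OF FH(1) d nz] d nz FH(2,3)])
qed

section \<open>The Whittaker functions of a given homomorphism\<close>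

locale whittaker_morphism = principal_series +
 fixes \<Phi>
 assumes \<Phi>: "\<Phi> \<in> whittaker_homs \<sigma>"
begin

lemma
 shows Phi_outside: "f \<notin> H_fin \<sigma> ==> \<Phi> f = (\<lambda>g. 0)"
  and Phi_fin: "f \<in> H_fin \<sigma> ==> \<Phi> f \<in> whittaker_fin"
  and Phi_ae: "f \<in> H_fin \<sigma> ==> h \<in> H_fin \<sigma> ==> ae_eq f h ==> \<Phi> f = \<Phi> h"
  and Phi_lin: "f \<in> H_fin \<sigma> ==> h \<in> H_fin \<sigma> ==> \<Phi> (\<lambda>k. a * f k + b * h k) = (\<lambda>g. a * \<Phi> f g + b * \<Phi> h g)"
  and Phi_K: "f \<in> H_fin \<sigma> ==> \<kappa> \<in> K_grp ==> \<Phi> (prin_act \<sigma> \<kappa> f) = (\<lambda>g. \<Phi> f (g ** \<kappa>))"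
  and Phi_lie: "f \<in> H_fin \<sigma> ==> h \<in> H_fin \<sigma> ==> has_lie_deriv_C \<sigma> Y f h ==> g \<in> G_grp ==> \<Phi> h g = right_deriv_C Y (\<Phi> f) g"
 using \<Phi> unfolding whittaker_homs_def by blast+

definition "\<phi> q = \<Phi> (Z q)"

lemma Z_fin: "even (q - \<delta>) ==> Z q \<in> H_fin \<sigma>"
 using Z_comb_H_fin[of "{q}" "\<lambda>_. 1"] by simp

lemma Phi_sum:
 assumes "finite Q" "\<forall>q\<in>Q. even (q - \<delta>)"
 shows "\<Phi> (\<lambda>k. \<Sum>q\<in>Q. c q * Z q k) = (\<lambda>g. \<Sum>q\<in>Q. c q * \<phi> q g)"
 using assms
proof (induction Q rule: finite_induct)
 case empty
 have "\<Phi> (\<lambda>k. 0 * Z \<delta> k + 0 * Z \<delta> k) = (\<lambda>g. 0 * \<Phi> (Z \<delta>) g + 0 * \<Phi> (Z \<delta>) g)" by (intro Phi_lin Z_fin) simp_all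
 then show ?case by simp
next
 case (insert p Q)
 have "\<Phi> (\<lambda>k. c p * Z p k + 1 * (\<Sum>q\<in>Q. c q * Z q k)) = (\<lambda>g. c p * \<Phi> (Z p) g + 1 * \<Phi> (\<lambda>k. \<Sum>q\<in>Q. c q * Z q k) g)"
  using insert by (intro Phi_lin Z_fin Z_comb_H_fin) auto
 then show ?case using insert by (simp add: \<phi>_def)
qed

lemma Phi_eval:
 assumes f: "f \<in> borel_measurable borel" and Q: "finite Q" "\<And>q. q \<in> Q ==> even (q - \<delta>)"
  and ae: "ae_eq f (\<lambda>k. \<Sum>q\<in>Q. c q * Z q k)"
 shows "\<Phi> f g = (\<Sum>q\<in>Q. c q * \<phi> q g)"
proof -
 have "\<Phi> f = \<Phi> (\<lambda>k. \<Sum>q\<in>Q. c q * Z q k)" by (rule Phi_ae[OF H_fin_I[OF f Q ae] Z_comb_H_fin[OF Q] ae])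
 then show ?thesis using Phi_sum[OF Q(1)] Q(2) by simp
qed

lemma phi_rot:
 assumes q: "even (q - \<delta>)"
 shows "\<phi> q (g ** rot \<tau>) = expi q \<tau> * \<phi> q g"
proof -
 have ae: "ae_eq (prin_act \<sigma> (rot \<tau>) (Z q)) (\<lambda>k. \<Sum>p\<in>{q}. expi p \<tau> * Z p k)"
  unfolding ae_eq_def using AE_haar_K_in_K by eventually_elim (simp add: prin_act_K Z_rot[OF _ q])
 have "\<Phi> (prin_act \<sigma> (rot \<tau>) (Z q)) g = (\<Sum>p\<in>{q}. expi p \<tau> * \<phi> p g)"
  by (rule Phi_eval[OF prin_act_measurable[OF K_in_G[OF rot_in_K] Z_measurable[OF q]] _ _ ae]) (use q in auto)
 then show ?thesis unfolding Phi_K[OF Z_fin[OF q] rot_in_K] by (simp add: \<phi>_def)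
qed

lemma phi_refl2:
 assumes q: "even (q - \<delta>)"
 shows "\<phi> q (g ** refl2) = sg * \<phi> (- q) g"
proof -
 have q': "even (- q - \<delta>)" using q by presburger
 have ae: "ae_eq (prin_act \<sigma> refl2 (Z q)) (\<lambda>k. \<Sum>p\<in>{- q}. sg * Z p k)"
  unfolding ae_eq_def using AE_haar_K_in_K by eventually_elim (simp add: prin_act_K Z_refl2[OF _ q])
 have "\<Phi> (prin_act \<sigma> refl2 (Z q)) g = (\<Sum>p\<in>{- q}. sg * \<phi> p g)"
  by (rule Phi_eval[OF prin_act_measurable[OF K_in_G[OF refl2_in_K] Z_measurable[OF q]] _ _ ae]) (use q' in auto)
 then show ?thesis unfolding Phi_K[OF Z_fin[OF q] refl2_in_K] by (simp add: \<phi>_def)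
qed

lemma phi_space: "even (q - \<delta>) ==> \<phi> q \<in> whittaker_space"
 using Phi_fin[OF Z_fin] by (simp add: \<phi>_def whittaker_fin_def)

lemma phi_derivative:
 assumes q: "even (q - \<delta>)" and g: "g \<in> G_grp"
 shows "(\<phi> q has_derivative frechet_derivative (\<phi> q) (at g)) (at g)"
proof -
 have "smooth_on G_grp (\<phi> q)" using phi_space[OF q] by (simp add: whittaker_space_def)
 then show ?thesis by (rule smooth_on_derivative(1)[OF _ g])
qed

lemma right_deriv_phi:
 assumes q: "even (q - \<delta>)" and g: "g \<in> G_grp"
 shows "right_deriv X (\<phi> q) g = frechet_derivative (\<phi> q) (at g) (g ** X)"
 unfolding right_deriv_def
 by (rule vector_derivative_at, rule has_vector_derivative_along[OF mat_exp_curve_deriv]) (use phi_derivative[OF q g] in simp)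

text \<open>X is regarded as a complex matrix with imaginary part 0. Its action on
  \<open>Z q\<close> is an explicit combination of neighbouring weights, which linearity of \<Phi>
  carries over to the functions \<phi>; equivariance turns the same action into the derivative along
  X.\<close>

lemma phi_lie:
 assumes q: "even (q - \<delta>)" and g: "g \<in> G_grp"
 shows "frechet_derivative (\<phi> q) (at g) (g ** X) = lie_comb X \<phi> q g"
proof -
 define Y :: "complex^2^2" where "Y = (\<chi> i j. of_real (X$i$j))"
 have Y: "re_mat Y = X" "im_mat Y = 0" by (simp_all add: re_mat_def im_mat_def Y_def vec_eq_iff)
 have Q: "finite {q}" "\<And>p. p \<in> {q} ==> even (p - \<delta>)" using q by auto
 let ?h = "\<lambda>X k. \<Sum>p\<in>{q}. (\<lambda>_. 1) p * lie_comb X Z p k"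
 have ae: "ae_eq (Z q) (\<lambda>k. \<Sum>p\<in>{q}. (\<lambda>_. 1) p * Z p k)" by (simp add: ae_eq_def)
 have L: "has_lie_deriv \<sigma> X (Z q) (?h X)" for X by (rule has_lie_deriv_comb[OF Z_measurable[OF q] Q ae])
 have h: "?h X \<in> H_fin \<sigma>" by (rule lie_sum_H_fin[OF Q])
 have z: "lie_comb 0 V q k = 0" for V k by (simp add: lie_comb_def lie_a_def lie_u_def lie_d_def Complex_eq)
 have "has_lie_deriv_C \<sigma> Y (Z q) (?h X)"
  unfolding has_lie_deriv_C_def Y
 proof (rule conjI, rule_tac [2] exI[of _ "?h X"], rule_tac [2] exI[of _ "?h 0"], rule_tac [2] conjI[OF L], rule_tac [2] conjI[OF L])
  show "?h X \<in> H_sp \<sigma>" using h by (simp add: H_fin_def)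
  show "ae_eq (?h X) (\<lambda>k. ?h X k + \<i> * ?h 0 k)" by (simp add: z ae_eq_def)
 qed
 from Phi_lie[OF Z_fin[OF q] h this g]
 have 1: "\<Phi> (?h X) g = right_deriv_C Y (\<phi> q) g" by (simp only: \<phi>_def)
 have "right_deriv 0 (\<phi> q) g = 0" by (simp add: right_deriv_def)
 then have 2: "right_deriv_C Y (\<phi> q) g = frechet_derivative (\<phi> q) (at g) (g ** X)"
  unfolding right_deriv_C_def Y by (simp add: right_deriv_phi[OF q g])
 obtain Q' c' where Q': "finite Q'" "\<And>q. q \<in> Q' ==> even (q - \<delta>)" "\<And>V k. (\<Sum>p\<in>{q}. (\<lambda>_. 1) p * lie_comb X V p k) = (\<Sum>q\<in>Q'. c' q * V q k)"
  using lie_comb_expand[OF Q, of "\<lambda>_. 1" X] by blast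
 have "\<Phi> (?h X) g = (\<Sum>q\<in>Q'. c' q * \<phi> q g)"
  unfolding Q'(3) using Phi_sum[OF Q'(1)] Q'(2) by simp
 also have "\<dots> = lie_comb X \<phi> q g" unfolding Q'(3)[symmetric] by simp
 finally show ?thesis using 1 2 by simp
qed

text \<open>The identity matrix acts on every weight by \<nu>1 + \<nu>2, so t -> \<phi> q (exp t g)
  solves a linear equation with this constant coefficient.\<close>

lemma phi_scale:
 assumes q: "even (q - \<delta>)" and g: "g \<in> G_grp" and c: "c > 0"
 shows "\<phi> q (c *\<^sub>R g) = of_real c powr (\<nu>1 + \<nu>2) * \<phi> q g"
proof -
 let ?\<mu> = "\<nu>1 + \<nu>2"
 have G: "exp t *\<^sub>R g \<in> G_grp" for t using g by (simp add: G_grp_det det_2)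
 have m: "A ** mat 1 = A" for A :: mat2 by simp
 have "((\<lambda>t. exp (- ?\<mu> * of_real t) * \<phi> q (exp t *\<^sub>R g)) has_vector_derivative 0) (at t)" for t
 proof -
  have "((\<lambda>t. exp t *\<^sub>R g) has_vector_derivative exp t *\<^sub>R g) (at t)"
   using has_vector_derivative_scaleR[OF DERIV_exp has_vector_derivative_const[of g]] by simp
  from has_vector_derivative_along[OF this phi_derivative[OF q G]]
  have "((\<lambda>t. \<phi> q (exp t *\<^sub>R g)) has_vector_derivative lie_comb (mat 1) \<phi> q (exp t *\<^sub>R g)) (at t)"
   unfolding phi_lie[OF q G, of t "mat 1", symmetric] m .
  moreover have "lie_comb (mat 1) \<phi> q A = ?\<mu> * \<phi> q A" for A
   by (simp add: lie_comb_def lie_a_def lie_u_def lie_d_def Complex_eq)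
  moreover have "((\<lambda>t. exp (- ?\<mu> * of_real t)) has_vector_derivative - ?\<mu> * exp (- ?\<mu> * of_real t)) (at t)"
  proof -
   have "((\<lambda>z. exp (- ?\<mu> * z)) has_field_derivative - ?\<mu> * exp (- ?\<mu> * of_real t)) (at (of_real t))"
    by (auto intro!: derivative_eq_intros)
   then show ?thesis by (rule has_vector_derivative_real_field)
  qed
  ultimately show ?thesis using has_vector_derivative_mult by (fastforce simp: algebra_simps)
 qed
 then obtain C where C: "\<And>t. exp (- ?\<mu> * of_real t) * \<phi> q (exp t *\<^sub>R g) = C"
  using has_vector_derivative_zero_constant[of UNIV "\<lambda>t. exp (- ?\<mu> * of_real t) * \<phi> q (exp t *\<^sub>R g)"] by auto
 have "C = \<phi> q g" using C[of 0] by simp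
 then have "exp (- ?\<mu> * of_real (ln c)) * \<phi> q (c *\<^sub>R g) = \<phi> q g" using C[of "ln c"] c by simp
 moreover have "of_real c powr ?\<mu> = exp (?\<mu> * of_real (ln c))" using c by (simp add: powr_def Ln_of_real)
 moreover have "exp (?\<mu> * of_real (ln c)) * exp (- ?\<mu> * of_real (ln c)) = 1"
  by (simp only: mult_minus_left exp_minus_inverse)
 ultimately show ?thesis by (metis mult.assoc mult_1)
qed

definition "w q y = \<phi> q (diag2 y 1)"

text \<open>Two directions at diag(y, 1) are compared. The direction diag(1/y, 0) gives the
  derivative in y. The upper nilpotent direction divided by y can be moved to the left of the
  matrix, where the character of N evaluates it. Difference and sum of the two formulas are the
  raising and lowering relations.\<close>

lemma w_system: "sys w"
 unfolding whittaker_system_def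
proof (intro allI impI)
 fix q :: int and y :: real assume q: "even (q - \<delta>)" and y: "y > 0"
 let ?g = "diag2 y 1 :: mat2" and ?E = "vector [vector [0, 1], vector [0, 0]] :: mat2"
 let ?D = "lie_comb (diag2 (1 / y) 0) \<phi> q ?g"
 let ?\<mu> = "\<nu>1 + \<nu>2" and ?\<nu> = "\<nu>1 - \<nu>2"
 have g: "?g \<in> G_grp" using y by (simp add: G_grp_det det_2)
 have E: "?E$1$1 = 0" "?E$1$2 = 1" "?E$2$1 = 0" "?E$2$2 = 0" by simp_all
 have y0: "complex_of_real y \<noteq> 0" using y by simp
 have cd: "((\<lambda>y. diag2 y 1 :: mat2) has_vector_derivative diag2 1 0) (at y)"
 proof -
  have "(\<lambda>y. diag2 y 1 :: mat2) = (\<lambda>y. diag2 0 1 + y *\<^sub>R diag2 1 0)" by (rule ext) (simp add: mat2_eq_iff)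
  moreover have "((\<lambda>y. diag2 0 1 + y *\<^sub>R diag2 1 0 :: mat2) has_vector_derivative diag2 1 0) (at y)"
   by (auto intro!: derivative_eq_intros)
  ultimately show ?thesis by simp
 qed
 have e1: "?g ** diag2 (1 / y) 0 = diag2 1 0" using y by (simp add: mat2_eq_iff mat2_mult_nth)
 have D: "(w q has_vector_derivative ?D) (at y)"
  unfolding w_def[abs_def] phi_lie[OF q g, symmetric] e1
  by (rule has_vector_derivative_along[OF cd phi_derivative[OF q g]])
 have N: "lie_comb ((1 / y) *\<^sub>R ?E) \<phi> q ?g = 2 * of_real pi * \<i> * w q y"
 proof -
  let ?n = "\<lambda>t. mat 1 + t *\<^sub>R ?E"
  have n: "?n t \<in> N_grp" for t by (simp add: N_grp_def E)
  have "((\<lambda>t. ?g + t *\<^sub>R (?E ** ?g)) has_vector_derivative ?E ** ?g) (at 0)" by (auto intro!: derivative_eq_intros)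
  moreover have "?g + t *\<^sub>R (?E ** ?g) = ?n t ** ?g" for t by (simp add: mat2_eq_iff mat2_mult_nth E)
  ultimately have c: "((\<lambda>t. ?n t ** ?g) has_vector_derivative ?E ** ?g) (at 0)" by simp
  have "?n 0 ** ?g = ?g" by simp
  then have "((\<lambda>t. \<phi> q (?n t ** ?g)) has_vector_derivative frechet_derivative (\<phi> q) (at ?g) (?E ** ?g)) (at 0)"
   using has_vector_derivative_along[OF c] phi_derivative[OF q g] by simp
  moreover have "\<phi> q (?n t ** ?g) = exp (2 * of_real pi * \<i> * of_real t) * w q y" for t
   using phi_space[OF q] n g unfolding whittaker_space_def w_def psi1_def by (simp add: E)
  ultimately have d1: "((\<lambda>t. exp (2 * of_real pi * \<i> * of_real t) * w q y) has_vector_derivative frechet_derivative (\<phi> q) (at ?g) (?E ** ?g)) (at 0)" by simp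
  have d2: "((\<lambda>t. exp (2 * of_real pi * \<i> * of_real t) * w q y) has_vector_derivative 2 * of_real pi * \<i> * w q y) (at 0)"
  proof -
   have "((\<lambda>z. exp (2 * of_real pi * \<i> * z) * w q y) has_field_derivative 2 * of_real pi * \<i> * w q y) (at (of_real 0))"
    by (auto intro!: derivative_eq_intros)
   then show ?thesis by (rule has_vector_derivative_real_field)
  qed
  have "?g ** ((1 / y) *\<^sub>R ?E) = ?E ** ?g" using y by (simp add: mat2_eq_iff mat2_mult_nth E)
  then show ?thesis using vector_derivative_unique_at[OF d1 d2] phi_lie[OF q g, of "(1 / y) *\<^sub>R ?E"] by simp
 qed
 have i: "2 * of_real y * ?D = ?\<mu> * w q y + (?\<nu> + 1 + of_int q) * w (q + 2) y / 2 + (?\<nu> + 1 - of_int q) * w (q - 2) y / 2"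
  using y0 by (simp add: lie_comb_def lie_a_def lie_u_def lie_d_def Complex_eq w_def field_simps)
 have "4 * of_real pi * of_real y * w q y = - \<i> * (2 * of_real y) * (2 * of_real pi * \<i> * w q y)" by (simp add: algebra_simps)
 also have "\<dots> = of_int q * w q y - (?\<nu> + 1 + of_int q) * w (q + 2) y / 2 + (?\<nu> + 1 - of_int q) * w (q - 2) y / 2"
  unfolding N[symmetric] using y0 by (simp add: lie_comb_def lie_a_def lie_u_def lie_d_def Complex_eq w_def E field_simps)
 finally have ii: "4 * of_real pi * of_real y * w q y = of_int q * w q y - (?\<nu> + 1 + of_int q) * w (q + 2) y / 2 + (?\<nu> + 1 - of_int q) * w (q - 2) y / 2" .
 have r: "2 * of_real y * ?D - 4 * of_real pi * of_real 1 * of_real y * w q y + (of_int q - ?\<mu>) * w q y = (?\<nu> + 1 + of_int q) * w (q + 2) y"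
  unfolding of_real_1 mult_1_right i ii by (simp add: field_simps)
 have l: "2 * of_real y * ?D + 4 * of_real pi * of_real 1 * of_real y * w q y + (- of_int q - ?\<mu>) * w q y = (?\<nu> + 1 - of_int q) * w (q - 2) y"
  unfolding of_real_1 mult_1_right i ii by (simp add: field_simps)
 show "\<exists>D. (w q has_vector_derivative D) (at y) \<and>
   2 * of_real y * D - 4 * of_real pi * of_real 1 * of_real y * w q y + (of_int q - ?\<mu>) * w q y = (?\<nu> + 1 + of_int q) * w (q + 2) y \<and>
   2 * of_real y * D + 4 * of_real pi * of_real 1 * of_real y * w q y + (- of_int q - ?\<mu>) * w q y = (?\<nu> + 1 - of_int q) * w (q - 2) y"
  using D r l by blast
qed

end

lemma weight_family_scale:
 assumes "c > 0" "y > 0"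
 shows "weight_family l \<mu> s w q (c *\<^sub>R diag2 y 1) = of_real c powr \<mu> * w q y"
proof -
 let ?g = "c *\<^sub>R diag2 y 1 :: mat2"
 have n: "row_norm2 ?g = c\<^sup>2" "iwa_x ?g = 0" "iwa_y ?g = y" "row_cplx ?g = of_real c" "det ?g > 0"
  using assms by (auto simp: row_norm2_def iwa_x_def iwa_y_def row_cplx_def det_2 power2_eq_square complex_eq_iff)
 have "of_real (c\<^sup>2) powr ((\<mu> - of_int q) / 2) * of_real c powi q = of_real c powr \<mu>"
 proof -
  have c: "complex_of_real c = exp (of_real (ln c))" using assms by (simp add: exp_of_real)
  have "complex_of_real c powi q = exp (of_int q * of_real (ln c))" unfolding c by (simp add: exp_power_int)
  moreover have "of_real (c\<^sup>2) powr ((\<mu> - of_int q) / 2) = exp ((\<mu> - of_int q) * of_real (ln c))"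
   using assms by (simp add: powr_def Ln_of_real ln_realpow flip: of_real_power)
  moreover have "of_real c powr \<mu> = exp (\<mu> * of_real (ln c))" using assms by (simp add: powr_def Ln_of_real)
  ultimately show ?thesis by (simp add: exp_add[symmetric] algebra_simps)
 qed
 then show ?thesis using n by (simp add: weight_family_def weight_fn_def)
qed

lemma iwasawa_scaled:
 assumes "det g > 0"
 obtains n c y \<theta> where "n \<in> N_grp" "c > 0" "y > 0" "g = n ** (c *\<^sub>R diag2 y 1) ** rot \<theta>"
proof -
 have d: "det g \<noteq> 0" using assms by simp
 define p where "p = P_part g"
 define n where "n = (vector [vector [1, p$1$2 / p$2$2], vector [0, 1]] :: mat2)"
 have nn: "n$1$1 = 1" "n$1$2 = p$1$2 / p$2$2" "n$2$1 = 0" "n$2$2 = 1" by (simp_all add: n_def)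
 have r: "sqrt (row_norm2 g) > 0" using row_norm2_pos[OF d] by simp
 have p: "p$2$1 = 0" "p$1$1 > 0" "p$2$2 > 0" unfolding p_def P_part_nth[OF d] using r d by auto
 have pn: "n ** (p$2$2 *\<^sub>R diag2 (p$1$1 / p$2$2) 1) = p" using p by (simp add: mat2_eq_iff mat2_mult_nth nn)
 have "det g = det p * det (K_part g)" using P_part_K_part[OF d] by (metis det_mul p_def)
 moreover have "det p > 0" using p by (simp add: det_2)
 ultimately have dk: "det (K_part g) > 0" using assms by (simp add: zero_less_mult_iff)
 from K_part_in_K[OF d] show ?thesis
 proof (cases rule: K_grp_cases)
  case (1 \<theta>)
  show ?thesis
  proof (rule that[of n "p$2$2" "p$1$1 / p$2$2" \<theta>])
   show "g = n ** (p$2$2 *\<^sub>R diag2 (p$1$1 / p$2$2) 1) ** rot \<theta>" unfolding pn using P_part_K_part[OF d] by (simp add: p_def 1)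
  qed (use p in \<open>auto simp: N_grp_def nn\<close>)
 next
  case (2 \<theta>)
  then have "det (K_part g) = -1" by (simp add: det_mul det_2[of refl2])
  then show ?thesis using dk by simp
 qed
qed

context whittaker_morphism begin

text \<open>Both functions behave in the same way under N, positive scalars and rotations, and they
  agree at diag(y, 1), where \<open>w\<close> was read off.\<close>

lemma phi_eq_pos:
 assumes q: "even (q - \<delta>)" and g: "det g > 0"
 shows "\<phi> q g = W w q g"
proof -
 obtain n c y \<theta> where n: "n \<in> N_grp" "c > 0" "y > 0" "g = n ** (c *\<^sub>R diag2 y 1) ** rot \<theta>" by (rule iwasawa_scaled[OF g])
 have G: "c *\<^sub>R diag2 y 1 \<in> G_grp" "diag2 y 1 \<in> G_grp" using n by (auto simp: G_grp_det det_2)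
 have "\<phi> q (n ** (c *\<^sub>R diag2 y 1)) = psi1 n * \<phi> q (c *\<^sub>R diag2 y 1)"
  using phi_space[OF q] n(1) G(1) unfolding whittaker_space_def by blast
 then show ?thesis unfolding n(4) phi_rot[OF q] weight_family_rot weight_family_N[OF n(1)] weight_family_scale[OF n(2,3)]
  by (simp add: phi_scale[OF q G(2) n(2)] psi1_def w_def)
qed

lemma phi_eq:
 assumes q: "even (q - \<delta>)"
 shows "\<phi> q g = W w q g"
proof -
 consider "det g > 0" | "det g < 0" | "det g = 0" by linarith
 then show ?thesis
 proof cases
  case 1
  then show ?thesis by (rule phi_eq_pos[OF q])
 next
  case 2
  have q': "even (- q - \<delta>)" using q by presburger
  have g: "g = g ** refl2 ** refl2" by (simp add: matrix_mul_assoc[symmetric])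
  have "\<phi> q (g ** refl2 ** refl2) = W w q (g ** refl2 ** refl2)"
   unfolding phi_refl2[OF q] weight_family_refl2[OF sg_sg, where q = q and g = "g ** refl2"] using 2 by (simp add: phi_eq_pos[OF q'])
  then show ?thesis using g by simp
 next
  case 3
  then have "g \<notin> G_grp" by (simp add: G_grp_det)
  then show ?thesis using phi_space[OF q] 3 by (simp add: whittaker_space_def weight_family_def)
 qed
qed

lemma Phi_eq: "\<Phi> = whittaker_hom w"
proof (rule ext, rule ext)
 fix f g
 show "\<Phi> f g = whittaker_hom w f g"
 proof (cases "f \<in> H_fin \<sigma>")
  case True
  have "\<Phi> f g = (\<Sum>q\<in>support f. coef f q * \<phi> q g)"
   by (rule Phi_eval[OF H_fin_borel[OF True] finite_support[OF True] support_even H_fin_expand[OF True]])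
  also have "\<dots> = (\<Sum>q\<in>support f. coef f q * W w q g)" by (intro sum.cong refl) (simp only: phi_eq[OF support_even])
  finally show ?thesis using True by (simp add: whittaker_hom_def)
 next
  case False
  then show ?thesis by (simp add: Phi_outside whittaker_hom_def)
 qed
qed

end

section \<open>Every homomorphism comes from a Bessel pair\<close>

context principal_series begin

text \<open>Only the positive axis matters, because \<open>weight_family\<close> evaluates
  \<open>weight_fn\<close> only at matrices of positive determinant, where \<open>iwa_y\<close> is
  positive.\<close>

lemma whittaker_hom_cong:
 assumes "\<And>q y. even (q - \<delta>) ==> y > 0 ==> w q y = v q y"
 shows "whittaker_hom w = whittaker_hom v"
proof (rule ext, rule ext)
 fix f g
 have "W w q g = W v q g" if q: "even (q - \<delta>)" for q
 proof -
  have q': "even (- q - \<delta>)" using q by presburger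
  show ?thesis using assms[OF q iwa_y_pos, of g] assms[OF q' iwa_y_pos, of "g ** refl2"]
   by (simp add: weight_family_def weight_fn_def)
 qed
 then show "whittaker_hom w f g = whittaker_hom v f g"
  unfolding whittaker_hom_def by (auto simp del: of_nat_diff intro!: sum.cong arg_cong2[where f = "(*)"] dest: support_even)
qed

lemma whittaker_homs_bessel:
 assumes d: "\<delta> \<in> {0, 1}" and nz: "\<And>n::nat. \<nu>1 - \<nu>2 + 1 + of_int (\<delta> + 2 * int n) \<noteq> 0" and \<Phi>: "\<Phi> \<in> whittaker_homs \<sigma>"
 obtains F H where "bessel_pair (bessel_order (\<nu>1 - \<nu>2) \<delta>) F H"
  "\<Phi> = whittaker_hom (whittaker_weight (\<nu>1 + \<nu>2) (\<nu>1 - \<nu>2) \<delta> F H)"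
proof -
 interpret whittaker_morphism \<nu>1 \<nu>2 \<delta>1 \<delta>2 \<Phi> by unfold_locales (rule \<Phi>)
 obtain F H where FH: "bessel_pair (bessel_order (\<nu>1 - \<nu>2) \<delta>) F H"
  "\<forall>q y. even (q - \<delta>) \<longrightarrow> y > 0 \<longrightarrow> w q y = whittaker_weight (\<nu>1 + \<nu>2) (\<nu>1 - \<nu>2) \<delta> F H q y"
  by (rule whittaker_system_bessel_pair[OF w_system d nz]) (rule that)
 show ?thesis by (rule that[OF FH(1)]) (rule trans[OF Phi_eq whittaker_hom_cong], rule FH(2)[rule_format])
qed

end

section \<open>Vertical integrals\<close>

lemma Gamma_R_tendsto:
 assumes "(s0 + a) / 2 \<notin> \<int>\<^sub>\<le>\<^sub>0"
 shows "((\<lambda>s. Gamma_R (s + a)) \<longlongrightarrow> Gamma_R (s0 + a)) (at s0)" "Gamma_R (s0 + a) \<noteq> 0"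
proof -
 have "((\<lambda>s. exp (- (s + a) / 2 * Ln (of_real pi)) * Gamma ((s + a) / 2)) \<longlongrightarrow> exp (- (s0 + a) / 2 * Ln (of_real pi)) * Gamma ((s0 + a) / 2)) (at s0)"
  by (intro tendsto_intros assms) auto
 then show "((\<lambda>s. Gamma_R (s + a)) \<longlongrightarrow> Gamma_R (s0 + a)) (at s0)" by (simp add: Gamma_R_def powr_def)
 show "Gamma_R (s0 + a) \<noteq> 0" using assms by (simp add: Gamma_R_def Gamma_eq_zero_iff)
qed

lemma Gamma_R_pole:
 assumes "(s0 + a) / 2 \<in> \<int>\<^sub>\<le>\<^sub>0"
 shows "filterlim (\<lambda>s. Gamma_R (s + a)) at_infinity (at s0)"
proof -
 obtain n where n: "(s0 + a) / 2 = - of_nat n" using assms by (auto elim: nonpos_Ints_cases')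
 have "((\<lambda>s. (s + a) / 2) \<longlongrightarrow> (s0 + a) / 2) (at s0)" by (intro tendsto_intros) auto
 moreover have "\<forall>\<^sub>F s in at s0. (s + a) / 2 \<noteq> (s0 + a) / 2" by (auto simp: eventually_at_filter)
 ultimately have "filterlim (\<lambda>s. (s + a) / 2) (at (- of_nat n)) (at s0)" unfolding n[symmetric] by (rule filterlim_atI)
 from filterlim_compose[OF Gamma_poles this]
 have "filterlim (\<lambda>s. Gamma ((s + a) / 2)) at_infinity (at s0)" .
 moreover have "((\<lambda>s. exp (- (s + a) / 2 * Ln (of_real pi))) \<longlongrightarrow> exp (- (s0 + a) / 2 * Ln (of_real pi))) (at s0)"
  by (intro tendsto_intros) auto
 ultimately have "filterlim (\<lambda>s. exp (- (s + a) / 2 * Ln (of_real pi)) * Gamma ((s + a) / 2)) at_infinity (at s0)"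
  by (intro tendsto_mult_filterlim_at_infinity) auto
 then show ?thesis by (simp add: Gamma_R_def powr_def)
qed

text \<open>Gamma has no zeros, so the second factor has either a pole or a nonzero limit. Poles
  must be exhibited because \<open>has_vertical_integral\<close> only says that the line is to the
  right of all of them, and the real part has to be shown to exceed -Re a and -Re b.\<close>

lemma Gamma_R_prod_pole:
 assumes "(s0 + a) / 2 \<in> \<int>\<^sub>\<le>\<^sub>0"
 shows "filterlim (\<lambda>s. Gamma_R (s + a) * Gamma_R (s + b)) at_infinity (at s0)"
proof (cases "(s0 + b) / 2 \<in> \<int>\<^sub>\<le>\<^sub>0")
 case True
 then show ?thesis using Gamma_R_pole assms by (intro filterlim_at_infinity_times) auto
next
 case False
 have "filterlim (\<lambda>s. Gamma_R (s + b) * Gamma_R (s + a)) at_infinity (at s0)"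
  by (rule tendsto_mult_filterlim_at_infinity[OF Gamma_R_tendsto[OF False] Gamma_R_pole[OF assms]])
 then show ?thesis by (simp add: mult.commute)
qed

lemma is_pole_times_powr:
 fixes s0 :: complex
 assumes "filterlim f at_infinity (at s0)" "y > 0"
 shows "is_pole (\<lambda>s. f s * of_real y powr (- s)) s0"
proof -
 have "((\<lambda>s. exp (- s * Ln (of_real y))) \<longlongrightarrow> exp (- s0 * Ln (of_real y))) (at s0)" by (intro tendsto_intros)
 then have "filterlim (\<lambda>s. exp (- s * Ln (of_real y)) * f s) at_infinity (at s0)"
  by (rule tendsto_mult_filterlim_at_infinity) (use assms in auto)
 then show ?thesis using assms(2) by (simp add: is_pole_def powr_def mult.commute)
qed

lemma vertical_integral_even:
 assumes y: "y > 0"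
 shows "has_vertical_integral (\<lambda>s. Gamma_R (s + a) * Gamma_R (s + b) * of_real y powr (- s))
  (4 * of_real pi * \<i> * of_real y powr ((a + b) / 2) * K_int ((a - b) / 2) (2 * pi * y))"
 unfolding has_vertical_integral_def
proof (intro allI impI)
 fix c :: real
 assume c: "\<forall>s. is_pole (\<lambda>s. Gamma_R (s + a) * Gamma_R (s + b) * of_real y powr (- s)) s \<longrightarrow> Re s < c"
 have "is_pole (\<lambda>s. Gamma_R (s + a) * Gamma_R (s + b) * of_real y powr (- s)) (- a)"
  by (rule is_pole_times_powr[OF Gamma_R_prod_pole y]) simp
 moreover have "is_pole (\<lambda>s. Gamma_R (s + b) * Gamma_R (s + a) * of_real y powr (- s)) (- b)"
  by (rule is_pole_times_powr[OF Gamma_R_prod_pole y]) simp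
 ultimately have "c > - Re a" "c > - Re b" using c by (auto simp: mult.commute[of "Gamma_R (_ + b)"])
 then show "has_bochner_integral lborel (\<lambda>t. \<i> * (Gamma_R (Complex c t + a) * Gamma_R (Complex c t + b) * of_real y powr (- Complex c t)))
  (4 * of_real pi * \<i> * of_real y powr ((a + b) / 2) * K_int ((a - b) / 2) (2 * pi * y))"
  using Gamma_R_mellin y by blast
qed

lemma half_notin_nonpos_Ints: "(1 / 2 :: complex) \<notin> \<int>\<^sub>\<le>\<^sub>0"
proof
 assume "(1 / 2 :: complex) \<in> \<int>\<^sub>\<le>\<^sub>0"
 then obtain n where n: "(1 / 2 :: complex) = - of_nat n" by (auto elim: nonpos_Ints_cases')
 have "Re (1 / 2 :: complex) = Re (- of_nat n)" by (simp only: n)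
 then show False by simp
qed

text \<open>At -b the first summand has a pole. The second contains Gamma_R(a - b), which is
  singular only if a - b is 0, -2, -4 and so on; \<open>ne\<close> excludes the first value and
  \<open>hyp\<close> the others.\<close>

lemma odd_pole_right:
 assumes hyp: "\<And>n::nat. a - b + 2 + 2 * of_nat n \<noteq> 0" and ne: "a \<noteq> b" and y: "y > 0"
 shows "is_pole (\<lambda>s. (Gamma_R (s + (a + 1)) * Gamma_R (s + b) + q * Gamma_R (s + a) * Gamma_R (s + (b + 1))) * of_real y powr (- s)) (- b)"
proof (rule is_pole_times_powr[OF _ y])
 have h: "(- b + a) / 2 \<notin> \<int>\<^sub>\<le>\<^sub>0"
 proof
  assume "(- b + a) / 2 \<in> \<int>\<^sub>\<le>\<^sub>0"
  then obtain n where n: "(- b + a) / 2 = - of_nat n" by (auto elim: nonpos_Ints_cases')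
  then have e: "a - b = - 2 * of_nat n" by (simp add: field_simps)
  show False
  proof (cases n)
   case 0
   then show ?thesis using e ne by simp
  next
   case (Suc m)
   then show ?thesis using e hyp[of m] by (simp add: algebra_simps)
  qed
 qed
 have h2: "(- b + (b + 1)) / 2 \<notin> \<int>\<^sub>\<le>\<^sub>0" using half_notin_nonpos_Ints by simp
 have "((\<lambda>s. q * Gamma_R (s + a) * Gamma_R (s + (b + 1))) \<longlongrightarrow> q * Gamma_R (- b + a) * Gamma_R (- b + (b + 1))) (at (- b))"
  by (intro tendsto_intros Gamma_R_tendsto(1) h h2)
 moreover have "filterlim (\<lambda>s. Gamma_R (s + b) * Gamma_R (s + (a + 1))) at_infinity (at (- b))" by (rule Gamma_R_prod_pole) simp
 ultimately have "filterlim (\<lambda>s. q * Gamma_R (s + a) * Gamma_R (s + (b + 1)) + Gamma_R (s + b) * Gamma_R (s + (a + 1))) at_infinity (at (- b))"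
  by (rule tendsto_add_filterlim_at_infinity)
 then show "filterlim (\<lambda>s. Gamma_R (s + (a + 1)) * Gamma_R (s + b) + q * Gamma_R (s + a) * Gamma_R (s + (b + 1))) at_infinity (at (- b))"
  by (subst add.commute, subst mult.commute[of "Gamma_R (_ + (a + 1))"])
qed

text \<open>At -a the second summand has a pole, and the first contains Gamma_R(b - a), which
  \<open>ne\<close> keeps away from its poles.\<close>

lemma odd_pole_left:
 assumes ne: "\<And>n::nat. a - b \<noteq> 2 * of_nat n" and q: "q \<noteq> 0" and y: "y > 0"
 shows "is_pole (\<lambda>s. (Gamma_R (s + (a + 1)) * Gamma_R (s + b) + q * Gamma_R (s + a) * Gamma_R (s + (b + 1))) * of_real y powr (- s)) (- a)"
proof (rule is_pole_times_powr[OF _ y])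
 have h: "(- a + b) / 2 \<notin> \<int>\<^sub>\<le>\<^sub>0"
 proof
  assume "(- a + b) / 2 \<in> \<int>\<^sub>\<le>\<^sub>0"
  then obtain n where n: "(- a + b) / 2 = - of_nat n" by (auto elim: nonpos_Ints_cases')
  then have "a - b = 2 * of_nat n" by (simp add: field_simps)
  then show False using ne by blast
 qed
 have h2: "(- a + (a + 1)) / 2 \<notin> \<int>\<^sub>\<le>\<^sub>0" using half_notin_nonpos_Ints by simp
 have "((\<lambda>s. Gamma_R (s + (a + 1)) * Gamma_R (s + b)) \<longlongrightarrow> Gamma_R (- a + (a + 1)) * Gamma_R (- a + b)) (at (- a))"
  by (intro tendsto_intros Gamma_R_tendsto(1) h h2)
 moreover have "filterlim (\<lambda>s. q * (Gamma_R (s + a) * Gamma_R (s + (b + 1)))) at_infinity (at (- a))"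
  by (rule tendsto_mult_filterlim_at_infinity[OF tendsto_const q Gamma_R_prod_pole]) simp
 ultimately show "filterlim (\<lambda>s. Gamma_R (s + (a + 1)) * Gamma_R (s + b) + q * Gamma_R (s + a) * Gamma_R (s + (b + 1))) at_infinity (at (- a))"
  unfolding mult.assoc by (rule tendsto_add_filterlim_at_infinity)
qed

text \<open>When \<open>a - b\<close> is a positive even integer, \<open>- a\<close> may fail to be a pole, but it lies to the left
 of the pole \<open>- b\<close>. For \<open>a = b\<close> and \<open>q = -1\<close> the integrand vanishes identically, so
 every line is admissible.\<close>

lemma vertical_integral_odd:
 assumes hyp: "\<And>n::nat. a - b + 2 + 2 * of_nat n \<noteq> 0" and q: "q \<in> {1, -1 :: int}" and y: "y > 0"
 shows "has_vertical_integral (\<lambda>s. (Gamma_R (s + (a + 1)) * Gamma_R (s + b) + of_int q * Gamma_R (s + a) * Gamma_R (s + (b + 1))) * of_real y powr (- s))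
  (4 * of_real pi * \<i> * of_real y powr ((a + b + 1) / 2) * (K_int ((a - b + 1) / 2) (2 * pi * y) + of_int q * K_int ((a - b - 1) / 2) (2 * pi * y)))"
  (is "has_vertical_integral ?F ?v")
proof (cases "a = b \<and> q = -1")
 case True
 have k: "K_int ((b - b - 1) / 2) (2 * pi * y) = K_int ((b - b + 1) / 2) (2 * pi * y)" using K_int_minus[of "1 / 2"] by simp
 have f: "?F s = 0" for s using True by simp
 have v: "?v = 0" using True k by simp
 show ?thesis unfolding f v has_vertical_integral_def by (simp add: has_bochner_integral_zero)
next
 case False
 show ?thesis unfolding has_vertical_integral_def
 proof (intro allI impI)
  fix c :: real
  assume c: "\<forall>s. is_pole ?F s \<longrightarrow> Re s < c"
  have q0: "of_int q \<noteq> (0 :: complex)" using q by auto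
  have "c > - Re a \<and> c > - Re b"
  proof (cases "a = b")
   case True
   then have "q = 1" using False q by auto
   have "filterlim (\<lambda>s. 2 * (Gamma_R (s + a) * Gamma_R (s + (a + 1)))) at_infinity (at (- a))"
    by (rule tendsto_mult_filterlim_at_infinity[OF tendsto_const _ Gamma_R_prod_pole]) simp_all
   then have "is_pole (\<lambda>s. 2 * (Gamma_R (s + a) * Gamma_R (s + (a + 1))) * of_real y powr (- s)) (- a)" using y by (rule is_pole_times_powr)
   moreover have "(\<lambda>s. 2 * (Gamma_R (s + a) * Gamma_R (s + (a + 1))) * of_real y powr (- s)) = ?F"
    unfolding True \<open>q = 1\<close> of_int_1 by (rule ext) (simp add: algebra_simps)
   ultimately have "is_pole ?F (- a)" by (simp only:)
   then have "Re (- a) < c" using c by blast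
   then show ?thesis using True by simp
  next
   case ne: False
   have b: "c > - Re b" using c odd_pole_right[OF hyp ne y] by fastforce
   show ?thesis
   proof (cases "\<exists>n::nat. a - b = 2 * of_nat n")
    case True
    then obtain n :: nat where "a - b = 2 * of_nat n" by blast
    then have "Re (a - b) = Re (2 * of_nat n)" by (rule arg_cong)
    then have "Re a \<ge> Re b" by simp
    then show ?thesis using b by simp
   next
    case False
    then show ?thesis using b c odd_pole_left[OF _ q0 y, of a b] by fastforce
   qed
  qed
  then have c1: "c > - Re (a + 1)" "c > - Re b" "c > - Re a" "c > - Re (b + 1)" by auto
  have "has_bochner_integral lborel
   (\<lambda>t. \<i> * (Gamma_R (Complex c t + (a + 1)) * Gamma_R (Complex c t + b) * of_real y powr (- Complex c t))
     + of_int q * (\<i> * (Gamma_R (Complex c t + a) * Gamma_R (Complex c t + (b + 1)) * of_real y powr (- Complex c t))))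
   (4 * of_real pi * \<i> * of_real y powr ((a + 1 + b) / 2) * K_int ((a + 1 - b) / 2) (2 * pi * y)
    + of_int q * (4 * of_real pi * \<i> * of_real y powr ((a + (b + 1)) / 2) * K_int ((a - (b + 1)) / 2) (2 * pi * y)))"
   by (intro has_bochner_integral_add has_bochner_integral_mult_right Gamma_R_mellin c1 y)
  moreover have "a + 1 + b = a + b + 1" "a + (b + 1) = a + b + 1" "a + 1 - b = a - b + 1" "a - (b + 1) = a - b - 1" by simp_all
  ultimately show "has_bochner_integral lborel (\<lambda>t. \<i> * ?F (Complex c t)) ?v"
   by (simp only: algebra_simps)
 qed
qed

context principal_series begin

lemma whittaker_hom_diag:
 assumes "even (q - \<delta>)" "y1 > 0" "y2 > 0"
 shows "whittaker_hom w (Z q) (diag2 (y1 * y2) y2) = of_real y2 powr (\<nu>1 + \<nu>2) * w q y1"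
proof -
 have "diag2 (y1 * y2) y2 = y2 *\<^sub>R diag2 y1 1" by (simp add: mat2_eq_iff mult.commute)
 then show ?thesis using weight_family_scale[OF assms(3,2)] by (simp add: whittaker_hom_Z[OF assms(1)])
qed

lemma whittaker_hom_comb:
 "whittaker_hom (\<lambda>q y. a * w q y + b * v q y) f g = a * whittaker_hom w f g + b * whittaker_hom v f g"
proof -
 have "W (\<lambda>q y. a * w q y + b * v q y) q g = a * W w q g + b * W v q g" for q
  by (simp add: weight_family_def weight_fn_def algebra_simps)
 then show ?thesis by (simp add: whittaker_hom_def sum.distrib sum_distrib_left algebra_simps)
qed

end

lemma whittaker_weight_comb:
 "whittaker_weight \<mu> \<nu> d (\<lambda>z. a * F z + b * F' z) (\<lambda>z. a * H z + b * H' z) q y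
  = a * whittaker_weight \<mu> \<nu> d F H q y + b * whittaker_weight \<mu> \<nu> d F' H' q y"
 by (simp add: whittaker_weight_def pair_eval_lin algebra_simps)

lemma whittaker_weight_pointwise:
 assumes "F (2 * pi * y) = F' (2 * pi * y)" "H (2 * pi * y) = H' (2 * pi * y)"
 shows "whittaker_weight \<mu> \<nu> d F H q y = whittaker_weight \<mu> \<nu> d F' H' q y"
 using assms by (simp add: whittaker_weight_def pair_eval_def)

lemma whittaker_weight_0: "whittaker_weight \<mu> \<nu> 0 F H 0 y = of_real y powr ((\<mu> + 1) / 2) * F (2 * pi * y)"
 by (simp add: whittaker_weight_def weight_pair_def base_pair_def pair_eval_def)

lemma whittaker_weight_1:
 assumes "q \<in> {1, -1}"
 shows "whittaker_weight \<mu> \<nu> 1 F H q y = \<i> powi q * of_real y powr ((\<mu> + 2) / 2) * (H (2 * pi * y) + of_int q * F (2 * pi * y))"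
 using assms by (auto simp: whittaker_weight_def weight_pair_def base_pair_def pair_eval_def power_int_minus algebra_simps)

section \<open>The theorem\<close>

context principal_series begin

abbreviation "hom_of A B \<equiv> whittaker_hom (whittaker_weight (\<nu>1 + \<nu>2) (\<nu>1 - \<nu>2) \<delta> A B)"

lemma hom_of_value_even:
 assumes "\<delta>1 = \<delta>2" "y1 > 0" "y2 > 0"
 shows "hom_of A B (Z 0) (diag2 (y1 * y2) y2) =
  of_real y1 powr ((\<nu>1 + \<nu>2 + 1) / 2) * of_real y2 powr (\<nu>1 + \<nu>2) * A (2 * pi * y1)"
 using whittaker_hom_diag[OF _ assms(2,3), of 0] assms(1) by (simp add: whittaker_weight_0)

lemma hom_of_value_odd:
 assumes "\<delta>1 = 1" "\<delta>2 = 0" and q: "q \<in> {1, -1}" and y: "y1 > 0" "y2 > 0"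
 shows "hom_of A B (Z q) (diag2 (y1 * y2) y2) =
  \<i> powi q * of_real y1 powr ((\<nu>1 + \<nu>2 + 2) / 2) * of_real y2 powr (\<nu>1 + \<nu>2) * (B (2 * pi * y1) + of_int q * A (2 * pi * y1))"
proof -
 have d: "\<delta> = 1" using assms by simp
 have "even (q - \<delta>)" unfolding d using q by auto
 from whittaker_hom_diag[OF this y] show ?thesis by (simp add: d whittaker_weight_1[OF q])
qed

text \<open>For \<delta>1 = \<delta>2 the weight 0 determines A, and the first equation of a Bessel
  pair then gives B from the derivative of A. In the other case the weights 1 and -1 give B + A and
  B - A.\<close>

lemma hom_of_inj:
 assumes d: "\<delta> \<in> {0, 1}" "\<delta>1 \<in> {0, 1}" "\<delta>2 \<in> {0, 1}" and bp: "bessel_pair r A B" "bessel_pair r A' B'"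
  and eq: "hom_of A B = hom_of A' B'" and z: "z > 0"
 shows "A z = A' z" "B z = B' z"
proof -
 have c: "(\<delta>1 = \<delta>2) \<or> (\<delta>1 = 1 \<and> \<delta>2 = 0)" using d by auto
 have "A z = A' z \<and> B z = B' z"
 proof (cases "\<delta>1 = \<delta>2")
  case True
  have AA: "A x = A' x" if x: "x > 0" for x
  proof -
   have y: "x / (2 * pi) > 0" using x by simp
   have "complex_of_real (x / (2 * pi)) powr ((\<nu>1 + \<nu>2 + 1) / 2) \<noteq> 0" using x by simp
   moreover have "hom_of A B (Z 0) (diag2 (x / (2 * pi) * 1) 1) = hom_of A' B' (Z 0) (diag2 (x / (2 * pi) * 1) 1)" unfolding eq ..
   ultimately show ?thesis unfolding hom_of_value_even[OF True y zero_less_one] using x by simp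
  qed
  have "(A has_vector_derivative r / of_real z * A z - B z) (at z)" using bp(1) z by (simp add: bessel_pair_def)
  then have "(A' has_vector_derivative r / of_real z * A z - B z) (at z)"
   by (rule has_vector_derivative_transform_within_open[of _ _ _ "{0<..}"]) (use AA z in auto)
  moreover have "(A' has_vector_derivative r / of_real z * A' z - B' z) (at z)" using bp(2) z by (simp add: bessel_pair_def)
  ultimately have "r / of_real z * A z - B z = r / of_real z * A' z - B' z" by (rule vector_derivative_unique_at)
  then show ?thesis using AA[OF z] by simp
 next
  case False
  then have p: "\<delta>1 = 1" "\<delta>2 = 0" using c by auto
  have y: "z / (2 * pi) > 0" using z by simp
  have n: "complex_of_real (z / (2 * pi)) powr ((\<nu>1 + \<nu>2 + 2) / 2) \<noteq> 0" using z by simp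
  have "B z + of_int q * A z = B' z + of_int q * A' z" if q: "q \<in> {1, -1}" for q
  proof -
   have "hom_of A B (Z q) (diag2 (z / (2 * pi) * 1) 1) = hom_of A' B' (Z q) (diag2 (z / (2 * pi) * 1) 1)" unfolding eq ..
   then show ?thesis unfolding hom_of_value_odd[OF p q y zero_less_one] using n z by simp
  qed
  from this[of 1] this[of "-1"] have *: "B z + A z = B' z + A' z" "B z - A z = B' z - A' z" by auto
  have "2 * B z = 2 * B' z" "2 * A z = 2 * A' z"
   using arg_cong2[OF *, of "(+)"] arg_cong2[OF *, of "(-)"] by simp_all
  then show ?thesis by simp
 qed
 then show "A z = A' z" "B z = B' z" by auto
qed

lemma hom_of_comb:
 "hom_of (\<lambda>z. a * A z + b * A' z) (\<lambda>z. a * B z + b * B' z) = (\<lambda>f g. a * hom_of A B f g + b * hom_of A' B' f g)"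
 unfolding whittaker_weight_comb[abs_def] by (rule ext, rule ext) (rule whittaker_hom_comb)

lemma hom_of_cong:
 assumes "\<And>z. z > 0 ==> A z = A' z" "\<And>z. z > 0 ==> B z = B' z"
 shows "hom_of A B = hom_of A' B'"
 using assms by (intro whittaker_hom_cong whittaker_weight_pointwise) auto

text \<open>Existence is Cramer's rule for the Bessel pair behind \<Phi>; uniqueness holds because a
  homomorphism determines its pair.\<close>

lemma hom_of_basis:
 assumes d: "\<delta> \<in> {0, 1}" "\<delta>1 \<in> {0, 1}" "\<delta>2 \<in> {0, 1}"
  and nz: "\<And>n::nat. \<nu>1 - \<nu>2 + 1 + of_int (\<delta> + 2 * int n) \<noteq> 0"
  and bp: "bessel_pair (bessel_order (\<nu>1 - \<nu>2) \<delta>) F1 H1" "bessel_pair (bessel_order (\<nu>1 - \<nu>2) \<delta>) F2 H2"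
  and w: "w \<noteq> 0" "\<And>z. z > 0 ==> of_real z * (F1 z * H2 z - H1 z * F2 z) = w"
  and \<Phi>: "\<Phi> \<in> whittaker_homs \<sigma>"
 shows "\<exists>!ab. \<Phi> = (\<lambda>f g. fst ab * hom_of F1 H1 f g + snd ab * hom_of F2 H2 f g)"
proof -
 obtain A B where FH: "bessel_pair (bessel_order (\<nu>1 - \<nu>2) \<delta>) A B" "\<Phi> = hom_of A B"
  using whittaker_homs_bessel[OF d(1) nz \<Phi>] by blast
 obtain a b where ab: "\<And>z. z > 0 ==> A z = a * F1 z + b * F2 z" "\<And>z. z > 0 ==> B z = a * H1 z + b * H2 z"
  using bessel_pair_basis[OF FH(1) bp w] by blast
 have "\<Phi> = (\<lambda>f g. a * hom_of F1 H1 f g + b * hom_of F2 H2 f g)"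
  unfolding FH(2) hom_of_comb[symmetric] by (rule hom_of_cong[OF ab])
 moreover have "ab = (a, b)" if e: "\<Phi> = (\<lambda>f g. fst ab * hom_of F1 H1 f g + snd ab * hom_of F2 H2 f g)" for ab
 proof -
  have lc: "bessel_pair (bessel_order (\<nu>1 - \<nu>2) \<delta>) (\<lambda>z. fst ab * F1 z + snd ab * F2 z) (\<lambda>z. fst ab * H1 z + snd ab * H2 z)"
   by (rule bessel_pair_lin_comb[OF bp])
  have "hom_of (\<lambda>z. fst ab * F1 z + snd ab * F2 z) (\<lambda>z. fst ab * H1 z + snd ab * H2 z) = hom_of A B"
   by (rule trans[OF hom_of_comb trans[OF e[symmetric] FH(2)]])
  note i = hom_of_inj[OF d lc FH(1) this]
  have x: "fst ab * F1 z + snd ab * F2 z = a * F1 z + b * F2 z" if "z > 0" for z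
   by (rule trans[OF i(1)[OF that] ab(1)[OF that]])
  have y: "fst ab * H1 z + snd ab * H2 z = a * H1 z + b * H2 z" if "z > 0" for z
   by (rule trans[OF i(2)[OF that] ab(2)[OF that]])
  have "fst ab = a" "snd ab = b" by (rule bessel_pair_basis_unique[OF w x y]; assumption)+
  then show ?thesis by (simp add: prod_eq_iff)
 qed
 ultimately show ?thesis by (intro ex1I[of _ "(a, b)"]) auto
qed

end

theorem theorem3p3:
  fixes \<nu>1 \<nu>2 :: complex and \<delta>1 \<delta>2 :: nat and \<sigma> :: "mat2 \<Rightarrow> complex"
  assumes "\<delta>1 \<in> {0, 1}" and "\<delta>2 \<in> {0, 1}" and "\<delta>1 \<ge> \<delta>2"
    and "\<not> (\<exists>n::int. n \<le> 0 \<and> \<nu>1 - \<nu>2 + of_nat \<delta>1 - of_nat \<delta>2 + 1 = of_int (2 * n))"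
    and "\<sigma> = sigma_char \<nu>1 \<delta>1 \<nu>2 \<delta>2"
  shows "\<exists>\<Phi>mg \<in> whittaker_homs_mg \<sigma>.
    (\<delta>1 = \<delta>2 \<longrightarrow> (\<forall>y1>0. \<forall>y2>0.
       \<Phi>mg (zeta_fn \<delta>1 \<delta>2 0) (diag2 (y1 * y2) y2) =
         2 * complex_of_real y1 powr ((\<nu>1 + \<nu>2 + 1) / 2) * complex_of_real y2 powr (\<nu>1 + \<nu>2) *
           bessel_K ((\<nu>1 - \<nu>2) / 2) (2 * complex_of_real pi * complex_of_real y1) \<and>
       (\<exists>v. has_vertical_integral
              (\<lambda>s. Gamma_R (s + \<nu>1) * Gamma_R (s + \<nu>2) * complex_of_real y1 powr (- s)) v \<and>
            \<Phi>mg (zeta_fn \<delta>1 \<delta>2 0) (diag2 (y1 * y2) y2) =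
              complex_of_real y1 powr (1 / 2) * complex_of_real y2 powr (\<nu>1 + \<nu>2) /
                (4 * complex_of_real pi * \<i>) * v))) \<and>
    (\<delta>1 = 1 \<and> \<delta>2 = 0 \<longrightarrow> (\<forall>q\<in>{1, -1::int}. \<forall>y1>0. \<forall>y2>0.
       \<Phi>mg (zeta_fn \<delta>1 \<delta>2 q) (diag2 (y1 * y2) y2) =
         2 * \<i> powi q *
           complex_of_real y1 powr ((\<nu>1 + \<nu>2 + 2) / 2) * complex_of_real y2 powr (\<nu>1 + \<nu>2) *
           (bessel_K ((\<nu>1 - \<nu>2 + 1) / 2) (2 * complex_of_real pi * complex_of_real y1) +
            of_int q * bessel_K ((\<nu>1 - \<nu>2 - 1) / 2) (2 * complex_of_real pi * complex_of_real y1)) \<and>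
       (\<exists>v. has_vertical_integral
              (\<lambda>s. (Gamma_R (s + \<nu>1 + 1) * Gamma_R (s + \<nu>2) +
                    of_int q * Gamma_R (s + \<nu>1) * Gamma_R (s + \<nu>2 + 1)) *
                   complex_of_real y1 powr (- s)) v \<and>
            \<Phi>mg (zeta_fn \<delta>1 \<delta>2 q) (diag2 (y1 * y2) y2) =
              \<i> powi q *
                (complex_of_real y1 powr (1 / 2) * complex_of_real y2 powr (\<nu>1 + \<nu>2) /
                  (4 * complex_of_real pi * \<i>)) * v))) \<and>
    ((\<nexists>n::int. \<nu>1 - \<nu>2 = of_nat \<delta>1 - of_nat \<delta>2 + of_int (2 * n)) \<longrightarrow>
       (\<exists>\<Phi>p \<in> whittaker_homs \<sigma>. \<exists>\<Phi>m \<in> whittaker_homs \<sigma>.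
          (\<forall>(\<Phi>, e) \<in> {(\<Phi>p, 1), (\<Phi>m, -1)}.
             (\<delta>1 = \<delta>2 \<longrightarrow> (\<forall>y1>0. \<forall>y2>0.
                \<Phi> (zeta_fn \<delta>1 \<delta>2 0) (diag2 (y1 * y2) y2) =
                  complex_of_real y1 powr ((\<nu>1 + \<nu>2 + 1) / 2) * complex_of_real y2 powr (\<nu>1 + \<nu>2) *
                    bessel_I_hat (e * ((\<nu>1 - \<nu>2) / 2)) (2 * complex_of_real pi * complex_of_real y1))) \<and>
             (\<delta>1 = 1 \<and> \<delta>2 = 0 \<longrightarrow> (\<forall>q\<in>{1, -1::int}. \<forall>y1>0. \<forall>y2>0.
                \<Phi> (zeta_fn \<delta>1 \<delta>2 q) (diag2 (y1 * y2) y2) =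
                  \<i> powi q *
                    complex_of_real y1 powr ((\<nu>1 + \<nu>2 + 2) / 2) * complex_of_real y2 powr (\<nu>1 + \<nu>2) *
                    (bessel_I_hat (e * ((\<nu>1 - \<nu>2 + 1) / 2)) (2 * complex_of_real pi * complex_of_real y1) +
                     of_int q *
                       bessel_I_hat (e * ((\<nu>1 - \<nu>2 - 1) / 2)) (2 * complex_of_real pi * complex_of_real y1))))) \<and>
          (\<forall>\<Phi> \<in> whittaker_homs \<sigma>. \<exists>!ab::complex \<times> complex.
             \<Phi> = (\<lambda>f g. fst ab * \<Phi>p f g + snd ab * \<Phi>m f g)) \<and>
          \<Phi>mg = (\<lambda>f g. \<Phi>p f g + \<Phi>m f g)))"
    (is "\<exists>\<Phi>mg\<in>_. (_ \<longrightarrow> (\<forall>y1>0. \<forall>y2>0. ?even_K \<Phi>mg y1 y2 \<and> ?even_int \<Phi>mg y1 y2)) \<and>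
      (_ \<longrightarrow> (\<forall>q\<in>_. \<forall>y1>0. \<forall>y2>0. ?odd_K \<Phi>mg q y1 y2 \<and> ?odd_int \<Phi>mg q y1 y2)) \<and> (_ \<longrightarrow> ?basis \<Phi>mg)")
proof -
 interpret ps: principal_series \<nu>1 \<nu>2 \<delta>1 \<delta>2 .
 let ?\<nu> = "\<nu>1 - \<nu>2" and ?\<delta> = "int \<delta>1 - int \<delta>2"
 define r where "r = bessel_order ?\<nu> ?\<delta>"
 have d: "?\<delta> \<in> {0, 1}" using assms(1-3) by auto
 \<comment> \<open>The arithmetic hypothesis at the even number -2 n: it says that no ladder step
   divides by 0.\<close>
 have nz: "?\<nu> + 1 + of_int (?\<delta> + 2 * int n) \<noteq> 0" for n :: nat
 proof
  assume "?\<nu> + 1 + of_int (?\<delta> + 2 * int n) = 0"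
  then have "\<nu>1 - \<nu>2 + of_nat \<delta>1 - of_nat \<delta>2 + 1 = of_int (2 * (- int n))" by (simp add: algebra_simps eq_neg_iff_add_eq_0)
  then show False using assms(4) by (metis neg_le_0_iff_le of_nat_0_le_iff)
 qed
 have in_homs: "ps.hom_of A B \<in> whittaker_homs \<sigma>" if "bessel_pair r A B" for A B
  unfolding assms(5) using that unfolding r_def by (intro ps.whittaker_hom_in whittaker_weight_system d nz)
 \<comment> \<open>\<open>K_int\<close> is twice the Bessel function K, which accounts for the
   factor 2 in the stated values.\<close>
 define \<Phi>mg where "\<Phi>mg = ps.hom_of (K_int r) (K_int (r + 1))"
 have mg: "\<Phi>mg \<in> whittaker_homs_mg \<sigma>"
  unfolding assms(5) \<Phi>mg_def r_def
  by (intro ps.whittaker_hom_mg whittaker_weight_system bessel_pair_K_int d nz pow_bounded_whittaker_weight_K)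
 have K: "bessel_K s (2 * complex_of_real pi * complex_of_real y) = K_int s (2 * pi * y) / 2" if "y > 0" for s y
  using bessel_K_eq[of "2 * pi * y" s] that by simp
 have I: "bessel_I_hat s (complex_of_real (2 * pi * y)) = bessel_I_hat s (2 * complex_of_real pi * complex_of_real y)" for s y
  by simp
 have powr_half: "complex_of_real y powr (1 / 2) * complex_of_real y powr s = complex_of_real y powr (s + 1 / 2)" if "y > 0" for y s
  using that by (simp add: powr_add mult.commute)
 have k: "4 * complex_of_real pi * \<i> \<noteq> 0" by simp
 have cancel: "A * B / c * (c * C * D) = A * B * C * D" if "c \<noteq> 0" for A B C D c :: complex
  using that by (simp add: field_simps)
 show ?thesis
 proof (rule bexI[OF _ mg], intro conjI impI allI ballI)
  fix y1 y2 :: real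
  assume e: "\<delta>1 = \<delta>2" and y: "y1 > 0" "y2 > 0"
  have r: "r = ?\<nu> / 2" using e by (simp add: r_def bessel_order_def)
  note val = ps.hom_of_value_even[OF e y, of "K_int r" "K_int (r + 1)", folded \<Phi>mg_def]
  show "?even_K \<Phi>mg y1 y2"
   unfolding val K[OF y(1)] r by simp
  \<comment> \<open>The value of the vertical integral. Division by 4 pi \<i> leaves y1^((\<nu>1 +
    \<nu>2)/2) and \<open>K_int\<close>; the prefactor supplies the missing y1^(1/2).\<close>
  let ?v = "4 * of_real pi * \<i> * of_real y1 powr ((\<nu>1 + \<nu>2) / 2) * K_int (?\<nu> / 2) (2 * pi * y1)"
  have "\<Phi>mg (zeta_fn \<delta>1 \<delta>2 0) (diag2 (y1 * y2) y2) =
    complex_of_real y1 powr (1 / 2) * complex_of_real y2 powr (\<nu>1 + \<nu>2) / (4 * complex_of_real pi * \<i>) * ?v"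
  proof -
   have p: "complex_of_real y1 powr ((\<nu>1 + \<nu>2 + 1) / 2) = of_real y1 powr (1 / 2) * of_real y1 powr ((\<nu>1 + \<nu>2) / 2)"
    unfolding powr_half[OF y(1)] by (simp add: field_simps)
   show ?thesis unfolding val r p cancel[OF k] by (simp only: mult.assoc mult.left_commute mult.commute)
  qed
  then show "?even_int \<Phi>mg y1 y2"
   using vertical_integral_even[OF y(1)] by blast
 next
  fix q :: int and y1 y2 :: real
  assume e: "\<delta>1 = 1 \<and> \<delta>2 = 0" and q: "q \<in> {1, -1}" and y: "y1 > 0" "y2 > 0"
  have r: "r = (?\<nu> - 1) / 2" "r + 1 = (?\<nu> + 1) / 2" using e by (simp_all add: r_def bessel_order_def field_simps)
  note val = ps.hom_of_value_odd[OF conjunct1[OF e] conjunct2[OF e] q y, of "K_int r" "K_int (r + 1)", folded \<Phi>mg_def]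
  show "?odd_K \<Phi>mg q y1 y2"
   unfolding val K[OF y(1)] r(2) unfolding r(1) by (simp add: algebra_simps)
  have hyp: "\<nu>1 - \<nu>2 + 2 + 2 * of_nat n \<noteq> 0" for n :: nat using nz[of n] e by (simp add: algebra_simps)
  let ?v = "4 * of_real pi * \<i> * of_real y1 powr ((\<nu>1 + \<nu>2 + 1) / 2) *
   (K_int ((?\<nu> + 1) / 2) (2 * pi * y1) + of_int q * K_int ((?\<nu> - 1) / 2) (2 * pi * y1))"
  have "\<Phi>mg (zeta_fn \<delta>1 \<delta>2 q) (diag2 (y1 * y2) y2) =
    \<i> powi q * (complex_of_real y1 powr (1 / 2) * complex_of_real y2 powr (\<nu>1 + \<nu>2) / (4 * complex_of_real pi * \<i>)) * ?v"
  proof -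
   have p: "complex_of_real y1 powr ((\<nu>1 + \<nu>2 + 2) / 2) = of_real y1 powr (1 / 2) * of_real y1 powr ((\<nu>1 + \<nu>2 + 1) / 2)"
    unfolding powr_half[OF y(1)] by (simp add: field_simps)
   show ?thesis unfolding val r(2) unfolding r(1) p mult.assoc[of "\<i> powi q" "_ / _"] cancel[OF k] by (simp only: mult.assoc mult.left_commute mult.commute)
  qed
  then show "?odd_int \<Phi>mg q y1 y2"
   using vertical_integral_odd[OF hyp q y(1)] unfolding add.assoc[symmetric] by blast
 next
  assume ni: "\<nexists>n::int. \<nu>1 - \<nu>2 = of_nat \<delta>1 - of_nat \<delta>2 + of_int (2 * n)"
  \<comment> \<open>Here r = (\<nu>1 - \<nu>2 - \<delta>1 + \<delta>2)/2, so the assumption of the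
    second part says exactly that r is not an integer.\<close>
  have rZ: "r \<notin> \<int>"
  proof
   assume "r \<in> \<int>"
   then obtain n where "r = of_int n" by (auto elim: Ints_cases)
   then have "\<nu>1 - \<nu>2 = of_nat \<delta>1 - of_nat \<delta>2 + of_int (2 * n)" by (simp add: r_def bessel_order_def field_simps)
   then show False using ni by blast
  qed
  then have rZ1: "r + 1 \<notin> \<int>" "- r \<notin> \<int>" "r + 1 \<notin> \<int>\<^sub>\<le>\<^sub>0" "- r \<notin> \<int>\<^sub>\<le>\<^sub>0"
   by (auto dest: Ints_diff[OF _ Ints_1] Ints_minus nonpos_Ints_Int)
  let ?F1 = "\<lambda>z::real. bessel_I_hat r (of_real z)" and ?H1 = "\<lambda>z::real. bessel_I_hat (r + 1) (of_real z)"
  let ?F2 = "\<lambda>z::real. bessel_I_hat (- r) (of_real z)" and ?H2 = "\<lambda>z::real. bessel_I_hat (- r - 1) (of_real z)"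
  note bp = bessel_pair_I_hat[OF rZ] bessel_pair_I_hat_neg[OF rZ]
  have bp0: "bessel_pair (bessel_order ?\<nu> ?\<delta>) ?F1 ?H1" "bessel_pair (bessel_order ?\<nu> ?\<delta>) ?F2 ?H2"
   unfolding r_def[symmetric] by (rule bp)+
  have w: "2 * Gamma (- r) * Gamma (r + 1) \<noteq> 0" using rZ1 by (simp add: Gamma_eq_zero_iff)
  define \<Phi>p where "\<Phi>p = ps.hom_of ?F1 ?H1"
  define \<Phi>m where "\<Phi>m = ps.hom_of ?F2 ?H2"
  \<comment> \<open>The relation between K and I, used at both orders r and r + 1 of the
    pair.\<close>
  have sum: "\<Phi>mg = (\<lambda>f g. \<Phi>p f g + \<Phi>m f g)"
  proof -
   have m: "- (r + 1) = - r - 1" by simp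
   have "\<Phi>mg = ps.hom_of (\<lambda>z. 1 * ?F1 z + 1 * ?F2 z) (\<lambda>z. 1 * ?H1 z + 1 * ?H2 z)"
    unfolding \<Phi>mg_def using K_int_eq_I_hat[OF rZ] K_int_eq_I_hat[OF rZ1(1)] unfolding m by (intro ps.hom_of_cong) simp_all
   then show ?thesis unfolding ps.hom_of_comb \<Phi>p_def \<Phi>m_def by simp
  qed
  have basis: "\<exists>!ab. \<Phi> = (\<lambda>f g. fst ab * \<Phi>p f g + snd ab * \<Phi>m f g)" if "\<Phi> \<in> whittaker_homs \<sigma>" for \<Phi>
   unfolding \<Phi>p_def \<Phi>m_def
   by (rule ps.hom_of_basis[OF d assms(1,2) nz bp0 w I_hat_wronskian[OF rZ] that[unfolded assms(5)]]; assumption)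
  \<comment> \<open>The sign e = \<plusminus>1 treats both solutions at once: their orders are e r
    and e (r + 1).\<close>
  have even_val: "ps.hom_of (\<lambda>z. bessel_I_hat (e * r) (of_real z)) H (zeta_fn \<delta>1 \<delta>2 0) (diag2 (y1 * y2) y2) =
    complex_of_real y1 powr ((\<nu>1 + \<nu>2 + 1) / 2) * complex_of_real y2 powr (\<nu>1 + \<nu>2) *
     bessel_I_hat (e * ((\<nu>1 - \<nu>2) / 2)) (2 * complex_of_real pi * complex_of_real y1)"
   if "\<delta>1 = \<delta>2" "y1 > 0" "y2 > 0" for e H y1 y2
   unfolding ps.hom_of_value_even[OF that] I using that(1) by (simp add: r_def bessel_order_def)
  have odd_val: "ps.hom_of (\<lambda>z. bessel_I_hat (e * r) (of_real z)) (\<lambda>z. bessel_I_hat (e * (r + 1)) (of_real z)) (zeta_fn \<delta>1 \<delta>2 q) (diag2 (y1 * y2) y2) =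
    \<i> powi q * complex_of_real y1 powr ((\<nu>1 + \<nu>2 + 2) / 2) * complex_of_real y2 powr (\<nu>1 + \<nu>2) *
    (bessel_I_hat (e * ((\<nu>1 - \<nu>2 + 1) / 2)) (2 * complex_of_real pi * complex_of_real y1) +
     of_int q * bessel_I_hat (e * ((\<nu>1 - \<nu>2 - 1) / 2)) (2 * complex_of_real pi * complex_of_real y1))"
   if "\<delta>1 = 1" "\<delta>2 = 0" "q \<in> {1, -1}" "y1 > 0" "y2 > 0" for e q y1 y2
  proof -
   have r: "r = (?\<nu> - 1) / 2" "r + 1 = (?\<nu> + 1) / 2" using that(1,2) by (simp_all add: r_def bessel_order_def field_simps)
   show ?thesis unfolding ps.hom_of_value_odd[OF that] I r(2) unfolding r(1) ..
  qed
  have p1: "\<Phi>p = ps.hom_of (\<lambda>z. bessel_I_hat (1 * r) (of_real z)) (\<lambda>z. bessel_I_hat (1 * (r + 1)) (of_real z))"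
   by (simp add: \<Phi>p_def)
  have m1: "\<Phi>m = ps.hom_of (\<lambda>z. bessel_I_hat (-1 * r) (of_real z)) (\<lambda>z. bessel_I_hat (-1 * (r + 1)) (of_real z))"
   by (simp add: \<Phi>m_def)
  have pm: "P \<Phi>p 1 \<and> P \<Phi>m (-1) ==> \<forall>(\<Phi>, e)\<in>{(\<Phi>p, 1), (\<Phi>m, -1)}. P \<Phi> e" for P :: "whittaker_map => complex => bool"
   by auto
  show "?basis \<Phi>mg"
  proof (rule bexI[of _ \<Phi>p], rule bexI[of _ \<Phi>m], intro conjI)
   show "\<Phi>p \<in> whittaker_homs \<sigma>" "\<Phi>m \<in> whittaker_homs \<sigma>"
    unfolding \<Phi>p_def \<Phi>m_def by (rule in_homs[OF bp(1)], rule in_homs[OF bp(2)])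
   show "\<Phi>mg = (\<lambda>f g. \<Phi>p f g + \<Phi>m f g)" by (rule sum)
   show "\<forall>\<Phi>\<in>whittaker_homs \<sigma>. \<exists>!ab. \<Phi> = (\<lambda>f g. fst ab * \<Phi>p f g + snd ab * \<Phi>m f g)" using basis by blast
  qed (rule pm, unfold p1 m1, intro conjI impI allI ballI; (elim conjE)?; (rule even_val | rule odd_val); assumption)
 qed
qed

end
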